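(* For $d\in\mathbb{N}$ and $B>0$ let $N_d(B)$ be the number of orders $\mathcal{O}\subseteq\mathbb{Z}^d$ (subrings of $\mathbb{Z}^d$ containing the identity $(1,\dots,1)$ and of finite index) with $[\mathbb{Z}^d:\mathcal{O}]\le B$, where $\mathbb{Z}^d$ has componentwise addition and multiplication. Then: (1) if $2\le d\le 5$, there is a real number $C_d>0$ such that $N_d(B)\sim C_d B(\log B)^{\binom{d}{2}-1}$ as $B\to\infty$; (2) if $d\ge 6$, then for every $\epsilon>0$, $$B(\log B)^{\binom{d}{2}-1}\ll N_d(B)\ll_\epsilon B^{\frac{d}{2}-\frac{7}{6}+\epsilon}$$ as $B\to\infty$. *)

theory Defs
  imports
    Complex_Main
    "HOL-Library.FuncSet"
    "HOL-Library.Landau_Symbols"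
    "HOL-Algebra.AbelCoset"
    "HOL-Algebra.Subrings"
begin

definition int_power_ring :: "nat \<Rightarrow> (nat \<Rightarrow> int) ring" where
  "int_power_ring d =
    \<lparr>carrier = {..<d} \<rightarrow>\<^sub>E UNIV,
     mult = (\<lambda>x y. \<lambda>i\<in>{..<d}. x i * y i),
     one = (\<lambda>i\<in>{..<d}. 1),
     zero = (\<lambda>i\<in>{..<d}. 0),
     add = (\<lambda>x y. \<lambda>i\<in>{..<d}. x i + y i)\<rparr>"

lemma int_power_ring_simps [simp]:
  "carrier (int_power_ring d) = extensional {..<d}"
  "x \<otimes>\<^bsub>int_power_ring d\<^esub> y = (\<lambda>i\<in>{..<d}. x i * y i)"
  "\<one>\<^bsub>int_power_ring d\<^esub> = (\<lambda>i\<in>{..<d}. 1)"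
  "\<zero>\<^bsub>int_power_ring d\<^esub> = (\<lambda>i\<in>{..<d}. 0)"
  "x \<oplus>\<^bsub>int_power_ring d\<^esub> y = (\<lambda>i\<in>{..<d}. x i + y i)"
  by (simp_all add: int_power_ring_def PiE_def)

lemma cring_int_power_ring: "cring (int_power_ring d)"
proof -
  have neg: "\<exists>y\<in>carrier (int_power_ring d).
      y \<oplus>\<^bsub>int_power_ring d\<^esub> x = \<zero>\<^bsub>int_power_ring d\<^esub>" for x
    by (rule bexI[of _ "\<lambda>i\<in>{..<d}. - x i"]) (simp_all cong: restrict_cong)
  have unit: "restrict x {..<d} = x" if "x \<in> extensional {..<d}" for x :: "nat \<Rightarrow> int"
    using that by (rule extensional_restrict)
  have "abelian_group (int_power_ring d)"
    by (rule abelian_groupI, rule_tac [6] neg)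
       (simp_all add: unit add_ac cong: restrict_cong)
  moreover have "comm_monoid (int_power_ring d)"
    by (rule comm_monoidI) (simp_all add: unit mult_ac cong: restrict_cong)
  ultimately show ?thesis
    by (rule cringI) (simp add: distrib_right cong: restrict_cong)
qed

definition additive_index :: "('a, 'b) ring_scheme \<Rightarrow> 'a set \<Rightarrow> nat" where
  "additive_index R H = card (a_rcosets\<^bsub>R\<^esub> H)"

text \<open>The library notion of a subring is unital: it contains the identity of the ambient ring.
  Finiteness of the set of cosets has to be required separately, since the cardinality of
  an infinite set is 0.\<close>

definition is_order_of :: "(nat \<Rightarrow> int) set \<Rightarrow> nat \<Rightarrow> bool" where
  "is_order_of A d \<longleftrightarrow>
    subring A (int_power_ring d) \<and> finite (a_rcosets\<^bsub>int_power_ring d\<^esub> A)"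

definition num_orders :: "nat \<Rightarrow> real \<Rightarrow> nat" where
  "num_orders d B =
    card {A. is_order_of A d \<and> real (additive_index (int_power_ring d) A) \<le> B}"

end

theory Submission
  imports Defs "HOL-Library.Function_Algebras" "HOL-Computational_Algebra.Squarefree" "HOL-Number_Theory.Number_Theory" "HOL-Analysis.Analysis"
    "HOL-Real_Asymp.Real_Asymp"
begin

text \<open>
  Let \<open>f k\<close> be the number of orders of index \<open>k\<close> in \<open>\<int>\<^sup>d\<close>. By the Chinese remainder theorem \<open>f\<close> is
  multiplicative, and \<open>f p = d choose 2\<close> because an order of prime index consists of the
  vectors two of whose coordinates agree modulo \<open>p\<close>. Everything else rests on bounds for \<open>f (p ^ e)\<close>.

  Dropping a coordinate \<open>i\<close> from an order of index \<open>p ^ e\<close> exhibits it as a fibre product of an order in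
  one dimension less with \<open>\<int>\<close> over \<open>\<int>/p ^ k\<close>, where \<open>p ^ k\<close> generates the conductor at \<open>i\<close>. A duality argument shows that the
  conductor exponents sum to at most \<open>2 * e\<close>, so some \<open>i\<close> has \<open>d * k \<le> 2 * e\<close>. Hence \<open>f (p ^ e)\<close> is bounded recursively
  by numbers of ring homomorphisms to \<open>\<int>/p ^ k\<close>. A homomorphism is pinned down coordinate by coordinate
  by quadratic congruences, which gives the exponents for \<open>d \<le> 4\<close> and the induction step for \<open>d \<ge> 6\<close>. In dimension 5 this is
  too weak: there an order in \<open>\<int>\<^sup>4\<close> is either of the form \<open>\<int> + p B\<close>, which allows a descent to the order \<open>B\<close>, or it has an idempotent
  or two generators, and then there are fewer homomorphisms.

  For \<open>d \<le> 5\<close> one gets \<open>f (p ^ e) \<le> b e * p powr (e - 3/2)\<close> for \<open>e \<ge> 2\<close> with \<open>b\<close> summable, so \<open>f\<close> is the Dirichlet convolution of the \<open>d choose 2\<close>-fold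
  divisor function with a function \<open>g\<close> such that \<open>\<Sum>k. \<bar>g k\<bar> / k\<close> converges, and the asymptotics follow by
  elementary partial summation. For \<open>d \<ge> 6\<close> the same argument on squarefree indices gives the lower bound,
  and convergence of the Euler product of \<open>\<Sum>k. f k / k powr s\<close> gives the upper bound.
\<close>

section \<open>Additive subgroups of finite index\<close>

text \<open>The recursion over coordinates just fails in dimension 5. In dimension 4 the exponent is
  about 2 e / 3, and an order there has about \<open>p ^ (3 * k / 2)\<close> unital homomorphisms by
  the trivial bound; k = 2 e / 5 then gives 2 (e - k) / 3 + 3 k / 2 = e, while already e - 1 makes
  the sum over primes diverge. With two generators, one satisfies a split quartic congruence (3 k /
  4) and the other a quadratic one (k / 2); replacing 3 k / 2 by 5 k / 4 lowers the total to 9 e /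
  10. Orders Z + p B admit no such improvement one by one, but they are rare: they correspond
  injectively to orders B whose index is smaller by the factor \<open>p ^ 3\<close>, at the price of
  a factor \<open>p ^ 3\<close> in the homomorphism count and with k lowered by 2. This is why
  homomorphisms are counted on average over all orders of a given index. Positivity of the leading
  constant is a separate matter: the absolutely convergent series that represents it has terms of
  unknown sign, so the constant is bounded below by comparison with a divisor function.\<close>

text \<open>The ring \<open>\<int>\<^sup>I\<close> is modelled by the functions vanishing outside \<open>I\<close>, so that the pointwise operations
  on functions apply and \<open>\<int>\<^sup>J\<close> is a subset of \<open>\<int>\<^sup>I\<close> for \<open>J \<subseteq> I\<close>.\<close>

definition vecs :: "nat set \<Rightarrow> (nat \<Rightarrow> int) set" where
  "vecs I = {x. \<forall>i. i \<notin> I \<longrightarrow> x i = 0}"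

definition sc :: "int \<Rightarrow> (nat \<Rightarrow> int) \<Rightarrow> nat \<Rightarrow> int" where
  "sc c x = (\<lambda>i. c * x i)"

lemma sc_apply [simp]: "sc c x i = c * x i"
  by (simp add: sc_def)

definition add_subgroup :: "(nat \<Rightarrow> int) set \<Rightarrow> bool" where
  "add_subgroup A \<longleftrightarrow> 0 \<in> A \<and> (\<forall>x\<in>A. \<forall>y\<in>A. x - y \<in> A)"

definition subrng :: "(nat \<Rightarrow> int) set \<Rightarrow> bool" where
  "subrng A \<longleftrightarrow> add_subgroup A \<and> (\<forall>x\<in>A. \<forall>y\<in>A. x * y \<in> A)"

definition suborder :: "nat set \<Rightarrow> (nat \<Rightarrow> int) set \<Rightarrow> bool" where
  "suborder I A \<longleftrightarrow> A \<subseteq> vecs I \<and> subrng A \<and> indicator I \<in> A"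

lemma add_subgroup_0: "add_subgroup A \<Longrightarrow> 0 \<in> A"
  and add_subgroup_diff: "add_subgroup A \<Longrightarrow> x \<in> A \<Longrightarrow> y \<in> A \<Longrightarrow> x - y \<in> A"
  by (auto simp: add_subgroup_def)

lemma add_subgroup_uminus: "add_subgroup A \<Longrightarrow> x \<in> A \<Longrightarrow> - x \<in> A"
  using add_subgroup_diff[of A 0 x] by (simp add: add_subgroup_0)

lemma add_subgroup_add: "add_subgroup A \<Longrightarrow> x \<in> A \<Longrightarrow> y \<in> A \<Longrightarrow> x + y \<in> A"
  using add_subgroup_diff[of A x "- y"] by (simp add: add_subgroup_uminus)

lemma add_subgroup_sc: assumes "add_subgroup A" "x \<in> A" shows "sc c x \<in> A"
proof -
  have nat: "sc (int n) x \<in> A" for n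
  proof (induction n)
    case 0 thus ?case using add_subgroup_0[OF assms(1)] by (simp add: sc_def zero_fun_def)
  next
    case (Suc n)
    have "sc (int (Suc n)) x = sc (int n) x + x" by (auto simp: algebra_simps)
    thus ?case using add_subgroup_add[OF assms(1) Suc assms(2)] by (simp only:)
  qed
  show ?thesis
  proof (cases "c \<ge> 0")
    case True thus ?thesis using nat[of "nat c"] by simp
  next
    case False
    have "sc c x = - sc (int (nat (- c))) x" using False by (auto simp: fun_eq_iff)
    thus ?thesis using add_subgroup_uminus[OF assms(1) nat] by metis
  qed
qed

lemma add_subgroup_sum:
  "add_subgroup A \<Longrightarrow> (\<And>i. i \<in> T \<Longrightarrow> f i \<in> A) \<Longrightarrow> sum f T \<in> A"
  by (induction T rule: infinite_finite_induct) (auto simp: add_subgroup_0 add_subgroup_add)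

lemma sum_fun_apply: "(\<Sum>i\<in>T. f i) j = (\<Sum>i\<in>T. f i j)" for f :: "'a \<Rightarrow> 'b \<Rightarrow> 'c::comm_monoid_add"
  by (induction T rule: infinite_finite_induct) auto

lemma power_fun_apply: "(x ^ n) j = x j ^ n" for x :: "'b \<Rightarrow> 'c::comm_monoid_mult"
  by (induction n) auto

lemma subrng_add_subgroup: "subrng A \<Longrightarrow> add_subgroup A"
  and subrng_mult: "subrng A \<Longrightarrow> x \<in> A \<Longrightarrow> y \<in> A \<Longrightarrow> x * y \<in> A"
  by (auto simp: subrng_def)

lemma suborder_subrng: "suborder I A \<Longrightarrow> subrng A"
  and suborder_add_subgroup: "suborder I A \<Longrightarrow> add_subgroup A"
  and suborder_vecs: "suborder I A \<Longrightarrow> A \<subseteq> vecs I"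
  and suborder_one: "suborder I A \<Longrightarrow> indicator I \<in> A"
  by (auto simp: suborder_def subrng_def)

lemma suborder_mult: "suborder I A \<Longrightarrow> x \<in> A \<Longrightarrow> y \<in> A \<Longrightarrow> x * y \<in> A"
  by (auto simp: suborder_def subrng_def)

lemma subrng_pow: "subrng A \<Longrightarrow> x \<in> A \<Longrightarrow> x ^ Suc n \<in> A"
  by (induction n) (auto simp: subrng_mult)

lemma vecs_add_subgroup: "add_subgroup (vecs I)"
  by (auto simp: add_subgroup_def vecs_def)

lemma vecs_subrng: "subrng (vecs I)"
  by (auto simp: subrng_def vecs_add_subgroup) (auto simp: vecs_def)

lemma add_subgroup_Int: "add_subgroup A \<Longrightarrow> add_subgroup B \<Longrightarrow> add_subgroup (A \<inter> B)"
  by (auto simp: add_subgroup_def)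

lemma subrng_Int: "subrng A \<Longrightarrow> subrng B \<Longrightarrow> subrng (A \<inter> B)"
  by (auto simp: subrng_def add_subgroup_Int)

lemma vecs_zero: "A \<subseteq> vecs I \<Longrightarrow> x \<in> A \<Longrightarrow> i \<notin> I \<Longrightarrow> x i = 0"
  by (auto simp: vecs_def)

section \<open>Residues and the index\<close>

definition full :: "nat \<Rightarrow> nat set \<Rightarrow> (nat \<Rightarrow> int) set \<Rightarrow> bool" where
  "full N I A \<longleftrightarrow> (\<forall>x\<in>vecs I. sc (int N) x \<in> A)"

text \<open>When \<open>full N I A\<close> holds, A is a union of cosets of N Z^I and these vectors
  represent them. Membership, equality of subgroups and the index become statements about finite
  sets, which is why indices are handled through numbers of residues.\<close>

definition resid :: "nat \<Rightarrow> (nat \<Rightarrow> int) set \<Rightarrow> (nat \<Rightarrow> int) set" where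
  "resid N A = {x \<in> A. \<forall>i. 0 \<le> x i \<and> x i < int N}"

definition vmod :: "nat \<Rightarrow> (nat \<Rightarrow> int) \<Rightarrow> nat \<Rightarrow> int" where
  "vmod N x = (\<lambda>i. x i mod int N)"

lemma vmod_apply [simp]: "vmod N x i = x i mod int N"
  by (simp add: vmod_def)

lemma vmod_vecs: "x \<in> vecs I \<Longrightarrow> vmod N x \<in> vecs I"
  by (auto simp: vecs_def)

lemma vecs_div: "x \<in> vecs I \<Longrightarrow> (\<lambda>i. x i div c) \<in> vecs I"
  by (auto simp: vecs_def)

lemma full_dvd: "full N I A \<Longrightarrow> N dvd M \<Longrightarrow> full M I A"
proof -
  assume a: "full N I A" "N dvd M"
  then obtain c where c: "M = N * c" by auto
  have "sc (int M) x = sc (int N) (sc (int c) x)" for x by (auto simp: c)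
  moreover have "sc (int N) (sc (int c) x) \<in> A" if "x \<in> vecs I" for x
    using a add_subgroup_sc[OF vecs_add_subgroup that] unfolding full_def by blast
  ultimately show ?thesis unfolding full_def by simp
qed

lemma full_mem: assumes "full N I A" "x \<in> vecs I" "\<And>i. i \<in> I \<Longrightarrow> int N dvd x i" shows "x \<in> A"
proof -
  have "x = sc (int N) (\<lambda>i. x i div int N)"
  proof
    fix i show "x i = sc (int N) (\<lambda>i. x i div int N) i"
      using assms(2) assms(3)[of i] by (cases "i \<in> I") (auto simp: vecs_def)
  qed
  moreover have "(\<lambda>i. x i div int N) \<in> vecs I" using assms(2) by (auto simp: vecs_def)
  moreover hence "sc (int N) (\<lambda>i. x i div int N) \<in> A" using assms(1) unfolding full_def by blast
  ultimately show ?thesis by simp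
qed

lemma vmod_diff_mem:
  assumes "full N I A" "x \<in> vecs I" shows "x - vmod N x \<in> A"
proof (rule full_mem[OF assms(1)])
  show "x - vmod N x \<in> vecs I" using assms(2) by (auto simp: vecs_def)
  show "int N dvd (x - vmod N x) i" for i by (simp add: minus_mod_eq_mult_div)
qed

lemma vmod_mem:
  assumes "add_subgroup A" "A \<subseteq> vecs I" "full N I A" "x \<in> A" shows "vmod N x \<in> A"
proof -
  have "x - (x - vmod N x) \<in> A"
    by (rule add_subgroup_diff[OF assms(1,4) vmod_diff_mem[OF assms(3)]]) (use assms(2,4) in blast)
  thus ?thesis by simp
qed

lemma vmod_resid:
  assumes "add_subgroup A" "A \<subseteq> vecs I" "full N I A" "x \<in> A" "N > 0"
  shows "vmod N x \<in> resid N A"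
  using vmod_mem[OF assms(1-4)] assms(5) by (simp add: resid_def)

lemma full_vecs: "full N I (vecs I)"
  by (auto simp: full_def vecs_def)

lemma vmod_vecs_resid: "x \<in> vecs I \<Longrightarrow> N > 0 \<Longrightarrow> vmod N x \<in> resid N (vecs I)"
  by (auto simp: resid_def vecs_def)

lemma card_resid_vecs:
  assumes "finite I" "N > 0"
  shows "finite (resid N (vecs I)) \<and> card (resid N (vecs I)) = N ^ card I"
proof -
  have b: "bij_betw (\<lambda>x. restrict x I) (resid N (vecs I)) (I \<rightarrow>\<^sub>E {0..<int N})"
  proof (rule bij_betw_byWitness[where f' = "\<lambda>x i. if i \<in> I then x i else 0"])
    show "\<forall>a\<in>resid N (vecs I). (\<lambda>i. if i \<in> I then restrict a I i else 0) = a"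
      by (auto simp: resid_def vecs_def fun_eq_iff)
    show "\<forall>a'\<in>I \<rightarrow>\<^sub>E {0..<int N}. restrict (\<lambda>i. if i \<in> I then a' i else 0) I = a'"
      by (auto simp: fun_eq_iff restrict_def PiE_def extensional_def)
    show "(\<lambda>x. restrict x I) ` resid N (vecs I) \<subseteq> I \<rightarrow>\<^sub>E {0..<int N}"
      by (auto simp: resid_def)
    show "(\<lambda>x i. if i \<in> I then x i else 0) ` (I \<rightarrow>\<^sub>E {0..<int N}) \<subseteq> resid N (vecs I)"
    proof safe
      fix x assume x: "x \<in> I \<rightarrow>\<^sub>E {0..<int N}"
      have "i \<in> I \<Longrightarrow> 0 \<le> x i \<and> x i < int N" for i using PiE_mem[OF x, of i] by simp
      thus "(\<lambda>i. if i \<in> I then x i else 0) \<in> resid N (vecs I)"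
        using assms(2) by (auto simp: resid_def vecs_def)
    qed
  qed
  have "finite (I \<rightarrow>\<^sub>E {0..<int N})" "card (I \<rightarrow>\<^sub>E {0..<int N}) = N ^ card I"
    using assms by (auto simp: finite_PiE card_PiE)
  with bij_betw_finite[OF b] bij_betw_same_card[OF b] show ?thesis by simp
qed

lemma finite_resid: "finite I \<Longrightarrow> N > 0 \<Longrightarrow> A \<subseteq> vecs I \<Longrightarrow> finite (resid N A)"
  by (rule finite_subset[of _ "resid N (vecs I)"]) (use card_resid_vecs in \<open>auto simp: resid_def\<close>)

definition cosets_of :: "nat set \<Rightarrow> (nat \<Rightarrow> int) set \<Rightarrow> (nat \<Rightarrow> int) set set" where
  "cosets_of I A = (\<lambda>x. (+) x ` A) ` vecs I"

lemma coset_eq_iff: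
  assumes "add_subgroup A" shows "(+) x ` A = (+) y ` A \<longleftrightarrow> x - y \<in> A"
proof
  assume "(+) x ` A = (+) y ` A"
  moreover have "x \<in> (+) x ` A" using add_subgroup_0[OF assms] by force
  ultimately obtain a where "a \<in> A" "x = y + a" by auto
  thus "x - y \<in> A" by simp
next
  have *: "(+) x ` A \<subseteq> (+) y ` A" if "x - y \<in> A" for x y
  proof
    fix z assume "z \<in> (+) x ` A"
    then obtain a where "a \<in> A" "z = y + ((x - y) + a)" by (auto simp: algebra_simps)
    thus "z \<in> (+) y ` A" using that add_subgroup_add[OF assms] by blast
  qed
  assume "x - y \<in> A"
  moreover hence "y - x \<in> A" using add_subgroup_uminus[OF assms] by force
  ultimately show "(+) x ` A = (+) y ` A" using * by blast
qed

text \<open>Lagrange's theorem in Z^I / N Z^I: every coset of A contains a residue, and translation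
  by x followed by reduction carries the residues of A bijectively to those in x + A.\<close>

lemma card_resid_mult_index:
  assumes A: "add_subgroup A" "A \<subseteq> vecs I" and I: "finite I" and N: "N > 0" "full N I A"
  shows "finite (cosets_of I A)" "card (resid N A) * card (cosets_of I A) = N ^ card I"
proof -
  let ?B = "resid N (vecs I)" and ?f = "\<lambda>x. (+) x ` A"
  have fin: "finite ?B" and card: "card ?B = N ^ card I" using card_resid_vecs[OF I N(1)] by auto
  have im: "?f ` ?B = cosets_of I A"
  proof -
    have 1: "?f x = ?f (vmod N x)" "vmod N x \<in> ?B" if "x \<in> vecs I" for x
      using vmod_diff_mem[OF N(2) that] vmod_vecs_resid[OF that N(1)] by (simp_all only: coset_eq_iff[OF A(1)])
    have "?B \<subseteq> vecs I" by (auto simp: resid_def)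
    moreover have "?f ` vecs I \<subseteq> ?f ` ?B"
    proof (rule image_subsetI)
      fix x assume "x \<in> vecs I"
      from 1[OF this] show "?f x \<in> ?f ` ?B" by (rule image_eqI)
    qed
    ultimately show ?thesis unfolding cosets_of_def by (simp only: equalityI image_mono)
  qed
  show finc: "finite (cosets_of I A)" unfolding im[symmetric] using fin by auto
  have fib: "card {y \<in> ?B. ?f y = C} = card (resid N A)" if "C \<in> ?f ` ?B" for C
  proof -
    obtain x where x: "x \<in> ?B" "C = ?f x" using \<open>C \<in> ?f ` ?B\<close> by (rule imageE)
    have xv: "x \<in> vecs I" using x by (auto simp: resid_def)
    have "bij_betw (\<lambda>r. vmod N (x + r)) (resid N A) {y \<in> ?B. ?f y = C}"
    proof (rule bij_betw_byWitness[where f' = "\<lambda>y. vmod N (y - x)"])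
      show "\<forall>a\<in>resid N A. vmod N (vmod N (x + a) - x) = a"
        by (auto simp: resid_def fun_eq_iff mod_diff_left_eq)
      show "\<forall>a'\<in>{y \<in> ?B. ?f y = C}. vmod N (x + vmod N (a' - x)) = a'"
        by (auto simp: resid_def fun_eq_iff mod_add_right_eq)
      show "(\<lambda>r. vmod N (x + r)) ` resid N A \<subseteq> {y \<in> ?B. ?f y = C}"
      proof (rule image_subsetI)
        fix r assume r: "r \<in> resid N A"
        hence v: "x + r \<in> vecs I" "r \<in> A" using A(2) xv by (auto simp: resid_def vecs_def)
        have "?f (vmod N (x + r)) = ?f (x + r)"
          using coset_eq_iff[OF A(1)] vmod_diff_mem[OF N(2) v(1)] by metis
        also have "\<dots> = C" using v(2) coset_eq_iff[OF A(1), of "x + r" x] x by simp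
        finally show "vmod N (x + r) \<in> {y \<in> ?B. ?f y = C}"
          using vmod_vecs_resid[OF v(1) N(1)] by simp
      qed
      show "(\<lambda>y. vmod N (y - x)) ` {y \<in> ?B. ?f y = C} \<subseteq> resid N A"
      proof (rule image_subsetI)
        fix y assume "y \<in> {y \<in> ?B. ?f y = C}"
        hence "y - x \<in> A" using x coset_eq_iff[OF A(1), of y x] by simp
        thus "vmod N (y - x) \<in> resid N A" by (rule vmod_resid[OF A N(2) _ N(1)])
      qed
    qed
    from bij_betw_same_card[OF this] show ?thesis by simp
  qed
  have "card ?B = (\<Sum>C\<in>?f ` ?B. card {y \<in> ?B. ?f y = C})"
    using sum.image_gen[OF fin, of "\<lambda>_. 1::nat" ?f] by (simp only: card_eq_sum)
  also have "\<dots> = (\<Sum>C\<in>?f ` ?B. card (resid N A))" by (rule sum.cong[OF refl fib])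
  also have "\<dots> = card (cosets_of I A) * card (resid N A)" by (simp only: im sum_constant of_nat_id)
  finally show "card (resid N A) * card (cosets_of I A) = N ^ card I" using card by (simp only: mult.commute)
qed

text \<open>The index annihilates the quotient: adding x permutes the cosets, so the sum of all
  representatives changes by the index times x on the one hand and only by an element of A on the
  other.\<close>

lemma full_index:
  assumes A: "add_subgroup A" "A \<subseteq> vecs I" and fin: "finite (cosets_of I A)"
  shows "full (card (cosets_of I A)) I A" "card (cosets_of I A) > 0"
proof -
  let ?C = "cosets_of I A"
  show "card ?C > 0" using fin by (auto simp: card_gt_0_iff cosets_of_def vecs_def)
  define r where "r C = (SOME x. x \<in> vecs I \<and> C = (+) x ` A)" for C
  have r: "r C \<in> vecs I" "C = (+) (r C) ` A" if "C \<in> ?C" for C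
  proof -
    have "\<exists>x. x \<in> vecs I \<and> C = (+) x ` A" using that by (auto simp: cosets_of_def)
    from someI_ex[OF this] show "r C \<in> vecs I" "C = (+) (r C) ` A" unfolding r_def by blast+
  qed
  show "full (card ?C) I A" unfolding full_def
  proof
    fix x assume x: "x \<in> vecs I"
    let ?t = "\<lambda>C. (+) x ` C"
    have tr: "?t ((+) y ` A) = (+) (x + y) ` A" for y
      by (auto simp: image_image add.assoc)
    have mem: "?t C \<in> ?C" if "C \<in> ?C" for C
    proof -
      have "?t C = (+) (x + r C) ` A" by (rule trans[OF arg_cong[OF r(2)[OF that], of ?t] tr])
      moreover have "x + r C \<in> vecs I" using add_subgroup_add[OF vecs_add_subgroup x r(1)[OF that]] .
      ultimately show ?thesis unfolding cosets_of_def by blast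
    qed
    have inj: "inj_on ?t ?C"
      by (rule inj_onI) (simp add: inj_image_eq_iff[of "(+) x"] inj_def)
    have "?t ` ?C = ?C"
      by (rule card_subset_eq[OF fin]) (use mem card_image[OF inj] in auto)
    hence bij: "bij_betw ?t ?C ?C" using inj by (simp add: bij_betw_def)
    \<comment> \<open>The representatives cancel because \<open>?t\<close> permutes the cosets; each
      single summand lies in A since x + r C and r (?t C) lie in the same coset.\<close>
    have "sc (int (card ?C)) x = (\<Sum>C\<in>?C. x + r C - r (?t C))"
    proof -
      have "(\<Sum>C\<in>?C. r (?t C)) = (\<Sum>C\<in>?C. r C)"
        by (rule sum.reindex_bij_betw[OF bij])
      hence "(\<Sum>C\<in>?C. x + r C - r (?t C)) = (\<Sum>C\<in>?C. x)"
        by (simp add: sum_subtractf sum.distrib)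
      also have "\<dots> = sc (int (card ?C)) x" by (auto simp: fun_eq_iff sum_fun_apply)
      finally show ?thesis by simp
    qed
    also have "\<dots> \<in> A"
    proof (rule add_subgroup_sum[OF A(1)])
      fix C assume C: "C \<in> ?C"
      have "(+) (x + r C) ` A = (+) (r (?t C)) ` A"
        by (rule trans[OF trans[OF tr[symmetric] arg_cong[OF r(2)[OF C], of ?t, symmetric]] r(2)[OF mem[OF C]]])
      thus "x + r C - r (?t C) \<in> A" by (simp only: coset_eq_iff[OF A(1)])
    qed
    finally show "sc (int (card ?C)) x \<in> A" .
  qed
qed

section \<open>Counting homomorphisms to residue rings\<close>

lemma prime_pow_not_dvd_mult:
  fixes p :: int
  assumes "prime p" "\<not> p ^ Suc m dvd a" "\<not> p ^ Suc n dvd b"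
  shows "\<not> p ^ Suc (m + n) dvd a * b"
proof
  assume d: "p ^ Suc (m + n) dvd a * b"
  have nz: "a \<noteq> 0" "b \<noteq> 0" using assms by auto
  have nu: "\<not> is_unit p" using assms(1) not_prime_unit by blast
  have "Suc (m + n) \<le> multiplicity p (a * b)"
    using d nz nu power_dvd_iff_le_multiplicity[of "a * b" p "Suc (m + n)"] by auto
  also have "\<dots> = multiplicity p a + multiplicity p b"
    using nz assms(1) by (intro prime_elem_multiplicity_mult_distrib) auto
  finally show False
    using assms(2,3) nz nu power_dvd_iff_le_multiplicity[of a p "Suc m"]
      power_dvd_iff_le_multiplicity[of b p "Suc n"] by auto
qed

lemma int_div_in_range:
  fixes X a b :: int
  assumes "0 \<le> X" "X < a * b" "a > 0"
  shows "X div a \<in> {0..<b}"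
proof -
  have "X div a < b"
  proof (rule ccontr)
    assume "\<not> X div a < b"
    hence "a * b \<le> a * (X div a)" using assms(3) by simp
    also have "\<dots> = X - X mod a" by (simp add: minus_mod_eq_mult_div)
    also have "\<dots> \<le> X" using assms(3) by simp
    finally show False using assms(2) by simp
  qed
  thus ?thesis using assms by (simp add: pos_imp_zdiv_nonneg_iff)
qed

lemma finite_int_range_filter: "finite {X \<in> {0..<N::int}. P X}"
  by (rule finite_subset[of _ "{0..<N}"]) auto

lemma card_residue_class_le:
  fixes a :: int and p :: nat
  assumes "p > 0" "r \<le> k"
  shows "card {X \<in> {0..<int (p ^ k)}. [X = a] (mod int (p ^ r))} \<le> p ^ (k - r)"
proof -
  let ?S = "{X \<in> {0..<int (p ^ k)}. [X = a] (mod int (p ^ r))}"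
  have pk: "int (p ^ k) = int (p ^ r) * int (p ^ (k - r))"
    using assms(2) by (metis le_add_diff_inverse of_nat_mult power_add)
  have "inj_on (\<lambda>X. X div int (p ^ r)) ?S"
  proof (rule inj_onI)
    fix X Y assume XY: "X \<in> ?S" "Y \<in> ?S" and "X div int (p ^ r) = Y div int (p ^ r)"
    moreover from XY have "X mod int (p ^ r) = Y mod int (p ^ r)" unfolding Cong.cong_def by force
    ultimately show "X = Y" by (metis div_mult_mod_eq)
  qed
  moreover have "(\<lambda>X. X div int (p ^ r)) ` ?S \<subseteq> {0..<int (p ^ (k - r))}"
  proof (rule image_subsetI)
    fix X assume "X \<in> ?S"
    hence "0 \<le> X" "X < int (p ^ r) * int (p ^ (k - r))" using pk by auto
    moreover have "int (p ^ r) > 0" using assms(1) by simp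
    ultimately show "X div int (p ^ r) \<in> {0..<int (p ^ (k - r))}"
      by (rule int_div_in_range)
  qed
  ultimately have "card ?S \<le> card {0..<int (p ^ (k - r))}" by (intro card_inj_on_le) auto
  thus ?thesis by (simp only: card_atLeastLessThan_int diff_0_right nat_int)
qed

lemma card_Sigma_bound:
  assumes "finite B" "\<And>b. b \<in> B \<Longrightarrow> finite (C b)" "\<And>b. b \<in> B \<Longrightarrow> card (C b) \<le> M"
    "inj_on g A" "g ` A \<subseteq> Sigma B C"
  shows "finite A" "card A \<le> card B * M"
proof -
  have f: "finite (Sigma B C)" using assms(1,2) by auto
  show "finite A" using inj_on_finite[OF assms(4,5) f] .
  have "card A \<le> card (Sigma B C)" using card_inj_on_le[OF assms(4,5) f] .
  also have "\<dots> = (\<Sum>b\<in>B. card (C b))" using assms(1,2) by (intro card_SigmaI) auto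
  also have "\<dots> \<le> (\<Sum>b\<in>B. M)" using assms(3) by (intro sum_mono) auto
  finally show "card A \<le> card B * M" by simp
qed

text \<open>Subtracting the congruence of one solution X0 leaves the product (X - X0) (X - (d -
  X0)), so every solution agrees with X0 or d - X0 modulo p to half the exponent, rounded up. The
  argument is uniform in p, including p = 2 and degenerate discriminants.\<close>

lemma card_quadratic_solutions:
  fixes c d :: int and p :: nat
  assumes "prime p"
  shows "card {X \<in> {0..<int (p ^ k)}. [X * X = d * X + c] (mod int (p ^ k))} \<le> 2 * p ^ (k div 2)"
proof -
  let ?S = "{X \<in> {0..<int (p ^ k)}. [X * X = d * X + c] (mod int (p ^ k))}"
  let ?r = "k - k div 2"
  let ?T = "\<lambda>a. {X \<in> {0..<int (p ^ k)}. [X = a] (mod int (p ^ ?r))}"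
  show ?thesis
  proof (cases "?S = {}")
    case False
    then obtain X0 where X0: "[X0 * X0 = d * X0 + c] (mod int (p ^ k))" by auto
    have "?S \<subseteq> ?T X0 \<union> ?T (d - X0)"
    proof
      fix X assume X: "X \<in> ?S"
      hence "[X * X = d * X + c] (mod int (p ^ k))" by simp
      from cong_diff[OF this X0] have "int (p ^ k) dvd (X * X - X0 * X0) - ((d * X + c) - (d * X0 + c))"
        by (simp add: cong_iff_dvd_diff)
      also have "(X * X - X0 * X0) - ((d * X + c) - (d * X0 + c)) = (X - X0) * (X - (d - X0))"
        by (simp add: algebra_simps)
      finally have dv: "int p ^ k dvd (X - X0) * (X - (d - X0))" by simp
      have "int p ^ ?r dvd X - X0 \<or> int p ^ ?r dvd X - (d - X0)"
      proof (cases ?r)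
        case (Suc m)
        hence "Suc (m + m) \<le> k" by linarith
        hence "int p ^ Suc (m + m) dvd (X - X0) * (X - (d - X0))"
          using dv by (meson dvd_trans le_imp_power_dvd)
        thus ?thesis using prime_pow_not_dvd_mult[of "int p" m "X - X0" m] assms Suc by auto
      next
        case 0 thus ?thesis by (simp only: power_0 one_dvd simp_thms)
      qed
      thus "X \<in> ?T X0 \<union> ?T (d - X0)" using X by (auto simp: cong_iff_dvd_diff)
    qed
    hence "card ?S \<le> card (?T X0 \<union> ?T (d - X0))" by (intro card_mono finite_UnI finite_int_range_filter)
    also have "\<dots> \<le> card (?T X0) + card (?T (d - X0))" by (rule card_Un_le)
    also have "\<dots> \<le> p ^ (k - ?r) + p ^ (k - ?r)"
      using assms by (intro add_mono card_residue_class_le) (auto simp: prime_gt_0_nat)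
    also have "k - ?r = k div 2" by simp
    finally show ?thesis by simp
  next
    case True
    thus ?thesis by (simp only: card.empty)
  qed
qed

text \<open>One of the four factors carries at least a quarter of the exponent, rounded up, so X is
  confined to one of four residue classes modulo that power of p.\<close>

lemma card_split_quartic_solutions:
  fixes a b c d :: int and p :: nat
  assumes "prime p"
  shows "card {X \<in> {0..<int (p ^ k)}. int (p ^ k) dvd (X - a) * (X - b) * ((X - c) * (X - d))}
    \<le> 4 * p ^ (3 * k div 4)"
proof -
  let ?S = "{X \<in> {0..<int (p ^ k)}. int (p ^ k) dvd (X - a) * (X - b) * ((X - c) * (X - d))}"
  let ?r = "k - 3 * k div 4"
  let ?T = "\<lambda>a. {X \<in> {0..<int (p ^ k)}. [X = a] (mod int (p ^ ?r))}"
  have pp: "prime (int p)" using assms by simp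
  have "?S \<subseteq> (?T a \<union> ?T b) \<union> (?T c \<union> ?T d)"
  proof
    fix X assume X: "X \<in> ?S"
    have "int p ^ ?r dvd X - a \<or> int p ^ ?r dvd X - b \<or> int p ^ ?r dvd X - c \<or> int p ^ ?r dvd X - d"
    proof (cases ?r)
      case (Suc m)
      hence "Suc ((m + m) + (m + m)) \<le> k" by linarith
      hence "int p ^ Suc ((m + m) + (m + m)) dvd (X - a) * (X - b) * ((X - c) * (X - d))"
        using X dvd_trans[OF le_imp_power_dvd, of _ _ "int p"] by (simp only: mem_Collect_eq of_nat_power)
      thus ?thesis
        using prime_pow_not_dvd_mult[OF pp, of "m + m" "(X - a) * (X - b)" "m + m" "(X - c) * (X - d)"]
          prime_pow_not_dvd_mult[OF pp, of m "X - a" m "X - b"]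
          prime_pow_not_dvd_mult[OF pp, of m "X - c" m "X - d"] Suc by auto
    next
      case 0 thus ?thesis by (simp only: power_0 one_dvd simp_thms)
    qed
    thus "X \<in> (?T a \<union> ?T b) \<union> (?T c \<union> ?T d)" using X by (auto simp: cong_iff_dvd_diff)
  qed
  hence "card ?S \<le> card ((?T a \<union> ?T b) \<union> (?T c \<union> ?T d))" by (intro card_mono finite_UnI finite_int_range_filter)
  also have "\<dots> \<le> (card (?T a) + card (?T b)) + (card (?T c) + card (?T d))"
    by (intro order_trans[OF card_Un_le] add_mono card_Un_le)
  also have "\<dots> \<le> (p ^ (k - ?r) + p ^ (k - ?r)) + (p ^ (k - ?r) + p ^ (k - ?r))"
    using assms by (intro add_mono card_residue_class_le) (auto simp: prime_gt_0_nat)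
  also have "k - ?r = 3 * k div 4" by simp
  finally show ?thesis by simp
qed

text \<open>Taking values among the standard representatives, and \<open>undefined\<close> outside
  \<open>J\<close>, makes each homomorphism to Z/q a single function, so that counting is a
  cardinality. The condition says nothing about units because \<open>J\<close> is usually an ideal
  that misses the identity vector.\<close>

definition homs :: "nat \<Rightarrow> (nat \<Rightarrow> int) set \<Rightarrow> ((nat \<Rightarrow> int) \<Rightarrow> int) set" where
  "homs q J = {\<phi> \<in> J \<rightarrow>\<^sub>E {0..<int q}. \<forall>x\<in>J. \<forall>y\<in>J.
     [\<phi> (x + y) = \<phi> x + \<phi> y] (mod int q) \<and> [\<phi> (x * y) = \<phi> x * \<phi> y] (mod int q)}"

lemma homs_add: "\<phi> \<in> homs q J \<Longrightarrow> x \<in> J \<Longrightarrow> y \<in> J \<Longrightarrow> [\<phi> (x + y) = \<phi> x + \<phi> y] (mod int q)"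
  and homs_mult: "\<phi> \<in> homs q J \<Longrightarrow> x \<in> J \<Longrightarrow> y \<in> J \<Longrightarrow> [\<phi> (x * y) = \<phi> x * \<phi> y] (mod int q)"
  and homs_range: "\<phi> \<in> homs q J \<Longrightarrow> x \<in> J \<Longrightarrow> 0 \<le> \<phi> x \<and> \<phi> x < int q"
  by (auto simp: homs_def PiE_def Pi_def)

lemma homs_diff:
  assumes "add_subgroup J" "\<phi> \<in> homs q J" "x \<in> J" "y \<in> J"
  shows "[\<phi> (x - y) = \<phi> x - \<phi> y] (mod int q)"
proof -
  have "[\<phi> (x - y + y) = \<phi> (x - y) + \<phi> y] (mod int q)"
    using assms add_subgroup_diff by (intro homs_add[OF assms(2)]) auto
  hence "[\<phi> x - \<phi> y = \<phi> (x - y) + \<phi> y - \<phi> y] (mod int q)" by (intro cong_diff) auto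
  thus ?thesis by (simp add: cong_sym)
qed

lemma homs_zero: "add_subgroup J \<Longrightarrow> \<phi> \<in> homs q J \<Longrightarrow> [\<phi> 0 = 0] (mod int q)"
  using homs_diff[of J \<phi> q 0 0] by (simp add: add_subgroup_0)

lemma homs_sc:
  assumes "add_subgroup J" "\<phi> \<in> homs q J" "x \<in> J"
  shows "[\<phi> (sc c x) = c * \<phi> x] (mod int q)"
proof -
  have nat: "[\<phi> (sc (int n) x) = int n * \<phi> x] (mod int q)" for n
  proof (induction n)
    case 0
    have "sc (int 0) x = 0" by auto
    thus ?case using homs_zero[OF assms(1,2)] by (simp only: of_nat_0 mult_zero_left)
  next
    case (Suc n)
    have "sc (int (Suc n)) x = sc (int n) x + x" by (auto simp: algebra_simps)
    moreover have "[\<phi> (sc (int n) x + x) = \<phi> (sc (int n) x) + \<phi> x] (mod int q)"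
      by (intro homs_add[OF assms(2)] add_subgroup_sc assms)
    moreover have "[\<phi> (sc (int n) x) + \<phi> x = int n * \<phi> x + \<phi> x] (mod int q)"
      by (intro cong_add Suc cong_refl)
    ultimately have "[\<phi> (sc (int (Suc n)) x) = int n * \<phi> x + \<phi> x] (mod int q)"
      by (simp only:) (rule cong_trans)
    moreover have "int n * \<phi> x + \<phi> x = int (Suc n) * \<phi> x" by (simp add: algebra_simps)
    ultimately show ?case by (simp only:)
  qed
  show ?thesis
  proof (cases "c \<ge> 0")
    case True
    hence "int (nat c) = c" by simp
    thus ?thesis using nat[of "nat c"] by (simp only:)
  next
    case False
    have "sc c x = 0 - sc (int (nat (- c))) x" using False by (auto simp: fun_eq_iff)
    moreover have "[\<phi> (0 - sc (int (nat (- c))) x) = \<phi> 0 - \<phi> (sc (int (nat (- c))) x)] (mod int q)"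
      by (intro homs_diff[OF assms(1,2)] add_subgroup_0 add_subgroup_sc assms)
    moreover have "[\<phi> 0 - \<phi> (sc (int (nat (- c))) x) = 0 - int (nat (- c)) * \<phi> x] (mod int q)"
      by (intro cong_diff homs_zero[OF assms(1,2)] nat)
    ultimately have "[\<phi> (sc c x) = 0 - int (nat (- c)) * \<phi> x] (mod int q)"
      by (simp only:) (rule cong_trans)
    moreover have "0 - int (nat (- c)) * \<phi> x = c * \<phi> x" using False by simp
    ultimately show ?thesis by (simp only:)
  qed
qed

lemma homs_eqI:
  assumes "\<phi> \<in> homs q J" "\<psi> \<in> homs q J" "\<And>x. x \<in> J \<Longrightarrow> [\<phi> x = \<psi> x] (mod int q)"
  shows "\<phi> = \<psi>"
proof (rule PiE_ext[of _ J "\<lambda>_. {0..<int q}"])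
  show "\<phi> \<in> J \<rightarrow>\<^sub>E {0..<int q}" "\<psi> \<in> J \<rightarrow>\<^sub>E {0..<int q}" using assms by (auto simp: homs_def)
  fix x assume "x \<in> J"
  from assms(3)[OF this] homs_range[OF assms(1) this] homs_range[OF assms(2) this]
  show "\<phi> x = \<psi> x" by (simp add: Cong.cong_def)
qed

lemma homs_restrict:
  assumes "subrng J'" "J' \<subseteq> J" "\<phi> \<in> homs q J"
  shows "restrict \<phi> J' \<in> homs q J'"
proof -
  have "x + y \<in> J'" "x * y \<in> J'" if "x \<in> J'" "y \<in> J'" for x y
    using that assms(1) subrng_mult add_subgroup_add subrng_add_subgroup by auto
  moreover have "[\<phi> (x + y) = \<phi> x + \<phi> y] (mod int q)" "[\<phi> (x * y) = \<phi> x * \<phi> y] (mod int q)"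
    if "x \<in> J'" "y \<in> J'" for x y
    using that assms(2) homs_add[OF assms(3)] homs_mult[OF assms(3)] by blast+
  moreover have "\<phi> x \<in> {0..<int q}" if "x \<in> J'" for x
    using that assms(2) homs_range[OF assms(3)] by auto
  ultimately show ?thesis unfolding homs_def by simp
qed

text \<open>The i-th coordinates of J form an ideal of Z, and v realizes a generator. The generator
  is 0 when J vanishes at i.\<close>

lemma add_subgroup_coord_gen:
  assumes "add_subgroup J" obtains v where "v \<in> J" "\<And>x. x \<in> J \<Longrightarrow> v i dvd x i"
proof (cases "\<exists>x\<in>J. x i \<noteq> 0")
  case False
  thus ?thesis using that[of 0] add_subgroup_0[OF assms] by auto
next
  case True
  then obtain v where v: "v \<in> J" "v i \<noteq> 0" and least: "\<And>y. y \<in> J \<and> y i \<noteq> 0 \<Longrightarrow> nat \<bar>v i\<bar> \<le> nat \<bar>y i\<bar>"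
    using ex_has_least_nat[of "\<lambda>x. x \<in> J \<and> x i \<noteq> 0" _ "\<lambda>x. nat \<bar>x i\<bar>"] by blast
  have "v i dvd x i" if "x \<in> J" for x
  proof -
    let ?y = "x - sc (x i div v i) v"
    have "?y \<in> J" using that v add_subgroup_diff add_subgroup_sc assms by simp
    moreover have "?y i = x i mod v i" by (simp add: minus_div_mult_eq_mod)
    moreover have "\<bar>x i mod v i\<bar> < \<bar>v i\<bar>" using v(2) by (rule abs_mod_less)
    ultimately have "x i mod v i = 0" using least[of ?y] by fastforce
    thus ?thesis by (simp add: dvd_eq_mod_eq_0)
  qed
  thus ?thesis using that v by blast
qed

text \<open>If \<open>v\<close> has a minimal nonzero \<open>i\<close>-th coordinate, then \<open>v * v - v i v\<close> lies in \<open>J\<close> and has \<open>i\<close>-th coordinate 0,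
  so the image of \<open>v\<close> solves a quadratic congruence once the homomorphism is known on the smaller ring.\<close>

lemma card_homs_le:
  assumes "prime p" "finite S" "subrng J" "J \<subseteq> vecs S"
  shows "finite (homs (p ^ k) J) \<and> card (homs (p ^ k) J) \<le> (2 * p ^ (k div 2)) ^ card S"
  using assms(2-)
proof (induction S arbitrary: J rule: finite_induct)
  case empty
  have J: "J \<subseteq> {0}" using empty(2) by (auto simp: vecs_def fun_eq_iff)
  have "\<phi> = \<psi>" if h: "\<phi> \<in> homs (p ^ k) J" "\<psi> \<in> homs (p ^ k) J" for \<phi> \<psi>
  proof (rule homs_eqI[OF h])
    fix x assume "x \<in> J"
    hence "x = 0" using J by auto
    thus "[\<phi> x = \<psi> x] (mod int (p ^ k))"
      using homs_zero[OF subrng_add_subgroup[OF empty(1)]] h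
      by (metis (no_types, lifting) cong_sym cong_trans)
  qed
  hence "homs (p ^ k) J = {} \<or> (\<exists>\<phi>. homs (p ^ k) J = {\<phi>})" by blast
  thus ?case by auto
next
  case (insert i S)
  let ?q = "p ^ k" and ?J = "J \<inter> vecs S"
  have sg: "add_subgroup J" using insert.prems(1) by (rule subrng_add_subgroup)
  have J': "subrng ?J" using insert.prems(1) vecs_subrng by (rule subrng_Int)
  obtain v where v: "v \<in> J" "\<And>x. x \<in> J \<Longrightarrow> v i dvd x i" using add_subgroup_coord_gen[OF sg] by blast
  define w where "w = v * v - sc (v i) v"
  have mem: "x \<in> vecs S" if "x \<in> J" "x i = 0" for x
    using that insert.prems(2) by (auto simp: vecs_def)
  have wJ: "w \<in> J" unfolding w_def
    using v insert.prems(1) by (intro add_subgroup_diff[OF sg] subrng_mult add_subgroup_sc[OF sg])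
  have w: "w \<in> ?J" using mem[OF wJ] wJ by (simp add: w_def)
  let ?C = "\<lambda>\<psi>. {X \<in> {0..<int ?q}. [X * X = v i * X + \<psi> w] (mod int ?q)}"
  let ?g = "\<lambda>\<phi>. (restrict \<phi> ?J, \<phi> v)"
  have IH: "finite (homs ?q ?J)" "card (homs ?q ?J) \<le> (2 * p ^ (k div 2)) ^ card S"
    using insert.IH[OF J'] by auto
  have inj: "inj_on ?g (homs ?q J)"
  proof (rule inj_onI)
    fix \<phi> \<psi> assume h: "\<phi> \<in> homs ?q J" "\<psi> \<in> homs ?q J" and eq: "?g \<phi> = ?g \<psi>"
    show "\<phi> = \<psi>"
    proof (rule homs_eqI[OF h])
      fix x assume x: "x \<in> J"
      obtain c where c: "x i = v i * c" using v(2)[OF x] by blast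
      let ?y = "x - sc c v"
      have y: "?y \<in> J" using x v sg add_subgroup_diff add_subgroup_sc by simp
      hence "?y \<in> ?J" using mem[OF y] c by (simp add: mult.commute)
      hence eqy: "\<phi> ?y = \<psi> ?y" using eq by (metis prod.inject restrict_apply')
      have x': "x = ?y + sc c v" by simp
      have *: "[\<theta> x = \<theta> ?y + c * \<theta> v] (mod int ?q)" if "\<theta> \<in> homs ?q J" for \<theta>
      proof -
        have "[\<theta> (?y + sc c v) = \<theta> ?y + \<theta> (sc c v)] (mod int ?q)"
          by (intro homs_add[OF that y] add_subgroup_sc[OF sg v(1)])
        moreover have "[\<theta> ?y + \<theta> (sc c v) = \<theta> ?y + c * \<theta> v] (mod int ?q)"
          by (intro cong_add cong_refl homs_sc[OF sg that v(1)])
        ultimately show ?thesis by (metis x' cong_trans)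
      qed
      show "[\<phi> x = \<psi> x] (mod int ?q)"
        using *[OF h(1)] *[OF h(2)] eq eqy by (metis prod.inject cong_sym cong_trans)
    qed
  qed
  have sub: "?g ` homs ?q J \<subseteq> Sigma (homs ?q ?J) ?C"
  proof (rule image_subsetI)
    fix \<phi> assume h: "\<phi> \<in> homs ?q J"
    have "v * v = w + sc (v i) v" by (simp add: w_def)
    hence "[\<phi> (v * v) = \<phi> w + \<phi> (sc (v i) v)] (mod int ?q)"
      using homs_add[OF h wJ add_subgroup_sc[OF sg v(1)]] by simp
    moreover have "[\<phi> w + \<phi> (sc (v i) v) = \<phi> w + v i * \<phi> v] (mod int ?q)"
      by (intro cong_add cong_refl homs_sc[OF sg h v(1)])
    moreover have "[\<phi> v * \<phi> v = \<phi> (v * v)] (mod int ?q)" using homs_mult[OF h v(1) v(1)] by (rule cong_sym)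
    ultimately have "[\<phi> v * \<phi> v = \<phi> w + v i * \<phi> v] (mod int ?q)" using cong_trans by blast
    thus "?g \<phi> \<in> Sigma (homs ?q ?J) ?C"
      using homs_restrict[OF J' _ h] homs_range[OF h v(1)] w by (auto simp: add.commute)
  qed
  have "finite (homs ?q J)" "card (homs ?q J) \<le> card (homs ?q ?J) * (2 * p ^ (k div 2))"
    using card_Sigma_bound[OF IH(1) finite_int_range_filter card_quadratic_solutions[OF assms(1)] inj sub] .
  moreover have "card (homs ?q ?J) * (2 * p ^ (k div 2)) \<le> (2 * p ^ (k div 2)) ^ card S * (2 * p ^ (k div 2))"
    using IH(2) by (rule mult_le_mono1)
  ultimately show ?case
    using insert.hyps by (simp only: card_insert_disjoint power_Suc2 simp_thms)
qed

section \<open>The conductor inequality\<close>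

definition dot :: "nat set \<Rightarrow> (nat \<Rightarrow> int) \<Rightarrow> (nat \<Rightarrow> int) \<Rightarrow> int" where
  "dot I x y = (\<Sum>i\<in>I. x i * y i)"

lemma dot_commute: "dot I x y = dot I y x"
  by (simp add: dot_def mult.commute)

lemma dot_add: "dot I w (x + y) = dot I w x + dot I w y"
  by (simp add: dot_def algebra_simps sum.distrib)

lemma dot_vmod: "int M dvd dot I w x - dot I w (vmod M x)"
proof -
  have "dot I w x - dot I w (vmod M x) = (\<Sum>i\<in>I. w i * (x i - x i mod int M))"
    by (simp add: dot_def algebra_simps sum_subtractf)
  also have "int M dvd \<dots>"
    by (intro dvd_sum dvd_mult) (simp add: minus_mod_eq_mult_div)
  finally show ?thesis .
qed

lemma dot_indicator: "finite I \<Longrightarrow> i \<in> I \<Longrightarrow> dot I x (sc c (indicator {i})) = c * x i"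
proof -
  assume "finite I" "i \<in> I"
  have "dot I x (sc c (indicator {i})) = (\<Sum>j\<in>I. if j = i then c * x i else 0)"
    unfolding dot_def by (intro sum.cong) (auto simp: indicator_def)
  thus ?thesis using \<open>finite I\<close> \<open>i \<in> I\<close> by (simp add: sum.delta')
qed

section \<open>Characters and the dual lattice\<close>

definition echar :: "nat \<Rightarrow> int \<Rightarrow> complex" where
  "echar M t = cis (2 * pi * real_of_int t / real M)"

lemma echar_add: "echar M (s + t) = echar M s * echar M t"
  by (simp add: echar_def cis_mult algebra_simps add_divide_distrib)

lemma echar_eq_1: assumes "M > 0" shows "echar M t = 1 \<longleftrightarrow> int M dvd t"
proof -
  have "echar M t = exp (\<i> * complex_of_real (2 * pi * real_of_int t / real M))"
    by (simp add: echar_def cis_conv_exp)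
  also have "\<dots> = 1 \<longleftrightarrow> (\<exists>n::int. 2 * pi * real_of_int t / real M = real_of_int (2 * n) * pi)"
    by (subst exp_eq_1) simp
  also have "\<dots> \<longleftrightarrow> (\<exists>n::int. real_of_int t = real_of_int (n * int M))"
    using assms by (simp add: field_simps)
  also have "\<dots> \<longleftrightarrow> int M dvd t" by (simp only: of_int_eq_iff dvd_def mult.commute)
  finally show ?thesis .
qed

lemma echar_cong: assumes "M > 0" "int M dvd s - t" shows "echar M s = echar M t"
  using echar_add[of M "s - t" t] echar_eq_1[OF assms(1)] assms(2) by simp

text \<open>Orthogonality: translating the residues by an element z of A with
  \<open>dot I w z\<close> not divisible by M multiplies the sum by a root of unity different from
  1.\<close>

lemma character_sum:
  assumes A: "add_subgroup A" "A \<subseteq> vecs I" and I: "finite I" and M: "M > 0" "full M I A"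
  shows "(\<Sum>x\<in>resid M A. echar M (dot I w x)) =
    (if \<forall>x\<in>A. int M dvd dot I w x then of_nat (card (resid M A)) else 0)"
proof (cases "\<forall>x\<in>A. int M dvd dot I w x")
  case True
  hence "(\<Sum>x\<in>resid M A. echar M (dot I w x)) = (\<Sum>x\<in>resid M A. 1)"
    using echar_eq_1[OF M(1)] by (intro sum.cong) (auto simp: resid_def)
  thus ?thesis using True by simp
next
  case False
  then obtain z where z: "z \<in> A" "\<not> int M dvd dot I w z" by auto
  let ?S = "\<Sum>x\<in>resid M A. echar M (dot I w x)"
  have bij: "bij_betw (\<lambda>x. vmod M (x + z)) (resid M A) (resid M A)"
  proof (rule bij_betw_byWitness[where f' = "\<lambda>x. vmod M (x - z)"])
    show "\<forall>a\<in>resid M A. vmod M (vmod M (a + z) - z) = a"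
      by (auto simp: resid_def fun_eq_iff mod_diff_left_eq)
    show "\<forall>a\<in>resid M A. vmod M (vmod M (a - z) + z) = a"
      by (auto simp: resid_def fun_eq_iff mod_add_left_eq)
    show "(\<lambda>x. vmod M (x + z)) ` resid M A \<subseteq> resid M A"
      by (intro image_subsetI vmod_resid[OF A M(2) _ M(1)] add_subgroup_add[OF A(1) _ z(1)]) (simp add: resid_def)
    show "(\<lambda>x. vmod M (x - z)) ` resid M A \<subseteq> resid M A"
      by (intro image_subsetI vmod_resid[OF A M(2) _ M(1)] add_subgroup_diff[OF A(1) _ z(1)]) (simp add: resid_def)
  qed
  have "?S = (\<Sum>x\<in>resid M A. echar M (dot I w (vmod M (x + z))))"
    by (rule sum.reindex_bij_betw[OF bij, symmetric])
  also have "\<dots> = (\<Sum>x\<in>resid M A. echar M (dot I w x) * echar M (dot I w z))"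
  proof (rule sum.cong)
    fix x assume "x \<in> resid M A"
    have "echar M (dot I w (vmod M (x + z))) = echar M (dot I w (x + z))"
      by (rule echar_cong[OF M(1) dot_vmod, symmetric])
    thus "echar M (dot I w (vmod M (x + z))) = echar M (dot I w x) * echar M (dot I w z)"
      by (simp add: dot_add echar_add)
  qed simp
  also have "\<dots> = ?S * echar M (dot I w z)" by (simp add: sum_distrib_right)
  finally have "?S * (1 - echar M (dot I w z)) = 0" by (simp add: algebra_simps)
  moreover have "echar M (dot I w z) \<noteq> 1" using z echar_eq_1[OF M(1)] by simp
  ultimately have "?S = 0" by simp
  thus ?thesis using False by (simp only: if_False)
qed

text \<open>For \<open>full M I A\<close> this is M times the dual lattice of A with respect to
  \<open>dot\<close>; the scaling keeps it inside Z^I.\<close>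

definition dual :: "nat \<Rightarrow> nat set \<Rightarrow> (nat \<Rightarrow> int) set \<Rightarrow> (nat \<Rightarrow> int) set" where
  "dual M I A = {w \<in> vecs I. \<forall>x\<in>A. int M dvd dot I w x}"

lemma indicator_vecs: "sc c (indicator {i}) \<in> vecs I" if "i \<in> I"
  using that by (auto simp: vecs_def indicator_def)

text \<open>Double counting of the sum of \<open>echar M (dot I w x)\<close> over the residues w of
  Z^I and x of A: summing over x first retains the w in the dual, summing over w first retains only
  x = 0.\<close>

lemma card_dual:
  assumes A: "add_subgroup A" "A \<subseteq> vecs I" and I: "finite I" and M: "M > 0" "full M I A"
  shows "card (resid M (dual M I A)) * card (resid M A) = M ^ card I"
proof -
  let ?B = "resid M (vecs I)"
  have fB: "finite ?B" "card ?B = M ^ card I" using card_resid_vecs[OF I M(1)] by auto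
  have W: "resid M (dual M I A) = {w \<in> ?B. \<forall>x\<in>A. int M dvd dot I w x}"
    by (auto simp: resid_def dual_def)
  have "(\<Sum>w\<in>?B. \<Sum>x\<in>resid M A. echar M (dot I w x)) =
      (\<Sum>w\<in>?B. if \<forall>x\<in>A. int M dvd dot I w x then of_nat (card (resid M A)) else 0)"
    by (intro sum.cong character_sum assms refl)
  also have "\<dots> = (\<Sum>w\<in>resid M (dual M I A). of_nat (card (resid M A)))"
    unfolding W by (intro sum.inter_filter[symmetric] fB)
  also have "\<dots> = of_nat (card (resid M (dual M I A)) * card (resid M A))" by simp
  finally have 1: "(\<Sum>w\<in>?B. \<Sum>x\<in>resid M A. echar M (dot I w x)) = of_nat (card (resid M (dual M I A)) * card (resid M A))" .
  have "(\<Sum>w\<in>?B. \<Sum>x\<in>resid M A. echar M (dot I w x)) = (\<Sum>x\<in>resid M A. \<Sum>w\<in>?B. echar M (dot I x w))"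
    by (subst sum.swap) (simp add: dot_commute)
  also have "\<dots> = (\<Sum>x\<in>resid M A. if \<forall>w\<in>vecs I. int M dvd dot I x w then of_nat (card ?B) else 0)"
    by (intro sum.cong character_sum vecs_add_subgroup full_vecs I M(1) refl subset_refl)
  also have "\<dots> = (\<Sum>x\<in>resid M A. if x = 0 then of_nat (card ?B) else 0)"
  proof (rule sum.cong)
    fix x assume x: "x \<in> resid M A"
    have "(\<forall>w\<in>vecs I. int M dvd dot I x w) \<longleftrightarrow> x = 0"
    proof
      assume a: "\<forall>w\<in>vecs I. int M dvd dot I x w"
      have "x i = 0" for i
      proof (cases "i \<in> I")
        case True
        hence "int M dvd x i"
          using a indicator_vecs[OF True, of 1] dot_indicator[OF I True, of x 1] by force
        moreover have "0 \<le> x i" "x i < int M" using x by (auto simp: resid_def)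
        ultimately show ?thesis by (metis dvd_imp_mod_0 mod_pos_pos_trivial)
      next
        case False thus ?thesis using x A(2) by (auto simp: resid_def vecs_def)
      qed
      thus "x = 0" by (simp add: fun_eq_iff)
    qed (simp add: dot_def)
    thus "(if \<forall>w\<in>vecs I. int M dvd dot I x w then of_nat (card ?B) else 0) = (if x = 0 then of_nat (card ?B) else (0::complex))"
      by (simp only:)
  qed simp
  also have "\<dots> = of_nat (M ^ card I)"
  proof -
    have "0 \<in> resid M A" using add_subgroup_0[OF A(1)] M(1) by (simp add: resid_def)
    thus ?thesis using finite_resid[OF I M(1) A(2)] fB(2) by (simp add: sum.delta)
  qed
  finally show ?thesis using 1 by (metis of_nat_eq_iff)
qed

lemma dual_add_subgroup: "add_subgroup (dual M I A)"
  unfolding add_subgroup_def dual_def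
proof (intro conjI ballI CollectI; (elim CollectE conjE)?)
  show "0 \<in> vecs I" by (simp add: vecs_def)
  show "int M dvd dot I 0 x" for x by (simp add: dot_def)
  fix x y assume "x \<in> vecs I" "y \<in> vecs I" "\<forall>z\<in>A. int M dvd dot I x z" "\<forall>z\<in>A. int M dvd dot I y z"
  thus "x - y \<in> vecs I" "z \<in> A \<Longrightarrow> int M dvd dot I (x - y) z" for z
    by (auto simp: vecs_def dot_def left_diff_distrib sum_subtractf)
qed

text \<open>\<open>dot\<close> is the trace form of Z^I, so multiplication by y is self-adjoint and
  the dual lattice is a module over A. This is how the ring structure of A enters the conductor
  inequality.\<close>

lemma dual_mult:
  assumes "w \<in> dual M I A" "y \<in> A" "\<And>x y. x \<in> A \<Longrightarrow> y \<in> A \<Longrightarrow> x * y \<in> A"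
  shows "w * y \<in> dual M I A"
proof -
  have "dot I (w * y) x = dot I w (y * x)" for x by (simp add: dot_def mult.assoc)
  thus ?thesis using assms by (auto simp: dual_def vecs_def)
qed

lemma full_dual: "full M I (dual M I A)"
  unfolding full_def dual_def
proof (intro ballI CollectI conjI)
  fix x assume "x \<in> vecs I"
  thus "sc (int M) x \<in> vecs I" by (auto simp: vecs_def)
  show "int M dvd dot I (sc (int M) x) y" for y
    by (simp add: dot_def mult.assoc) (intro dvd_sum, simp)
qed

text \<open>Gauss's lemma as a cancellation law: the constant p is a prime element of Z[X], so a
  factor Q that is nonzero modulo p can be cancelled from divisibility by any power of p.\<close>

lemma const_prime_power_dvd_poly_mult:
  fixes p :: int
  assumes "prime p" "\<not> [:p:] dvd Q" "[:p ^ k:] dvd Q * D"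
  shows "[:p ^ k:] dvd D"
  using assms(3)
proof (induction k arbitrary: D)
  case (Suc k)
  have pe: "prime_elem [:p:]" by (simp only: prime_elem_const_poly_iff prime_imp_prime_elem[OF assms(1)])
  have "[:p:] dvd [:p ^ Suc k:]" by (simp add: const_poly_dvd_const_poly_iff)
  hence "[:p:] dvd Q * D" using Suc.prems dvd_trans by blast
  hence "[:p:] dvd D" using pe assms(2) by (simp add: prime_elem_dvd_mult_iff)
  then obtain D' where D': "D = [:p:] * D'" by (elim dvdE)
  have "[:p:] * [:p ^ k:] dvd [:p:] * (Q * D')" using Suc.prems by (simp add: D' mult.left_commute mult.commute)
  hence "[:p ^ k:] dvd Q * D'" using assms(1) by (subst (asm) dvd_times_left_cancel_iff) auto
  from Suc.IH[OF this] have "[:p:] * [:p ^ k:] dvd D" unfolding D' by (rule mult_dvd_mono[OF dvd_refl])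
  thus ?case by (simp add: mult.commute)
next
  case 0
  show ?case by (simp add: one_pCons[symmetric])
qed


text \<open>Index \<open>p ^ e\<close>, expressed by counting residues modulo a large power of \<open>p\<close>.\<close>

definition pidx :: "nat \<Rightarrow> nat set \<Rightarrow> (nat \<Rightarrow> int) set \<Rightarrow> nat \<Rightarrow> bool" where
  "pidx p I A e \<longleftrightarrow> (\<exists>K0. \<forall>K\<ge>K0. full (p ^ K) I A \<and>
     card (resid (p ^ K) A) * p ^ e = p ^ (K * card I))"

text \<open>The conductor of A in Z^I is an ideal of Z^I, hence a product of ideals of Z, one for
  each coordinate; \<open>k\<close> is the exponent of its component at \<open>i\<close>.\<close>

definition cond_exp :: "nat \<Rightarrow> (nat \<Rightarrow> int) set \<Rightarrow> nat \<Rightarrow> nat \<Rightarrow> bool" where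
  "cond_exp p A i k \<longleftrightarrow> (\<forall>c. sc c (indicator {i}) \<in> A \<longleftrightarrow> int (p ^ k) dvd c)"

lemma vec_decomp: "finite I \<Longrightarrow> x \<in> vecs I \<Longrightarrow> x = (\<Sum>i\<in>I. sc (x i) (indicator {i}))"
proof
  fix j assume I: "finite I" and x: "x \<in> vecs I"
  have "(\<Sum>i\<in>I. sc (x i) (indicator {i})) j = (\<Sum>i\<in>I. if i = j then x j else 0)"
    unfolding sum_fun_apply by (intro sum.cong) (auto simp: indicator_def)
  thus "x j = (\<Sum>i\<in>I. sc (x i) (indicator {i})) j"
    using I x by (cases "j \<in> I") (auto simp: vecs_def)
qed

lemma cond_exp_mem:
  assumes "finite I" "add_subgroup A" "\<And>i. i \<in> I \<Longrightarrow> cond_exp p A i (\<kappa> i)" "x \<in> vecs I"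
    "\<And>i. i \<in> I \<Longrightarrow> int (p ^ \<kappa> i) dvd x i"
  shows "x \<in> A"
proof -
  have "(\<Sum>i\<in>I. sc (x i) (indicator {i})) \<in> A"
    using assms(3,5) by (intro add_subgroup_sum assms) (simp add: cond_exp_def)
  thus ?thesis using vec_decomp[OF assms(1,4)] by (simp only:)
qed

text \<open>\<open>R\<close> represents A modulo the conductor, and the conductor has
  \<open>p ^ (K - \<kappa> i)\<close> residues modulo \<open>p ^ K\<close> in coordinate i. The
  inequality serves as a lower bound for \<open>card R\<close>.\<close>

lemma card_resid_le_conductor:
  assumes p: "p > 0" and I: "finite I" and A: "add_subgroup A" "A \<subseteq> vecs I"
    and \<kappa>: "\<And>i. i \<in> I \<Longrightarrow> cond_exp p A i (\<kappa> i)" "\<And>i. i \<in> I \<Longrightarrow> \<kappa> i \<le> K"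
  defines "R \<equiv> {x \<in> A. \<forall>i\<in>I. 0 \<le> x i \<and> x i < int (p ^ \<kappa> i)}"
  shows "finite R" "card (resid (p ^ K) A) \<le> card R * p ^ (\<Sum>i\<in>I. K - \<kappa> i)"
proof -
  let ?P = "PiE I (\<lambda>i. {0..<int (p ^ (K - \<kappa> i))})"
  let ?m = "\<lambda>x i. if i \<in> I then x i mod int (p ^ \<kappa> i) else 0"
  let ?d = "\<lambda>x. \<lambda>i\<in>I. x i div int (p ^ \<kappa> i)"
  have pos: "0 < int (p ^ n)" for n using p by simp
  have "R \<subseteq> resid (p ^ K) (vecs I)"
  proof
    fix x assume x: "x \<in> R"
    have "0 \<le> x i \<and> x i < int (p ^ K)" for i
    proof (cases "i \<in> I")
      case True
      have "p ^ \<kappa> i \<le> p ^ K" using p \<kappa>(2)[OF True] by (intro power_increasing) auto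
      hence "int (p ^ \<kappa> i) \<le> int (p ^ K)" by (simp only: of_nat_le_iff)
      thus ?thesis using x True unfolding R_def by force
    next
      case False
      thus ?thesis using x A(2) pos unfolding R_def vecs_def by force
    qed
    thus "x \<in> resid (p ^ K) (vecs I)" using x A(2) by (auto simp: resid_def R_def)
  qed
  thus fR: "finite R" using card_resid_vecs[OF I, of "p ^ K"] p finite_subset by auto
  have pK: "int (p ^ K) = int (p ^ \<kappa> i) * int (p ^ (K - \<kappa> i))" if "i \<in> I" for i
    using \<kappa>(2)[OF that] by (metis le_add_diff_inverse of_nat_mult power_add)
  have mR: "?m x \<in> R" if x: "x \<in> A" for x
  proof -
    have "x - ?m x \<in> A"
    proof (rule cond_exp_mem[OF I A(1) \<kappa>(1)])
      show "x - ?m x \<in> vecs I" using x A(2) by (auto simp: vecs_def)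
      show "i \<in> I \<Longrightarrow> int (p ^ \<kappa> i) dvd (x - ?m x) i" for i
        by (simp del: of_nat_power add: minus_mod_eq_mult_div)
    qed
    hence "x - (x - ?m x) \<in> A" using add_subgroup_diff[OF A(1) x] by blast
    thus ?thesis using pos unfolding R_def by (simp del: of_nat_power)
  qed
  have "inj_on (\<lambda>x. (?m x, ?d x)) (resid (p ^ K) A)"
  proof (rule inj_onI)
    fix x y assume x: "x \<in> resid (p ^ K) A" and y: "y \<in> resid (p ^ K) A" and e: "(?m x, ?d x) = (?m y, ?d y)"
    show "x = y"
    proof
      fix i show "x i = y i"
      proof (cases "i \<in> I")
        case True
        have "?m x = ?m y" "?d x = ?d y" using e by (simp_all only: prod.inject)
        hence "?m x i = ?m y i" "?d x i = ?d y i" using fun_cong[of _ _ i] by blast+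
        thus ?thesis using True by (simp del: of_nat_power) (metis div_mult_mod_eq)
      next
        case False
        moreover have "x \<in> A" "y \<in> A" using x y by (auto simp: resid_def)
        ultimately show ?thesis using vecs_zero[OF A(2)] by metis
      qed
    qed
  qed
  moreover have "(\<lambda>x. (?m x, ?d x)) ` resid (p ^ K) A \<subseteq> R \<times> ?P"
  proof (rule image_subsetI)
    fix x assume x: "x \<in> resid (p ^ K) A"
    have "x i div int (p ^ \<kappa> i) \<in> {0..<int (p ^ (K - \<kappa> i))}" if "i \<in> I" for i
      by (rule int_div_in_range) (use x pK[OF that] pos in \<open>auto simp: resid_def simp del: of_nat_power\<close>)
    hence "?d x \<in> ?P" by (simp del: of_nat_power)
    thus "(?m x, ?d x) \<in> R \<times> ?P" using mR x by (simp add: resid_def)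
  qed
  moreover have "finite (R \<times> ?P)" using fR I by (intro finite_cartesian_product finite_PiE) auto
  ultimately have "card (resid (p ^ K) A) \<le> card (R \<times> ?P)" by (intro card_inj_on_le)
  also have "\<dots> = card R * (\<Prod>i\<in>I. p ^ (K - \<kappa> i))"
    using I by (simp add: card_cartesian_product card_PiE del: of_nat_power)
  finally show "card (resid (p ^ K) A) \<le> card R * p ^ (\<Sum>i\<in>I. K - \<kappa> i)"
    by (simp add: power_sum)
qed

text \<open>If every w failed, adjoining u, that is \<open>p ^ (k - 1)\<close> times the l-th unit
  vector, would leave the dual unchanged, and by \<open>card_dual\<close> also the number of
  residues. Then u would lie in A, against the choice of k.\<close>

lemma dual_generator:
  assumes p: "prime p" and I: "finite I" and A: "add_subgroup A" "A \<subseteq> vecs I"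
    and K: "full (p ^ K) I A" and l: "l \<in> I" "cond_exp p A l k" "0 < k"
  obtains w where "w \<in> dual (p ^ K) I A" "\<not> int (p ^ K) dvd int (p ^ (k - 1)) * w l"
proof -
  let ?M = "p ^ K" and ?u = "sc (int (p ^ (k - 1))) (indicator {l})"
  have M: "?M > 0" using p by (simp add: prime_gt_0_nat)
  define A' where "A' = {x. \<exists>a\<in>A. \<exists>c. x = a + sc c ?u}"
  have uv: "?u \<in> vecs I" by (rule indicator_vecs[OF l(1)])
  have A'v: "A' \<subseteq> vecs I" unfolding A'_def
    using A(2) add_subgroup_add[OF vecs_add_subgroup] add_subgroup_sc[OF vecs_add_subgroup uv] by blast
  have A'g: "add_subgroup A'" unfolding add_subgroup_def
  proof (intro conjI ballI)
    have "0 = 0 + sc 0 ?u" by (simp add: fun_eq_iff)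
    thus "0 \<in> A'" unfolding A'_def using add_subgroup_0[OF A(1)] by blast
    fix x y assume "x \<in> A'" "y \<in> A'"
    then obtain a b c d where "a \<in> A" "b \<in> A" "x = a + sc c ?u" "y = b + sc d ?u" unfolding A'_def by blast
    moreover hence "x - y = (a - b) + sc (c - d) ?u" by (auto simp: fun_eq_iff algebra_simps)
    ultimately show "x - y \<in> A'" unfolding A'_def using add_subgroup_diff[OF A(1)] by blast
  qed
  have AA': "A \<subseteq> A'"
  proof
    fix a assume "a \<in> A"
    moreover have "a = a + sc 0 ?u" by (simp add: fun_eq_iff)
    ultimately show "a \<in> A'" unfolding A'_def by blast
  qed
  have K': "full ?M I A'" using K AA' unfolding full_def by blast
  have uA': "?u \<in> A'"
  proof -
    have "?u = 0 + sc 1 ?u" by (simp add: fun_eq_iff)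
    thus ?thesis unfolding A'_def using add_subgroup_0[OF A(1)] by blast
  qed
  have uA: "?u \<notin> A"
  proof
    assume "?u \<in> A"
    hence "int (p ^ k) dvd int (p ^ (k - 1))" using l(2) by (simp only: cond_exp_def)
    hence "p ^ k dvd p ^ (k - 1)" by (simp only: int_dvd_int_iff)
    hence "k \<le> k - 1" using power_dvd_imp_le[OF _ prime_gt_1_nat[OF p]] by blast
    thus False using l(3) by simp
  qed
  have "\<exists>w\<in>dual ?M I A. \<not> int ?M dvd int (p ^ (k - 1)) * w l"
  proof (rule ccontr)
    assume "\<not> ?thesis"
    hence a: "int ?M dvd dot I w ?u" if "w \<in> dual ?M I A" for w
      using that dot_indicator[OF I l(1), of w "int (p ^ (k - 1))"] by (metis)
    have "int ?M dvd dot I w x" if w: "w \<in> dual ?M I A" and x: "x \<in> A'" for w x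
    proof -
      obtain b c where b: "b \<in> A" "x = b + sc c ?u" using x unfolding A'_def by blast
      have "dot I w (sc c ?u) = c * dot I w ?u" by (simp add: dot_def sum_distrib_left algebra_simps)
      hence "dot I w x = dot I w b + c * dot I w ?u" using b by (simp only: dot_add)
      thus ?thesis using a[OF w] w b(1) by (auto simp: dual_def simp del: of_nat_power sc_apply intro!: dvd_add dvd_mult)
    qed
    hence "dual ?M I A' = dual ?M I A" unfolding dual_def using AA' by blast
    hence "card (resid ?M (dual ?M I A)) * card (resid ?M A') = card (resid ?M (dual ?M I A)) * card (resid ?M A)"
      using card_dual[OF A I M K] card_dual[OF A'g A'v I M K'] by simp
    moreover have "card (resid ?M (dual ?M I A)) \<noteq> 0" using card_dual[OF A I M K] M by (metis mult_zero_left power_eq_0_iff less_numeral_extra(3))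
    ultimately have "card (resid ?M A') = card (resid ?M A)" by simp
    moreover have "resid ?M A \<subseteq> resid ?M A'" using AA' by (auto simp: resid_def)
    ultimately have "resid ?M A = resid ?M A'" using card_subset_eq[OF finite_resid[OF I M A'v]] by simp
    moreover have "vmod ?M ?u \<in> resid ?M A'" by (rule vmod_resid[OF A'g A'v K' uA' M])
    ultimately have "vmod ?M ?u \<in> resid ?M A" by (simp only:)
    hence "vmod ?M ?u \<in> A" unfolding resid_def by blast
    hence "(?u - vmod ?M ?u) + vmod ?M ?u \<in> A"
      using vmod_diff_mem[OF K uv] by (intro add_subgroup_add[OF A(1)])
    thus False using uA by (simp only: diff_add_cancel)
  qed
  thus ?thesis using that by blast
qed


text \<open>For each \<open>i\<close> the dual lattice contains an element whose \<open>i\<close>-th coordinate has the largest order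
  the conductor allows. Multiplying polynomials over \<open>A\<close> by the polynomial with these elements as coefficients embeds
  polynomials over \<open>A\<close> modulo the conductor into polynomials over the dual; letting the degree tend to infinity
  compares the two indices.\<close>

lemma conductor_sum_le:
  assumes p: "prime p" and I: "finite I" and A: "suborder I A" "pidx p I A e"
    and \<kappa>: "\<And>i. i \<in> I \<Longrightarrow> cond_exp p A i (\<kappa> i)"
  shows "(\<Sum>i\<in>I. \<kappa> i) \<le> 2 * e"
proof -
  have Ag: "add_subgroup A" "A \<subseteq> vecs I"
    using A(1) suborder_add_subgroup suborder_vecs by auto
  obtain K where K: "full (p ^ K) I A" "card (resid (p ^ K) A) * p ^ e = p ^ (K * card I)"
    using A(2) unfolding pidx_def by blast
  let ?M = "p ^ K" and ?W = "dual (p ^ K) I A"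
  have p0: "p > 0" "p > 1" using p prime_gt_0_nat prime_gt_1_nat by auto
  have M: "?M > 0" using p0 by simp
  have \<kappa>K: "\<kappa> i \<le> K" if "i \<in> I" for i
  proof -
    have "sc (int ?M) (indicator {i}) \<in> A"
      using K(1) indicator_vecs[OF that, of 1] unfolding full_def by (simp add: sc_def)
    hence "int (p ^ \<kappa> i) dvd int ?M" using \<kappa>[OF that] by (simp only: cond_exp_def)
    hence "p ^ \<kappa> i dvd ?M" by (simp only: int_dvd_int_iff)
    thus ?thesis using power_dvd_imp_le[OF _ p0(2)] by blast
  qed
  have cW: "card (resid ?M ?W) = p ^ e"
  proof -
    have "card (resid ?M ?W) * card (resid ?M A) = p ^ e * card (resid ?M A)"
      using card_dual[OF Ag I M K(1)] K(2) by (simp add: power_mult mult.commute)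
    moreover have "card (resid ?M A) \<noteq> 0" using K(2) p0 by (metis mult_zero_left power_eq_0_iff less_numeral_extra(3))
    ultimately show ?thesis by simp
  qed
  have fW: "finite (resid ?M ?W)" by (rule finite_resid[OF I M]) (auto simp: dual_def)
  have Wv: "?W \<subseteq> vecs I" by (auto simp: dual_def)
  have Wdvd: "int (p ^ (K - \<kappa> l)) dvd w l" if "w \<in> ?W" "l \<in> I" for w l
  proof -
    have "sc (int (p ^ \<kappa> l)) (indicator {l}) \<in> A" using \<kappa>[OF that(2)] by (simp only: cond_exp_def dvd_refl)
    hence "int ?M dvd int (p ^ \<kappa> l) * w l" using that dot_indicator[OF I that(2)] unfolding dual_def by (metis (no_types, lifting) mem_Collect_eq)
    moreover have "int ?M = int (p ^ \<kappa> l) * int (p ^ (K - \<kappa> l))"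
      using \<kappa>K[OF that(2)] by (metis le_add_diff_inverse of_nat_mult power_add)
    ultimately have "int (p ^ \<kappa> l) * int (p ^ (K - \<kappa> l)) dvd int (p ^ \<kappa> l) * w l" by (simp only:)
    moreover have "int (p ^ \<kappa> l) \<noteq> 0" using p0 by simp
    ultimately show ?thesis using dvd_mult_cancel_left by blast
  qed
  have "\<exists>w. w \<in> ?W \<and> (0 < \<kappa> l \<longrightarrow> \<not> int ?M dvd int (p ^ (\<kappa> l - 1)) * w l)" if l: "l \<in> I" for l
  proof (cases "0 < \<kappa> l")
    case True
    obtain w where "w \<in> ?W" "\<not> int ?M dvd int (p ^ (\<kappa> l - 1)) * w l"
      by (rule dual_generator[OF p I Ag K(1) l \<kappa>[OF l] True])
    thus ?thesis by (intro exI[of _ w] conjI impI)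
  next
    case False
    show ?thesis by (intro exI[of _ 0] conjI add_subgroup_0 dual_add_subgroup) (simp add: False)
  qed
  hence "\<forall>l\<in>I. \<exists>w. w \<in> ?W \<and> (0 < \<kappa> l \<longrightarrow> \<not> int ?M dvd int (p ^ (\<kappa> l - 1)) * w l)" by (intro ballI)
  from bchoice[OF this] obtain g where "\<forall>l\<in>I. g l \<in> ?W \<and> (0 < \<kappa> l \<longrightarrow> \<not> int ?M dvd int (p ^ (\<kappa> l - 1)) * g l l)" by (elim exE)
  hence g: "\<And>l. l \<in> I \<Longrightarrow> g l \<in> ?W"
    "\<And>l. l \<in> I \<Longrightarrow> 0 < \<kappa> l \<Longrightarrow> \<not> int ?M dvd int (p ^ (\<kappa> l - 1)) * g l l" by simp_all
  \<comment> \<open>The coordinates also number the coefficients: \<open>g l\<close> becomes the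
    coefficient of degree l. One polynomial thereby has, for every coordinate l at once, a
    coefficient of the largest possible order at l.\<close>
  define G where "G j = (if j \<in> I then g j else 0)" for j
  have GW: "G j \<in> ?W" for j using g(1) add_subgroup_0[OF dual_add_subgroup] by (simp add: G_def)
  define D where "D = Suc (Max (insert 0 I))"
  have GD: "G j = 0" if "j \<ge> D" for j
  proof -
    have "j \<notin> I"
    proof
      assume "j \<in> I"
      hence "j \<le> Max (insert 0 I)" using I by (intro Max_ge) auto
      thus False using that unfolding D_def by linarith
    qed
    thus ?thesis by (simp add: G_def)
  qed
  define R where "R = {x \<in> A. \<forall>i\<in>I. 0 \<le> x i \<and> x i < int (p ^ \<kappa> i)}"
  have fR: "finite R" and cR: "card (resid ?M A) \<le> card R * p ^ (\<Sum>i\<in>I. K - \<kappa> i)"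
    using card_resid_le_conductor[OF p0(1) I Ag \<kappa> \<kappa>K] unfolding R_def by auto
  \<comment> \<open>Polynomials of degree below N over A modulo the conductor are multiplied by the
    fixed polynomial with coefficients \<open>G j\<close>. The result has degree below N + D and
    coefficients in the dual, which has \<open>p ^ e\<close> residues.\<close>
  have main: "card R ^ N \<le> (p ^ e) ^ (N + D)" for N
  proof -
    define X where "X x a = (if a < N then x a else (0 :: nat \<Rightarrow> int))" for x and a :: nat
    define Y where "Y x b = (\<Sum>j\<le>b. G j * X x (b - j))" for x b
    define \<Phi> where "\<Phi> x = (\<lambda>b\<in>{..<N + D}. vmod ?M (Y x b))" for x
    have XA: "X x a \<in> A" if "x \<in> PiE {..<N} (\<lambda>_. R)" for x a
      using PiE_mem[OF that, of a] add_subgroup_0[OF Ag(1)] by (auto simp: X_def R_def)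
    have YW: "Y x b \<in> ?W" if "x \<in> PiE {..<N} (\<lambda>_. R)" for x b
      unfolding Y_def
      by (intro add_subgroup_sum dual_add_subgroup dual_mult GW XA[OF that] suborder_mult[OF A(1)])
    have Y0: "Y x b = 0" if "b \<ge> N + D" for x b unfolding Y_def
    proof (rule sum.neutral, rule ballI)
      fix j assume "j \<in> {..b}"
      show "G j * X x (b - j) = 0"
      proof (cases "j \<ge> D")
        case True thus ?thesis using GD by simp
      next
        case False
        hence "\<not> b - j < N" using that by simp
        thus ?thesis by (simp add: X_def)
      qed
    qed
    have inj: "inj_on \<Phi> (PiE {..<N} (\<lambda>_. R))"
    proof (rule inj_onI)
      fix x y assume x: "x \<in> PiE {..<N} (\<lambda>_. R)" and y: "y \<in> PiE {..<N} (\<lambda>_. R)" and e: "\<Phi> x = \<Phi> y"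
      have YM: "int ?M dvd Y x b l - Y y b l" for b l
      proof (cases "b < N + D")
        case True
        hence "vmod ?M (Y x b) = vmod ?M (Y y b)" using fun_cong[OF e, of b] by (simp add: \<Phi>_def)
        hence "Y x b l mod int ?M = Y y b l mod int ?M" using fun_cong[of _ _ l] by (metis vmod_apply)
        thus ?thesis by (simp only: mod_eq_dvd_iff)
      next
        case False thus ?thesis by (simp add: Y0)
      qed
      have eq: "x a l = y a l" if a: "a < N" and l: "l \<in> I" for a l
      proof -
        define P where "P = (\<Sum>j<D. monom (G j l) j)"
        define Z where "Z = (\<Sum>a<N. monom (x a l - y a l) a)"
        have cP: "coeff P j = G j l" for j
          unfolding P_def coeff_sum coeff_monom using GD[of j] by (cases "j < D") auto
        have cZ: "coeff Z a = X x a l - X y a l" for a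
          unfolding Z_def coeff_sum coeff_monom by (auto simp: X_def)
        have "coeff (P * Z) b = Y x b l - Y y b l" for b
          by (simp add: coeff_mult cP cZ Y_def sum_fun_apply algebra_simps sum_subtractf)
        hence dv: "[:int ?M:] dvd P * Z" using YM by (simp add: const_poly_dvd_iff del: of_nat_power)
        have pe: "int ?M = int (p ^ (K - \<kappa> l)) * int p ^ \<kappa> l"
          using \<kappa>K[OF l] by (metis le_add_diff_inverse2 of_nat_mult of_nat_power power_add)
        \<comment> \<open>At coordinate l the power of p dividing P is known exactly if
          \<open>\<kappa> l\<close> is positive: all dual vectors are divisible by this power, and
          \<open>G l l\<close> by no higher one. The quotient Q is thus nonzero modulo p and can be
          cancelled.\<close>
        have "[:int (p ^ (K - \<kappa> l)):] dvd P" using Wdvd[OF GW l] by (simp add: const_poly_dvd_iff cP del: of_nat_power)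
        then obtain Q where Q: "P = [:int (p ^ (K - \<kappa> l)):] * Q" by (elim dvdE)
        have "[:int (p ^ (K - \<kappa> l)):] * [:int p ^ \<kappa> l:] dvd [:int (p ^ (K - \<kappa> l)):] * (Q * Z)"
        proof -
          have "[:int ?M:] = [:int (p ^ (K - \<kappa> l)):] * [:int p ^ \<kappa> l:]" unfolding pe by (simp add: mult.commute)
          thus ?thesis using dv by (simp only: Q mult.assoc)
        qed
        hence dvQ: "[:int p ^ \<kappa> l:] dvd Q * Z" using p0 by (subst (asm) dvd_times_left_cancel_iff) auto
        have "[:int p ^ \<kappa> l:] dvd Z"
        proof (cases "0 < \<kappa> l")
          case True
          have "\<not> [:int p:] dvd Q"
          proof
            assume "[:int p:] dvd Q"
            hence "int p dvd coeff Q l" by (simp add: const_poly_dvd_iff)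
            then obtain t where t: "coeff Q l = int p * t" by (elim dvdE)
            have "G l l = int (p ^ (K - \<kappa> l)) * coeff Q l" using cP[of l] by (simp add: Q)
            hence "int (p ^ (\<kappa> l - 1)) * g l l = (int (p ^ (K - \<kappa> l)) * (int p ^ (\<kappa> l - 1) * int p)) * t"
              using l by (simp add: G_def t algebra_simps)
            also have "int p ^ (\<kappa> l - 1) * int p = int p ^ \<kappa> l" using True by (metis Suc_diff_1 power_Suc2)
            finally have "int ?M dvd int (p ^ (\<kappa> l - 1)) * g l l" unfolding pe by simp
            thus False using g(2)[OF l True] by blast
          qed
          thus ?thesis using const_prime_power_dvd_poly_mult[OF _ _ dvQ] p by simp
        next
          case False
          thus ?thesis by (simp add: one_pCons[symmetric])
        qed
        hence "int p ^ \<kappa> l dvd coeff Z a" by (simp add: const_poly_dvd_iff)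
        hence d: "int (p ^ \<kappa> l) dvd x a l - y a l" using a by (simp add: cZ X_def)
        have "x a \<in> R" "y a \<in> R" using x y a by auto
        hence "x a l mod int (p ^ \<kappa> l) = x a l" "y a l mod int (p ^ \<kappa> l) = y a l"
          using l unfolding R_def by (auto simp del: of_nat_power)
        thus ?thesis using d by (metis mod_eq_dvd_iff)
      qed
      show "x = y"
      proof (rule PiE_ext[OF x y])
        fix a assume a: "a \<in> {..<N}"
        have v: "x a \<in> vecs I" "y a \<in> vecs I" using PiE_mem[OF x a] PiE_mem[OF y a] Ag(2) by (auto simp: R_def)
        show "x a = y a"
        proof
          fix l show "x a l = y a l" using eq[of a l] a v by (cases "l \<in> I") (auto simp: vecs_def)
        qed
      qed
    qed
    have sub: "\<Phi> ` PiE {..<N} (\<lambda>_. R) \<subseteq> PiE {..<N + D} (\<lambda>_. resid ?M ?W)"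
    proof (rule image_subsetI)
      fix x assume x: "x \<in> PiE {..<N} (\<lambda>_. R)"
      have "vmod ?M (Y x b) \<in> resid ?M ?W" for b
        by (rule vmod_resid[OF dual_add_subgroup Wv full_dual YW[OF x] M])
      thus "\<Phi> x \<in> PiE {..<N + D} (\<lambda>_. resid ?M ?W)" by (simp add: \<Phi>_def)
    qed
    have "card (PiE {..<N} (\<lambda>_. R)) \<le> card (PiE {..<N + D} (\<lambda>_. resid ?M ?W))"
      by (rule card_inj_on_le[OF inj sub]) (simp add: finite_PiE fW)
    thus ?thesis by (simp add: card_PiE cW)
  qed
  let ?s = "\<Sum>i\<in>I. \<kappa> i"
  have cR': "p ^ ?s \<le> card R * p ^ e"
  proof -
    have "(\<Sum>i\<in>I. K - \<kappa> i) + ?s = (\<Sum>i\<in>I. K)"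
      unfolding sum.distrib[symmetric] using \<kappa>K by (intro sum.cong) auto
    hence "(\<Sum>i\<in>I. K - \<kappa> i) + ?s = K * card I" by simp
    hence "p ^ (\<Sum>i\<in>I. K - \<kappa> i) * p ^ ?s = p ^ (K * card I)"
      by (simp only: power_add[symmetric])
    also have "\<dots> \<le> card R * p ^ (\<Sum>i\<in>I. K - \<kappa> i) * p ^ e"
      unfolding K(2)[symmetric] using cR by (rule mult_le_mono1)
    finally have "p ^ (\<Sum>i\<in>I. K - \<kappa> i) * p ^ ?s \<le> p ^ (\<Sum>i\<in>I. K - \<kappa> i) * (card R * p ^ e)"
      by (simp add: algebra_simps)
    thus ?thesis using p0 by simp
  qed
  show ?thesis
  proof (rule ccontr)
    assume "\<not> ?thesis"
    hence s: "2 * e + 1 \<le> ?s" by simp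
    \<comment> \<open>The assumption gives (2 e + 1) N \<le> 2 e N + e D, which fails as soon as N
      exceeds e D.\<close>
    define N where "N = e * D + 1"
    have "p ^ (?s * N) \<le> (card R * p ^ e) ^ N" unfolding power_mult using cR' by (rule power_mono) simp
    also have "\<dots> \<le> (p ^ e) ^ (N + D) * (p ^ e) ^ N"
      unfolding power_mult_distrib using main[of N] by (rule mult_le_mono1)
    also have "\<dots> = p ^ (e * (N + D) + e * N)" by (simp only: power_mult[symmetric] power_add[symmetric])
    finally have "?s * N \<le> e * (N + D) + e * N" by (rule power_le_imp_le_exp[OF p0(2)])
    moreover have "(2 * e + 1) * N \<le> ?s * N" using s by (rule mult_le_mono1)
    ultimately have "(2 * e + 1) * N \<le> e * (N + D) + e * N" by (rule order_trans[rotated])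
    thus False by (simp add: N_def algebra_simps)
  qed
qed

section \<open>Dropping a coordinate\<close>

definition uhoms :: "nat \<Rightarrow> nat set \<Rightarrow> (nat \<Rightarrow> int) set \<Rightarrow> ((nat \<Rightarrow> int) \<Rightarrow> int) set" where
  "uhoms q I A = {\<phi> \<in> homs q A. [\<phi> (indicator I) = 1] (mod int q)}"

definition ords :: "nat \<Rightarrow> nat set \<Rightarrow> nat \<Rightarrow> (nat \<Rightarrow> int) set set" where
  "ords p I e = {A. suborder I A \<and> pidx p I A e}"

lemma shift_mem:
  assumes A: "suborder I A" and l: "l \<in> I" and x: "x \<in> A"
  shows "x - sc (x l) (indicator I) \<in> A \<inter> vecs (I - {l})"
proof -
  let ?y = "x - sc (x l) (indicator I)"
  have "?y \<in> A"
    by (intro add_subgroup_diff[OF suborder_add_subgroup[OF A]] x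
        add_subgroup_sc[OF suborder_add_subgroup[OF A]] suborder_one[OF A])
  moreover have "?y i = 0" if "i \<notin> I - {l}" for i
    using that l vecs_zero[OF suborder_vecs[OF A] x] by (cases "i = l") (auto simp: indicator_def)
  ultimately show ?thesis unfolding vecs_def by blast
qed

lemma uhoms_shift:
  assumes A: "suborder I A" and l: "l \<in> I" and x: "x \<in> A" and h: "\<phi> \<in> uhoms q I A"
  shows "[\<phi> x = \<phi> (x - sc (x l) (indicator I)) + x l] (mod int q)"
proof -
  let ?s = "sc (x l) (indicator I)"
  have sg: "add_subgroup A" using A by (rule suborder_add_subgroup)
  have \<phi>: "\<phi> \<in> homs q A" "[\<phi> (indicator I) = 1] (mod int q)" using h by (auto simp: uhoms_def)
  have "[\<phi> (x - ?s + ?s) = \<phi> (x - ?s) + \<phi> ?s] (mod int q)"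
    by (intro homs_add[OF \<phi>(1)] add_subgroup_diff[OF sg] x add_subgroup_sc[OF sg] suborder_one[OF A])
  hence 1: "[\<phi> x = \<phi> (x - ?s) + \<phi> ?s] (mod int q)" by (simp only: diff_add_cancel)
  have "[\<phi> ?s = x l * \<phi> (indicator I)] (mod int q)" by (rule homs_sc[OF sg \<phi>(1) suborder_one[OF A]])
  moreover have "[x l * \<phi> (indicator I) = x l * 1] (mod int q)" by (intro cong_mult cong_refl \<phi>(2))
  ultimately have "[\<phi> ?s = x l * 1] (mod int q)" by (rule cong_trans)
  hence "[\<phi> (x - ?s) + \<phi> ?s = \<phi> (x - ?s) + x l * 1] (mod int q)" by (intro cong_add cong_refl)
  with 1 have "[\<phi> x = \<phi> (x - ?s) + x l * 1] (mod int q)" by (rule cong_trans)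
  thus ?thesis by simp
qed

text \<open>A is the sum of Z 1 and its elements vanishing at l, and a unital homomorphism has no
  freedom on Z 1. This saves one of the \<open>card I\<close> factors of
  \<open>card_homs_le\<close>.\<close>

lemma card_uhoms_le_homs:
  assumes A: "suborder I A" and l: "l \<in> I" and fin: "finite (homs q (A \<inter> vecs (I - {l})))"
  shows "finite (uhoms q I A)" "card (uhoms q I A) \<le> card (homs q (A \<inter> vecs (I - {l})))"
proof -
  let ?J = "A \<inter> vecs (I - {l})"
  have J: "subrng ?J" by (intro subrng_Int suborder_subrng[OF A] vecs_subrng)
  have inj: "inj_on (\<lambda>\<phi>. restrict \<phi> ?J) (uhoms q I A)"
  proof (rule inj_onI)
    fix \<phi> \<psi> assume h: "\<phi> \<in> uhoms q I A" "\<psi> \<in> uhoms q I A" and e: "restrict \<phi> ?J = restrict \<psi> ?J"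
    show "\<phi> = \<psi>"
    proof (rule homs_eqI[of _ q A])
      show "\<phi> \<in> homs q A" "\<psi> \<in> homs q A" using h by (auto simp: uhoms_def)
      fix x assume x: "x \<in> A"
      let ?y = "x - sc (x l) (indicator I)"
      have "\<phi> ?y = \<psi> ?y" using fun_cong[OF e, of ?y] shift_mem[OF A l x] by (simp only: restrict_apply')
      thus "[\<phi> x = \<psi> x] (mod int q)"
        using uhoms_shift[OF A l x h(1)] uhoms_shift[OF A l x h(2)] cong_sym cong_trans by metis
    qed
  qed
  have sub: "(\<lambda>\<phi>. restrict \<phi> ?J) ` uhoms q I A \<subseteq> homs q ?J"
    using homs_restrict[OF J] by (auto simp: uhoms_def)
  show "finite (uhoms q I A)" using inj_on_finite[OF inj sub fin] .
  show "card (uhoms q I A) \<le> card (homs q ?J)" using card_inj_on_le[OF inj sub fin] .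
qed

lemma card_uhoms_le:
  assumes p: "prime p" and A: "suborder I A" and I: "finite I" "I \<noteq> {}"
  shows "finite (uhoms (p ^ k) I A)" "card (uhoms (p ^ k) I A) \<le> (2 * p ^ (k div 2)) ^ (card I - 1)"
proof -
  obtain l where l: "l \<in> I" using I by auto
  let ?J = "A \<inter> vecs (I - {l})"
  have J: "subrng ?J" by (intro subrng_Int suborder_subrng[OF A] vecs_subrng)
  have h: "finite (homs (p ^ k) ?J)" "card (homs (p ^ k) ?J) \<le> (2 * p ^ (k div 2)) ^ card (I - {l})"
    using card_homs_le[OF p _ J, of "I - {l}" k] I by auto
  show "finite (uhoms (p ^ k) I A)" by (rule card_uhoms_le_homs(1)[OF A l h(1)])
  show "card (uhoms (p ^ k) I A) \<le> (2 * p ^ (k div 2)) ^ (card I - 1)"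
    using card_uhoms_le_homs(2)[OF A l h(1)] h(2) l by simp
qed

lemma ex_cond_exp:
  assumes p: "prime p" and A: "add_subgroup A" "full (p ^ K) I A" and i: "i \<in> I"
  obtains k where "cond_exp p A i k"
proof -
  let ?J = "A \<inter> vecs {i}"
  have J: "add_subgroup ?J" by (intro add_subgroup_Int A vecs_add_subgroup)
  obtain v where v: "v \<in> ?J" "\<And>x. x \<in> ?J \<Longrightarrow> v i dvd x i" using add_subgroup_coord_gen[OF J] by blast
  have sc_vecs: "sc c (indicator {i}) \<in> vecs {i}" for c by (rule indicator_vecs) simp
  have vi: "v = sc (v i) (indicator {i})"
    using v(1) by (auto simp: vecs_def indicator_def fun_eq_iff)
  have iff: "sc c (indicator {i}) \<in> A \<longleftrightarrow> v i dvd c" for c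
  proof
    assume "sc c (indicator {i}) \<in> A"
    hence "v i dvd sc c (indicator {i}) i" using v(2) sc_vecs by blast
    thus "v i dvd c" by simp
  next
    assume "v i dvd c"
    then obtain t where "c = v i * t" by blast
    hence "sc c (indicator {i}) = sc t (sc (v i) (indicator {i}))" by (auto simp: fun_eq_iff)
    moreover have "sc t (sc (v i) (indicator {i})) \<in> A" using vi v(1) add_subgroup_sc[OF A(1)] by simp
    ultimately show "sc c (indicator {i}) \<in> A" by (simp only:)
  qed
  have "sc (int (p ^ K)) (indicator {i}) \<in> A"
    using A(2) indicator_vecs[OF i, of 1] unfolding full_def by (simp add: sc_def)
  hence "v i dvd int (p ^ K)" by (simp only: iff)
  hence "nat \<bar>v i\<bar> dvd p ^ K" by (simp add: nat_dvd_iff)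
  then obtain k where "nat \<bar>v i\<bar> = p ^ k" using divides_primepow_nat[OF p] by blast
  hence "\<bar>v i\<bar> = int (p ^ k)" by (metis abs_ge_zero int_nat_eq)
  hence "v i dvd c \<longleftrightarrow> int (p ^ k) dvd c" for c by (metis abs_dvd_iff)
  thus ?thesis using that iff unfolding cond_exp_def by blast
qed

section \<open>Projection along a coordinate\<close>

definition proj :: "nat \<Rightarrow> (nat \<Rightarrow> int) \<Rightarrow> nat \<Rightarrow> int" where
  "proj i x = x(i := 0)"

lemma proj_simps [simp]: "proj i x j = (if j = i then 0 else x j)"
  by (simp add: proj_def)

lemma proj_hom: "proj i (x - y) = proj i x - proj i y" "proj i (x + y) = proj i x + proj i y"
    "proj i (x * y) = proj i x * proj i y" "proj i (sc c x) = sc c (proj i x)" "proj i 0 = 0"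
  by (auto simp: fun_eq_iff)

definition fibre_prod :: "nat set \<Rightarrow> nat \<Rightarrow> nat \<Rightarrow> (nat \<Rightarrow> int) set \<Rightarrow> ((nat \<Rightarrow> int) \<Rightarrow> int) \<Rightarrow> (nat \<Rightarrow> int) set" where
  "fibre_prod I i q A' \<phi> = {x \<in> vecs I. proj i x \<in> A' \<and> [x i = \<phi> (proj i x)] (mod int q)}"

lemma suborder_proj:
  assumes "suborder I A" "i \<in> I" shows "suborder (I - {i}) (proj i ` A)"
  unfolding suborder_def subrng_def add_subgroup_def
proof (intro conjI ballI)
  show "proj i ` A \<subseteq> vecs (I - {i})" using vecs_zero[OF suborder_vecs[OF assms(1)]] by (auto simp: vecs_def)
  show "0 \<in> proj i ` A" using add_subgroup_0[OF suborder_add_subgroup[OF assms(1)]] proj_hom(5) by (metis imageI)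
  have "indicator (I - {i}) = proj i (indicator I)" by (auto simp: fun_eq_iff indicator_def)
  thus "indicator (I - {i}) \<in> proj i ` A" using suborder_one[OF assms(1)] by blast
  fix x y assume "x \<in> proj i ` A" "y \<in> proj i ` A"
  then obtain a b where "a \<in> A" "b \<in> A" "x = proj i a" "y = proj i b" by blast
  moreover hence "a - b \<in> A" "a * b \<in> A"
    using add_subgroup_diff[OF suborder_add_subgroup[OF assms(1)]] suborder_mult[OF assms(1)] by auto
  ultimately show "x - y \<in> proj i ` A" "x * y \<in> proj i ` A" by (metis imageI proj_hom(1,3))+
qed

text \<open>Goursat's argument: two elements of A with the same projection differ by an element of A
  supported at i, hence by a multiple of \<open>p ^ k\<close> there. The i-th coordinate modulo
  \<open>p ^ k\<close> is therefore a function of the projection, and it inherits being a unital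
  ring homomorphism.\<close>

lemma suborder_fibre:
  assumes p: "p > 0" and A: "suborder I A" and i: "i \<in> I" and k: "cond_exp p A i k"
  obtains \<phi> where "\<phi> \<in> uhoms (p ^ k) (I - {i}) (proj i ` A)" "A = fibre_prod I i (p ^ k) (proj i ` A) \<phi>"
proof -
  let ?q = "p ^ k" and ?A = "proj i ` A"
  have sg: "add_subgroup A" using A by (rule suborder_add_subgroup)
  have q: "int ?q > 0" using p by simp
  have ker: "int ?q dvd x i" if "x \<in> A" "proj i x = 0" for x
  proof -
    have "x = sc (x i) (indicator {i})"
    proof
      fix j show "x j = sc (x i) (indicator {i}) j" using fun_cong[OF that(2), of j] by (auto simp: indicator_def split: if_splits)
    qed
    thus ?thesis using k that(1) unfolding cond_exp_def by metis
  qed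
  define s where "s y = (SOME x. x \<in> A \<and> proj i x = y)" for y
  have s: "s y \<in> A" "proj i (s y) = y" if "y \<in> ?A" for y
  proof -
    have "\<exists>x. x \<in> A \<and> proj i x = y" using that by blast
    from someI_ex[OF this] show "s y \<in> A" "proj i (s y) = y" unfolding s_def by auto
  qed
  define \<phi> where "\<phi> = (\<lambda>y\<in>?A. s y i mod int ?q)"
  have eq: "[x i = \<phi> (proj i x)] (mod int ?q)" if x: "x \<in> A" for x
  proof -
    have y: "proj i x \<in> ?A" using x by blast
    have "x - s (proj i x) \<in> A" using add_subgroup_diff[OF sg x s(1)[OF y]] .
    moreover have "proj i (x - s (proj i x)) = 0" using s(2)[OF y] by (simp only: proj_hom diff_self)
    ultimately have "int ?q dvd (x - s (proj i x)) i" by (rule ker)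
    hence "[x i = s (proj i x) i] (mod int ?q)" by (simp add: cong_iff_dvd_diff)
    thus ?thesis using y by (simp add: \<phi>_def Cong.cong_def del: of_nat_power)
  qed
  have conv: "x \<in> A" if x: "x \<in> vecs I" "proj i x \<in> ?A" "[x i = \<phi> (proj i x)] (mod int ?q)" for x
  proof -
    let ?t = "s (proj i x)"
    have t: "?t \<in> A" "proj i ?t = proj i x" using s x(2) by auto
    have "[?t i = \<phi> (proj i ?t)] (mod int ?q)" by (rule eq[OF t(1)])
    hence "[x i = ?t i] (mod int ?q)" using x(3) t(2) cong_sym cong_trans by metis
    hence "sc (x i - ?t i) (indicator {i}) \<in> A" using k by (simp only: cond_exp_def cong_iff_dvd_diff)
    moreover have "x = ?t + sc (x i - ?t i) (indicator {i})"
    proof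
      fix j show "x j = (?t + sc (x i - ?t i) (indicator {i})) j"
        using fun_cong[OF t(2), of j] by (auto simp: indicator_def split: if_splits)
    qed
    ultimately show ?thesis using add_subgroup_add[OF sg t(1)] by metis
  qed
  have "A = fibre_prod I i ?q ?A \<phi>"
    unfolding fibre_prod_def using eq conv suborder_vecs[OF A] by blast
  moreover have "\<phi> \<in> uhoms ?q (I - {i}) ?A"
  proof -
    have "\<phi> y \<in> {0..<int ?q}" if "y \<in> ?A" for y using that q by (simp add: \<phi>_def del: of_nat_power)
    hence "\<phi> \<in> ?A \<rightarrow>\<^sub>E {0..<int ?q}" by (simp add: \<phi>_def)
    moreover have "[\<phi> (x + y) = \<phi> x + \<phi> y] (mod int ?q) \<and> [\<phi> (x * y) = \<phi> x * \<phi> y] (mod int ?q)"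
      if "x \<in> ?A" "y \<in> ?A" for x y
    proof -
      obtain a b where ab: "a \<in> A" "b \<in> A" "x = proj i a" "y = proj i b" using \<open>x \<in> ?A\<close> \<open>y \<in> ?A\<close> by blast
      have e: "[\<phi> x = a i] (mod int ?q)" "[\<phi> y = b i] (mod int ?q)" using eq ab cong_sym by metis+
      have "[\<phi> (proj i (a + b)) = (a + b) i] (mod int ?q)" "[\<phi> (proj i (a * b)) = (a * b) i] (mod int ?q)"
        using eq[OF add_subgroup_add[OF sg ab(1,2)]] eq[OF suborder_mult[OF A ab(1,2)]] by (simp_all only: cong_sym_eq)
      hence "[\<phi> (x + y) = a i + b i] (mod int ?q)" "[\<phi> (x * y) = a i * b i] (mod int ?q)"
        using ab by (simp_all add: proj_hom)
      thus ?thesis using cong_add[OF e] cong_mult[OF e] cong_sym cong_trans by metis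
    qed
    moreover have "[\<phi> (indicator (I - {i})) = 1] (mod int ?q)"
    proof -
      have "indicator (I - {i}) = proj i (indicator I)" by (auto simp: fun_eq_iff indicator_def)
      moreover have "(indicator I :: nat \<Rightarrow> int) i = 1" using i by simp
      ultimately show ?thesis using eq[OF suborder_one[OF A]] by (metis cong_sym)
    qed
    ultimately show ?thesis by (simp add: uhoms_def homs_def)
  qed
  ultimately show ?thesis using that by blast
qed

text \<open>The kernel of the projection on A consists of the multiples of \<open>p ^ k\<close> in
  coordinate i. Above each residue of the projection lie \<open>p ^ (K - k)\<close> residues of A
  instead of \<open>p ^ K\<close>, so the index of A is \<open>p ^ k\<close> times that of the
  projection.\<close>

lemma pidx_proj:
  assumes p: "prime p" and A: "suborder I A" "pidx p I A e" and I: "finite I" and i: "i \<in> I"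
    and k: "cond_exp p A i k" and \<phi>: "A = fibre_prod I i (p ^ k) (proj i ` A) \<phi>"
  shows "k \<le> e" "pidx p (I - {i}) (proj i ` A) (e - k)"
proof -
  let ?A = "proj i ` A" and ?I = "I - {i}"
  have p0: "p > 0" "p > 1" using p prime_gt_0_nat prime_gt_1_nat by auto
  have sg: "add_subgroup A" "A \<subseteq> vecs I" using A suborder_add_subgroup suborder_vecs by auto
  have A': "suborder ?I ?A" by (rule suborder_proj[OF A(1) i])
  have sg': "add_subgroup ?A" "?A \<subseteq> vecs ?I" using A' suborder_add_subgroup suborder_vecs by auto
  obtain K0 where K0: "\<And>K. K \<ge> K0 \<Longrightarrow> full (p ^ K) I A \<and> card (resid (p ^ K) A) * p ^ e = p ^ (K * card I)"
    using A(2) unfolding pidx_def by blast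
  have full': "full (p ^ K) ?I ?A" if "K \<ge> K0" for K
    unfolding full_def
  proof
    fix x assume x: "x \<in> vecs ?I"
    hence "x \<in> vecs I" "proj i x = x" by (auto simp: vecs_def fun_eq_iff)
    hence "sc (int (p ^ K)) x \<in> A" "proj i (sc (int (p ^ K)) x) = sc (int (p ^ K)) x"
      using K0[OF that] unfolding full_def by (auto simp only: proj_hom)
    thus "sc (int (p ^ K)) x \<in> ?A" by (metis imageI)
  qed
  have cd: "card (resid (p ^ K) A) = card (resid (p ^ K) ?A) * p ^ (K - k)" if K: "K \<ge> K0" "K \<ge> k" for K
  proof -
    let ?M = "p ^ K" and ?q = "int (p ^ k)"
    have M: "?M > 0" and q: "?q > 0" using p0 by auto
    have fA: "full ?M I A" using K0[OF K(1)] by blast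
    have Mq: "int ?M = ?q * int (p ^ (K - k))" using K(2) by (metis le_add_diff_inverse of_nat_mult power_add)
    define r where "r y = \<phi> y mod ?q" for y
    have memA: "x \<in> A \<longleftrightarrow> x \<in> vecs I \<and> proj i x \<in> ?A \<and> x i mod ?q = r (proj i x)" for x
      by (subst \<phi>) (simp only: fibre_prod_def mem_Collect_eq Cong.cong_def r_def)
    have r: "0 \<le> r y" "r y < ?q" for y using q by (simp_all add: r_def del: of_nat_power)
    have "bij_betw (\<lambda>x. (proj i x, x i div ?q)) (resid ?M A) (resid ?M ?A \<times> {0..<int (p ^ (K - k))})"
    proof (rule bij_betw_byWitness[where f' = "\<lambda>(y, t). y(i := r y + ?q * t)"])
      show "\<forall>a\<in>resid ?M A. (\<lambda>(y, t). y(i := r y + ?q * t)) (proj i a, a i div ?q) = a"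
      proof
        fix a assume "a \<in> resid ?M A"
        hence "a i mod ?q = r (proj i a)" using memA[of a] unfolding resid_def by blast
        hence "r (proj i a) + ?q * (a i div ?q) = a i" by (metis mod_mult_div_eq)
        thus "(\<lambda>(y, t). y(i := r y + ?q * t)) (proj i a, a i div ?q) = a"
          by (simp add: fun_eq_iff del: of_nat_power)
      qed
      show "\<forall>a'\<in>resid ?M ?A \<times> {0..<int (p ^ (K - k))}.
        (\<lambda>x. (proj i x, x i div ?q)) ((\<lambda>(y, t). y(i := r y + ?q * t)) a') = a'"
      proof
        fix a' assume "a' \<in> resid ?M ?A \<times> {0..<int (p ^ (K - k))}"
        then obtain y t where a': "a' = (y, t)" and y: "y \<in> resid ?M ?A" by blast
        hence "y \<in> vecs ?I" using sg'(2) by (auto simp: resid_def)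
        hence "proj i (y(i := r y + ?q * t)) = y" by (auto simp: fun_eq_iff vecs_def)
        moreover have "(r y + ?q * t) div ?q = t" using r[of y] q by (simp del: of_nat_power)
        ultimately show "(\<lambda>x. (proj i x, x i div ?q)) ((\<lambda>(y, t). y(i := r y + ?q * t)) a') = a'"
          unfolding a' by (simp del: of_nat_power)
      qed
      show "(\<lambda>x. (proj i x, x i div ?q)) ` resid ?M A \<subseteq> resid ?M ?A \<times> {0..<int (p ^ (K - k))}"
      proof (rule image_subsetI)
        fix x assume x: "x \<in> resid ?M A"
        have "x i div ?q \<in> {0..<int (p ^ (K - k))}"
          by (rule int_div_in_range[OF _ _ q]) (use x Mq in \<open>auto simp: resid_def simp del: of_nat_power\<close>)
        moreover have "proj i x \<in> resid ?M ?A" using x M unfolding resid_def by (auto simp del: of_nat_power)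
        ultimately show "(proj i x, x i div ?q) \<in> resid ?M ?A \<times> {0..<int (p ^ (K - k))}" by blast
      qed
      show "(\<lambda>(y, t). y(i := r y + ?q * t)) ` (resid ?M ?A \<times> {0..<int (p ^ (K - k))}) \<subseteq> resid ?M A"
      proof (rule image_subsetI)
        fix a' assume "a' \<in> resid ?M ?A \<times> {0..<int (p ^ (K - k))}"
        then obtain y t where a': "a' = (y, t)" and y: "y \<in> resid ?M ?A" and t: "t \<in> {0..<int (p ^ (K - k))}" by blast
        let ?x = "y(i := r y + ?q * t)"
        have yA: "y \<in> ?A" "y \<in> vecs ?I" using y sg'(2) by (auto simp: resid_def)
        have pr: "proj i ?x = y" using yA(2) by (auto simp: fun_eq_iff vecs_def)
        have xv: "?x \<in> vecs I" using yA(2) i by (auto simp: vecs_def)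
        have "?x i mod ?q = r y" using r[of y] by (simp del: of_nat_power)
        hence "?x i mod ?q = r (proj i ?x)" "proj i ?x \<in> ?A" using yA(1) by (simp_all only: pr)
        hence "?x \<in> A" using xv by (intro iffD2[OF memA] conjI)
        moreover have "r y + ?q * t < int ?M"
        proof -
          have "?q * (t + 1) \<le> ?q * int (p ^ (K - k))" using t q by (intro mult_left_mono) auto
          thus ?thesis using r(2)[of y] Mq by (simp add: algebra_simps del: of_nat_power)
        qed
        moreover have "0 \<le> r y + ?q * t" using r(1)[of y] t q by (simp del: of_nat_power)
        ultimately show "(\<lambda>(y, t). y(i := r y + ?q * t)) a' \<in> resid ?M A"
          using y unfolding resid_def a' by (simp del: of_nat_power)
      qed
    qed
    from bij_betw_same_card[OF this] show ?thesis
      by (simp only: card_cartesian_product card_atLeastLessThan_int diff_0_right nat_int)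
  qed
  have cI: "card I = Suc (card ?I)" using I i by (rule card.remove)
  have key: "card (resid (p ^ K) ?A) * p ^ e = p ^ (K * card ?I) * p ^ k" if K: "K \<ge> K0" "K \<ge> k" for K
  proof -
    have "p ^ (K - k) * (card (resid (p ^ K) ?A) * p ^ e) = p ^ (K * card I)"
      using K0[OF K(1)] cd[OF K] by (simp only: ac_simps)
    also have "K * card I = (K - k) + (K * card ?I + k)" using K(2) cI by simp
    finally have "p ^ (K - k) * (card (resid (p ^ K) ?A) * p ^ e) = p ^ (K - k) * (p ^ (K * card ?I) * p ^ k)"
      by (simp only: power_add)
    thus ?thesis using p0 by simp
  qed
  show ke: "k \<le> e"
  proof -
    let ?K = "max K0 k"
    have "resid (p ^ ?K) ?A \<subseteq> resid (p ^ ?K) (vecs ?I)" using sg'(2) by (auto simp: resid_def)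
    moreover have fin: "finite (resid (p ^ ?K) (vecs ?I)) \<and> card (resid (p ^ ?K) (vecs ?I)) = (p ^ ?K) ^ card ?I"
      using I p0 by (intro card_resid_vecs) auto
    ultimately have "card (resid (p ^ ?K) ?A) \<le> p ^ (?K * card ?I)"
      using card_mono by (metis power_mult)
    hence "p ^ (?K * card ?I) * p ^ k \<le> p ^ (?K * card ?I) * p ^ e"
      using key[of ?K] by (metis max.cobounded1 max.cobounded2 mult_le_mono1)
    hence "p ^ k \<le> p ^ e" using p0 by simp
    thus ?thesis using p0 power_le_imp_le_exp by blast
  qed
  show "pidx p ?I ?A (e - k)" unfolding pidx_def
  proof (intro exI[of _ "max K0 k"] allI impI conjI)
    fix K assume "max K0 k \<le> K"
    hence K: "K \<ge> K0" "K \<ge> k" by auto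
    show "full (p ^ K) ?I ?A" by (rule full'[OF K(1)])
    have "p ^ e = p ^ (e - k) * p ^ k" using ke by (simp add: power_add[symmetric])
    hence "(card (resid (p ^ K) ?A) * p ^ (e - k)) * p ^ k = p ^ (K * card ?I) * p ^ k"
      using key[OF K] by (simp only: mult.assoc)
    thus "card (resid (p ^ K) ?A) * p ^ (e - k) = p ^ (K * card ?I)" using p0 by simp
  qed
qed

lemma ords_recursion:
  assumes p: "prime p" and I: "finite I" "I \<noteq> {}"
    and fin: "\<And>i j. i \<in> I \<Longrightarrow> finite (ords p (I - {i}) j)"
    and finu: "\<And>i j k A. i \<in> I \<Longrightarrow> A \<in> ords p (I - {i}) j \<Longrightarrow> finite (uhoms (p ^ k) (I - {i}) A)"
  shows "finite (ords p I e)"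
    "card (ords p I e) \<le> (\<Sum>i\<in>I. \<Sum>k | k \<le> e \<and> card I * k \<le> 2 * e.
       \<Sum>A\<in>ords p (I - {i}) (e - k). card (uhoms (p ^ k) (I - {i}) A))"
proof -
  let ?Q = "{k. k \<le> e \<and> card I * k \<le> 2 * e}"
  \<comment> \<open>An order may be reached through several coordinates i, so this union overcounts
    and yields only an inequality.\<close>
  let ?U = "\<Union>i\<in>I. \<Union>k\<in>?Q. \<Union>A\<in>ords p (I - {i}) (e - k). fibre_prod I i (p ^ k) A ` uhoms (p ^ k) (I - {i}) A"
  have p0: "p > 0" using p prime_gt_0_nat by auto
  have fQ: "finite ?Q" by (rule finite_subset[of _ "{..e}"]) auto
  have sub: "ords p I e \<subseteq> ?U"
  proof
    fix A assume "A \<in> ords p I e"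
    hence A: "suborder I A" "pidx p I A e" by (auto simp: ords_def)
    obtain K where K: "full (p ^ K) I A" using A(2) unfolding pidx_def by blast
    have "\<forall>i\<in>I. \<exists>k. cond_exp p A i k"
      using ex_cond_exp[OF p suborder_add_subgroup[OF A(1)] K] by metis
    from bchoice[OF this] obtain \<kappa> where \<kappa>: "\<And>i. i \<in> I \<Longrightarrow> cond_exp p A i (\<kappa> i)" by blast
    have s: "(\<Sum>i\<in>I. \<kappa> i) \<le> 2 * e" by (rule conductor_sum_le[OF p I(1) A \<kappa>])
    have "\<exists>i\<in>I. card I * \<kappa> i \<le> 2 * e"
    proof (rule ccontr)
      assume "\<not> ?thesis"
      hence "card I * (2 * e) < (\<Sum>i\<in>I. card I * \<kappa> i)"
        using I sum_strict_mono[of I "\<lambda>_. 2 * e" "\<lambda>i. card I * \<kappa> i"] by (simp add: not_le)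
      also have "\<dots> = card I * (\<Sum>i\<in>I. \<kappa> i)" by (simp add: sum_distrib_left)
      also have "\<dots> \<le> card I * (2 * e)" using s by simp
      finally show False by simp
    qed
    then obtain i where i: "i \<in> I" "card I * \<kappa> i \<le> 2 * e" by blast
    obtain \<phi> where \<phi>: "\<phi> \<in> uhoms (p ^ \<kappa> i) (I - {i}) (proj i ` A)" "A = fibre_prod I i (p ^ \<kappa> i) (proj i ` A) \<phi>"
      by (rule suborder_fibre[OF p0 A(1) i(1) \<kappa>[OF i(1)]])
    have pr: "\<kappa> i \<le> e" "pidx p (I - {i}) (proj i ` A) (e - \<kappa> i)"
      by (rule pidx_proj[OF p A I(1) i(1) \<kappa>[OF i(1)] \<phi>(2)])+
    have "proj i ` A \<in> ords p (I - {i}) (e - \<kappa> i)"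
      using pr(2) suborder_proj[OF A(1) i(1)] by (simp add: ords_def)
    moreover have "A \<in> fibre_prod I i (p ^ \<kappa> i) (proj i ` A) ` uhoms (p ^ \<kappa> i) (I - {i}) (proj i ` A)"
      by (rule image_eqI[of A "fibre_prod I i (p ^ \<kappa> i) (proj i ` A)" \<phi>, OF \<phi>(2,1)])
    moreover have "\<kappa> i \<in> ?Q" using i(2) pr(1) by simp
    ultimately show "A \<in> ?U" by (intro UN_I[OF i(1)] UN_I)
  qed
  have "finite ?U" using I(1) fQ fin finu by (intro finite_UN_I finite_imageI)
  thus "finite (ords p I e)" using sub finite_subset by blast
  have "card (ords p I e) \<le> card ?U" using sub \<open>finite ?U\<close> card_mono by blast
  also have "\<dots> \<le> (\<Sum>i\<in>I. card (\<Union>k\<in>?Q. \<Union>A\<in>ords p (I - {i}) (e - k). fibre_prod I i (p ^ k) A ` uhoms (p ^ k) (I - {i}) A))"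
    by (rule card_UN_le[OF I(1)])
  also have "\<dots> \<le> (\<Sum>i\<in>I. \<Sum>k\<in>?Q. card (\<Union>A\<in>ords p (I - {i}) (e - k). fibre_prod I i (p ^ k) A ` uhoms (p ^ k) (I - {i}) A))"
    by (intro sum_mono card_UN_le fQ)
  also have "\<dots> \<le> (\<Sum>i\<in>I. \<Sum>k\<in>?Q. \<Sum>A\<in>ords p (I - {i}) (e - k). card (fibre_prod I i (p ^ k) A ` uhoms (p ^ k) (I - {i}) A))"
    by (intro sum_mono card_UN_le fin)
  also have "\<dots> \<le> (\<Sum>i\<in>I. \<Sum>k\<in>?Q. \<Sum>A\<in>ords p (I - {i}) (e - k). card (uhoms (p ^ k) (I - {i}) A))"
    by (intro sum_mono card_image_le finu)
  finally show "card (ords p I e) \<le> (\<Sum>i\<in>I. \<Sum>k | k \<le> e \<and> card I * k \<le> 2 * e.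
       \<Sum>A\<in>ords p (I - {i}) (e - k). card (uhoms (p ^ k) (I - {i}) A))" by simp
qed

section \<open>Homomorphism counts for orders in dimension four\<close>

lemma euler_int:
  fixes a :: int and m :: nat
  assumes "coprime a (int m)" "m > 0"
  shows "[a ^ totient m = 1] (mod int m)"
proof -
  define b where "b = nat (a mod int m)"
  have b: "int b = a mod int m" using assms(2) by (simp add: b_def)
  have "coprime (int b) (int m)" using assms unfolding b by simp
  hence "coprime b m" by simp
  hence "[b ^ totient m = 1] (mod m)" by (rule euler_theorem)
  hence "[int (b ^ totient m) = int 1] (mod int m)" by (simp only: cong_int_iff)
  hence "[int b ^ totient m = 1] (mod int m)" by simp
  moreover have "[a ^ totient m = int b ^ totient m] (mod int m)"
    by (intro cong_pow) (simp add: b Cong.cong_def)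
  ultimately show ?thesis using cong_trans by blast
qed

text \<open>After subtracting \<open>x b\<close> from every coordinate, a high power is congruent to
  1 where the element is a unit modulo p and to 0 elsewhere, modulo \<open>p ^ Suc K\<close>. It
  differs from the idempotent of T by a vector that fullness puts into A.\<close>

lemma idempotent_exists:
  assumes p: "prime p" and A: "suborder I A" and K: "full (p ^ K) I A"
    and x: "x \<in> A" and ab: "a \<in> I" "b \<in> I" "\<not> [x a = x b] (mod int p)"
  obtains T where "T \<subseteq> I" "a \<in> T" "b \<notin> T" "indicator T \<in> A"
proof -
  define T where "T = {i \<in> I. \<not> [x i = x b] (mod int p)}"
  \<comment> \<open>The totient turns units into 1; the factor \<open>Suc K\<close> makes the
    exponent large enough to annihilate coordinates divisible by p.\<close>
  define n where "n = totient (p ^ Suc K) * Suc K"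
  have p0: "p > 0" using p prime_gt_0_nat by blast
  have n: "n \<ge> Suc K"
  proof -
    have "totient (p ^ Suc K) > 0" using p0 by simp
    thus ?thesis unfolding n_def by (cases "totient (p ^ Suc K)") auto
  qed
  define y where "y = x - sc (x b) (indicator I)"
  have yA: "y \<in> A" unfolding y_def
    by (intro add_subgroup_diff[OF suborder_add_subgroup[OF A]] x
        add_subgroup_sc[OF suborder_add_subgroup[OF A]] suborder_one[OF A])
  have yn: "y ^ n \<in> A"
    using subrng_pow[OF suborder_subrng[OF A] yA, of "n - 1"] n by (cases n) auto
  have yi: "y i = x i - x b" if "i \<in> I" for i using that by (simp add: y_def)
  have K': "full (p ^ Suc K) I A" by (rule full_dvd[OF K]) simp
  have "indicator T - y ^ n \<in> A"
  proof (rule full_mem[OF K'])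
    show "indicator T - y ^ n \<in> vecs I"
      using vecs_zero[OF suborder_vecs[OF A] yn] by (auto simp: vecs_def T_def indicator_def)
    fix i assume i: "i \<in> I"
    show "int (p ^ Suc K) dvd (indicator T - y ^ n) i"
    proof (cases "i \<in> T")
      case True
      hence "\<not> int p dvd y i" using yi[OF i] by (simp add: T_def cong_iff_dvd_diff)
      hence "coprime (int p) (y i)" using p by (intro prime_imp_coprime) auto
      hence "coprime (y i) (int (p ^ Suc K))" by (simp add: coprime_commute)
      hence "[y i ^ totient (p ^ Suc K) = 1] (mod int (p ^ Suc K))" using p0 by (intro euler_int) auto
      hence "[(y i ^ totient (p ^ Suc K)) ^ Suc K = 1 ^ Suc K] (mod int (p ^ Suc K))" by (rule cong_pow)
      hence "[y i ^ n = 1] (mod int (p ^ Suc K))" unfolding n_def power_mult by (simp only: power_one)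
      hence "int (p ^ Suc K) dvd 1 - y i ^ n" by (simp only: cong_iff_dvd_diff dvd_diff_commute)
      thus ?thesis using True by (simp add: power_fun_apply)
    next
      case False
      hence "int p dvd y i" using yi[OF i] i by (simp add: T_def cong_iff_dvd_diff)
      hence "int p ^ n dvd y i ^ n" by (rule dvd_power_same)
      moreover have "int p ^ Suc K dvd int p ^ n" by (rule le_imp_power_dvd[OF n])
      ultimately have "int p ^ Suc K dvd y i ^ n" using dvd_trans by blast
      thus ?thesis using False by (simp add: power_fun_apply)
    qed
  qed
  hence "(indicator T - y ^ n) + y ^ n \<in> A" by (rule add_subgroup_add[OF suborder_add_subgroup[OF A] _ yn])
  hence "indicator T \<in> A" by (simp only: diff_add_cancel)
  moreover have "T \<subseteq> I" "a \<in> T" "b \<notin> T" using ab by (auto simp: T_def)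
  ultimately show ?thesis using that by blast
qed

lemma homs_determined:
  assumes J: "subrng J" and t: "t \<in> J" and h: "\<phi> \<in> homs q J" and 1: "[\<phi> t = 1] (mod int q)" and x: "x \<in> J"
  shows "[\<phi> x = \<phi> (x * t)] (mod int q)"
proof -
  have "[\<phi> (x * t) = \<phi> x * \<phi> t] (mod int q)" by (rule homs_mult[OF h x t])
  moreover have "[\<phi> x * \<phi> t = \<phi> x * 1] (mod int q)" by (intro cong_mult cong_refl 1)
  ultimately have "[\<phi> (x * t) = \<phi> x * 1] (mod int q)" by (rule cong_trans)
  thus ?thesis by (simp add: cong_sym_eq)
qed

text \<open>Z modulo \<open>p ^ k\<close> has only the idempotents 0 and 1. If the idempotent of T
  goes to 1, the homomorphism is determined on the part supported on T, where it is unital; if it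
  goes to 0, on the part supported on the remaining coordinates. Each part receives the trivial
  bound.\<close>

lemma card_homs_idempotent:
  assumes p: "prime p" and I: "finite I" and A: "suborder I A" and l: "l \<in> I"
    and T: "T \<subseteq> I - {l}" "T \<noteq> {}" "indicator T \<in> A"
  shows "card (homs (p ^ k) (A \<inter> vecs (I - {l})))
    \<le> (2 * p ^ (k div 2)) ^ (card T - 1) + (2 * p ^ (k div 2)) ^ card (I - {l} - T)"
proof -
  let ?J = "A \<inter> vecs (I - {l})" and ?q = "p ^ k" and ?t = "indicator T :: nat \<Rightarrow> int"
  let ?S = "I - {l} - T"
  have J: "subrng ?J" by (intro subrng_Int suborder_subrng[OF A] vecs_subrng)
  note sg = subrng_add_subgroup[OF J]
  have fT: "finite T" "finite ?S" using I T finite_subset by auto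
  have t: "?t \<in> ?J" using T by (auto simp: vecs_def indicator_def)
  let ?U1 = "{\<phi> \<in> homs ?q ?J. [\<phi> ?t = 1] (mod int ?q)}"
  let ?U0 = "{\<phi> \<in> homs ?q ?J. [\<phi> ?t = 0] (mod int ?q)}"
  have tt: "?t * ?t = ?t" by (auto simp: fun_eq_iff indicator_def)
  have cover: "homs ?q ?J \<subseteq> ?U1 \<union> ?U0"
  proof
    fix \<phi> assume h: "\<phi> \<in> homs ?q ?J"
    have "[\<phi> (?t * ?t) = \<phi> ?t * \<phi> ?t] (mod int ?q)" by (rule homs_mult[OF h t t])
    hence "int ?q dvd \<phi> ?t - \<phi> ?t * \<phi> ?t" by (simp only: tt cong_iff_dvd_diff)
    hence "int ?q dvd \<phi> ?t * (1 - \<phi> ?t)" by (simp add: algebra_simps)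
    hence d: "int p ^ k dvd \<phi> ?t * (1 - \<phi> ?t)" by simp
    have pp: "prime (int p)" using p by simp
    have "int p ^ k dvd \<phi> ?t \<or> int p ^ k dvd 1 - \<phi> ?t"
    proof (cases "int p dvd \<phi> ?t")
      case True
      have "\<not> int p dvd 1 - \<phi> ?t"
      proof
        assume "int p dvd 1 - \<phi> ?t"
        hence "int p dvd (1 - \<phi> ?t) + \<phi> ?t" using True by (rule dvd_add)
        thus False using pp not_prime_unit[of "int p"] by simp
      qed
      hence "coprime (int p ^ k) (1 - \<phi> ?t)" using prime_imp_coprime[OF pp] by simp
      thus ?thesis using d coprime_dvd_mult_left_iff by blast
    next
      case False
      hence "coprime (int p ^ k) (\<phi> ?t)" using prime_imp_coprime[OF pp] by simp
      thus ?thesis using d coprime_dvd_mult_right_iff by blast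
    qed
    thus "\<phi> \<in> ?U1 \<union> ?U0" using h by (auto simp: cong_iff_dvd_diff dvd_diff_commute)
  qed
  have O1: "suborder T (A \<inter> vecs T)"
    unfolding suborder_def using subrng_Int[OF suborder_subrng[OF A] vecs_subrng, of T] T(3) by (auto simp: vecs_def indicator_def)
  have u1: "finite (uhoms ?q T (A \<inter> vecs T))" "card (uhoms ?q T (A \<inter> vecs T)) \<le> (2 * p ^ (k div 2)) ^ (card T - 1)"
    using card_uhoms_le[OF p O1 fT(1) T(2)] by auto
  have sub1: "A \<inter> vecs T \<subseteq> ?J" "A \<inter> vecs ?S \<subseteq> ?J" using T(1) by (auto simp: vecs_def)
  have inj1: "inj_on (\<lambda>\<phi>. restrict \<phi> (A \<inter> vecs T)) ?U1"
  proof (rule inj_onI)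
    fix \<phi> \<psi> assume h: "\<phi> \<in> ?U1" "\<psi> \<in> ?U1" and e: "restrict \<phi> (A \<inter> vecs T) = restrict \<psi> (A \<inter> vecs T)"
    hence h': "\<phi> \<in> homs ?q ?J" "\<psi> \<in> homs ?q ?J" "[\<phi> ?t = 1] (mod int ?q)" "[\<psi> ?t = 1] (mod int ?q)" by blast+
    show "\<phi> = \<psi>"
    proof (rule homs_eqI[OF h'(1,2)])
      fix x assume x: "x \<in> ?J"
      have "x * ?t \<in> A \<inter> vecs T" using suborder_mult[OF A _ T(3)] x by (auto simp: vecs_def)
      hence "\<phi> (x * ?t) = \<psi> (x * ?t)" using fun_cong[OF e, of "x * ?t"] by (simp only: restrict_apply')
      thus "[\<phi> x = \<psi> x] (mod int ?q)"
        using homs_determined[OF J t h'(1,3) x] homs_determined[OF J t h'(2,4) x] cong_sym cong_trans by metis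
    qed
  qed
  have im1: "(\<lambda>\<phi>. restrict \<phi> (A \<inter> vecs T)) ` ?U1 \<subseteq> uhoms ?q T (A \<inter> vecs T)"
  proof (rule image_subsetI)
    fix \<phi> assume h: "\<phi> \<in> ?U1"
    have tT: "?t \<in> A \<inter> vecs T" using suborder_one[OF O1] .
    have "restrict \<phi> (A \<inter> vecs T) \<in> homs ?q (A \<inter> vecs T)"
      by (rule homs_restrict[OF suborder_subrng[OF O1] sub1(1)]) (use h in blast)
    thus "restrict \<phi> (A \<inter> vecs T) \<in> uhoms ?q T (A \<inter> vecs T)"
      using h tT by (simp only: uhoms_def mem_Collect_eq restrict_apply' simp_thms)
  qed
  have JS: "subrng (A \<inter> vecs ?S)" by (intro subrng_Int suborder_subrng[OF A] vecs_subrng)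
  have u0: "finite (homs ?q (A \<inter> vecs ?S))" "card (homs ?q (A \<inter> vecs ?S)) \<le> (2 * p ^ (k div 2)) ^ card ?S"
    using card_homs_le[OF p fT(2) JS, of k] by auto
  have inj0: "inj_on (\<lambda>\<phi>. restrict \<phi> (A \<inter> vecs ?S)) ?U0"
  proof (rule inj_onI)
    fix \<phi> \<psi> assume h: "\<phi> \<in> ?U0" "\<psi> \<in> ?U0" and e: "restrict \<phi> (A \<inter> vecs ?S) = restrict \<psi> (A \<inter> vecs ?S)"
    hence h': "\<phi> \<in> homs ?q ?J" "\<psi> \<in> homs ?q ?J" "[\<phi> ?t = 0] (mod int ?q)" "[\<psi> ?t = 0] (mod int ?q)" by blast+
    show "\<phi> = \<psi>"
    proof (rule homs_eqI[OF h'(1,2)])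
      fix x assume x: "x \<in> ?J"
      let ?y = "x - x * ?t"
      have xt: "x * ?t \<in> ?J" by (rule subrng_mult[OF J x t])
      have y: "?y \<in> ?J" by (rule add_subgroup_diff[OF sg x xt])
      have yS: "?y \<in> A \<inter> vecs ?S" using y by (auto simp: vecs_def indicator_def)
      hence "\<phi> ?y = \<psi> ?y" using fun_cong[OF e, of ?y] by (simp only: restrict_apply')
      moreover have "[\<theta> ?y = \<theta> x] (mod int ?q)" if th: "\<theta> \<in> homs ?q ?J" "[\<theta> ?t = 0] (mod int ?q)" for \<theta>
      proof -
        have "[\<theta> ?y = \<theta> x - \<theta> (x * ?t)] (mod int ?q)" by (rule homs_diff[OF sg th(1) x xt])
        moreover have "[\<theta> (x * ?t) = \<theta> x * 0] (mod int ?q)"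
          using homs_mult[OF th(1) x t] cong_mult[OF cong_refl th(2), of "\<theta> x"] cong_trans by blast
        hence "[\<theta> x - \<theta> (x * ?t) = \<theta> x - \<theta> x * 0] (mod int ?q)" by (intro cong_diff cong_refl)
        ultimately have "[\<theta> ?y = \<theta> x - \<theta> x * 0] (mod int ?q)" by (rule cong_trans)
        thus ?thesis by simp
      qed
      ultimately show "[\<phi> x = \<psi> x] (mod int ?q)"
        using h' cong_sym cong_trans by metis
    qed
  qed
  have im0: "(\<lambda>\<phi>. restrict \<phi> (A \<inter> vecs ?S)) ` ?U0 \<subseteq> homs ?q (A \<inter> vecs ?S)"
    by (rule image_subsetI, rule homs_restrict[OF JS sub1(2)]) blast
  have "card ?U1 \<le> (2 * p ^ (k div 2)) ^ (card T - 1)"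
    using card_inj_on_le[OF inj1 im1 u1(1)] u1(2) by (rule order_trans)
  moreover have "card ?U0 \<le> (2 * p ^ (k div 2)) ^ card ?S"
    using card_inj_on_le[OF inj0 im0 u0(1)] u0(2) by (rule order_trans)
  moreover have "card (homs ?q ?J) \<le> card (?U1 \<union> ?U0)"
    using inj_on_finite[OF inj1 im1 u1(1)] inj_on_finite[OF inj0 im0 u0(1)] cover by (intro card_mono) auto
  moreover have "card (?U1 \<union> ?U0) \<le> card ?U1 + card ?U0" by (rule card_Un_le)
  ultimately show ?thesis by linarith
qed

text \<open>A is the direct sum of Z 1 and its elements vanishing at l; modulo M the first summand
  contributes the factor M.\<close>

lemma card_resid_shift:
  assumes A: "suborder I A" and M: "M > 0" "full M I A" and l: "l \<in> I"
  shows "card (resid M A) = M * card (resid M (A \<inter> vecs (I - {l})))"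
proof -
  let ?J = "A \<inter> vecs (I - {l})" and ?o = "indicator I :: nat \<Rightarrow> int"
  have sg: "add_subgroup A" "A \<subseteq> vecs I" using A suborder_add_subgroup suborder_vecs by auto
  have m: "vmod M x \<in> resid M A" if "x \<in> A" for x by (rule vmod_resid[OF sg M(2) that M(1)])
  have "bij_betw (\<lambda>x. (x l, vmod M (x - sc (x l) ?o))) (resid M A) ({0..<int M} \<times> resid M ?J)"
  proof (rule bij_betw_byWitness[where f' = "\<lambda>(t, y). vmod M (y + sc t ?o)"])
    show "\<forall>a\<in>resid M A. (\<lambda>(t, y). vmod M (y + sc t ?o)) (a l, vmod M (a - sc (a l) ?o)) = a"
      by (auto simp: resid_def fun_eq_iff mod_add_left_eq)
    show "\<forall>a'\<in>{0..<int M} \<times> resid M ?J.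
        (\<lambda>x. (x l, vmod M (x - sc (x l) ?o))) ((\<lambda>(t, y). vmod M (y + sc t ?o)) a') = a'"
    proof
      fix a' assume "a' \<in> {0..<int M} \<times> resid M ?J"
      then obtain t y where a': "a' = (t, y)" and t: "0 \<le> t" "t < int M" and y: "y \<in> resid M ?J" by auto
      have yv: "y \<in> vecs (I - {l})" using y by (simp add: resid_def)
      have yl: "y l = 0" using yv by (simp add: vecs_def)
      hence xl: "vmod M (y + sc t ?o) l = t" using t l by simp
      have "vmod M (vmod M (y + sc t ?o) - sc t ?o) = y"
      proof
        fix i
        have "vmod M (vmod M (y + sc t ?o) - sc t ?o) i = ((y i + t * ?o i) mod int M - t * ?o i) mod int M"
          by simp
        also have "\<dots> = (y i + t * ?o i - t * ?o i) mod int M" by (rule mod_diff_left_eq)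
        also have "\<dots> = y i" using y by (simp add: resid_def)
        finally show "vmod M (vmod M (y + sc t ?o) - sc t ?o) i = y i" .
      qed
      thus "(\<lambda>x. (x l, vmod M (x - sc (x l) ?o))) ((\<lambda>(t, y). vmod M (y + sc t ?o)) a') = a'"
        unfolding a' prod.case xl by simp
    qed
    show "(\<lambda>x. (x l, vmod M (x - sc (x l) ?o))) ` resid M A \<subseteq> {0..<int M} \<times> resid M ?J"
    proof (rule image_subsetI)
      fix x assume x: "x \<in> resid M A"
      hence xA: "x \<in> A" by (simp add: resid_def)
      have y: "x - sc (x l) ?o \<in> ?J" by (rule shift_mem[OF A l xA])
      have "vmod M (x - sc (x l) ?o) \<in> resid M A" using m y by blast
      moreover have "vmod M (x - sc (x l) ?o) \<in> vecs (I - {l})"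
        using y by (intro vmod_vecs) blast
      ultimately have "vmod M (x - sc (x l) ?o) \<in> resid M ?J" unfolding resid_def by blast
      moreover have "x l \<in> {0..<int M}" using x by (simp add: resid_def)
      ultimately show "(x l, vmod M (x - sc (x l) ?o)) \<in> {0..<int M} \<times> resid M ?J" by blast
    qed
    show "(\<lambda>(t, y). vmod M (y + sc t ?o)) ` ({0..<int M} \<times> resid M ?J) \<subseteq> resid M A"
    proof (rule image_subsetI)
      fix a' assume "a' \<in> {0..<int M} \<times> resid M ?J"
      then obtain t y where a': "a' = (t, y)" and y: "y \<in> A" by (auto simp: resid_def)
      have "y + sc t ?o \<in> A" by (intro add_subgroup_add[OF sg(1)] y add_subgroup_sc[OF sg(1)] suborder_one[OF A])
      thus "(\<lambda>(t, y). vmod M (y + sc t ?o)) a' \<in> resid M A" unfolding a' prod.case by (rule m)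
    qed
  qed
  from bij_betw_same_card[OF this] show ?thesis
    by (simp only: card_cartesian_product card_atLeastLessThan_int diff_0_right nat_int)
qed

section \<open>Lattices of rank three and their reduction modulo p\<close>

definition lc3 :: "(nat \<Rightarrow> int) \<Rightarrow> (nat \<Rightarrow> int) \<Rightarrow> (nat \<Rightarrow> int) \<Rightarrow> int \<Rightarrow> int \<Rightarrow> int \<Rightarrow> nat \<Rightarrow> int" where
  "lc3 u v w r s t = (\<lambda>i. r * u i + s * v i + t * w i)"

lemma lc3_eq: "lc3 u v w r s t = sc r u + sc s v + sc t w"
  by (auto simp: lc3_def fun_eq_iff)

definition basis3 :: "(nat \<Rightarrow> int) set \<Rightarrow> (nat \<Rightarrow> int) \<Rightarrow> (nat \<Rightarrow> int) \<Rightarrow> (nat \<Rightarrow> int) \<Rightarrow> bool" where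
  "basis3 J u v w \<longleftrightarrow> u \<in> J \<and> v \<in> J \<and> w \<in> J \<and> (\<forall>x\<in>J. \<exists>r s t. x = lc3 u v w r s t) \<and>
     (\<forall>r s t. lc3 u v w r s t = 0 \<longrightarrow> r = 0 \<and> s = 0 \<and> t = 0)"

lemma basis3_span: "basis3 J u v w \<Longrightarrow> x \<in> J \<Longrightarrow> \<exists>r s t. x = lc3 u v w r s t"
  and basis3_indep: "basis3 J u v w \<Longrightarrow> lc3 u v w r s t = 0 \<Longrightarrow> r = 0 \<and> s = 0 \<and> t = 0"
  and basis3_mem: "basis3 J u v w \<Longrightarrow> u \<in> J" "basis3 J u v w \<Longrightarrow> v \<in> J" "basis3 J u v w \<Longrightarrow> w \<in> J"
  unfolding basis3_def by simp_all

text \<open>A triangular basis: u generates the a-coordinates, v the b-coordinates of the elements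
  vanishing at a, and w the c-coordinates of those vanishing at a and b. Fullness makes the three
  pivots nonzero, which gives independence.\<close>

lemma basis3_exists:
  assumes J: "add_subgroup J" "J \<subseteq> vecs {a, b, c}" and d: "a \<noteq> b" "a \<noteq> c" "b \<noteq> c"
    and M: "M > 0" "full M {a, b, c} J"
  obtains u v w where "basis3 J u v w"
proof -
  let ?J2 = "J \<inter> vecs {b, c}" and ?J3 = "J \<inter> vecs {c}"
  have J2: "add_subgroup ?J2" and J3: "add_subgroup ?J3"
    by (intro add_subgroup_Int J vecs_add_subgroup)+
  obtain u where u: "u \<in> J" "\<And>x. x \<in> J \<Longrightarrow> u a dvd x a" using add_subgroup_coord_gen[OF J(1)] by blast
  obtain v where v: "v \<in> ?J2" "\<And>x. x \<in> ?J2 \<Longrightarrow> v b dvd x b" using add_subgroup_coord_gen[OF J2] by blast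
  obtain w where w: "w \<in> ?J3" "\<And>x. x \<in> ?J3 \<Longrightarrow> w c dvd x c" using add_subgroup_coord_gen[OF J3] by blast
  have M': "sc (int M) (indicator {i}) \<in> J" if "i \<in> {a, b, c}" for i
    using M(2) indicator_vecs[OF that, of 1] unfolding full_def by (simp add: sc_def)
  have nz: "u a \<noteq> 0" "v b \<noteq> 0" "w c \<noteq> 0"
  proof -
    have "u a dvd sc (int M) (indicator {a}) a" by (intro u(2) M') simp
    thus "u a \<noteq> 0" using M(1) by auto
    have "v b dvd sc (int M) (indicator {b}) b" by (intro v(2) IntI M' indicator_vecs) simp_all
    thus "v b \<noteq> 0" using M(1) by auto
    have "w c dvd sc (int M) (indicator {c}) c" by (intro w(2) IntI M' indicator_vecs) simp_all
    thus "w c \<noteq> 0" using M(1) by auto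
  qed
  have z: "v a = 0" "w a = 0" "w b = 0" using v(1) w(1) d by (auto simp: vecs_def)
  have out: "u i = 0 \<and> v i = 0 \<and> w i = 0" if "i \<notin> {a, b, c}" for i
    using that u(1) v(1) w(1) vecs_zero[OF J(2)] by auto
  have span: "\<exists>r s t. x = lc3 u v w r s t" if x: "x \<in> J" for x
  proof -
    obtain r where r: "x a = u a * r" using u(2)[OF x] by (elim dvdE)
    let ?x = "x - sc r u"
    have x1: "?x \<in> J" by (intro add_subgroup_diff[OF J(1)] x add_subgroup_sc[OF J(1)] u(1))
    have "?x i = 0" if "i \<notin> {b, c}" for i
      using that r out[of i] vecs_zero[OF J(2) x] by (cases "i = a") auto
    hence x1': "?x \<in> ?J2" using x1 unfolding vecs_def by blast
    obtain s where s: "?x b = v b * s" using v(2)[OF x1'] by (elim dvdE)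
    let ?y = "?x - sc s v"
    have y1: "?y \<in> J" using v(1) by (intro add_subgroup_diff[OF J(1)] x1 add_subgroup_sc[OF J(1)]) blast
    have ya: "?y a = 0" "?y b = 0" using r s z by simp_all
    have "?y i = 0" if "i \<notin> {c}" for i
      using that ya out[of i] vecs_zero[OF J(2) x] by (cases "i = a"; cases "i = b") auto
    hence y1': "?y \<in> ?J3" using y1 unfolding vecs_def by blast
    obtain t where t: "?y c = w c * t" using w(2)[OF y1'] by (elim dvdE)
    have "x = lc3 u v w r s t"
    proof
      fix i show "x i = lc3 u v w r s t i"
        using r s t z out[of i] vecs_zero[OF J(2) x, of i] unfolding lc3_def
        by (cases "i = a"; cases "i = b"; cases "i = c") (auto simp: algebra_simps)
    qed
    thus ?thesis by blast
  qed
  have ind: "r = 0 \<and> s = 0 \<and> t = 0" if e: "lc3 u v w r s t = 0" for r s t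
  proof -
    have e: "r * u i + s * v i + t * w i = 0" for i using fun_cong[OF e, of i] by (simp add: lc3_def)
    have r: "r = 0" using e[of a] z nz by simp
    have s: "s = 0" using e[of b] z nz r by simp
    have "t = 0" using e[of c] nz r s by simp
    thus ?thesis using r s by simp
  qed
  have "basis3 J u v w" unfolding basis3_def
  proof (intro conjI ballI allI)
    show "u \<in> J" "v \<in> J" "w \<in> J" using u(1) v(1) w(1) by auto
    show "\<exists>r s t. x = lc3 u v w r s t" if "x \<in> J" for x by (rule span[OF that])
    show "lc3 u v w r s t = 0 \<longrightarrow> r = 0 \<and> s = 0 \<and> t = 0" for r s t using ind by (intro impI)
  qed
  thus ?thesis by (rule that)
qed

definition pmult :: "nat \<Rightarrow> (nat \<Rightarrow> int) set \<Rightarrow> (nat \<Rightarrow> int) set" where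
  "pmult p J = sc (int p) ` J"

lemma pmult_add_subgroup: assumes "add_subgroup J" shows "add_subgroup (pmult p J)"
  unfolding add_subgroup_def pmult_def
proof (intro conjI ballI)
  have "0 = sc (int p) 0" by (simp add: fun_eq_iff)
  thus "0 \<in> sc (int p) ` J" using add_subgroup_0[OF assms] by blast
  fix x y assume "x \<in> sc (int p) ` J" "y \<in> sc (int p) ` J"
  then obtain a b where "a \<in> J" "b \<in> J" "x = sc (int p) a" "y = sc (int p) b" by blast
  moreover hence "x - y = sc (int p) (a - b)" by (simp add: fun_eq_iff algebra_simps)
  ultimately show "x - y \<in> sc (int p) ` J" using add_subgroup_diff[OF assms] by blast
qed

lemma pmult_sc: "x \<in> J \<Longrightarrow> int p dvd c \<Longrightarrow> add_subgroup J \<Longrightarrow> sc c x \<in> pmult p J"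
proof -
  assume a: "x \<in> J" "int p dvd c" "add_subgroup J"
  then obtain d where d: "c = int p * d" by blast
  have "sc c x = sc (int p) (sc d x)" by (simp add: fun_eq_iff d)
  thus ?thesis unfolding pmult_def using add_subgroup_sc[OF a(3,1)] by blast
qed

lemma pmult_mult:
  assumes "subrng J" "x \<in> pmult p J" "y \<in> J" shows "x * y \<in> pmult p J"
proof -
  obtain a where "a \<in> J" "x = sc (int p) a" using assms(2) unfolding pmult_def by blast
  moreover hence "x * y = sc (int p) (a * y)" by (simp add: fun_eq_iff)
  ultimately show ?thesis unfolding pmult_def using subrng_mult[OF assms(1) _ assms(3)] by blast
qed

lemma pmult_cancel:
  assumes p: "prime p" and J: "add_subgroup J" and x: "x \<in> J" "sc c x \<in> pmult p J" "\<not> int p dvd c"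
  shows "x \<in> pmult p J"
proof -
  have "coprime c (int p)" using p x(3) prime_imp_coprime[of "int p" c] by (simp add: coprime_commute)
  then obtain d where "[c * d = 1] (mod int p)" using cong_solve_coprime_int by blast
  hence "int p dvd 1 - d * c" by (simp add: cong_iff_dvd_diff dvd_diff_commute mult.commute)
  hence "sc (1 - d * c) x \<in> pmult p J" by (intro pmult_sc J x(1))
  moreover have "sc d (sc c x) \<in> pmult p J" by (intro add_subgroup_sc[OF pmult_add_subgroup[OF J]] x(2))
  ultimately have "sc (1 - d * c) x + sc d (sc c x) \<in> pmult p J"
    by (intro add_subgroup_add[OF pmult_add_subgroup[OF J]])
  moreover have "sc (1 - d * c) x + sc d (sc c x) = x" by (simp add: fun_eq_iff algebra_simps)
  ultimately show ?thesis by (simp only:)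
qed

lemma pmult_lc3:
  assumes J: "add_subgroup J" and B: "basis3 J u v w"
  shows "lc3 u v w r s t \<in> pmult p J \<longleftrightarrow> int p dvd r \<and> int p dvd s \<and> int p dvd t"
proof
  assume "lc3 u v w r s t \<in> pmult p J"
  then obtain y where y: "y \<in> J" "lc3 u v w r s t = sc (int p) y" unfolding pmult_def by blast
  obtain r' s' t' where "y = lc3 u v w r' s' t'" using basis3_span[OF B y(1)] by blast
  hence e: "lc3 u v w r s t i = int p * lc3 u v w r' s' t' i" for i using fun_cong[OF y(2), of i] by simp
  have "lc3 u v w (r - int p * r') (s - int p * s') (t - int p * t') = 0"
    using e by (simp add: fun_eq_iff lc3_def algebra_simps)
  hence "r - int p * r' = 0 \<and> s - int p * s' = 0 \<and> t - int p * t' = 0" by (rule basis3_indep[OF B])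
  thus "int p dvd r \<and> int p dvd s \<and> int p dvd t" by auto
next
  assume "int p dvd r \<and> int p dvd s \<and> int p dvd t"
  thus "lc3 u v w r s t \<in> pmult p J" unfolding lc3_eq
    by (intro add_subgroup_add[OF pmult_add_subgroup[OF J]] pmult_sc J basis3_mem[OF B]) blast+
qed

text \<open>Linear independence of the images in the vector space J / p J over the field with p
  elements, written with integer coefficients.\<close>

definition indep3 :: "nat \<Rightarrow> (nat \<Rightarrow> int) set \<Rightarrow> (nat \<Rightarrow> int) \<Rightarrow> (nat \<Rightarrow> int) \<Rightarrow> (nat \<Rightarrow> int) \<Rightarrow> bool" where
  "indep3 p J u y z \<longleftrightarrow> (\<forall>\<alpha> \<beta> \<gamma>. lc3 u y z \<alpha> \<beta> \<gamma> \<in> pmult p J \<longrightarrow> int p dvd \<alpha> \<and> int p dvd \<beta> \<and> int p dvd \<gamma>)"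

text \<open>Cramer's rule: \<open>D\<close> is the determinant of the three vectors with respect to a basis of \<open>J\<close>.\<close>

lemma indep3_determinant:
  assumes p: "prime p" and J: "add_subgroup J" and B: "basis3 J v1 v2 v3"
    and m: "u \<in> J" "y \<in> J" "z \<in> J" and ind: "indep3 p J u y z"
  obtains D where "\<not> int p dvd D" "\<forall>x\<in>J. \<exists>\<alpha> \<beta> \<gamma>. sc D x = lc3 u y z \<alpha> \<beta> \<gamma>"
proof -
  obtain u1 u2 u3 where u: "u = lc3 v1 v2 v3 u1 u2 u3" using basis3_span[OF B m(1)] by blast
  obtain y1 y2 y3 where y: "y = lc3 v1 v2 v3 y1 y2 y3" using basis3_span[OF B m(2)] by blast
  obtain z1 z2 z3 where z: "z = lc3 v1 v2 v3 z1 z2 z3" using basis3_span[OF B m(3)] by blast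
  define D where "D = u1 * (z2 * y3 - z3 * y2) - u2 * (z1 * y3 - z3 * y1) + u3 * (z1 * y2 - z2 * y1)"
  have span: "\<exists>\<alpha> \<beta> \<gamma>. sc D x = lc3 u y z \<alpha> \<beta> \<gamma>" if xJ: "x \<in> J" for x
  proof -
    obtain x1 x2 x3 where x: "x = lc3 v1 v2 v3 x1 x2 x3" using basis3_span[OF B xJ] by blast
    have "sc D x = lc3 u y z
       (x1 * (z2 * y3 - z3 * y2) - x2 * (z1 * y3 - z3 * y1) + x3 * (z1 * y2 - z2 * y1))
       (u1 * (z2 * x3 - z3 * x2) - u2 * (z1 * x3 - z3 * x1) + u3 * (z1 * x2 - z2 * x1))
       (u1 * (x2 * y3 - x3 * y2) - u2 * (x1 * y3 - x3 * y1) + u3 * (x1 * y2 - x2 * y1))"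
    proof
      fix i
      show "sc D x i = lc3 u y z
       (x1 * (z2 * y3 - z3 * y2) - x2 * (z1 * y3 - z3 * y1) + x3 * (z1 * y2 - z2 * y1))
       (u1 * (z2 * x3 - z3 * x2) - u2 * (z1 * x3 - z3 * x1) + u3 * (z1 * x2 - z2 * x1))
       (u1 * (x2 * y3 - x3 * y2) - u2 * (x1 * y3 - x3 * y1) + u3 * (x1 * y2 - x2 * y1)) i"
        unfolding sc_apply D_def x u y z lc3_def by (simp add: algebra_simps)
    qed
    thus ?thesis by blast
  qed
  \<comment> \<open>If p divides D, the cofactors yield relations between u, y and z modulo p.
    Independence forces p to divide all 2 by 2 minors of u and z, which are the coefficients of y;
    the relations between u and z alone then force p to divide the coordinates of u.\<close>
  have "\<not> int p dvd D"
  proof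
    assume D: "int p dvd D"
    have P: "lc3 v1 v2 v3 a b c \<in> pmult p J" if "int p dvd a" "int p dvd b" "int p dvd c" for a b c
      using pmult_lc3[OF J B] that by blast
    have e3: "lc3 u y z (- (y1 * z2 - y2 * z1)) (u1 * z2 - u2 * z1) (- (u1 * y2 - u2 * y1)) = lc3 v1 v2 v3 0 0 D"
      unfolding u y z lc3_def D_def by (rule ext) (simp add: algebra_simps)
    have "lc3 v1 v2 v3 0 0 D \<in> pmult p J" by (rule P) (use D in auto)
    hence m12: "int p dvd u1 * z2 - u2 * z1" using ind unfolding indep3_def e3[symmetric] by blast
    have e2: "lc3 u y z (- (y1 * z3 - y3 * z1)) (u1 * z3 - u3 * z1) (- (u1 * y3 - u3 * y1)) = lc3 v1 v2 v3 0 (- D) 0"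
      unfolding u y z lc3_def D_def by (rule ext) (simp add: algebra_simps)
    have "lc3 v1 v2 v3 0 (- D) 0 \<in> pmult p J" by (rule P) (use D in auto)
    hence m13: "int p dvd u1 * z3 - u3 * z1" using ind unfolding indep3_def e2[symmetric] by blast
    have e1: "lc3 u y z (- (y2 * z3 - y3 * z2)) (u2 * z3 - u3 * z2) (- (u2 * y3 - u3 * y2)) = lc3 v1 v2 v3 D 0 0"
      unfolding u y z lc3_def D_def by (rule ext) (simp add: algebra_simps)
    have "lc3 v1 v2 v3 D 0 0 \<in> pmult p J" by (rule P) (use D in auto)
    hence m23: "int p dvd u2 * z3 - u3 * z2" using ind unfolding indep3_def e1[symmetric] by blast
    have f1: "lc3 u y z (- z1) 0 u1 = lc3 v1 v2 v3 0 (u1 * z2 - u2 * z1) (u1 * z3 - u3 * z1)"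
      unfolding u y z lc3_def by (rule ext) (simp add: algebra_simps)
    have "lc3 v1 v2 v3 0 (u1 * z2 - u2 * z1) (u1 * z3 - u3 * z1) \<in> pmult p J" by (rule P) (use m12 m13 in auto)
    hence d1: "int p dvd u1" using ind unfolding indep3_def f1[symmetric] by blast
    have f2: "lc3 u y z (- z2) 0 u2 = lc3 v1 v2 v3 (- (u1 * z2 - u2 * z1)) 0 (u2 * z3 - u3 * z2)"
      unfolding u y z lc3_def by (rule ext) (simp add: algebra_simps)
    have "lc3 v1 v2 v3 (- (u1 * z2 - u2 * z1)) 0 (u2 * z3 - u3 * z2) \<in> pmult p J"
      by (rule P) (use m12 m23 in \<open>simp_all only: dvd_minus_iff dvd_0_right\<close>)
    hence d2: "int p dvd u2" using ind unfolding indep3_def f2[symmetric] by blast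
    have f3: "lc3 u y z (- z3) 0 u3 = lc3 v1 v2 v3 (- (u1 * z3 - u3 * z1)) (- (u2 * z3 - u3 * z2)) 0"
      unfolding u y z lc3_def by (rule ext) (simp add: algebra_simps)
    have "lc3 v1 v2 v3 (- (u1 * z3 - u3 * z1)) (- (u2 * z3 - u3 * z2)) 0 \<in> pmult p J"
      by (rule P) (use m13 m23 in \<open>simp_all only: dvd_minus_iff dvd_0_right\<close>)
    hence d3: "int p dvd u3" using ind unfolding indep3_def f3[symmetric] by blast
    have f: "lc3 u y z 1 0 0 = lc3 v1 v2 v3 u1 u2 u3" unfolding u lc3_def by auto
    have "lc3 v1 v2 v3 u1 u2 u3 \<in> pmult p J" by (rule P[OF d1 d2 d3])
    hence "int p dvd 1" using ind unfolding indep3_def f[symmetric] by blast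
    thus False using p not_prime_unit[of "int p"] by simp
  qed
  thus ?thesis using that span by blast
qed

text \<open>J / p J is a nilpotent commutative algebra of dimension three with nonzero product. If
  all squares vanish, then g, h and g h are independent. Otherwise u and u * u are independent for
  some u by nilpotency, and a basis vector completes them. Either way u and y generate J modulo p J
  as a ring.\<close>

lemma indep3_exists:
  assumes p: "prime p" and J: "subrng J" and B: "basis3 J v1 v2 v3"
    and nil: "\<And>x. x \<in> J \<Longrightarrow> \<exists>n. x ^ Suc n \<in> pmult p J"
    and g: "g \<in> J" "h \<in> J" "g * h \<notin> pmult p J"
  obtains u y z where "u \<in> J" "y \<in> J" "z \<in> J" "z = u * u \<or> z = u * y" "indep3 p J u y z"
proof (cases "\<exists>u\<in>J. u * u \<notin> pmult p J")
  case False
  hence sq: "x * x \<in> pmult p J" if "x \<in> J" for x using that by blast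
  have sg: "add_subgroup J" using J by (rule subrng_add_subgroup)
  note psg = pmult_add_subgroup[OF sg, of p]
  let ?z = "g * h"
  have z: "?z \<in> J" by (rule subrng_mult[OF J g(1,2)])
  have cz: "int p dvd c" if "sc c ?z \<in> pmult p J" for c
    using pmult_cancel[OF p sg z that] g(3) by blast
  have "indep3 p J g h ?z" unfolding indep3_def
  proof (intro allI impI)
    fix \<alpha> \<beta> \<gamma> assume a: "lc3 g h ?z \<alpha> \<beta> \<gamma> \<in> pmult p J"
    have 1: "sc \<beta> (h * h) \<in> pmult p J" "sc \<gamma> ((h * h) * g) \<in> pmult p J"
        "sc \<alpha> (g * g) \<in> pmult p J" "sc \<gamma> ((g * g) * h) \<in> pmult p J"
      by (intro add_subgroup_sc[OF psg] sq g pmult_mult[OF J])+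
    have "lc3 g h ?z \<alpha> \<beta> \<gamma> * h - sc \<beta> (h * h) - sc \<gamma> ((h * h) * g) \<in> pmult p J"
      by (intro add_subgroup_diff[OF psg] 1 pmult_mult[OF J a g(2)])
    moreover have "lc3 g h ?z \<alpha> \<beta> \<gamma> * h - sc \<beta> (h * h) - sc \<gamma> ((h * h) * g) = sc \<alpha> ?z"
      by (simp add: fun_eq_iff lc3_def algebra_simps)
    ultimately have da: "int p dvd \<alpha>" using cz by (simp only:)
    have "lc3 g h ?z \<alpha> \<beta> \<gamma> * g - sc \<alpha> (g * g) - sc \<gamma> ((g * g) * h) \<in> pmult p J"
      by (intro add_subgroup_diff[OF psg] 1 pmult_mult[OF J a g(1)])
    moreover have "lc3 g h ?z \<alpha> \<beta> \<gamma> * g - sc \<alpha> (g * g) - sc \<gamma> ((g * g) * h) = sc \<beta> ?z"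
      by (simp add: fun_eq_iff lc3_def algebra_simps)
    ultimately have db: "int p dvd \<beta>" using cz by (simp only:)
    have "lc3 g h ?z \<alpha> \<beta> \<gamma> - sc \<alpha> g - sc \<beta> h \<in> pmult p J"
      by (intro add_subgroup_diff[OF psg] a pmult_sc g da db sg)
    moreover have "lc3 g h ?z \<alpha> \<beta> \<gamma> - sc \<alpha> g - sc \<beta> h = sc \<gamma> ?z"
      by (simp add: fun_eq_iff lc3_def)
    ultimately have "int p dvd \<gamma>" using cz by (simp only:)
    thus "int p dvd \<alpha> \<and> int p dvd \<beta> \<and> int p dvd \<gamma>" using da db by blast
  qed
  thus ?thesis using that[of g h ?z] g z by blast
next
  case True
  then obtain u where u: "u \<in> J" "u * u \<notin> pmult p J" by blast
  have sg: "add_subgroup J" using J by (rule subrng_add_subgroup)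
  note psg = pmult_add_subgroup[OF sg, of p]
  let ?z = "u * u"
  have z: "?z \<in> J" by (rule subrng_mult[OF J u(1) u(1)])
  have uP: "u \<notin> pmult p J" using pmult_mult[OF J _ u(1)] u(2) by blast
  have uz: "int p dvd \<alpha> \<and> int p dvd \<beta>" if a: "sc \<alpha> u + sc \<beta> ?z \<in> pmult p J" for \<alpha> \<beta>
  proof -
    \<comment> \<open>A relation with invertible \<alpha> reads u = c u^2 modulo p J. Iterating it
      gives u = c^n u^(n+1) for every n, so nilpotency would put u into p J.\<close>
    have da: "int p dvd \<alpha>"
    proof (rule ccontr)
      assume "\<not> int p dvd \<alpha>"
      hence "coprime \<alpha> (int p)" using p prime_imp_coprime[of "int p" \<alpha>] by (simp add: coprime_commute)
      then obtain d where "[\<alpha> * d = 1] (mod int p)" using cong_solve_coprime_int by blast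
      hence d: "int p dvd 1 - d * \<alpha>" by (simp add: cong_iff_dvd_diff dvd_diff_commute mult.commute)
      define c where "c = - (d * \<beta>)"
      have "sc (1 - d * \<alpha>) u + sc d (sc \<alpha> u + sc \<beta> ?z) \<in> pmult p J"
        by (intro add_subgroup_add[OF psg] pmult_sc u(1) d sg add_subgroup_sc[OF psg] a)
      moreover have "sc (1 - d * \<alpha>) u + sc d (sc \<alpha> u + sc \<beta> ?z) = u - sc c ?z"
        by (simp add: fun_eq_iff algebra_simps c_def)
      ultimately have base: "u - sc c ?z \<in> pmult p J" by (simp only:)
      have ind: "u - sc (c ^ n) (u ^ Suc n) \<in> pmult p J" for n
      proof (induction n)
        case 0
        have "u - sc (c ^ 0) (u ^ Suc 0) = 0" by (simp add: fun_eq_iff)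
        thus ?case using add_subgroup_0[OF psg] by (simp only:)
      next
        case (Suc n)
        have "u - sc c ?z + sc c ((u - sc (c ^ n) (u ^ Suc n)) * u) \<in> pmult p J"
          by (intro add_subgroup_add[OF psg] base add_subgroup_sc[OF psg] pmult_mult[OF J Suc u(1)])
        moreover have "u - sc c ?z + sc c ((u - sc (c ^ n) (u ^ Suc n)) * u) = u - sc (c ^ Suc n) (u ^ Suc (Suc n))"
          by (simp add: fun_eq_iff algebra_simps power_fun_apply)
        ultimately show ?case by (simp only:)
      qed
      obtain n where n: "u ^ Suc n \<in> pmult p J" using nil[OF u(1)] by blast
      have "(u - sc (c ^ n) (u ^ Suc n)) + sc (c ^ n) (u ^ Suc n) \<in> pmult p J"
        by (intro add_subgroup_add[OF psg] ind add_subgroup_sc[OF psg] n)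
      thus False using uP by (simp only: diff_add_cancel)
    qed
    have "(sc \<alpha> u + sc \<beta> ?z) - sc \<alpha> u \<in> pmult p J"
      by (intro add_subgroup_diff[OF psg] a pmult_sc u(1) da sg)
    hence "sc \<beta> ?z \<in> pmult p J" by (simp only: add_diff_cancel_left')
    hence "int p dvd \<beta>" using pmult_cancel[OF p sg z] u(2) by blast
    thus ?thesis using da by blast
  qed
  obtain u1 u2 u3 where uu: "u = lc3 v1 v2 v3 u1 u2 u3" using basis3_span[OF B u(1)] by blast
  obtain z1 z2 z3 where zz: "?z = lc3 v1 v2 v3 z1 z2 z3" using basis3_span[OF B z] by blast
  have vJ: "v1 \<in> J" "v2 \<in> J" "v3 \<in> J" by (rule basis3_mem[OF B])+
  have P: "lc3 v1 v2 v3 a b c \<in> pmult p J \<longleftrightarrow> int p dvd a \<and> int p dvd b \<and> int p dvd c" for a b c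
    using pmult_lc3[OF sg B] by blast
  have minor: "int p dvd \<alpha> \<and> int p dvd \<beta>"
    if "int p dvd \<alpha> * a + \<beta> * b" "int p dvd \<alpha> * c + \<beta> * d" "\<not> int p dvd a * d - c * b" for \<alpha> \<beta> a b c d :: int
  proof -
    have "int p dvd d * (\<alpha> * a + \<beta> * b) - b * (\<alpha> * c + \<beta> * d)" "int p dvd a * (\<alpha> * c + \<beta> * d) - c * (\<alpha> * a + \<beta> * b)"
      using that by (intro dvd_diff dvd_mult; simp)+
    hence "int p dvd \<alpha> * (a * d - c * b)" "int p dvd \<beta> * (a * d - c * b)" by (simp_all add: algebra_simps)
    thus ?thesis using p that(3) by (simp add: prime_dvd_mult_iff)
  qed
  \<comment> \<open>A 2 by 2 minor of u and z that is a unit modulo p allows y to be the basis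
    vector of the omitted coordinate. If all minors vanish modulo p, then u and z are dependent
    there, contrary to \<open>uz\<close>.\<close>
  have third: "\<exists>y\<in>J. indep3 p J u y ?z"
  proof (cases "int p dvd u1 * z2 - u2 * z1")
    case False
    have "indep3 p J u v3 ?z" unfolding indep3_def
    proof (intro allI impI)
      fix \<alpha> \<beta> \<gamma> assume a: "lc3 u v3 ?z \<alpha> \<beta> \<gamma> \<in> pmult p J"
      have "lc3 u v3 ?z \<alpha> \<beta> \<gamma> = lc3 v1 v2 v3 (\<alpha> * u1 + \<gamma> * z1) (\<alpha> * u2 + \<gamma> * z2) (\<alpha> * u3 + \<gamma> * z3 + \<beta>)"
        by (subst zz) (simp add: uu lc3_def fun_eq_iff algebra_simps)
      with a have d: "int p dvd \<alpha> * u1 + \<gamma> * z1" "int p dvd \<alpha> * u2 + \<gamma> * z2" "int p dvd \<alpha> * u3 + \<gamma> * z3 + \<beta>"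
        by (simp_all only: P)
      have "int p dvd \<alpha> \<and> int p dvd \<gamma>" by (rule minor[OF d(1,2) False])
      moreover hence "int p dvd \<alpha> * u3 + \<gamma> * z3" by simp
      hence "int p dvd \<beta>" using d(3) by (simp only: dvd_add_right_iff)
      ultimately show "int p dvd \<alpha> \<and> int p dvd \<beta> \<and> int p dvd \<gamma>" by blast
    qed
    thus ?thesis using vJ by blast
  next
    case m12: True
    show ?thesis
    proof (cases "int p dvd u1 * z3 - u3 * z1")
      case False
      have "indep3 p J u v2 ?z" unfolding indep3_def
      proof (intro allI impI)
        fix \<alpha> \<beta> \<gamma> assume a: "lc3 u v2 ?z \<alpha> \<beta> \<gamma> \<in> pmult p J"
        have "lc3 u v2 ?z \<alpha> \<beta> \<gamma> = lc3 v1 v2 v3 (\<alpha> * u1 + \<gamma> * z1) (\<alpha> * u2 + \<gamma> * z2 + \<beta>) (\<alpha> * u3 + \<gamma> * z3)"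
          by (subst zz) (simp add: uu lc3_def fun_eq_iff algebra_simps)
        with a have d: "int p dvd \<alpha> * u1 + \<gamma> * z1" "int p dvd \<alpha> * u3 + \<gamma> * z3" "int p dvd \<alpha> * u2 + \<gamma> * z2 + \<beta>"
          by (simp_all only: P)
        have "int p dvd \<alpha> \<and> int p dvd \<gamma>" by (rule minor[OF d(1,2) False])
        moreover hence "int p dvd \<alpha> * u2 + \<gamma> * z2" by simp
        hence "int p dvd \<beta>" using d(3) by (simp only: dvd_add_right_iff)
        ultimately show "int p dvd \<alpha> \<and> int p dvd \<beta> \<and> int p dvd \<gamma>" by blast
      qed
      thus ?thesis using vJ by blast
    next
      case m13: True
      show ?thesis
      proof (cases "int p dvd u2 * z3 - u3 * z2")
        case False
        have "indep3 p J u v1 ?z" unfolding indep3_def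
        proof (intro allI impI)
          fix \<alpha> \<beta> \<gamma> assume a: "lc3 u v1 ?z \<alpha> \<beta> \<gamma> \<in> pmult p J"
          have "lc3 u v1 ?z \<alpha> \<beta> \<gamma> = lc3 v1 v2 v3 (\<alpha> * u1 + \<gamma> * z1 + \<beta>) (\<alpha> * u2 + \<gamma> * z2) (\<alpha> * u3 + \<gamma> * z3)"
            by (subst zz) (simp add: uu lc3_def fun_eq_iff algebra_simps)
          with a have d: "int p dvd \<alpha> * u2 + \<gamma> * z2" "int p dvd \<alpha> * u3 + \<gamma> * z3" "int p dvd \<alpha> * u1 + \<gamma> * z1 + \<beta>"
            by (simp_all only: P)
          have "int p dvd \<alpha> \<and> int p dvd \<gamma>" by (rule minor[OF d(1,2) False])
          moreover hence "int p dvd \<alpha> * u1 + \<gamma> * z1" by simp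
          hence "int p dvd \<beta>" using d(3) by (simp only: dvd_add_right_iff)
          ultimately show "int p dvd \<alpha> \<and> int p dvd \<beta> \<and> int p dvd \<gamma>" by blast
        qed
        thus ?thesis using vJ by blast
      next
        case m23: True
        have "sc (- z1) u + sc u1 ?z = lc3 v1 v2 v3 0 (u1 * z2 - u2 * z1) (u1 * z3 - u3 * z1)"
          by (subst zz) (simp add: uu lc3_def fun_eq_iff algebra_simps)
        hence "sc (- z1) u + sc u1 ?z \<in> pmult p J" using m12 m13 by (simp only: P dvd_0_right simp_thms)
        hence d1: "int p dvd u1" using uz by blast
        have "sc (- z2) u + sc u2 ?z = lc3 v1 v2 v3 (- (u1 * z2 - u2 * z1)) 0 (u2 * z3 - u3 * z2)"
          by (subst zz) (simp add: uu lc3_def fun_eq_iff algebra_simps)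
        hence "sc (- z2) u + sc u2 ?z \<in> pmult p J" using m12 m23 by (simp only: P dvd_0_right dvd_minus_iff simp_thms)
        hence d2: "int p dvd u2" using uz by blast
        have "sc (- z3) u + sc u3 ?z = lc3 v1 v2 v3 (- (u1 * z3 - u3 * z1)) (- (u2 * z3 - u3 * z2)) 0"
          by (subst zz) (simp add: uu lc3_def fun_eq_iff algebra_simps)
        hence "sc (- z3) u + sc u3 ?z \<in> pmult p J" using m13 m23 by (simp only: P dvd_0_right dvd_minus_iff simp_thms)
        hence d3: "int p dvd u3" using uz by blast
        have "u \<in> pmult p J" unfolding uu P using d1 d2 d3 by blast
        thus ?thesis using uP by blast
      qed
    qed
  qed
  thus ?thesis using that[of u _ ?z] u(1) z by blast
qed

lemma homs_lc3:
  assumes J: "add_subgroup J" and h: "\<phi> \<in> homs q J" and m: "u \<in> J" "y \<in> J" "z \<in> J"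
  shows "[\<phi> (lc3 u y z \<alpha> \<beta> \<gamma>) = \<alpha> * \<phi> u + \<beta> * \<phi> y + \<gamma> * \<phi> z] (mod int q)"
proof -
  note s = add_subgroup_sc[OF J m(1), of \<alpha>] add_subgroup_sc[OF J m(2), of \<beta>] add_subgroup_sc[OF J m(3), of \<gamma>]
  have "[\<phi> (sc \<alpha> u + sc \<beta> y + sc \<gamma> z) = \<phi> (sc \<alpha> u + sc \<beta> y) + \<phi> (sc \<gamma> z)] (mod int q)"
    by (intro homs_add[OF h] add_subgroup_add[OF J] s)
  moreover have "[\<phi> (sc \<alpha> u + sc \<beta> y) + \<phi> (sc \<gamma> z) = (\<phi> (sc \<alpha> u) + \<phi> (sc \<beta> y)) + \<phi> (sc \<gamma> z)] (mod int q)"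
    by (intro cong_add homs_add[OF h] cong_refl s)
  moreover have "[(\<phi> (sc \<alpha> u) + \<phi> (sc \<beta> y)) + \<phi> (sc \<gamma> z) = \<alpha> * \<phi> u + \<beta> * \<phi> y + \<gamma> * \<phi> z] (mod int q)"
    by (intro cong_add homs_sc[OF J h] m)
  ultimately show ?thesis unfolding lc3_eq using cong_trans by blast
qed

text \<open>D is invertible modulo \<open>p ^ k\<close>, so \<phi> is determined by its values at u,
  y and z, and z is a product of the other two kinds of value. The value at u satisfies a split
  quartic congruence; once it is fixed, expanding y * y gives a quadratic congruence for the value
  at y.\<close>

lemma card_homs_two_generators:
  assumes p: "prime p" and J: "subrng J" "J \<subseteq> vecs {a, b, c}"
    and m: "u \<in> J" "y \<in> J" "z \<in> J" and z: "z = u * u \<or> z = u * y"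
    and D: "\<not> int p dvd D" "\<And>x. x \<in> J \<Longrightarrow> \<exists>\<alpha> \<beta> \<gamma>. sc D x = lc3 u y z \<alpha> \<beta> \<gamma>"
  shows "card (homs (p ^ k) J) \<le> 4 * p ^ (3 * k div 4) * (2 * p ^ (k div 2))"
proof -
  let ?q = "p ^ k"
  have sg: "add_subgroup J" using J(1) by (rule subrng_add_subgroup)
  have "coprime D (int p)" using p D(1) prime_imp_coprime[of "int p" D] by (simp add: coprime_commute)
  hence cop: "coprime D (int ?q)" by simp
  then obtain E where E: "[D * E = 1] (mod int ?q)" using cong_solve_coprime_int by blast
  have zval: "[\<phi> z = (if z = u * u then \<phi> u * \<phi> u else \<phi> u * \<phi> y)] (mod int ?q)" if h: "\<phi> \<in> homs ?q J" for \<phi>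
    using z homs_mult[OF h m(1) m(1)] homs_mult[OF h m(1) m(2)] by auto
  have Dval: "[D * \<phi> x = \<alpha> * \<phi> u + \<beta> * \<phi> y + \<gamma> * \<phi> z] (mod int ?q)"
    if h: "\<phi> \<in> homs ?q J" and x: "x \<in> J" "sc D x = lc3 u y z \<alpha> \<beta> \<gamma>" for \<phi> x \<alpha> \<beta> \<gamma>
  proof -
    have "[\<phi> (sc D x) = D * \<phi> x] (mod int ?q)" by (rule homs_sc[OF sg h x(1)])
    hence "[D * \<phi> x = \<phi> (lc3 u y z \<alpha> \<beta> \<gamma>)] (mod int ?q)" unfolding x(2) by (rule cong_sym)
    thus ?thesis using homs_lc3[OF sg h m] cong_trans by blast
  qed
  obtain \<alpha> \<beta> \<gamma> where yy: "sc D (y * y) = lc3 u y z \<alpha> \<beta> \<gamma>" using D(2)[OF subrng_mult[OF J(1) m(2) m(2)]] by blast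
  \<comment> \<open>Coefficients of the quadratic congruence for the value Y at y when the value U
    at u is fixed. The value at z is U U or U Y, the second of which changes the linear coefficient;
    E inverts D.\<close>
  define d where "d U = (if z = u * u then E * \<beta> else E * (\<beta> + \<gamma> * U))" for U
  define c' where "c' U = (if z = u * u then E * (\<alpha> * U + \<gamma> * (U * U)) else E * (\<alpha> * U))" for U
  let ?B = "{X \<in> {0..<int ?q}. int ?q dvd (X - 0) * (X - u a) * ((X - u b) * (X - u c))}"
  let ?C = "\<lambda>U. {Y \<in> {0..<int ?q}. [Y * Y = d U * Y + c' U] (mod int ?q)}"
  have inj: "inj_on (\<lambda>\<phi>. (\<phi> u, \<phi> y)) (homs ?q J)"
  proof (rule inj_onI)
    fix \<phi> \<psi> assume h: "\<phi> \<in> homs ?q J" "\<psi> \<in> homs ?q J" and "(\<phi> u, \<phi> y) = (\<psi> u, \<psi> y)"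
    hence e: "\<phi> u = \<psi> u" "\<phi> y = \<psi> y" by simp_all
    have ez: "[\<phi> z = \<psi> z] (mod int ?q)"
      using zval[OF h(1)] zval[OF h(2)] unfolding e using cong_sym cong_trans by metis
    show "\<phi> = \<psi>"
    proof (rule homs_eqI[OF h])
      fix x assume x: "x \<in> J"
      obtain \<alpha> \<beta> \<gamma> where xx: "sc D x = lc3 u y z \<alpha> \<beta> \<gamma>" using D(2)[OF x] by blast
      have "[\<alpha> * \<phi> u + \<beta> * \<phi> y + \<gamma> * \<phi> z = \<alpha> * \<psi> u + \<beta> * \<psi> y + \<gamma> * \<psi> z] (mod int ?q)"
        unfolding e by (intro cong_add cong_mult cong_refl ez)
      hence "[D * \<phi> x = D * \<psi> x] (mod int ?q)"
        using Dval[OF h(1) x xx] Dval[OF h(2) x xx] cong_sym cong_trans by metis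
      thus "[\<phi> x = \<psi> x] (mod int ?q)" using cong_mult_lcancel[OF cop] by blast
    qed
  qed
  have sub: "(\<lambda>\<phi>. (\<phi> u, \<phi> y)) ` homs ?q J \<subseteq> Sigma ?B ?C"
  proof (rule image_subsetI)
    fix \<phi> assume h: "\<phi> \<in> homs ?q J"
    let ?U = "\<phi> u" and ?Y = "\<phi> y"
    have q: "?U \<in> {0..<int ?q}" "?Y \<in> {0..<int ?q}" using homs_range[OF h] m by auto
    \<comment> \<open>The coordinates of u are u a, u b, u c and otherwise 0, so u is a root of X (X
      - u a) (X - u b) (X - u c). The factor X keeps the relation inside J, where an identity may be
      missing.\<close>
    define e1 e2 e3 where "e1 = u a + u b + u c" and "e2 = u a * u b + u a * u c + u b * u c" and "e3 = u a * u b * u c"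
    have u2: "u * u \<in> J" and u3: "u * (u * u) \<in> J" and u4: "(u * u) * (u * u) \<in> J"
      by (intro subrng_mult[OF J(1)] m)+
    have rel: "(u * u) * (u * u) = lc3 u (u * u) (u * (u * u)) e3 (- e2) e1"
    proof
      fix i
      have "u i = 0 \<or> u i = u a \<or> u i = u b \<or> u i = u c" using vecs_zero[OF J(2) m(1), of i] by auto
      hence "u i * (u i - u a) * (u i - u b) * (u i - u c) = 0" by auto
      thus "((u * u) * (u * u)) i = lc3 u (u * u) (u * (u * u)) e3 (- e2) e1 i"
        by (simp add: lc3_def e1_def e2_def e3_def algebra_simps)
    qed
    have c2: "[\<phi> (u * u) = ?U * ?U] (mod int ?q)" by (rule homs_mult[OF h m(1) m(1)])
    have c3: "[\<phi> (u * (u * u)) = ?U * (?U * ?U)] (mod int ?q)"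
      using homs_mult[OF h m(1) u2] cong_mult[OF cong_refl c2, of ?U] cong_trans by blast
    have c4: "[\<phi> ((u * u) * (u * u)) = (?U * ?U) * (?U * ?U)] (mod int ?q)"
      using homs_mult[OF h u2 u2] cong_mult[OF c2 c2] cong_trans by blast
    have "[\<phi> ((u * u) * (u * u)) = e3 * ?U + - e2 * \<phi> (u * u) + e1 * \<phi> (u * (u * u))] (mod int ?q)"
      unfolding rel by (rule homs_lc3[OF sg h m(1) u2 u3])
    moreover have "[e3 * ?U + - e2 * \<phi> (u * u) + e1 * \<phi> (u * (u * u)) = e3 * ?U + - e2 * (?U * ?U) + e1 * (?U * (?U * ?U))] (mod int ?q)"
      by (intro cong_add cong_mult cong_refl c2 c3)
    ultimately have "[(?U * ?U) * (?U * ?U) = e3 * ?U + - e2 * (?U * ?U) + e1 * (?U * (?U * ?U))] (mod int ?q)"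
      using c4 cong_sym cong_trans by blast
    hence "int ?q dvd (?U * ?U) * (?U * ?U) - (e3 * ?U + - e2 * (?U * ?U) + e1 * (?U * (?U * ?U)))"
      by (simp only: cong_iff_dvd_diff)
    also have "(?U * ?U) * (?U * ?U) - (e3 * ?U + - e2 * (?U * ?U) + e1 * (?U * (?U * ?U))) =
      (?U - 0) * (?U - u a) * ((?U - u b) * (?U - u c))"
      by (simp add: e1_def e2_def e3_def algebra_simps)
    finally have B: "?U \<in> ?B" using q(1) by blast
    have "[D * \<phi> (y * y) = \<alpha> * ?U + \<beta> * ?Y + \<gamma> * \<phi> z] (mod int ?q)"
      by (rule Dval[OF h subrng_mult[OF J(1) m(2) m(2)] yy])
    moreover have "[D * (?Y * ?Y) = D * \<phi> (y * y)] (mod int ?q)"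
      by (intro cong_mult cong_refl cong_sym[OF homs_mult[OF h m(2) m(2)]])
    moreover have "[\<alpha> * ?U + \<beta> * ?Y + \<gamma> * \<phi> z = \<alpha> * ?U + \<beta> * ?Y + \<gamma> * (if z = u * u then ?U * ?U else ?U * ?Y)] (mod int ?q)"
      by (intro cong_add cong_mult cong_refl zval[OF h])
    ultimately have "[D * (?Y * ?Y) = \<alpha> * ?U + \<beta> * ?Y + \<gamma> * (if z = u * u then ?U * ?U else ?U * ?Y)] (mod int ?q)"
      using cong_trans by blast
    hence "[E * (D * (?Y * ?Y)) = E * (\<alpha> * ?U + \<beta> * ?Y + \<gamma> * (if z = u * u then ?U * ?U else ?U * ?Y))] (mod int ?q)"
      by (intro cong_mult cong_refl)
    moreover have "E * (\<alpha> * ?U + \<beta> * ?Y + \<gamma> * (if z = u * u then ?U * ?U else ?U * ?Y)) = d ?U * ?Y + c' ?U"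
      by (simp add: d_def c'_def algebra_simps)
    moreover have "[(D * E) * (?Y * ?Y) = 1 * (?Y * ?Y)] (mod int ?q)" by (intro cong_mult cong_refl E)
    ultimately have "[?Y * ?Y = d ?U * ?Y + c' ?U] (mod int ?q)"
      using cong_sym cong_trans by (metis (no_types, lifting) mult.assoc mult.commute mult_1)
    thus "(?U, ?Y) \<in> Sigma ?B ?C" using B q(2) by blast
  qed
  have "card (homs ?q J) \<le> card ?B * (2 * p ^ (k div 2))"
    by (rule card_Sigma_bound(2)[OF finite_int_range_filter finite_int_range_filter card_quadratic_solutions[OF p] inj sub])
  also have "\<dots> \<le> 4 * p ^ (3 * k div 4) * (2 * p ^ (k div 2))"
    by (intro mult_le_mono1 card_split_quartic_solutions p)
  finally show ?thesis .
qed

section \<open>Orders of the form Z + p B\<close>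

definition pdiv :: "nat \<Rightarrow> nat set \<Rightarrow> (nat \<Rightarrow> int) set \<Rightarrow> (nat \<Rightarrow> int) set" where
  "pdiv p S J = {x \<in> vecs S. sc (int p) x \<in> J}"

text \<open>Since (x / p) (y / p) = (x y / p) / p, products of elements of J lying in p J is what
  closes the divided lattice under multiplication.\<close>

lemma pdiv_subrng:
  assumes p: "p > 0" and J: "subrng J" and sq: "\<And>x y. x \<in> J \<Longrightarrow> y \<in> J \<Longrightarrow> x * y \<in> pmult p J"
  shows "subrng (pdiv p S J)"
  unfolding subrng_def add_subgroup_def
proof (intro conjI ballI)
  have sg: "add_subgroup J" using J by (rule subrng_add_subgroup)
  have "sc (int p) 0 = 0" by (simp add: fun_eq_iff)
  thus "0 \<in> pdiv p S J" using add_subgroup_0[OF sg] add_subgroup_0[OF vecs_add_subgroup] unfolding pdiv_def by simp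
  fix x y assume xy: "x \<in> pdiv p S J" "y \<in> pdiv p S J"
  hence v: "x \<in> vecs S" "y \<in> vecs S" and m: "sc (int p) x \<in> J" "sc (int p) y \<in> J" by (auto simp: pdiv_def)
  have "sc (int p) (x - y) = sc (int p) x - sc (int p) y" by (simp add: fun_eq_iff algebra_simps)
  hence "sc (int p) (x - y) \<in> J" using add_subgroup_diff[OF sg m] by (simp only:)
  thus "x - y \<in> pdiv p S J" unfolding pdiv_def using add_subgroup_diff[OF vecs_add_subgroup v] by blast
  obtain j where j: "j \<in> J" "sc (int p) x * sc (int p) y = sc (int p) j" using sq[OF m] unfolding pmult_def by blast
  have "j = sc (int p) (x * y)"
  proof
    fix i
    have "(sc (int p) x * sc (int p) y) i = sc (int p) j i" using j(2) by (rule fun_cong)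
    thus "j i = sc (int p) (x * y) i" using p by (simp add: mult.left_commute)
  qed
  hence "sc (int p) (x * y) \<in> J" using j(1) by (simp only:)
  thus "x * y \<in> pdiv p S J" unfolding pdiv_def using subrng_mult[OF vecs_subrng v] by blast
qed

text \<open>All values \<phi> x are divisible by p, because the square of \<phi> x is p times
  another value modulo \<open>p ^ k\<close>. Hence \<phi> (p y) / p defines a homomorphism on the
  divided lattice, but only modulo \<open>p ^ (k - 2)\<close>: multiplicativity is an identity
  between multiples of p^2. It determines \<phi> modulo \<open>p ^ (k - 1)\<close>, leaving p
  choices at each of three basis vectors.\<close>

lemma card_homs_pdiv:
  assumes p: "prime p" and k: "k \<ge> 2" and S: "finite S" and J: "subrng J" "J \<subseteq> vecs S"
    and B: "basis3 J v1 v2 v3" and dv: "\<And>x i. x \<in> J \<Longrightarrow> int p dvd x i"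
    and sq: "\<And>x y. x \<in> J \<Longrightarrow> y \<in> J \<Longrightarrow> x * y \<in> pmult p J"
  shows "card (homs (p ^ k) J) \<le> card (homs (p ^ (k - 2)) (pdiv p S J)) * p ^ 3"
proof -
  let ?q = "p ^ k" and ?r = "int (p ^ (k - 2))" and ?J = "pdiv p S J" and ?P = "int p"
  have p0: "p > 0" "?P > 0" using p prime_gt_0_nat by auto
  have q: "int ?q = ?P * (?P * ?r)"
  proof -
    obtain k' where "k = Suc (Suc k')" using k by (metis add_2_eq_Suc le_add_diff_inverse)
    thus ?thesis by simp
  qed
  have r0: "?r > 0" using p0 by simp
  have sg: "add_subgroup J" using J(1) by (rule subrng_add_subgroup)
  have J2: "subrng ?J" by (rule pdiv_subrng[OF p0(1) J(1) sq])
  have dvphi: "?P dvd \<phi> x" if h: "\<phi> \<in> homs ?q J" and x: "x \<in> J" for \<phi> x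
  proof -
    obtain j where j: "j \<in> J" "x * x = sc ?P j" using sq[OF x x] unfolding pmult_def by blast
    have "[\<phi> x * \<phi> x = \<phi> (sc ?P j)] (mod int ?q)" using homs_mult[OF h x x] unfolding j(2) by (rule cong_sym)
    hence "[\<phi> x * \<phi> x = ?P * \<phi> j] (mod int ?q)" using homs_sc[OF sg h j(1)] cong_trans by blast
    hence "int ?q dvd \<phi> x * \<phi> x - ?P * \<phi> j" by (simp only: cong_iff_dvd_diff)
    hence "?P dvd \<phi> x * \<phi> x - ?P * \<phi> j" unfolding q using dvd_mult_left by blast
    hence "?P dvd \<phi> x * \<phi> x" by (metis dvd_diff_right_iff dvd_triv_left diff_add_cancel dvd_add)
    thus ?thesis using p by (simp add: prime_dvd_mult_iff)
  qed
  define \<theta> where "\<theta> \<phi> y = \<phi> (sc ?P y) div ?P" for \<phi> :: "(nat \<Rightarrow> int) \<Rightarrow> int" and y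
  have \<theta>: "\<phi> (sc ?P y) = ?P * \<theta> \<phi> y" if "\<phi> \<in> homs ?q J" "y \<in> ?J" for \<phi> y
    using dvphi[OF that(1), of "sc ?P y"] that(2) by (simp add: \<theta>_def pdiv_def)
  define \<psi> where "\<psi> \<phi> = (\<lambda>y\<in>?J. \<theta> \<phi> y mod ?r)" for \<phi>
  define hf where "hf x = (\<lambda>i. x i div ?P)" for x :: "nat \<Rightarrow> int"
  have hf: "sc ?P (hf x) = x" "hf x \<in> ?J" if x: "x \<in> J" for x
  proof -
    show s: "sc ?P (hf x) = x" using dv[OF x] by (simp add: hf_def fun_eq_iff)
    have "hf x \<in> vecs S" using vecs_zero[OF J(2) x] by (simp add: hf_def vecs_def)
    thus "hf x \<in> ?J" unfolding pdiv_def using s x by simp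
  qed
  have im: "\<psi> \<phi> \<in> homs (p ^ (k - 2)) ?J" if h: "\<phi> \<in> homs ?q J" for \<phi>
  proof -
    have "\<psi> \<phi> \<in> ?J \<rightarrow>\<^sub>E {0..<?r}" using r0 by (simp add: \<psi>_def del: of_nat_power)
    moreover have "[\<psi> \<phi> (x + y) = \<psi> \<phi> x + \<psi> \<phi> y] (mod ?r) \<and> [\<psi> \<phi> (x * y) = \<psi> \<phi> x * \<psi> \<phi> y] (mod ?r)"
      if x: "x \<in> ?J" and y: "y \<in> ?J" for x y
    proof -
      have xy: "x + y \<in> ?J" "x * y \<in> ?J"
        using subrng_mult[OF J2 x y] add_subgroup_add[OF subrng_add_subgroup[OF J2] x y] by auto
      have m: "sc ?P x \<in> J" "sc ?P y \<in> J" "sc ?P (x * y) \<in> J" using x y xy(2) by (auto simp: pdiv_def)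
      have "sc ?P (x + y) = sc ?P x + sc ?P y" by (simp add: fun_eq_iff algebra_simps)
      hence "[\<phi> (sc ?P (x + y)) = \<phi> (sc ?P x) + \<phi> (sc ?P y)] (mod int ?q)" using homs_add[OF h m(1,2)] by (simp only:)
      hence "int ?q dvd ?P * \<theta> \<phi> (x + y) - (?P * \<theta> \<phi> x + ?P * \<theta> \<phi> y)"
        by (simp only: \<theta>[OF h x] \<theta>[OF h y] \<theta>[OF h xy(1)] cong_iff_dvd_diff)
      hence "?P * (?P * ?r) dvd ?P * (\<theta> \<phi> (x + y) - (\<theta> \<phi> x + \<theta> \<phi> y))" unfolding q by (simp only: right_diff_distrib distrib_left)
      hence "?P * ?r dvd \<theta> \<phi> (x + y) - (\<theta> \<phi> x + \<theta> \<phi> y)" using p0 by (simp del: of_nat_power)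
      hence "?r dvd \<theta> \<phi> (x + y) - (\<theta> \<phi> x + \<theta> \<phi> y)" by (rule dvd_mult_right)
      hence 1: "\<theta> \<phi> (x + y) mod ?r = (\<theta> \<phi> x + \<theta> \<phi> y) mod ?r" by (simp only: mod_eq_dvd_iff)
      have "sc ?P x * sc ?P y = sc ?P (sc ?P (x * y))" by (simp add: fun_eq_iff)
      hence "[\<phi> (sc ?P (sc ?P (x * y))) = \<phi> (sc ?P x) * \<phi> (sc ?P y)] (mod int ?q)" using homs_mult[OF h m(1,2)] by (simp only:)
      moreover have "[\<phi> (sc ?P (sc ?P (x * y))) = ?P * \<phi> (sc ?P (x * y))] (mod int ?q)" by (rule homs_sc[OF sg h m(3)])
      ultimately have "[?P * \<phi> (sc ?P (x * y)) = \<phi> (sc ?P x) * \<phi> (sc ?P y)] (mod int ?q)" using cong_sym cong_trans by blast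
      hence "int ?q dvd ?P * (?P * \<theta> \<phi> (x * y)) - (?P * \<theta> \<phi> x) * (?P * \<theta> \<phi> y)"
        by (simp only: \<theta>[OF h x] \<theta>[OF h y] \<theta>[OF h xy(2)] cong_iff_dvd_diff)
      also have "?P * (?P * \<theta> \<phi> (x * y)) - (?P * \<theta> \<phi> x) * (?P * \<theta> \<phi> y) = ?P * (?P * (\<theta> \<phi> (x * y) - \<theta> \<phi> x * \<theta> \<phi> y))"
        by (simp add: algebra_simps)
      finally have "?P * (?P * ?r) dvd ?P * (?P * (\<theta> \<phi> (x * y) - \<theta> \<phi> x * \<theta> \<phi> y))" unfolding q .
      hence "?r dvd \<theta> \<phi> (x * y) - \<theta> \<phi> x * \<theta> \<phi> y" using p0 by (simp del: of_nat_power)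
      hence 2: "\<theta> \<phi> (x * y) mod ?r = (\<theta> \<phi> x * \<theta> \<phi> y) mod ?r" by (simp only: mod_eq_dvd_iff)
      have v: "\<psi> \<phi> x = \<theta> \<phi> x mod ?r" "\<psi> \<phi> y = \<theta> \<phi> y mod ?r" "\<psi> \<phi> (x + y) = \<theta> \<phi> (x + y) mod ?r" "\<psi> \<phi> (x * y) = \<theta> \<phi> (x * y) mod ?r"
        unfolding \<psi>_def using x y xy by (simp_all only: restrict_apply')
      show ?thesis unfolding v Cong.cong_def 1 2 by (simp only: mod_mod_trivial mod_add_eq mod_mult_eq simp_thms)
    qed
    ultimately show ?thesis unfolding homs_def by blast
  qed
  let ?t = "\<lambda>\<phi> v. \<phi> v div (?P * ?r)"
  let ?g = "\<lambda>\<phi>. (\<psi> \<phi>, ?t \<phi> v1, ?t \<phi> v2, ?t \<phi> v3)"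
  have val: "\<phi> v = ?P * (\<psi> \<phi> (hf v) + ?r * ?t \<phi> v)" if h: "\<phi> \<in> homs ?q J" and v: "v \<in> J" for \<phi> v
  proof -
    have "\<phi> v = ?P * \<theta> \<phi> (hf v)" using \<theta>[OF h hf(2)[OF v]] hf(1)[OF v] by simp
    moreover have "?t \<phi> v = \<phi> v div ?P div ?r" using r0 by (simp add: zdiv_zmult2_eq)
    moreover have "\<phi> v div ?P = \<theta> \<phi> (hf v)" unfolding \<theta>_def using hf(1)[OF v] by simp
    moreover have "\<psi> \<phi> (hf v) = \<theta> \<phi> (hf v) mod ?r" unfolding \<psi>_def using hf(2)[OF v] by (simp only: restrict_apply')
    ultimately show ?thesis by (simp only: mod_mult_div_eq)
  qed
  note vJ = basis3_mem[OF B]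
  have inj: "inj_on ?g (homs ?q J)"
  proof (rule inj_onI)
    fix \<phi> \<phi>' assume h: "\<phi> \<in> homs ?q J" "\<phi>' \<in> homs ?q J" and e: "?g \<phi> = ?g \<phi>'"
    have e': "\<psi> \<phi> = \<psi> \<phi>'" "?t \<phi> v1 = ?t \<phi>' v1" "?t \<phi> v2 = ?t \<phi>' v2" "?t \<phi> v3 = ?t \<phi>' v3"
      using e by (simp_all only: prod.inject)
    have ev: "\<phi> v1 = \<phi>' v1" "\<phi> v2 = \<phi>' v2" "\<phi> v3 = \<phi>' v3"
      using val[OF h(1) vJ(1)] val[OF h(2) vJ(1)] val[OF h(1) vJ(2)] val[OF h(2) vJ(2)]
        val[OF h(1) vJ(3)] val[OF h(2) vJ(3)] e' by metis+
    show "\<phi> = \<phi>'"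
    proof (rule homs_eqI[OF h])
      fix x assume x: "x \<in> J"
      obtain a b c where xx: "x = lc3 v1 v2 v3 a b c" using basis3_span[OF B x] by blast
      show "[\<phi> x = \<phi>' x] (mod int ?q)" unfolding xx
        using homs_lc3[OF sg h(1) vJ] homs_lc3[OF sg h(2) vJ] ev cong_sym cong_trans by metis
    qed
  qed
  have sub: "?g ` homs ?q J \<subseteq> Sigma (homs (p ^ (k - 2)) ?J) (\<lambda>_. {0..<?P} \<times> {0..<?P} \<times> {0..<?P})"
  proof (rule image_subsetI)
    fix \<phi> assume h: "\<phi> \<in> homs ?q J"
    have "?t \<phi> v \<in> {0..<?P}" if "v \<in> J" for v
      by (rule int_div_in_range) (use homs_range[OF h that] q p0 r0 in \<open>simp_all add: mult.commute del: of_nat_power\<close>)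
    thus "?g \<phi> \<in> Sigma (homs (p ^ (k - 2)) ?J) (\<lambda>_. {0..<?P} \<times> {0..<?P} \<times> {0..<?P})"
      using im[OF h] vJ by blast
  qed
  have fin: "finite (homs (p ^ (k - 2)) ?J)"
    using card_homs_le[OF p S J2, of "k - 2"] by (auto simp: pdiv_def)
  show ?thesis
    by (rule card_Sigma_bound(2)[OF fin _ _ inj sub]) (simp_all add: card_cartesian_product power3_eq_cube)
qed

text \<open>If \<open>A = \<int> + p B\<close> for an order \<open>B\<close>, then \<open>undiv p I l A = B\<close>; the set is defined for every \<open>A\<close>.\<close>

definition undiv :: "nat \<Rightarrow> nat set \<Rightarrow> nat \<Rightarrow> (nat \<Rightarrow> int) set \<Rightarrow> (nat \<Rightarrow> int) set" where
  "undiv p I l A = {x \<in> vecs I. x - sc (x l) (indicator I) \<in> pdiv p (I - {l}) (A \<inter> vecs (I - {l}))}"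

lemma suborder_undiv:
  assumes A: "suborder I A" and l: "l \<in> I" and p: "p > 0"
    and sq: "\<And>x y. x \<in> A \<inter> vecs (I - {l}) \<Longrightarrow> y \<in> A \<inter> vecs (I - {l}) \<Longrightarrow> x * y \<in> pmult p (A \<inter> vecs (I - {l}))"
  shows "suborder I (undiv p I l A)"
  unfolding suborder_def subrng_def add_subgroup_def
proof (intro conjI ballI)
  let ?J = "A \<inter> vecs (I - {l})" and ?o = "indicator I :: nat \<Rightarrow> int"
  let ?D = "pdiv p (I - {l}) ?J"
  have J: "subrng ?J" by (intro subrng_Int suborder_subrng[OF A] vecs_subrng)
  have D: "subrng ?D" by (rule pdiv_subrng[OF p J sq])
  note sg = subrng_add_subgroup[OF D]
  show "undiv p I l A \<subseteq> vecs I" by (auto simp: undiv_def)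
  have "(0 :: nat \<Rightarrow> int) - sc (0 l) ?o = 0" by (simp add: fun_eq_iff)
  thus "0 \<in> undiv p I l A" unfolding undiv_def
    using add_subgroup_0[OF sg] add_subgroup_0[OF vecs_add_subgroup] by (simp only: mem_Collect_eq simp_thms)
  have "?o - sc (?o l) ?o = 0" using l by (simp add: fun_eq_iff)
  moreover have "?o \<in> vecs I" by (simp add: vecs_def)
  ultimately show "?o \<in> undiv p I l A" unfolding undiv_def
    using add_subgroup_0[OF sg] by (simp only: mem_Collect_eq simp_thms)
  fix x y assume "x \<in> undiv p I l A" "y \<in> undiv p I l A"
  hence v: "x \<in> vecs I" "y \<in> vecs I" and x: "x - sc (x l) ?o \<in> ?D" and y: "y - sc (y l) ?o \<in> ?D"
    by (simp_all only: undiv_def mem_Collect_eq)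
  have "(x - y) - sc ((x - y) l) ?o = (x - sc (x l) ?o) - (y - sc (y l) ?o)" by (simp add: fun_eq_iff algebra_simps)
  hence "(x - y) - sc ((x - y) l) ?o \<in> ?D" using add_subgroup_diff[OF sg x y] by (simp only:)
  thus "x - y \<in> undiv p I l A" unfolding undiv_def using add_subgroup_diff[OF vecs_add_subgroup v] by blast
  have "(x * y) - sc ((x * y) l) ?o =
      sc (x l) (y - sc (y l) ?o) + sc (y l) (x - sc (x l) ?o) + (x - sc (x l) ?o) * (y - sc (y l) ?o)"
  proof
    fix i show "((x * y) - sc ((x * y) l) ?o) i =
      (sc (x l) (y - sc (y l) ?o) + sc (y l) (x - sc (x l) ?o) + (x - sc (x l) ?o) * (y - sc (y l) ?o)) i"
      using v by (cases "i \<in> I") (simp_all add: vecs_def algebra_simps)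
  qed
  moreover have "sc (x l) (y - sc (y l) ?o) + sc (y l) (x - sc (x l) ?o) + (x - sc (x l) ?o) * (y - sc (y l) ?o) \<in> ?D"
    by (intro add_subgroup_add[OF sg] add_subgroup_sc[OF sg] subrng_mult[OF D] x y)
  ultimately have "(x * y) - sc ((x * y) l) ?o \<in> ?D" by (simp only:)
  thus "x * y \<in> undiv p I l A" unfolding undiv_def using subrng_mult[OF vecs_subrng v] by blast
qed

lemma undiv_Int: "l \<in> I \<Longrightarrow> undiv p I l A \<inter> vecs (I - {l}) = pdiv p (I - {l}) (A \<inter> vecs (I - {l}))"
proof -
  assume l: "l \<in> I"
  have e: "x - sc (x l) (indicator I) = x" if "x \<in> vecs (I - {l})" for x
    using that by (simp add: fun_eq_iff vecs_def)
  have "x \<in> vecs I" if "x \<in> vecs (I - {l})" for x using that by (auto simp: vecs_def)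
  thus ?thesis unfolding undiv_def using e by (auto simp: pdiv_def)
qed

lemma card_resid_pdiv:
  assumes p: "p > 0" and dv: "\<And>x i. x \<in> J \<Longrightarrow> int p dvd x i" and J: "J \<subseteq> vecs S"
  shows "card (resid (p ^ Suc K) J) = card (resid (p ^ K) (pdiv p S J))"
proof -
  have "bij_betw (sc (int p)) (resid (p ^ K) (pdiv p S J)) (resid (p ^ Suc K) J)"
  proof (rule bij_betw_byWitness[where f' = "\<lambda>x i. x i div int p"])
    show "\<forall>a\<in>resid (p ^ K) (pdiv p S J). (\<lambda>i. sc (int p) a i div int p) = a" using p by (simp add: fun_eq_iff)
    have s: "sc (int p) (\<lambda>i. x i div int p) = x" if "x \<in> J" for x using dv[OF that] by (simp add: fun_eq_iff)
    thus "\<forall>a'\<in>resid (p ^ Suc K) J. sc (int p) (\<lambda>i. a' i div int p) = a'" by (simp only: resid_def mem_Collect_eq) blast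
    show "sc (int p) ` resid (p ^ K) (pdiv p S J) \<subseteq> resid (p ^ Suc K) J"
    proof (rule image_subsetI)
      fix x assume x: "x \<in> resid (p ^ K) (pdiv p S J)"
      hence "sc (int p) x \<in> J" by (simp only: resid_def pdiv_def mem_Collect_eq)
      moreover have "0 \<le> int p * x i \<and> int p * x i < int (p ^ Suc K)" for i
        using x p by (simp add: resid_def)
      ultimately show "sc (int p) x \<in> resid (p ^ Suc K) J" unfolding resid_def sc_apply[symmetric] by blast
    qed
    show "(\<lambda>x i. x i div int p) ` resid (p ^ Suc K) J \<subseteq> resid (p ^ K) (pdiv p S J)"
    proof (rule image_subsetI)
      fix x assume x: "x \<in> resid (p ^ Suc K) J"
      hence xJ: "x \<in> J" by (simp only: resid_def mem_Collect_eq)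
      have "(\<lambda>i. x i div int p) \<in> vecs S" using vecs_zero[OF J xJ] by (simp add: vecs_def)
      hence "(\<lambda>i. x i div int p) \<in> pdiv p S J" unfolding pdiv_def using s[OF xJ] xJ by (simp only: mem_Collect_eq simp_thms)
      moreover have "x i div int p \<in> {0..<int (p ^ K)}" for i
        by (rule int_div_in_range) (use x p in \<open>simp_all add: resid_def\<close>)
      ultimately show "(\<lambda>i. x i div int p) \<in> resid (p ^ K) (pdiv p S J)" unfolding resid_def by (simp only: mem_Collect_eq atLeastLessThan_iff simp_thms)
    qed
  qed
  from bij_betw_same_card[OF this] show ?thesis by simp
qed

text \<open>Passing from Z + p B to B divides a lattice of rank \<open>card I - 1\<close> by p and
  hence the index by \<open>p ^ (card I - 1)\<close>.\<close>

lemma pidx_undiv: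
  assumes p: "prime p" and I: "finite I" and A: "suborder I A" "pidx p I A j" and l: "l \<in> I"
    and dv: "\<And>x i. x \<in> A \<inter> vecs (I - {l}) \<Longrightarrow> int p dvd x i"
    and sq: "\<And>x y. x \<in> A \<inter> vecs (I - {l}) \<Longrightarrow> y \<in> A \<inter> vecs (I - {l}) \<Longrightarrow> x * y \<in> pmult p (A \<inter> vecs (I - {l}))"
  shows "card I - 1 \<le> j" "pidx p I (undiv p I l A) (j - (card I - 1))"
proof -
  let ?J = "A \<inter> vecs (I - {l})" and ?U = "undiv p I l A" and ?n = "card I"
  have p0: "p > 0" "p > 1" using p prime_gt_0_nat prime_gt_1_nat by auto
  have n: "?n \<ge> 1" using I l by (metis card_gt_0_iff empty_iff Suc_leI One_nat_def)
  have U: "suborder I ?U" by (rule suborder_undiv[OF A(1) l p0(1) sq])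
  have AU: "A \<subseteq> ?U"
  proof
    fix x assume x: "x \<in> A"
    have s: "x - sc (x l) (indicator I) \<in> ?J" by (rule shift_mem[OF A(1) l x])
    have "subrng ?J" by (intro subrng_Int suborder_subrng[OF A(1)] vecs_subrng)
    hence "sc (int p) (x - sc (x l) (indicator I)) \<in> ?J" using add_subgroup_sc[OF subrng_add_subgroup s] by blast
    hence "x - sc (x l) (indicator I) \<in> pdiv p (I - {l}) ?J" unfolding pdiv_def using s by (simp only: mem_Collect_eq Int_iff simp_thms)
    thus "x \<in> ?U" unfolding undiv_def using x suborder_vecs[OF A(1)] by blast
  qed
  obtain K0 where K0: "\<And>K. K \<ge> K0 \<Longrightarrow> full (p ^ K) I A \<and> card (resid (p ^ K) A) * p ^ j = p ^ (K * ?n)"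
    using A(2) unfolding pidx_def by blast
  have fU: "full (p ^ K) I ?U" if "K \<ge> K0" for K using K0[OF that] AU unfolding full_def by blast
  have key: "card (resid (p ^ K) ?U) * p ^ j = p ^ (K * ?n) * p ^ (?n - 1)" if K: "K \<ge> K0" for K
  proof -
    have "card (resid (p ^ Suc K) A) = p ^ Suc K * card (resid (p ^ Suc K) ?J)"
      by (rule card_resid_shift[OF A(1) _ _ l]) (use K0[of "Suc K"] K p0 in auto)
    also have "card (resid (p ^ Suc K) ?J) = card (resid (p ^ K) (pdiv p (I - {l}) ?J))"
      by (rule card_resid_pdiv[OF p0(1)], erule dv) auto
    also have "pdiv p (I - {l}) ?J = ?U \<inter> vecs (I - {l})" by (rule undiv_Int[OF l, symmetric])
    also have "p ^ Suc K * card (resid (p ^ K) (?U \<inter> vecs (I - {l}))) = p * card (resid (p ^ K) ?U)"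
      using card_resid_shift[OF U _ fU[OF K] l] p0 by simp
    finally have "p * card (resid (p ^ K) ?U) * p ^ j = p ^ (Suc K * ?n)" using K0[of "Suc K"] K by simp
    also have "Suc K * ?n = Suc (K * ?n + (?n - 1))" using n by simp
    finally have "p * (card (resid (p ^ K) ?U) * p ^ j) = p * (p ^ (K * ?n) * p ^ (?n - 1))"
      by (simp only: power_Suc power_add mult.assoc)
    thus ?thesis using p0 by simp
  qed
  show j: "?n - 1 \<le> j"
  proof -
    have "resid (p ^ K0) ?U \<subseteq> resid (p ^ K0) (vecs I)" using suborder_vecs[OF U] by (auto simp: resid_def)
    moreover have "finite (resid (p ^ K0) (vecs I)) \<and> card (resid (p ^ K0) (vecs I)) = (p ^ K0) ^ ?n"
      using I p0 by (intro card_resid_vecs) auto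
    ultimately have "card (resid (p ^ K0) ?U) \<le> p ^ (K0 * ?n)" using card_mono by (metis power_mult)
    hence "p ^ (K0 * ?n) * p ^ (?n - 1) \<le> p ^ (K0 * ?n) * p ^ j" using key[of K0] by (metis order_refl mult_le_mono1)
    hence "p ^ (?n - 1) \<le> p ^ j" using p0 by simp
    thus ?thesis using power_le_imp_le_exp[OF p0(2)] by blast
  qed
  show "pidx p I ?U (j - (?n - 1))" unfolding pidx_def
  proof (intro exI[of _ K0] allI impI conjI)
    fix K assume K: "K0 \<le> K"
    show "full (p ^ K) I ?U" by (rule fU[OF K])
    have "p ^ j = p ^ (j - (?n - 1)) * p ^ (?n - 1)" using j by (simp add: power_add[symmetric])
    hence "(card (resid (p ^ K) ?U) * p ^ (j - (?n - 1))) * p ^ (?n - 1) = p ^ (K * ?n) * p ^ (?n - 1)"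
      using key[OF K] by (simp only: mult.assoc)
    thus "card (resid (p ^ K) ?U) * p ^ (j - (?n - 1)) = p ^ (K * ?n)" using p0 by simp
  qed
qed

text \<open>Together the two conditions say that A = Z + p B for an order B: the first makes the
  elements of A vanishing at l integrally divisible by p, the second closes their quotients under
  multiplication.\<close>

definition special :: "nat \<Rightarrow> nat set \<Rightarrow> nat \<Rightarrow> (nat \<Rightarrow> int) set \<Rightarrow> bool" where
  "special p I l A \<longleftrightarrow> (\<forall>x\<in>A \<inter> vecs (I - {l}). \<forall>i. int p dvd x i) \<and>
     (\<forall>x\<in>A \<inter> vecs (I - {l}). \<forall>y\<in>A \<inter> vecs (I - {l}). x * y \<in> pmult p (A \<inter> vecs (I - {l})))"

lemma undiv_inj:
  assumes A: "suborder I A" "special p I l A" and B: "suborder I B"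
    and l: "l \<in> I" and e: "undiv p I l A \<subseteq> undiv p I l B"
  shows "A \<subseteq> B"
proof
  fix x assume x: "x \<in> A"
  let ?y = "x - sc (x l) (indicator I)"
  have y: "?y \<in> A \<inter> vecs (I - {l})" by (rule shift_mem[OF A(1) l x])
  define h where "h = (\<lambda>i. ?y i div int p)"
  have "int p dvd ?y i" for i using A(2) y unfolding special_def by blast
  hence h: "sc (int p) h = ?y" unfolding h_def by (intro ext) (simp only: sc_apply dvd_mult_div_cancel)
  have "h \<in> vecs (I - {l})" unfolding h_def by (rule vecs_div) (use y in blast)
  hence "h \<in> pdiv p (I - {l}) (A \<inter> vecs (I - {l}))" unfolding pdiv_def using y h by (simp only: mem_Collect_eq simp_thms)
  hence "h \<in> pdiv p (I - {l}) (B \<inter> vecs (I - {l}))" using e undiv_Int[OF l, of p A] undiv_Int[OF l, of p B] by blast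
  hence "sc (int p) h \<in> B" unfolding pdiv_def by blast
  hence "?y + sc (x l) (indicator I) \<in> B" unfolding h
    by (intro add_subgroup_add[OF suborder_add_subgroup[OF B]] add_subgroup_sc[OF suborder_add_subgroup[OF B]] suborder_one[OF B])
  thus "x \<in> B" by (simp only: diff_add_cancel)
qed

text \<open>If two coordinates can differ modulo p, there is an idempotent. Otherwise every element
  of J has all coordinates divisible by p, so J is nilpotent modulo p J. A nonzero product on J / p
  J then gives two generators, a zero product gives the form Z + p B.\<close>

lemma hom_count_dichotomy:
  assumes p: "prime p" and I: "finite I" "card I = 4" and l: "l \<in> I" and A: "suborder I A" "pidx p I A j"
  shows "card (homs (p ^ k) (A \<inter> vecs (I - {l}))) \<le> 8 * p ^ (k div 2 + 3 * k div 4) \<or>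
    (2 \<le> k \<and> special p I l A \<and>
     card (homs (p ^ k) (A \<inter> vecs (I - {l}))) \<le> p ^ 3 * card (homs (p ^ (k - 2)) (undiv p I l A \<inter> vecs (I - {l}))))"
proof -
  let ?J = "A \<inter> vecs (I - {l})" and ?S = "I - {l}"
  have p0: "p > 0" using p prime_gt_0_nat by blast
  have J: "subrng ?J" by (intro subrng_Int suborder_subrng[OF A(1)] vecs_subrng)
  note sg = subrng_add_subgroup[OF J]
  have S: "finite ?S" "card ?S = 3" using I l by auto
  obtain K where K: "full (p ^ K) I A" using A(2) unfolding pidx_def by blast
  show ?thesis
  proof (cases "\<exists>x\<in>A. \<exists>a\<in>I. \<exists>b\<in>I. \<not> [x a = x b] (mod int p)")
    case True
    then obtain x a b where xab: "x \<in> A" "a \<in> I" "b \<in> I" "\<not> [x a = x b] (mod int p)" by blast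
    obtain T0 where T0: "T0 \<subseteq> I" "a \<in> T0" "b \<notin> T0" "indicator T0 \<in> A"
      by (rule idempotent_exists[OF p A(1) K xab])
    have "\<exists>T. T \<subseteq> ?S \<and> T \<noteq> {} \<and> indicator T \<in> A"
    proof (cases "l \<in> T0")
      case False thus ?thesis using T0 by blast
    next
      case True
      \<comment> \<open>Homomorphisms are counted on the elements vanishing at l, so an idempotent
        containing l is replaced by its complement.\<close>
      have "indicator (I - T0) = indicator I - (indicator T0 :: nat \<Rightarrow> int)"
        using T0(1) by (auto simp: fun_eq_iff indicator_def)
      hence "indicator (I - T0) \<in> A"
        using add_subgroup_diff[OF suborder_add_subgroup[OF A(1)] suborder_one[OF A(1)] T0(4)] by (simp only:)
      moreover have "I - T0 \<subseteq> ?S" using True by blast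
      moreover have "I - T0 \<noteq> {}" using xab(3) T0(3) by blast
      ultimately show ?thesis by blast
    qed
    then obtain T where T: "T \<subseteq> ?S" "T \<noteq> {}" "indicator T \<in> A" by blast
    let ?b = "2 * p ^ (k div 2)"
    have b: "1 \<le> ?b" using p0 by (simp add: Suc_le_eq)
    have cT: "card T \<le> 3" "card T \<ge> 1" using card_mono[OF S(1) T(1)] S(2) T(2) finite_subset[OF T(1) S(1)]
      by (auto simp: Suc_le_eq card_gt_0_iff)
    have cS: "card (?S - T) = 3 - card T" using card_Diff_subset[OF finite_subset[OF T(1) S(1)] T(1)] S(2) by simp
    have "card (homs (p ^ k) ?J) \<le> ?b ^ (card T - 1) + ?b ^ card (?S - T)"
      by (rule card_homs_idempotent[OF p I(1) A(1) l T])
    \<comment> \<open>T has between one and three elements, so neither part contributes more than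
      two factors, against three in the trivial bound.\<close>
    also have "\<dots> \<le> ?b ^ 2 + ?b ^ 2" using cT cS by (intro add_mono power_increasing[OF _ b]) auto
    also have "\<dots> = 8 * p ^ (k div 2 + k div 2)" by (simp add: power2_eq_square power_add)
    also have "\<dots> \<le> 8 * p ^ (k div 2 + 3 * k div 4)"
      using p0 by (intro mult_le_mono2 power_increasing) auto
    finally show ?thesis by blast
  next
    case False
    have dv: "int p dvd x i" if x: "x \<in> ?J" for x i
    proof (cases "i \<in> I")
      case True
      hence "[x i = x l] (mod int p)" using False x l by blast
      moreover have "x l = 0" using x by (simp add: vecs_def)
      ultimately show ?thesis by (simp add: cong_iff_dvd_diff)
    next
      case False
      hence "x i = 0" using x by (simp add: vecs_def)
      thus ?thesis by simp
    qed
    obtain a b c where abc: "?S = {a, b, c}" "a \<noteq> b" "a \<noteq> c" "b \<noteq> c" using S(2) unfolding card_3_iff by blast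
    have fJ: "full (p ^ K) {a, b, c} ?J" unfolding full_def abc(1)[symmetric]
    proof
      fix x assume x: "x \<in> vecs ?S"
      hence "x \<in> vecs I" by (auto simp: vecs_def)
      hence "sc (int (p ^ K)) x \<in> A" using K unfolding full_def by blast
      thus "sc (int (p ^ K)) x \<in> ?J" using add_subgroup_sc[OF vecs_add_subgroup x] by blast
    qed
    have Jv: "?J \<subseteq> vecs {a, b, c}" using abc(1) by auto
    obtain v1 v2 v3 where B: "basis3 ?J v1 v2 v3"
      by (rule basis3_exists[OF sg Jv abc(2-4) _ fJ]) (use p0 in simp)
    show ?thesis
    proof (cases "\<forall>x\<in>?J. \<forall>y\<in>?J. x * y \<in> pmult p ?J")
      case sq: True
      show ?thesis
      proof (cases "2 \<le> k")
        case True
        have "card (homs (p ^ k) ?J) \<le> card (homs (p ^ (k - 2)) (pdiv p ?S ?J)) * p ^ 3"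
          by (rule card_homs_pdiv[OF p True S(1) J _ B], blast, erule dv) (use sq in blast)
        hence "card (homs (p ^ k) ?J) \<le> p ^ 3 * card (homs (p ^ (k - 2)) (undiv p I l A \<inter> vecs ?S))"
          unfolding undiv_Int[OF l] by (simp only: mult.commute)
        moreover have "special p I l A" unfolding special_def using dv sq by blast
        ultimately show ?thesis using True by blast
      next
        case False
        \<comment> \<open>For k < 2 there is no room for the descent, but the trivial bound is
          already the constant 8.\<close>
        hence k: "k div 2 = 0" by simp
        have "card (homs (p ^ k) ?J) \<le> (2 * p ^ (k div 2)) ^ card ?S"
          using card_homs_le[OF p S(1) J, of k] by blast
        also have "\<dots> = 8" unfolding S(2) k by simp
        also have "\<dots> \<le> 8 * p ^ (k div 2 + 3 * k div 4)" using p0 by (simp add: Suc_le_eq)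
        finally show ?thesis by blast
      qed
    next
      case ns: False
      then obtain g h where gh: "g \<in> ?J" "h \<in> ?J" "g * h \<notin> pmult p ?J" by blast
      \<comment> \<open>The power with exponent K + 2 is divisible by the same power of p in every
        coordinate. One factor p is split off, and what remains is still divisible by
        \<open>p ^ K\<close>, hence in J by fullness.\<close>
      have nil: "\<exists>n. x ^ Suc n \<in> pmult p ?J" if x: "x \<in> ?J" for x
      proof -
        define y where "y = (\<lambda>i. (x ^ Suc (Suc K)) i div int p)"
        have pd: "int p ^ Suc (Suc K) dvd (x ^ Suc (Suc K)) i" for i
          unfolding power_fun_apply by (rule dvd_power_same[OF dv[OF x]])
        hence yd: "int p ^ Suc K dvd y i" for i
        proof -
          obtain t where "(x ^ Suc (Suc K)) i = int p ^ Suc (Suc K) * t" using pd[of i] by (elim dvdE)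
          hence "(x ^ Suc (Suc K)) i = int p * (int p ^ Suc K * t)" by (simp only: power_Suc mult.assoc)
          hence "y i = int p ^ Suc K * t" unfolding y_def using p0 by (simp del: power_Suc)
          thus ?thesis by simp
        qed
        have xv: "x ^ Suc (Suc K) \<in> ?J" by (rule subrng_pow[OF J x])
        have yv: "y \<in> vecs ?S" unfolding y_def by (rule vecs_div) (use xv in blast)
        have pK: "int (p ^ K) dvd y i" for i using yd[of i] dvd_mult_right by simp
        have "y \<in> vecs {a, b, c}" using yv by (simp only: abc(1))
        hence "y \<in> ?J" by (rule full_mem[OF fJ]) (rule pK)
        moreover have "x ^ Suc (Suc K) = sc (int p) y"
        proof
          fix i
          have "int p dvd (x ^ Suc (Suc K)) i" using pd[of i] unfolding power_Suc[of "int p"] by (rule dvd_mult_left)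
          thus "(x ^ Suc (Suc K)) i = sc (int p) y i" unfolding y_def by (simp only: sc_apply dvd_mult_div_cancel)
        qed
        ultimately have "x ^ Suc (Suc K) \<in> pmult p ?J" unfolding pmult_def by (intro image_eqI)
        thus ?thesis by blast
      qed
      obtain u y z where uyz: "u \<in> ?J" "y \<in> ?J" "z \<in> ?J" "z = u * u \<or> z = u * y" "indep3 p ?J u y z"
        by (rule indep3_exists[OF p J B nil gh])
      obtain D where D: "\<not> int p dvd D" "\<forall>x\<in>?J. \<exists>\<alpha> \<beta> \<gamma>. sc D x = lc3 u y z \<alpha> \<beta> \<gamma>"
        by (rule indep3_determinant[OF p sg B uyz(1-3,5)])
      have "card (homs (p ^ k) ?J) \<le> 4 * p ^ (3 * k div 4) * (2 * p ^ (k div 2))"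
        by (rule card_homs_two_generators[OF p J Jv uyz(1-4) D(1)]) (rule bspec[OF D(2)])
      also have "\<dots> = 8 * p ^ (k div 2 + 3 * k div 4)" by (simp add: power_add)
      finally show ?thesis by blast
    qed
  qed
qed

text \<open>The exceptional orders are carried injectively by \<open>undiv\<close> to orders of
  index \<open>p ^ (j - 3)\<close>, each with homomorphisms modulo \<open>p ^ (k - 2)\<close>. The
  recursion therefore closes for the sum over all orders of one index, although it does not for a
  single order.\<close>

lemma sum_homs_recursion:
  assumes p: "prime p" and I: "finite I" "card I = 4" and l: "l \<in> I" and fin: "\<And>j. finite (ords p I j)"
  defines "N \<equiv> \<lambda>k A. card (homs (p ^ k) (A \<inter> vecs (I - {l})))"
  shows "(\<Sum>A\<in>ords p I j. N k A) \<le> card (ords p I j) * (8 * p ^ (k div 2 + 3 * k div 4)) +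
    (if 2 \<le> k \<and> 3 \<le> j then p ^ 3 * (\<Sum>A\<in>ords p I (j - 3). N (k - 2) A) else 0)"
proof -
  let ?c = "8 * p ^ (k div 2 + 3 * k div 4)" and ?O = "ords p I j" and ?u = "undiv p I l"
  let ?B = "{A \<in> ?O. \<not> N k A \<le> ?c}"
  have B: "2 \<le> k" "3 \<le> j" "special p I l A" "?u A \<in> ords p I (j - 3)" "N k A \<le> p ^ 3 * N (k - 2) (?u A)" if A: "A \<in> ?B" for A
  proof -
    have s: "suborder I A" "pidx p I A j" "\<not> N k A \<le> ?c" using A by (auto simp: ords_def)
    from hom_count_dichotomy[OF p I l s(1,2), of k] s(3)
    have d: "2 \<le> k" "special p I l A" "N k A \<le> p ^ 3 * N (k - 2) (?u A)" unfolding N_def by blast+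
    thus "2 \<le> k" "special p I l A" "N k A \<le> p ^ 3 * N (k - 2) (?u A)" by blast+
    have dv: "int p dvd x i" if "x \<in> A \<inter> vecs (I - {l})" for x i using d(2) that unfolding special_def by blast
    have sq: "x * y \<in> pmult p (A \<inter> vecs (I - {l}))" if "x \<in> A \<inter> vecs (I - {l})" "y \<in> A \<inter> vecs (I - {l})" for x y
      using d(2) that unfolding special_def by blast
    have "card I - 1 \<le> j" "pidx p I (?u A) (j - (card I - 1))"
      by (rule pidx_undiv[OF p I(1) s(1,2) l]; (erule dv | rule sq); assumption?)+
    thus "3 \<le> j" "?u A \<in> ords p I (j - 3)"
      using suborder_undiv[OF s(1) l prime_gt_0_nat[OF p] sq] I(2) by (simp_all add: ords_def)
  qed
  have fB: "finite ?B" using fin by simp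
  have 0: "(\<Sum>A\<in>?O. N k A) = (\<Sum>A\<in>?O - ?B. N k A) + (\<Sum>A\<in>?B. N k A)"
    by (rule sum.subset_diff[OF _ fin]) blast
  have "(\<Sum>A\<in>?O - ?B. N k A) \<le> (\<Sum>A\<in>?O - ?B. ?c)" by (rule sum_mono) blast
  also have "\<dots> = card (?O - ?B) * ?c" by (simp only: sum_constant of_nat_id)
  also have "\<dots> \<le> card ?O * ?c" by (intro mult_le_mono1 card_mono fin Diff_subset)
  finally have 1: "(\<Sum>A\<in>?O - ?B. N k A) \<le> card ?O * ?c" .
  have 2: "(\<Sum>A\<in>?B. N k A) \<le> (if 2 \<le> k \<and> 3 \<le> j then p ^ 3 * (\<Sum>A\<in>ords p I (j - 3). N (k - 2) A) else 0)"
  proof (cases "?B = {}")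
    case True show ?thesis unfolding True by simp
  next
    case False
    hence kj: "2 \<le> k" "3 \<le> j" using B(1,2) by blast+
    have inj: "inj_on ?u ?B"
    proof (rule inj_onI)
      fix A A' assume a: "A \<in> ?B" "A' \<in> ?B" and e: "?u A = ?u A'"
      have s: "suborder I A" "suborder I A'" using a by (auto simp: ords_def)
      show "A = A'" using undiv_inj[OF s(1) B(3)[OF a(1)] s(2) l] undiv_inj[OF s(2) B(3)[OF a(2)] s(1) l] e by blast
    qed
    have "(\<Sum>A\<in>?B. N k A) \<le> (\<Sum>A\<in>?B. p ^ 3 * N (k - 2) (?u A))" by (rule sum_mono[OF B(5)])
    also have "\<dots> = p ^ 3 * (\<Sum>A\<in>?u ` ?B. N (k - 2) A)" by (simp add: sum.reindex[OF inj] sum_distrib_left)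
    also have "\<dots> \<le> p ^ 3 * (\<Sum>A\<in>ords p I (j - 3). N (k - 2) A)"
      using B(4) by (intro mult_le_mono2 sum_mono2 fin) auto
    finally show ?thesis using kj by simp
  qed
  show ?thesis unfolding 0 by (rule add_mono[OF 1 2])
qed

section \<open>Exponents of the local bounds\<close>

text \<open>The constant and the exponent depend on e but not on p, as the later sum over primes
  requires. Monotonicity of \<open>c\<close> lets a recursion replace e - k by e.\<close>

definition ords_bound :: "nat \<Rightarrow> (nat \<Rightarrow> nat) \<Rightarrow> (nat \<Rightarrow> nat) \<Rightarrow> bool" where
  "ords_bound n c E \<longleftrightarrow> mono c \<and> (\<forall>p I e. prime p \<longrightarrow> finite I \<longrightarrow> card I = n \<longrightarrow>
     finite (ords p I e) \<and> card (ords p I e) \<le> c e * p ^ E e)"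

lemma ords_bound_1: "ords_bound 1 (\<lambda>_. 1) (\<lambda>_. 0)"
  unfolding ords_bound_def
proof (intro conjI allI impI)
  fix p e :: nat and I :: "nat set" assume "prime p" "finite I" "card I = 1"
  then obtain i where I: "I = {i}" using card_1_singletonE by blast
  have "ords p I e \<subseteq> {vecs I}"
  proof
    fix A assume "A \<in> ords p I e"
    hence A: "suborder I A" by (simp add: ords_def)
    have "x \<in> A" if "x \<in> vecs I" for x
    proof -
      have "x = sc (x i) (indicator I)" using that I by (auto simp: vecs_def fun_eq_iff indicator_def)
      thus ?thesis using add_subgroup_sc[OF suborder_add_subgroup[OF A] suborder_one[OF A]] by metis
    qed
    thus "A \<in> {vecs I}" using suborder_vecs[OF A] by blast
  qed
  thus "finite (ords p I e)" "card (ords p I e) \<le> 1 * p ^ 0"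
    using finite_subset[of _ "{vecs I}"] card_mono[of "{vecs I}"] by auto
qed (simp add: mono_def)

text \<open>The recursion with the trivial count of homomorphisms. The constant collects
  \<open>Suc n\<close> coordinates, at most \<open>Suc e\<close> conductor exponents and the factors
  2 of n - 1 quadratic congruences.\<close>

lemma ords_bound_Suc:
  assumes b: "ords_bound n c E" and n: "n \<ge> 1"
    and F: "\<And>e k. k \<le> e \<Longrightarrow> Suc n * k \<le> 2 * e \<Longrightarrow> E (e - k) + (n - 1) * (k div 2) \<le> F e"
  shows "ords_bound (Suc n) (\<lambda>e. Suc n * (Suc e * (c e * 2 ^ (n - 1)))) F"
  unfolding ords_bound_def
proof (intro conjI allI impI)
  have mono: "mono c" using b by (simp add: ords_bound_def)
  show "mono (\<lambda>e. Suc n * (Suc e * (c e * 2 ^ (n - 1))))"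
    by (intro monoI mult_le_mono le_refl) (use mono in \<open>auto simp: mono_def\<close>)
  fix p e :: nat and I :: "nat set" assume p: "prime p" and I: "finite I" "card I = Suc n"
  have p0: "p > 0" using p prime_gt_0_nat by blast
  have ne: "I \<noteq> {}" using I by auto
  have I': "finite (I - {i})" "card (I - {i}) = n" "I - {i} \<noteq> {}" if "i \<in> I" for i
  proof -
    show f: "finite (I - {i})" "card (I - {i}) = n" using I that by auto
    show "I - {i} \<noteq> {}" using f(2) n by (metis card.empty not_one_le_zero)
  qed
  have fin: "finite (ords p (I - {i}) j)" if "i \<in> I" for i j
    using b p I'[OF that] unfolding ords_bound_def by blast
  have cd: "card (ords p (I - {i}) j) \<le> c j * p ^ E j" if "i \<in> I" for i j
    using b p I'[OF that] unfolding ords_bound_def by blast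
  have u: "finite (uhoms (p ^ k) (I - {i}) A)" "card (uhoms (p ^ k) (I - {i}) A) \<le> (2 * p ^ (k div 2)) ^ (n - 1)"
    if i: "i \<in> I" and A: "A \<in> ords p (I - {i}) j" for i A j k
  proof -
    have s: "suborder (I - {i}) A" using A by (simp add: ords_def)
    show "finite (uhoms (p ^ k) (I - {i}) A)" by (rule card_uhoms_le(1)[OF p s I'(1,3)[OF i]])
    show "card (uhoms (p ^ k) (I - {i}) A) \<le> (2 * p ^ (k div 2)) ^ (n - 1)"
      using card_uhoms_le(2)[OF p s I'(1,3)[OF i], of k] I'(2)[OF i] by (simp only:)
  qed
  show "finite (ords p I e)" by (rule ords_recursion(1)[OF p I(1) ne fin u(1)])
  let ?Q = "{k. k \<le> e \<and> card I * k \<le> 2 * e}"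
  have fQ: "finite ?Q" "card ?Q \<le> Suc e"
  proof -
    have "?Q \<subseteq> {..e}" by blast
    thus "finite ?Q" "card ?Q \<le> Suc e" using finite_subset[of ?Q "{..e}"] card_mono[of "{..e}" ?Q] by auto
  qed
  have "card (ords p I e) \<le> (\<Sum>i\<in>I. \<Sum>k\<in>?Q. \<Sum>A\<in>ords p (I - {i}) (e - k). card (uhoms (p ^ k) (I - {i}) A))"
    by (rule ords_recursion(2)[OF p I(1) ne fin u(1)])
  also have "\<dots> \<le> (\<Sum>i\<in>I. \<Sum>k\<in>?Q. c e * 2 ^ (n - 1) * p ^ F e)"
  proof (intro sum_mono)
    fix i k assume i: "i \<in> I" and k: "k \<in> ?Q"
    have "(\<Sum>A\<in>ords p (I - {i}) (e - k). card (uhoms (p ^ k) (I - {i}) A)) \<le> (\<Sum>A\<in>ords p (I - {i}) (e - k). (2 * p ^ (k div 2)) ^ (n - 1))"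
      by (intro sum_mono u(2) i)
    also have "\<dots> = card (ords p (I - {i}) (e - k)) * (2 * p ^ (k div 2)) ^ (n - 1)" by simp
    also have "\<dots> \<le> (c (e - k) * p ^ E (e - k)) * (2 * p ^ (k div 2)) ^ (n - 1)" by (intro mult_le_mono1 cd i)
    also have "(2 * p ^ (k div 2)) ^ (n - 1) = 2 ^ (n - 1) * p ^ ((n - 1) * (k div 2))"
      by (simp only: power_mult_distrib power_mult[symmetric] mult.commute[of "k div 2"])
    also have "c (e - k) * p ^ E (e - k) * (2 ^ (n - 1) * p ^ ((n - 1) * (k div 2))) =
        c (e - k) * 2 ^ (n - 1) * p ^ (E (e - k) + (n - 1) * (k div 2))" by (simp only: power_add ac_simps)
    also have "\<dots> \<le> c e * 2 ^ (n - 1) * p ^ F e"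
    proof (intro mult_le_mono)
      show "c (e - k) \<le> c e" using mono by (simp add: mono_def)
      show "p ^ (E (e - k) + (n - 1) * (k div 2)) \<le> p ^ F e"
        using k I(2) p0 by (intro power_increasing F) auto
    qed simp
    finally show "(\<Sum>A\<in>ords p (I - {i}) (e - k). card (uhoms (p ^ k) (I - {i}) A)) \<le> c e * 2 ^ (n - 1) * p ^ F e" .
  qed
  also have "\<dots> = Suc n * (card ?Q * (c e * 2 ^ (n - 1) * p ^ F e))" using I(2) by (simp only: sum_constant of_nat_id)
  also have "\<dots> \<le> Suc n * (Suc e * (c e * 2 ^ (n - 1) * p ^ F e))" by (intro mult_le_mono le_refl fQ(2))
  finally show "card (ords p I e) \<le> Suc n * (Suc e * (c e * 2 ^ (n - 1))) * p ^ F e" by (simp only: mult.assoc)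
qed

definition poly_bound :: "(nat \<Rightarrow> nat) \<Rightarrow> bool" where
  "poly_bound c \<longleftrightarrow> (\<exists>C r. \<forall>e. c e \<le> C * Suc e ^ r)"

lemma poly_bound_step: assumes "poly_bound c" shows "poly_bound (\<lambda>e. a * (Suc e * (c e * b)))"
proof -
  obtain C r where C: "\<And>e. c e \<le> C * Suc e ^ r" using assms unfolding poly_bound_def by blast
  have "a * (Suc e * (c e * b)) \<le> (a * b * C) * Suc e ^ Suc r" for e
  proof -
    have "a * (Suc e * (c e * b)) \<le> a * (Suc e * ((C * Suc e ^ r) * b))" by (intro mult_le_mono C le_refl)
    also have "\<dots> = (a * b * C) * Suc e ^ Suc r" by (simp only: power_Suc ac_simps)
    finally show ?thesis .
  qed
  thus ?thesis unfolding poly_bound_def by blast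
qed

text \<open>The exponent that the recursion produces from e div 3 in dimension three. It is at most
  2 j / 3, but the rounding is kept because it decides the small cases in dimension five.\<close>

definition E4 :: "nat \<Rightarrow> nat" where
  "E4 j = Max ((\<lambda>k. (j - k) div 3 + 2 * (k div 2)) ` {k. 2 * k \<le> j})"

lemma finite_E4_range: "finite {k. 2 * k \<le> (j::nat)}"
  by (rule finite_subset[of _ "{..j}"]) auto

lemma E4_ge: "2 * k \<le> j \<Longrightarrow> (j - k) div 3 + 2 * (k div 2) \<le> E4 j"
  unfolding E4_def using finite_E4_range by (intro Max_ge) auto

lemma E4_attained: obtains k where "2 * k \<le> j" "E4 j = (j - k) div 3 + 2 * (k div 2)"
proof -
  have "E4 j \<in> (\<lambda>k. (j - k) div 3 + 2 * (k div 2)) ` {k. 2 * k \<le> j}"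
    unfolding E4_def using finite_E4_range by (intro Max_in finite_imageI) (auto intro!: exI[of _ 0])
  thus ?thesis using that by blast
qed

lemma ords_bound_2: obtains c where "poly_bound c" "ords_bound 2 c (\<lambda>_. 0)"
proof -
  let ?c = "\<lambda>e. Suc 1 * (Suc e * (1 * 2 ^ (1 - 1)))"
  have "poly_bound (\<lambda>_. 1)" unfolding poly_bound_def by (intro exI[of _ 1] exI[of _ 0]) simp
  hence "poly_bound ?c" by (intro poly_bound_step)
  moreover have "ords_bound (Suc 1) ?c (\<lambda>_. 0)" by (rule ords_bound_Suc[OF ords_bound_1]) auto
  hence "ords_bound 2 ?c (\<lambda>_. 0)" by (simp only: Suc_1)
  ultimately show ?thesis by (rule that)
qed

lemma ords_bound_3: obtains c where "poly_bound c" "ords_bound 3 c (\<lambda>e. e div 3)"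
proof -
  obtain c where c: "poly_bound c" "ords_bound 2 c (\<lambda>_. 0)" by (rule ords_bound_2)
  let ?c = "\<lambda>e. Suc 2 * (Suc e * (c e * 2 ^ (2 - 1)))"
  have "ords_bound (Suc 2) ?c (\<lambda>e. e div 3)"
  proof (rule ords_bound_Suc[OF c(2)])
    fix e k :: nat assume "Suc 2 * k \<le> 2 * e"
    hence "3 * k \<le> 2 * e" by simp
    hence "k div 2 \<le> e div 3" by linarith
    thus "0 + (2 - 1) * (k div 2) \<le> e div 3" by simp
  qed simp
  moreover have "Suc 2 = (3::nat)" by simp
  ultimately have "ords_bound 3 ?c (\<lambda>e. e div 3)" by (simp only:)
  with poly_bound_step[OF c(1)] show ?thesis by (rule that)
qed

lemma ords_bound_4: obtains c where "poly_bound c" "ords_bound 4 c E4"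
proof -
  obtain c where c: "poly_bound c" "ords_bound 3 c (\<lambda>e. e div 3)" by (rule ords_bound_3)
  let ?c = "\<lambda>e. Suc 3 * (Suc e * (c e * 2 ^ (3 - 1)))"
  have "ords_bound (Suc 3) ?c E4"
  proof (rule ords_bound_Suc[OF c(2)])
    fix e k :: nat assume "Suc 3 * k \<le> 2 * e"
    hence "2 * k \<le> e" by simp
    from E4_ge[OF this] show "(e - k) div 3 + (3 - 1) * (k div 2) \<le> E4 e" by simp
  qed simp
  moreover have "Suc 3 = (4::nat)" by simp
  ultimately have "ords_bound 4 ?c E4" by (simp only:)
  with poly_bound_step[OF c(1)] show ?thesis by (rule that)
qed

text \<open>The recursion unrolled: after a descents the pair (j, k) has become (j - 3 a, k - 2 a)
  and a factor \<open>p ^ (3 * a)\<close> has accumulated. T dominates the exponents of all stages,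
  of which there are at most \<open>Suc k\<close>.\<close>

lemma sum_homs_bound:
  assumes p: "prime p" and I: "finite I" "card I = 4" and l: "l \<in> I" and b: "ords_bound 4 c E4"
    and T: "\<And>a. 2 * a \<le> k \<Longrightarrow> 3 * a \<le> j \<Longrightarrow> 3 * a + E4 (j - 3 * a) + ((k - 2 * a) div 2 + 3 * (k - 2 * a) div 4) \<le> T"
  shows "(\<Sum>A\<in>ords p I j. card (homs (p ^ k) (A \<inter> vecs (I - {l})))) \<le> Suc k * (8 * c j * p ^ T)"
  using T
proof (induction k arbitrary: j T rule: less_induct)
  case (less k)
  let ?S = "\<lambda>j k. \<Sum>A\<in>ords p I j. card (homs (p ^ k) (A \<inter> vecs (I - {l})))"
  have p0: "p > 0" using p prime_gt_0_nat by blast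
  have fin: "finite (ords p I j)" for j using b p I unfolding ords_bound_def by blast
  have cd: "card (ords p I j) \<le> c j * p ^ E4 j" using b p I unfolding ords_bound_def by blast
  have mono: "c (j - 3) \<le> c j" using b unfolding ords_bound_def by (simp add: mono_def)
  have T0: "E4 j + (k div 2 + 3 * k div 4) \<le> T" using less.prems[of 0] by simp
  have "card (ords p I j) * (8 * p ^ (k div 2 + 3 * k div 4)) \<le> (c j * p ^ E4 j) * (8 * p ^ (k div 2 + 3 * k div 4))"
    by (rule mult_le_mono1[OF cd])
  also have "\<dots> = 8 * c j * p ^ (E4 j + (k div 2 + 3 * k div 4))" by (simp only: power_add ac_simps)
  also have "\<dots> \<le> 8 * c j * p ^ T" using p0 T0 by (intro mult_le_mono2 power_increasing) auto
  finally have 1: "card (ords p I j) * (8 * p ^ (k div 2 + 3 * k div 4)) \<le> 8 * c j * p ^ T" .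
  have 2: "(if 2 \<le> k \<and> 3 \<le> j then p ^ 3 * ?S (j - 3) (k - 2) else 0) \<le> k * (8 * c j * p ^ T)"
  proof (cases "2 \<le> k \<and> 3 \<le> j")
    case True
    \<comment> \<open>The stage a = 1 is admissible here, so the natural subtraction T - 3 below is
      exact.\<close>
    have T3: "3 \<le> T" using less.prems[of 1] True by simp
    have "?S (j - 3) (k - 2) \<le> Suc (k - 2) * (8 * c (j - 3) * p ^ (T - 3))"
    proof (rule less.IH)
      show "k - 2 < k" using True by simp
      fix a assume a: "2 * a \<le> k - 2" "3 * a \<le> j - 3"
      have "3 * (a + 1) + E4 (j - 3 * (a + 1)) + ((k - 2 * (a + 1)) div 2 + 3 * (k - 2 * (a + 1)) div 4) \<le> T"
        by (rule less.prems) (use a True in auto)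
      moreover have "j - 3 * (a + 1) = j - 3 - 3 * a" "k - 2 * (a + 1) = k - 2 - 2 * a" by simp_all
      ultimately have "3 * (a + 1) + E4 (j - 3 - 3 * a) + ((k - 2 - 2 * a) div 2 + 3 * (k - 2 - 2 * a) div 4) \<le> T"
        by (simp only:)
      moreover have "3 * (a + 1) + X + Y \<le> T \<Longrightarrow> 3 * a + X + Y \<le> T - 3" for X Y by simp
      ultimately show "3 * a + E4 (j - 3 - 3 * a) + ((k - 2 - 2 * a) div 2 + 3 * (k - 2 - 2 * a) div 4) \<le> T - 3" by blast
    qed
    hence "p ^ 3 * ?S (j - 3) (k - 2) \<le> p ^ 3 * (Suc (k - 2) * (8 * c (j - 3) * p ^ (T - 3)))" by (rule mult_le_mono2)
    also have "\<dots> = Suc (k - 2) * (8 * c (j - 3) * (p ^ 3 * p ^ (T - 3)))" by (simp only: ac_simps)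
    also have "p ^ 3 * p ^ (T - 3) = p ^ T" using T3 by (simp only: power_add[symmetric] le_add_diff_inverse)
    also have "Suc (k - 2) * (8 * c (j - 3) * p ^ T) \<le> k * (8 * c j * p ^ T)"
      using mono True by (intro mult_le_mono) auto
    finally show ?thesis using True by simp
  next
    case False thus ?thesis by (simp only: if_False zero_le)
  qed
  have "?S j k \<le> card (ords p I j) * (8 * p ^ (k div 2 + 3 * k div 4)) +
      (if 2 \<le> k \<and> 3 \<le> j then p ^ 3 * ?S (j - 3) (k - 2) else 0)"
    by (rule sum_homs_recursion[OF p I l fin])
  also have "\<dots> \<le> 8 * c j * p ^ T + k * (8 * c j * p ^ T)" by (rule add_mono[OF 1 2])
  finally show ?case by simp
qed

text \<open>Two demands on the exponent: e - 2 controls the sum over primes at small e, and 9 e / 10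
  leaves a margin growing with e for the sum over e. For e < 2 truncated subtraction gives
  0.\<close>

definition E5 :: "nat \<Rightarrow> nat" where "E5 e = min (e - 2) (9 * e div 10)"

text \<open>For j \<ge> 12 linear estimates suffice; in this range they miss the bound by a little,
  and the rounding in the divisions makes the difference.\<close>

lemma small_exponents:
  assumes "j < (12::nat)" "3 * k \<le> 2 * j" "2 * m \<le> j"
  shows "(j - m) div 3 + 2 * (m div 2) + (k div 2 + 3 * k div 4) \<le> (j + k) - 2"
proof -
  have "j = 0 \<or> j = 1 \<or> j = 2 \<or> j = 3 \<or> j = 4 \<or> j = 5 \<or> j = 6 \<or> j = 7 \<or> j = 8 \<or> j = 9 \<or> j = 10 \<or> j = 11"
    using assms(1) by presburger
  moreover have "k < 8" using assms(1,2) by simp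
  hence "k = 0 \<or> k = 1 \<or> k = 2 \<or> k = 3 \<or> k = 4 \<or> k = 5 \<or> k = 6 \<or> k = 7" by presburger
  moreover have "m < 6" using assms(1,3) by simp
  hence "m = 0 \<or> m = 1 \<or> m = 2 \<or> m = 3 \<or> m = 4 \<or> m = 5" by presburger
  ultimately show ?thesis using assms(2,3) by (elim disjE) simp_all
qed

lemma E5_numeric:
  assumes "5 * k \<le> 2 * (j + k)" "2 * a \<le> k" "3 * a \<le> j"
  shows "3 * a + E4 (j - 3 * a) + ((k - 2 * a) div 2 + 3 * (k - 2 * a) div 4) \<le> E5 (j + k)"
proof -
  define j' k' where "j' = j - 3 * a" and "k' = k - 2 * a"
  have jk: "j = j' + 3 * a" "k = k' + 2 * a" using assms by (auto simp: j'_def k'_def)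
  \<comment> \<open>The inequality 3 k \<le> 2 j is invariant under the descent from (j, k) to (j -
    3, k - 2), which subtracts 6 from both sides.\<close>
  have c: "3 * k' \<le> 2 * j'" using assms(1) unfolding jk by simp
  obtain m where m: "2 * m \<le> j'" "E4 j' = (j' - m) div 3 + 2 * (m div 2)" by (rule E4_attained)
  define X where "X = (j' - m) div 3 + 2 * (m div 2) + (k' div 2 + 3 * k' div 4)"
  have X12: "12 * X \<le> 8 * j' + 15 * k'"
  proof -
    have gen: "12 * (A + 2 * B + (C + D)) \<le> 8 * j' + 15 * k'"
      if "3 * A \<le> j' - m" "2 * B \<le> m" "2 * C \<le> k'" "4 * D \<le> 3 * k'" for A B C D :: nat
    proof -
      have "m \<le> j'" using m(1) by simp
      hence "3 * A + m \<le> j'" using that(1) le_diff_conv2 by blast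
      thus ?thesis using that(2-4) m(1) by simp
    qed
    show ?thesis unfolding X_def by (rule gen) (rule times_div_less_eq_dividend)+
  qed
  have e: "j + k = j' + k' + 5 * a" unfolding jk by simp
  \<comment> \<open>The linear bound (8 j' + 15 k') / 12 meets 9 (j' + k') / 10 exactly when 3 k' =
    2 j', which is the origin of 9/10. Each descent adds 3 to the exponent and removes 5 from j + k,
    so it stays below that ratio.\<close>
  have "10 * (3 * a + X) \<le> 9 * (j' + k' + 5 * a)" using X12 c by simp
  hence b: "3 * a + X \<le> 9 * (j + k) div 10"
    using div_le_mono[of "10 * (3 * a + X)" "9 * (j + k)" 10] unfolding e by simp
  have "3 * a + X \<le> (j + k) - 2"
  proof (cases "a = 0")
    case False
    hence "3 * a + X + 2 \<le> j' + k' + 5 * a" using X12 c by simp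
    thus ?thesis unfolding e by simp
  next
    case True
    have "X \<le> (j' + k') - 2"
    proof (cases "j' \<ge> 12")
      case True
      hence "X + 2 \<le> j' + k'" using X12 c by simp
      thus ?thesis by simp
    next
      case False
      thus ?thesis unfolding X_def using small_exponents[OF _ c m(1)] by simp
    qed
    thus ?thesis using True unfolding e by simp
  qed
  with b have "3 * a + X \<le> E5 (j + k)" unfolding E5_def by simp
  thus ?thesis unfolding j'_def[symmetric] k'_def[symmetric] m(2) X_def by (simp only: add.assoc)
qed

text \<open>The same recursion as before, except that homomorphisms are bounded in total over all
  orders of index \<open>p ^ (e - k)\<close> in dimension four.\<close>

lemma ords_bound_5: obtains c where "poly_bound c" "ords_bound 5 c E5"
proof -
  obtain c where c: "poly_bound c" "ords_bound 4 c E4" by (rule ords_bound_4)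
  \<comment> \<open>Written with factors 1 so that \<open>poly_bound_step\<close> applies
    twice.\<close>
  let ?c = "\<lambda>e. 5 * (Suc e * ((1 * (Suc e * (c e * 8))) * 1))"
  have mono: "mono c" using c(2) by (simp add: ords_bound_def)
  have "ords_bound 5 ?c E5" unfolding ords_bound_def
  proof (intro conjI allI impI)
    show "mono ?c" by (intro monoI mult_le_mono le_refl) (use mono in \<open>auto simp: mono_def\<close>)
    fix p e :: nat and I :: "nat set" assume p: "prime p" and I: "finite I" "card I = 5"
    have ne: "I \<noteq> {}" using I by auto
    have I': "finite (I - {i})" "card (I - {i}) = 4" "I - {i} \<noteq> {}" if "i \<in> I" for i
    proof -
      show f: "finite (I - {i})" "card (I - {i}) = 4" using I that by auto
      show "I - {i} \<noteq> {}" using f(2) by (metis card.empty zero_neq_numeral)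
    qed
    have fin: "finite (ords p (I - {i}) j)" if "i \<in> I" for i j
      using c(2) p I'[OF that] unfolding ords_bound_def by blast
    have u: "finite (uhoms (p ^ k) (I - {i}) A)" if i: "i \<in> I" and A: "A \<in> ords p (I - {i}) j" for i A j k
      by (rule card_uhoms_le(1)[OF p _ I'(1,3)[OF i]]) (use A in \<open>simp add: ords_def\<close>)
    show "finite (ords p I e)" by (rule ords_recursion(1)[OF p I(1) ne fin u])
    let ?Q = "{k. k \<le> e \<and> card I * k \<le> 2 * e}"
    have fQ: "finite ?Q" "card ?Q \<le> Suc e"
    proof -
      have "?Q \<subseteq> {..e}" by blast
      thus "finite ?Q" "card ?Q \<le> Suc e" using finite_subset[of ?Q "{..e}"] card_mono[of "{..e}" ?Q] by auto
    qed
    have "card (ords p I e) \<le> (\<Sum>i\<in>I. \<Sum>k\<in>?Q. \<Sum>A\<in>ords p (I - {i}) (e - k). card (uhoms (p ^ k) (I - {i}) A))"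
      by (rule ords_recursion(2)[OF p I(1) ne fin u])
    also have "\<dots> \<le> (\<Sum>i\<in>I. \<Sum>k\<in>?Q. Suc e * (c e * 8) * p ^ E5 e)"
    proof (intro sum_mono)
      fix i k assume i: "i \<in> I" and k: "k \<in> ?Q"
      obtain l where l: "l \<in> I - {i}" using I'(3)[OF i] by blast
      have "(\<Sum>A\<in>ords p (I - {i}) (e - k). card (uhoms (p ^ k) (I - {i}) A)) \<le>
        (\<Sum>A\<in>ords p (I - {i}) (e - k). card (homs (p ^ k) (A \<inter> vecs (I - {i} - {l}))))"
      proof (rule sum_mono)
        fix A assume A: "A \<in> ords p (I - {i}) (e - k)"
        hence s: "suborder (I - {i}) A" by (simp add: ords_def)
        have J: "subrng (A \<inter> vecs (I - {i} - {l}))" by (intro subrng_Int suborder_subrng[OF s] vecs_subrng)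
        have "finite (homs (p ^ k) (A \<inter> vecs (I - {i} - {l})))"
          using card_homs_le[OF p _ J, of "I - {i} - {l}" k] I(1) by auto
        thus "card (uhoms (p ^ k) (I - {i}) A) \<le> card (homs (p ^ k) (A \<inter> vecs (I - {i} - {l})))"
          by (rule card_uhoms_le_homs(2)[OF s l])
      qed
      also have "\<dots> \<le> Suc k * (8 * c (e - k) * p ^ E5 e)"
      proof (rule sum_homs_bound[OF p I'(1,2)[OF i] l c(2)])
        fix a assume a: "2 * a \<le> k" "3 * a \<le> e - k"
        have "5 * k \<le> 2 * ((e - k) + k)" using k I(2) by simp
        from E5_numeric[OF this a] show "3 * a + E4 (e - k - 3 * a) + ((k - 2 * a) div 2 + 3 * (k - 2 * a) div 4) \<le> E5 e"
          using k by simp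
      qed
      also have "\<dots> \<le> Suc e * (8 * c e * p ^ E5 e)"
        using k mono by (intro mult_le_mono) (auto simp: mono_def)
      finally show "(\<Sum>A\<in>ords p (I - {i}) (e - k). card (uhoms (p ^ k) (I - {i}) A)) \<le> Suc e * (c e * 8) * p ^ E5 e"
        by (simp only: ac_simps)
    qed
    also have "\<dots> = 5 * (card ?Q * (Suc e * (c e * 8) * p ^ E5 e))" using I(2) by (simp only: sum_constant of_nat_id)
    also have "\<dots> \<le> 5 * (Suc e * (Suc e * (c e * 8) * p ^ E5 e))" by (intro mult_le_mono le_refl fQ(2))
    finally show "card (ords p I e) \<le> ?c e * p ^ E5 e" by (simp only: mult.assoc mult_1 mult_1_right)
  qed
  moreover have "poly_bound ?c" by (intro poly_bound_step c(1))
  ultimately show ?thesis using that by blast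
qed

text \<open>In the step, n \<ge> 5 gives k \<le> e / 3. Trading the slope n/2 - 7/6 on k for (n - 1)
  / 2 costs 2 k / 3 \<le> 2 e / 9, less than the e / 2 by which the target grows. The summand -1,
  which survives because e - k \<ge> 1, is what later makes the sum over primes converge.\<close>

lemma ords_bound_ge_5:
  assumes "n \<ge> 5"
  shows "\<exists>c E. poly_bound c \<and> ords_bound n c E \<and> (\<forall>e\<ge>1. real (E e) \<le> (real n / 2 - 7 / 6) * real e - 1)"
  using assms
proof (induction n rule: dec_induct)
  case base
  obtain c where c: "poly_bound c" "ords_bound 5 c E5" by (rule ords_bound_5)
  have "real (E5 e) \<le> (real 5 / 2 - 7 / 6) * real e - 1" if "e \<ge> 1" for e
  proof -
    have "E5 e \<le> e - 1" unfolding E5_def by simp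
    hence "real (E5 e) \<le> real e - 1" using that by (simp add: of_nat_diff)
    thus ?thesis using that by simp
  qed
  thus ?case using c by blast
next
  case (step n)
  then obtain c E where c: "poly_bound c" "ords_bound n c E" and E: "\<And>e. e \<ge> 1 \<Longrightarrow> real (E e) \<le> (real n / 2 - 7 / 6) * real e - 1" by blast
  define G where "G e k = E (e - k) + (n - 1) * (k div 2)" for e k
  define F where "F e = Max (G e ` {k. k \<le> e \<and> Suc n * k \<le> 2 * e})" for e
  have fin: "finite {k. k \<le> e \<and> Suc n * k \<le> 2 * e}" for e
    by (rule finite_subset[of _ "{..e}"]) auto
  have "ords_bound (Suc n) (\<lambda>e. Suc n * (Suc e * (c e * 2 ^ (n - 1)))) F"
  proof (rule ords_bound_Suc[OF c(2)])
    fix e k assume "k \<le> e" "Suc n * k \<le> 2 * e"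
    hence "G e k \<le> F e" unfolding F_def using fin by (intro Max_ge) auto
    thus "E (e - k) + (n - 1) * (k div 2) \<le> F e" by (simp only: G_def)
  qed (use step.hyps in simp)
  moreover have "poly_bound (\<lambda>e. Suc n * (Suc e * (c e * 2 ^ (n - 1))))" by (intro poly_bound_step c(1))
  moreover have "real (F e) \<le> (real (Suc n) / 2 - 7 / 6) * real e - 1" if e: "e \<ge> 1" for e
  proof -
    have "F e \<in> G e ` {k. k \<le> e \<and> Suc n * k \<le> 2 * e}"
      unfolding F_def using fin by (intro Max_in finite_imageI) (auto intro!: exI[of _ 0])
    then obtain k where k: "k \<le> e" "Suc n * k \<le> 2 * e" "F e = G e k" by blast
    have "6 * k \<le> Suc n * k" using step.hyps by (intro mult_le_mono1) simp
    hence k3: "3 * k \<le> e" using k(2) by linarith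
    have "e - k \<ge> 1" using e k3 by linarith
    hence 1: "real (E (e - k)) \<le> (real n / 2 - 7 / 6) * (real e - real k) - 1" using E[of "e - k"] k(1) by (simp add: of_nat_diff)
    have "real (k div 2) \<le> real k / 2" by linarith
    hence "real (n - 1) * real (k div 2) \<le> (real n - 1) * (real k / 2)" using step.hyps by (intro mult_mono) (auto simp: of_nat_diff)
    hence "real (F e) \<le> (real n / 2 - 7 / 6) * (real e - real k) - 1 + (real n - 1) * (real k / 2)"
      using 1 unfolding k(3) G_def by simp
    also have "\<dots> = (real n / 2 - 7 / 6) * real e - 1 + real k * (2 / 3)" by (simp add: field_simps)
    also have "\<dots> \<le> (real n / 2 - 7 / 6) * real e - 1 + real e * (1 / 2)"
      using k3 by simp
    also have "\<dots> = (real (Suc n) / 2 - 7 / 6) * real e - 1" by (simp add: field_simps)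
    finally show ?thesis .
  qed
  ultimately show ?case by blast
qed

section \<open>Summatory functions of multiplicative functions\<close>

text \<open>The normalization \<open>f 0 = 0\<close> makes \<open>f\<close> determined by its values
  at prime powers on all of nat, so that functions can be compared there.\<close>

definition mult_fun :: "(nat \<Rightarrow> real) \<Rightarrow> bool" where
  "mult_fun f \<longleftrightarrow> f 0 = 0 \<and> f 1 = 1 \<and> (\<forall>a b. coprime a b \<longrightarrow> f (a * b) = f a * f b)"

lemma mult_fun_0: "mult_fun f \<Longrightarrow> f 0 = 0"
  and mult_fun_1: "mult_fun f \<Longrightarrow> f 1 = 1"
  and mult_fun_mult: "mult_fun f \<Longrightarrow> coprime a b \<Longrightarrow> f (a * b) = f a * f b"
  by (auto simp: mult_fun_def)

definition conv :: "(nat \<Rightarrow> real) \<Rightarrow> (nat \<Rightarrow> real) \<Rightarrow> nat \<Rightarrow> real" where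
  "conv f g n = (\<Sum>d | d dvd n. f d * g (n div d))"

lemma prime_power_split:
  fixes n :: nat
  assumes "n > 1"
  obtains p e m where "prime p" "e > 0" "n = p ^ e * m" "coprime (p ^ e) m" "m < n" "m > 0"
proof -
  obtain p where p: "prime p" "p dvd n" using prime_factor_nat[of n] assms by auto
  have n0: "n \<noteq> 0" "\<not> is_unit p" using assms p(1) by auto
  define e where "e = multiplicity p n"
  obtain m where m: "n = p ^ e * m" "\<not> p dvd m"
    using multiplicity_decompose'[OF n0] unfolding e_def by blast
  have e: "e > 0" using p n0 unfolding e_def by (simp add: prime_multiplicity_gt_zero_iff)
  have "coprime (p ^ e) m" using prime_imp_coprime[OF p(1) m(2)] by simp
  moreover have "m > 0" using m(1) assms by (cases m) auto
  moreover have "m < n"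
  proof -
    have "p ^ e > 1" by (rule one_less_power[OF prime_gt_1_nat[OF p(1)] e])
    thus ?thesis using m(1) \<open>m > 0\<close> by simp
  qed
  ultimately show ?thesis using that p(1) e m(1) by blast
qed

lemma mult_fun_le:
  assumes f: "mult_fun f" and g: "mult_fun g"
    and le: "\<And>p e. prime p \<Longrightarrow> 0 \<le> f (p ^ e) \<and> f (p ^ e) \<le> g (p ^ e)"
  shows "0 \<le> f n \<and> f n \<le> g n"
proof (induction n rule: less_induct)
  case (less n)
  consider "n = 0" | "n = 1" | "n > 1" by linarith
  thus ?case
  proof cases
    case 3
    then obtain p e m where n: "prime p" "e > 0" "n = p ^ e * m" "coprime (p ^ e) m" "m < n" "m > 0"
      by (rule prime_power_split)
    have "f n = f (p ^ e) * f m" "g n = g (p ^ e) * g m" using mult_fun_mult[OF f n(4)] mult_fun_mult[OF g n(4)] n(3) by auto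
    moreover have "f (p ^ e) * f m \<le> g (p ^ e) * g m" using le[OF n(1), of e] less[OF n(5)] by (intro mult_mono) auto
    ultimately show ?thesis using le[OF n(1), of e] less[OF n(5)] by simp
  qed (use f g in \<open>auto simp: mult_fun_def\<close>)
qed

lemma mult_fun_eq:
  assumes f: "mult_fun f" and g: "mult_fun g" and eq: "\<And>p e. prime p \<Longrightarrow> f (p ^ e) = g (p ^ e)"
  shows "f n = g n"
proof (induction n rule: less_induct)
  case (less n)
  consider "n = 0" | "n = 1" | "n > 1" by linarith
  thus ?case
  proof cases
    case 3
    then obtain p e m where n: "prime p" "e > 0" "n = p ^ e * m" "coprime (p ^ e) m" "m < n" "m > 0"
      by (rule prime_power_split)
    show ?thesis using mult_fun_mult[OF f n(4)] mult_fun_mult[OF g n(4)] n(3) eq[OF n(1)] less[OF n(5)] by simp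
  qed (use f g in \<open>auto simp: mult_fun_def\<close>)
qed

lemma bij_divisors_coprime:
  fixes a b :: nat
  assumes "coprime a b" "a > 0" "b > 0"
  shows "bij_betw (\<lambda>(x, y). x * y) ({d. d dvd a} \<times> {d. d dvd b}) {d. d dvd a * b}"
proof (rule bij_betw_byWitness[where f' = "\<lambda>d. (gcd d a, gcd d b)"])
  have key: "gcd (x * y) a = x" "gcd (x * y) b = y" if z: "x dvd a" "y dvd b" for x y
  proof -
    have "coprime a y" using assms(1) z(2) coprime_divisors[of a a y b] by simp
    hence "gcd (y * x) a = gcd x a" by (rule gcd_mult_left_left_cancel)
    thus "gcd (x * y) a = x" using z(1) by (simp add: gcd_proj1_iff mult.commute)
    have "coprime b x" using assms(1) z(1) coprime_divisors[of x a b b] by (simp add: coprime_commute)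
    hence "gcd (x * y) b = gcd y b" by (rule gcd_mult_left_left_cancel)
    thus "gcd (x * y) b = y" using z(2) by (simp add: gcd_proj1_iff)
  qed
  show "\<forall>z\<in>{d. d dvd a} \<times> {d. d dvd b}. (\<lambda>d. (gcd d a, gcd d b)) ((\<lambda>(x, y). x * y) z) = z"
    using key by auto
  show "\<forall>d\<in>{d. d dvd a * b}. (\<lambda>(x, y). x * y) (gcd d a, gcd d b) = d"
  proof
    fix d assume "d \<in> {d. d dvd a * b}"
    then obtain x y where "d = x * y" "x dvd a" "y dvd b" using dvd_productE by blast
    thus "(\<lambda>(x, y). x * y) (gcd d a, gcd d b) = d" using key by simp
  qed
qed (auto intro: mult_dvd_mono)

lemma mult_fun_conv:
  assumes f: "mult_fun f" and g: "mult_fun g" shows "mult_fun (conv f g)"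
  unfolding mult_fun_def
proof (intro conjI allI impI)
  \<comment> \<open>Every d divides 0, so this is a sum over an infinite set and has the default
    value 0.\<close>
  show "conv f g 0 = 0" by (simp add: conv_def)
  show "conv f g 1 = 1" using mult_fun_1[OF f] mult_fun_1[OF g] by (simp add: conv_def)
  fix a b :: nat assume co: "coprime a b"
  show "conv f g (a * b) = conv f g a * conv f g b"
  proof (cases "a = 0 \<or> b = 0")
    case True
    thus ?thesis by (auto simp: conv_def)
  next
    case False
    hence pos: "a > 0" "b > 0" by auto
    have "conv f g (a * b) = (\<Sum>(x, y)\<in>{d. d dvd a} \<times> {d. d dvd b}. f (x * y) * g (a * b div (x * y)))"
      unfolding conv_def
      using sum.reindex_bij_betw[OF bij_divisors_coprime[OF co pos], of "\<lambda>d. f d * g (a * b div d)"]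
      by (simp add: case_prod_unfold)
    also have "\<dots> = (\<Sum>(x, y)\<in>{d. d dvd a} \<times> {d. d dvd b}. (f x * g (a div x)) * (f y * g (b div y)))"
    proof (rule sum.cong, simp, clarify)
      fix x y assume xy: "x dvd a" "y dvd b"
      have c1: "coprime x y" using coprime_divisors[OF xy co] .
      have c2: "coprime (a div x) (b div y)" 
      proof (rule coprime_divisors[OF _ _ co])
        show "a div x dvd a" using xy(1) by (metis dvd_div_mult_self dvd_triv_left)
        show "b div y dvd b" using xy(2) by (metis dvd_div_mult_self dvd_triv_left)
      qed
      have "a * b div (x * y) = (a div x) * (b div y)" using xy by (simp add: div_mult_div_if_dvd)
      thus "f (x * y) * g (a * b div (x * y)) = f x * g (a div x) * (f y * g (b div y))"
        using mult_fun_mult[OF f c1] mult_fun_mult[OF g c2] by simp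
    qed
    also have "\<dots> = conv f g a * conv f g b"
      unfolding conv_def sum_product sum.cartesian_product by simp
    finally show ?thesis .
  qed
qed

lemma conv_prime_power:
  assumes "prime p" shows "conv f g (p ^ e) = (\<Sum>i\<le>e. f (p ^ i) * g (p ^ (e - i)))"
proof -
  have "{d. d dvd p ^ e} = (\<lambda>i. p ^ i) ` {..e}" using divides_primepow_nat[OF assms] by auto
  moreover have "inj_on (\<lambda>i. p ^ i) {..e}" using prime_gt_1_nat[OF assms] by (intro inj_onI) (simp add: power_inject_exp)
  ultimately have "conv f g (p ^ e) = (\<Sum>i\<le>e. f (p ^ i) * g (p ^ e div p ^ i))" unfolding conv_def by (simp add: sum.reindex)
  also have "\<dots> = (\<Sum>i\<le>e. f (p ^ i) * g (p ^ (e - i)))"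
    using prime_gt_0_nat[OF assms] by (intro sum.cong) (simp_all add: power_diff)
  finally show ?thesis .
qed

section \<open>Multiplicative extension and finite Euler products\<close>

definition mult_extend :: "(nat \<Rightarrow> nat \<Rightarrow> real) \<Rightarrow> nat \<Rightarrow> real" where
  "mult_extend \<gamma> n = (if n = 0 then 0 else \<Prod>p\<in>prime_factors n. \<gamma> p (multiplicity p n))"

lemma mult_fun_mult_extend: "mult_fun (mult_extend \<gamma>)"
  unfolding mult_fun_def
proof (intro conjI allI impI)
  show "mult_extend \<gamma> 0 = 0" "mult_extend \<gamma> 1 = 1" by (auto simp: mult_extend_def)
  fix a b :: nat assume co: "coprime a b"
  show "mult_extend \<gamma> (a * b) = mult_extend \<gamma> a * mult_extend \<gamma> b"
  proof (cases "a = 0 \<or> b = 0")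
    case False
    have pf: "prime_factors (a * b) = prime_factors a \<union> prime_factors b"
      using False by (simp add: prime_factors_product)
    have dj: "prime_factors a \<inter> prime_factors b = {}"
    proof (rule ccontr)
      assume "\<not> ?thesis"
      then obtain p where "p \<in> prime_factors a" "p \<in> prime_factors b" by blast
      hence "prime p" "p dvd a" "p dvd b" by auto
      thus False using co coprime_common_divisor[of a b p] not_prime_unit by blast
    qed
    have m: "multiplicity p (a * b) = multiplicity p a" if "p \<in> prime_factors a" for p
    proof -
      have p: "prime p" using that by auto
      have "p \<notin> prime_factors b" using that dj by blast
      hence "multiplicity p b = 0" using p False by (simp add: prime_factors_multiplicity)
      thus ?thesis using p False by (simp add: prime_elem_multiplicity_mult_distrib)
    qed
    have m': "multiplicity p (a * b) = multiplicity p b" if "p \<in> prime_factors b" for p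
    proof -
      have p: "prime p" using that by auto
      have "p \<notin> prime_factors a" using that dj by blast
      hence "multiplicity p a = 0" using p False by (simp add: prime_factors_multiplicity)
      thus ?thesis using p False by (simp add: prime_elem_multiplicity_mult_distrib)
    qed
    have "mult_extend \<gamma> (a * b) = (\<Prod>p\<in>prime_factors a. \<gamma> p (multiplicity p (a * b))) * (\<Prod>p\<in>prime_factors b. \<gamma> p (multiplicity p (a * b)))"
      using False unfolding mult_extend_def pf by (simp add: prod.union_disjoint[OF _ _ dj])
    also have "\<dots> = mult_extend \<gamma> a * mult_extend \<gamma> b" using False m m' by (simp add: mult_extend_def)
    finally show ?thesis .
  qed (auto simp: mult_extend_def)
qed

lemma mult_extend_prime_power:
  assumes "prime p" "\<gamma> p 0 = 1" shows "mult_extend \<gamma> (p ^ e) = \<gamma> p e"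
proof (cases "e = 0")
  case False
  have "prime_factors (p ^ e) = {p}" using assms(1) False by (simp add: prime_factors_power prime_prime_factors)
  thus ?thesis using assms prime_gt_0_nat[OF assms(1)] by (simp add: mult_extend_def)
qed (use assms in \<open>simp add: mult_extend_def\<close>)

text \<open>A finite Euler product, with a finite set of primes and exponents at most L. Induction
  on the set of primes splits off the p-part of n.\<close>

lemma sum_mult_fun_le_prod:
  fixes L :: nat
  assumes h: "mult_fun h" "\<And>n. h n \<ge> 0" and P: "finite P" "\<And>p. p \<in> P \<Longrightarrow> prime p"
  defines "S \<equiv> \<lambda>P. {n::nat. n > 0 \<and> prime_factors n \<subseteq> P \<and> (\<forall>p. multiplicity p n \<le> L)}"
  shows "finite (S P) \<and> sum h (S P) \<le> (\<Prod>p\<in>P. \<Sum>e\<le>L. h (p ^ e))"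
  using P
proof (induction P rule: finite_induct)
  case empty
  have "S {} \<subseteq> {1}" unfolding S_def by (auto simp: prime_factorization_empty_iff)
  hence "finite (S {})" "sum h (S {}) \<le> sum h {1}"
    using h(2) sum_mono2[of "{1}" "S {}" h] finite_subset[of "S {}" "{1}"] by auto
  thus ?case using mult_fun_1[OF h(1)] by simp
next
  case (insert p P)
  have p: "prime p" and P: "\<And>q. q \<in> P \<Longrightarrow> prime q" using insert.prems by auto
  have IH: "finite (S P)" "sum h (S P) \<le> (\<Prod>p\<in>P. \<Sum>e\<le>L. h (p ^ e))" using insert.IH P by auto
  let ?g = "\<lambda>(e, m). p ^ e * m"
  have co: "coprime (p ^ e) m" if "m \<in> S P" for e m
  proof -
    have "m > 0" "prime_factors m \<subseteq> P" using that by (auto simp: S_def)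
    hence "\<not> p dvd m" using insert.hyps(2) p by (auto simp: prime_factors_dvd)
    thus ?thesis using prime_imp_coprime[OF p] by simp
  qed
  have sub: "S (insert p P) \<subseteq> ?g ` ({..L} \<times> S P)"
  proof
    fix n assume n: "n \<in> S (insert p P)"
    hence n0: "n > 0" "n \<noteq> 0" "\<not> is_unit p" using p by (auto simp: S_def)
    obtain m where m: "n = p ^ multiplicity p n * m" "\<not> p dvd m" using multiplicity_decompose'[OF n0(2,3)] by blast
    have m0: "m > 0" using m(1) n0(1) by (cases m) auto
    have "m dvd p ^ multiplicity p n * m" by simp
    hence "m dvd n" by (simp only: m(1)[symmetric])
    have "prime_factors m \<subseteq> prime_factors n" using \<open>m dvd n\<close> n0 by (intro dvd_prime_factors) auto
    moreover have "p \<notin> prime_factors m" using m(2) by auto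
    ultimately have "prime_factors m \<subseteq> P" using n by (auto simp: S_def)
    moreover have "multiplicity q m \<le> L" for q
    proof -
      have "multiplicity q m \<le> multiplicity q n" using \<open>m dvd n\<close> n0 by (intro dvd_imp_multiplicity_le) auto
      thus ?thesis using n by (simp add: S_def) (meson le_trans)
    qed
    ultimately have "m \<in> S P" using m0 by (simp add: S_def)
    moreover have "multiplicity p n \<in> {..L}" using n by (simp add: S_def)
    ultimately show "n \<in> ?g ` ({..L} \<times> S P)" using m(1) by (intro image_eqI[of _ _ "(multiplicity p n, m)"]) auto
  qed
  have fin: "finite ({..L} \<times> S P)" using IH(1) by simp
  have "finite (S (insert p P))" using sub fin finite_subset by blast
  moreover have "sum h (S (insert p P)) \<le> sum h (?g ` ({..L} \<times> S P))"
    using sub fin h(2) by (intro sum_mono2) auto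
  moreover have "sum h (?g ` ({..L} \<times> S P)) \<le> sum (h \<circ> ?g) ({..L} \<times> S P)"
    using fin h(2) by (intro sum_image_le) auto
  moreover have "sum (h \<circ> ?g) ({..L} \<times> S P) = (\<Sum>(e, m)\<in>{..L} \<times> S P. h (p ^ e) * h m)"
    using mult_fun_mult[OF h(1) co] by (intro sum.cong) auto
  moreover have "\<dots> = (\<Sum>e\<le>L. h (p ^ e)) * sum h (S P)"
    unfolding sum_product sum.cartesian_product by simp
  moreover have "\<dots> \<le> (\<Sum>e\<le>L. h (p ^ e)) * (\<Prod>p\<in>P. \<Sum>e\<le>L. h (p ^ e))"
    using IH(2) h(2) by (intro mult_left_mono sum_nonneg) auto
  moreover have "\<dots> = (\<Prod>p\<in>insert p P. \<Sum>e\<le>L. h (p ^ e))" using insert.hyps by simp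
  ultimately show ?case by linarith
qed

text \<open>Partial sums are bounded by finite Euler products, and 1 + t \<le> exp t turns the
  product into the exponential of the double sum over primes and exponents.\<close>

lemma summable_mult_fun:
  assumes h: "mult_fun h" "\<And>n. h n \<ge> 0"
    and B: "\<And>N. (\<Sum>p | prime p \<and> p \<le> N. \<Sum>e\<in>{1..N}. h (p ^ e)) \<le> B"
  shows "summable h"
proof (rule bounded_imp_summable[of _ "exp B"])
  show "h n \<ge> 0" for n by (rule h(2))
  fix n
  let ?P = "{p::nat. prime p \<and> p \<le> n}"
  let ?S = "{k::nat. k > 0 \<and> prime_factors k \<subseteq> ?P \<and> (\<forall>p. multiplicity p k \<le> n)}"
  have fP: "finite ?P" by (rule finite_subset[of _ "{..n}"]) auto
  have S: "finite ?S \<and> sum h ?S \<le> (\<Prod>p\<in>?P. \<Sum>e\<le>n. h (p ^ e))"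
    by (rule sum_mult_fun_le_prod[OF h fP]) auto
  have "{1..n} \<subseteq> ?S"
  proof
    fix k assume k: "k \<in> {1..n}"
    have "p \<le> n" if "p \<in> prime_factors k" for p
      using that k dvd_imp_le[of p k] by (auto simp: prime_factors_dvd)
    moreover have "multiplicity p k \<le> n" for p
    \<comment> \<open>The bound ranges over all natural numbers p; for 0 and 1 the multiplicity in k
      is 0.\<close>
    proof (cases "p = 0 \<or> is_unit p")
      case True thus ?thesis using k by (auto simp: multiplicity_unit_left)
    next
      case False
      hence p: "p \<ge> 2" by (cases p) auto
      have "multiplicity p k < 2 ^ multiplicity p k" by (rule less_exp)
      also have "\<dots> \<le> p ^ multiplicity p k" using p by (intro power_mono) auto
      also have "\<dots> \<le> k" using k multiplicity_dvd[of p k] by (intro dvd_imp_le) auto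
      finally show ?thesis using k by simp
    qed
    ultimately show "k \<in> ?S" using k by auto
  qed
  hence "sum h {1..n} \<le> sum h ?S" using S h(2) by (intro sum_mono2) auto
  also have "\<dots> \<le> (\<Prod>p\<in>?P. \<Sum>e\<le>n. h (p ^ e))" using S by blast
  also have "\<dots> \<le> (\<Prod>p\<in>?P. exp (\<Sum>e\<in>{1..n}. h (p ^ e)))"
  proof (rule prod_mono)
    fix p assume "p \<in> ?P"
    have "(\<Sum>e\<le>n. h (p ^ e)) = h (p ^ 0) + (\<Sum>e\<in>{1..n}. h (p ^ e))"
      by (simp add: atMost_atLeast0 sum.atLeast_Suc_atMost)
    also have "\<dots> = 1 + (\<Sum>e\<in>{1..n}. h (p ^ e))" using mult_fun_1[OF h(1)] by simp
    also have "\<dots> \<le> exp (\<Sum>e\<in>{1..n}. h (p ^ e))" by (rule exp_ge_add_one_self)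
    finally show "0 \<le> (\<Sum>e\<le>n. h (p ^ e)) \<and> (\<Sum>e\<le>n. h (p ^ e)) \<le> exp (\<Sum>e\<in>{1..n}. h (p ^ e))"
      using h(2) by (simp add: sum_nonneg)
  qed
  also have "\<dots> = exp (\<Sum>p\<in>?P. \<Sum>e\<in>{1..n}. h (p ^ e))" using fP by (simp add: exp_sum)
  also have "\<dots> \<le> exp B" using B[of n] by simp
  finally have "sum h {1..n} \<le> exp B" .
  moreover have "(\<Sum>k\<le>n. h k) = sum h {1..n}" using mult_fun_0[OF h(1)] by (simp add: atMost_atLeast0 sum.atLeast_Suc_atMost)
  ultimately show "(\<Sum>k\<le>n. h k) \<le> exp B" by simp
qed

section \<open>Summatory functions and logarithmic sums\<close>

definition summ :: "(nat \<Rightarrow> real) \<Rightarrow> real \<Rightarrow> real" where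
  "summ f x = (\<Sum>n\<in>{1..nat \<lfloor>x\<rfloor>}. f n)"

lemma summ_conv:
  assumes "x \<ge> 0"
  shows "summ (conv f g) x = (\<Sum>d\<in>{1..nat \<lfloor>x\<rfloor>}. f d * summ g (x / real d))"
proof -
  define N where "N = nat \<lfloor>x\<rfloor>"
  have fl: "nat \<lfloor>x / real d\<rfloor> = N div d" for d :: nat
  proof -
    have "\<lfloor>x / real_of_int (int d)\<rfloor> = \<lfloor>x\<rfloor> div int d" by (rule floor_divide_real_eq_div) simp
    thus ?thesis unfolding N_def using assms by (simp add: nat_div_distrib)
  qed
  have "summ (conv f g) x = (\<Sum>n\<in>{1..N}. \<Sum>d | d dvd n. f d * g (n div d))"
    by (simp add: summ_def conv_def N_def)
  also have "\<dots> = (\<Sum>(n, d)\<in>Sigma {1..N} (\<lambda>n. {d. d dvd n}). f d * g (n div d))"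
    by (intro sum.Sigma) auto
  also have "\<dots> = (\<Sum>(d, m)\<in>Sigma {1..N} (\<lambda>d. {1..N div d}). f d * g m)"
  proof (rule sum.reindex_bij_witness[where i = "\<lambda>(d, m). (d * m, d)" and j = "\<lambda>(n, d). (d, n div d)"])
    fix a assume "a \<in> Sigma {1..N} (\<lambda>n. {d. d dvd n})"
    then obtain n d where a: "a = (n, d)" "1 \<le> n" "n \<le> N" "d dvd n" by auto
    have d: "1 \<le> d" "d \<le> n" using a dvd_imp_le[of d n] by (cases d, auto)
    show "(\<lambda>(d, m). (d * m, d)) ((\<lambda>(n, d). (d, n div d)) a) = a" using a by simp
    have "1 \<le> n div d" using d by (simp add: div_greater_zero_iff Suc_le_eq)
    thus "(\<lambda>(n, d). (d, n div d)) a \<in> Sigma {1..N} (\<lambda>d. {1..N div d})" using a d by (auto intro: div_le_mono)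
    show "(case (\<lambda>(n, d). (d, n div d)) a of (d, m) \<Rightarrow> f d * g m) = (case a of (n, d) \<Rightarrow> f d * g (n div d))" using a by simp
  next
    fix b assume "b \<in> Sigma {1..N} (\<lambda>d. {1..N div d})"
    then obtain d m where b: "b = (d, m)" "1 \<le> d" "d \<le> N" "1 \<le> m" "m \<le> N div d" by auto
    show "(\<lambda>(n, d). (d, n div d)) ((\<lambda>(d, m). (d * m, d)) b) = b" using b by simp
    have "d * m \<le> d * (N div d)" using b by simp
    also have "\<dots> \<le> N" by (rule times_div_less_eq_dividend)
    finally have "d * m \<le> N" .
    thus "(\<lambda>(d, m). (d * m, d)) b \<in> Sigma {1..N} (\<lambda>n. {d. d dvd n})" using b by (auto simp: Suc_le_eq)
  qed
  also have "\<dots> = (\<Sum>d\<in>{1..N}. \<Sum>m\<in>{1..N div d}. f d * g m)" by (rule sum.Sigma[symmetric]) auto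
  also have "\<dots> = (\<Sum>d\<in>{1..N}. f d * summ g (x / real d))" by (simp add: summ_def fl sum_distrib_left)
  finally show ?thesis by (simp add: N_def)
qed

text \<open>The second clause supplies the uniform majorant for exchanging limit and sum. It has 1 +
  ln y because it must hold from y = 1 on, where ln y vanishes.\<close>

definition growth :: "(real \<Rightarrow> real) \<Rightarrow> nat \<Rightarrow> real \<Rightarrow> bool" where
  "growth A r c \<longleftrightarrow> ((\<lambda>x. A x / (x * ln x ^ r)) \<longlongrightarrow> c) at_top \<and>
     (\<exists>C\<ge>0. \<forall>y\<ge>1. \<bar>A y\<bar> \<le> C * y * (1 + ln y) ^ r)"

text \<open>The mean value estimates for t^(r+1), obtained by induction on r.\<close>

lemma power_diff_bounds:
  fixes a b :: real
  assumes "0 \<le> b" "b \<le> a"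
  shows "real (Suc r) * (b ^ r * (a - b)) \<le> a ^ Suc r - b ^ Suc r \<and>
    a ^ Suc r - b ^ Suc r \<le> real (Suc r) * (a ^ r * (a - b))"
proof (induction r)
  case (Suc r)
  have e: "a ^ Suc (Suc r) - b ^ Suc (Suc r) = a * (a ^ Suc r - b ^ Suc r) + b ^ Suc r * (a - b)"
    by (simp add: algebra_simps)
  have "a * (a ^ Suc r - b ^ Suc r) \<le> a * (real (Suc r) * (a ^ r * (a - b)))"
    using Suc assms by (intro mult_left_mono) auto
  moreover have "b ^ Suc r * (a - b) \<le> a ^ Suc r * (a - b)" using assms by (intro mult_right_mono power_mono) auto
  moreover have "a * (real (Suc r) * (a ^ r * (a - b))) + a ^ Suc r * (a - b) = real (Suc (Suc r)) * (a ^ Suc r * (a - b))"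
    by (simp add: algebra_simps)
  moreover have "b * (real (Suc r) * (b ^ r * (a - b))) \<le> a * (a ^ Suc r - b ^ Suc r)"
  proof (rule mult_mono)
    show "real (Suc r) * (b ^ r * (a - b)) \<le> a ^ Suc r - b ^ Suc r" using Suc by blast
    show "0 \<le> real (Suc r) * (b ^ r * (a - b))" using assms by simp
  qed (use assms in auto)
  moreover have "b * (real (Suc r) * (b ^ r * (a - b))) + b ^ Suc r * (a - b) = real (Suc (Suc r)) * (b ^ Suc r * (a - b))"
    by (simp add: algebra_simps)
  ultimately show ?case unfolding e by linarith
qed simp

lemma ln_Suc_diff:
  assumes "n \<ge> 1"
  shows "1 / real (Suc n) \<le> ln (real (Suc n)) - ln (real n)" "ln (real (Suc n)) - ln (real n) \<le> 1 / real n"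
proof -
  have n: "real n > 0" using assms by simp
  have "ln (real n / real (Suc n)) \<le> real n / real (Suc n) - 1" using n by (intro ln_le_minus_one) simp
  also have "\<dots> = - (1 / real (Suc n))" by (simp add: field_simps)
  finally show "1 / real (Suc n) \<le> ln (real (Suc n)) - ln (real n)" using n by (simp add: ln_div)
  have "ln (real (Suc n) / real n) \<le> real (Suc n) / real n - 1" using n by (intro ln_le_minus_one) simp
  also have "\<dots> = 1 / real n" using n by (simp add: field_simps)
  finally show "ln (real (Suc n)) - ln (real n) \<le> 1 / real n" using n by (simp add: ln_div)
qed

lemma nat_floor_bounds:
  assumes "x \<ge> 1" shows "1 \<le> nat \<lfloor>x\<rfloor>" "real (nat \<lfloor>x\<rfloor>) \<le> x" "x < real (nat \<lfloor>x\<rfloor>) + 1"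
  using assms by linarith+

lemma floor_range:
  assumes "x \<ge> 1" "k \<in> {1..nat \<lfloor>x\<rfloor>}" shows "1 \<le> real k" "real k \<le> x"
proof -
  have "real k \<le> real (nat \<lfloor>x\<rfloor>)" using assms(2) by (simp only: atLeastAtMost_iff of_nat_le_iff)
  thus "real k \<le> x" using nat_floor_bounds(2)[OF assms(1)] by linarith
  show "1 \<le> real k" using assms(2) by simp
qed

definition logsum :: "nat \<Rightarrow> real \<Rightarrow> real" where
  "logsum r x = (\<Sum>k\<in>{1..nat \<lfloor>x\<rfloor>}. ln (x / real k) ^ r / real k)"

text \<open>Up to sign, \<psi> is an antiderivative of the summand as a function of k. Its
  difference over one step lies between two consecutive terms of the sum, and the differences
  telescope.\<close>

lemma logsum_bounds:
  assumes x: "x \<ge> 1"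
  shows "ln x ^ Suc r / real (Suc r) - 1 \<le> logsum r x" "logsum r x \<le> ln x ^ r + ln x ^ Suc r / real (Suc r)"
proof -
  define N where "N = nat \<lfloor>x\<rfloor>"
  note N = nat_floor_bounds[OF x, folded N_def]
  define \<psi> where "\<psi> k = ln (x / real k) ^ Suc r / real (Suc r)" for k
  define t where "t k = ln (x / real k) ^ r / real k" for k
  have lnk: "ln (x / real k) = ln x - ln (real k)" if "k \<ge> 1" for k using that x by (simp add: ln_div)
  have pos: "0 \<le> ln (x / real k)" if "1 \<le> k" "k \<le> N" for k
    using that N x by (intro ln_ge_zero) (simp add: field_simps)
  have tpos: "0 \<le> t k" if "1 \<le> k" "k \<le> N" for k using pos[OF that] unfolding t_def by simp
  have diff: "t (Suc n) \<le> \<psi> n - \<psi> (Suc n)" "\<psi> n - \<psi> (Suc n) \<le> t n" if n: "1 \<le> n" "Suc n \<le> N" for n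
  proof -
    let ?a = "ln (x / real n)" and ?b = "ln (x / real (Suc n))"
    have ab: "?a - ?b = ln (real (Suc n)) - ln (real n)" using lnk[of n] lnk[of "Suc n"] n by simp
    have b0: "0 \<le> ?b" using n by (intro pos) auto
    have "ln (real n) \<le> ln (real (Suc n))" using n by simp
    hence ba: "?b \<le> ?a" using ab by linarith
    note pd = power_diff_bounds[OF b0 ba, of r]
    have e: "\<psi> n - \<psi> (Suc n) = (?a ^ Suc r - ?b ^ Suc r) / real (Suc r)" unfolding \<psi>_def by (simp only: diff_divide_distrib)
    have "t (Suc n) = ?b ^ r * (1 / real (Suc n))" unfolding t_def by simp
    also have "\<dots> \<le> ?b ^ r * (?a - ?b)" unfolding ab using ln_Suc_diff(1)[OF n(1)] b0 by (intro mult_left_mono) auto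
    also have "\<dots> \<le> (?a ^ Suc r - ?b ^ Suc r) / real (Suc r)" using pd by (simp only: pos_le_divide_eq of_nat_0_less_iff zero_less_Suc mult.commute)
    finally show "t (Suc n) \<le> \<psi> n - \<psi> (Suc n)" unfolding e .
    have "(?a ^ Suc r - ?b ^ Suc r) / real (Suc r) \<le> ?a ^ r * (?a - ?b)"
      using pd by (simp only: pos_divide_le_eq of_nat_0_less_iff zero_less_Suc mult.commute)
    also have "\<dots> \<le> ?a ^ r * (1 / real n)" unfolding ab using ln_Suc_diff(2)[OF n(1)] b0 ba by (intro mult_left_mono) auto
    finally show "\<psi> n - \<psi> (Suc n) \<le> t n" unfolding e t_def by simp
  qed
  have up: "n \<le> N \<Longrightarrow> sum t {1..n} \<le> t 1 + \<psi> 1 - \<psi> n" if "1 \<le> n" for n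
    using that
  proof (induction n rule: dec_induct)
    case (step n)
    thus ?case using diff(1)[of n] by simp
  qed simp
  have lo: "n \<le> N \<Longrightarrow> \<psi> 1 - \<psi> n \<le> sum t {1..<n}" if "1 \<le> n" for n
    using that
  proof (induction n rule: dec_induct)
    case (step n)
    thus ?case using diff(2)[of n] by simp
  qed simp
  have L: "logsum r x = sum t {1..N}" unfolding logsum_def N_def t_def ..
  have \<psi>1: "\<psi> 1 = ln x ^ Suc r / real (Suc r)" "t 1 = ln x ^ r" unfolding \<psi>_def t_def by simp_all
  have \<psi>N: "0 \<le> \<psi> N" "\<psi> N \<le> 1"
  proof -
    have p: "0 \<le> ln (x / real N)" using pos[of N] N by simp
    thus "0 \<le> \<psi> N" unfolding \<psi>_def by simp
    \<comment> \<open>N is the integer part of x and at least 1, so x < N + 1 \<le> 2 N; with ln t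
      \<le> t - 1 the logarithm at the last index is at most 1.\<close>
    have "x / real N \<le> 2" using N by (simp add: field_simps)
    hence "ln (x / real N) \<le> x / real N - 1" using N x by (intro ln_le_minus_one) simp
    hence "ln (x / real N) \<le> 1" using \<open>x / real N \<le> 2\<close> by linarith
    hence "ln (x / real N) ^ Suc r \<le> 1" using p by (intro power_le_one)
    also have "1 \<le> real (Suc r)" by simp
    finally show "\<psi> N \<le> 1" unfolding \<psi>_def by simp
  qed
  show "logsum r x \<le> ln x ^ r + ln x ^ Suc r / real (Suc r)" using up[OF N(1)] \<psi>1 \<psi>N unfolding L by simp
  have "sum t {1..<N} \<le> sum t {1..N}" using tpos by (intro sum_mono2) auto
  thus "ln x ^ Suc r / real (Suc r) - 1 \<le> logsum r x" using lo[OF N(1)] \<psi>1 \<psi>N unfolding L by simp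
qed

lemma logsum_limit: "((\<lambda>x. logsum r x / ln x ^ Suc r) \<longlongrightarrow> 1 / real (Suc r)) at_top"
proof (rule tendsto_sandwich)
  have lninf: "filterlim (\<lambda>x::real. ln x ^ n) at_top at_top" if "n > 0" for n
    using that by (intro filterlim_pow_at_top ln_at_top)
  have ev: "\<forall>\<^sub>F x::real in at_top. x > exp 1" by (rule eventually_gt_at_top)
  have lnp: "ln x > 1" if "x > exp 1" for x :: real using that by (metis exp_gt_zero less_trans ln_exp ln_less_cancel_iff)
  show "\<forall>\<^sub>F x in at_top. 1 / real (Suc r) - inverse (ln x ^ Suc r) \<le> logsum r x / ln x ^ Suc r"
    using ev
  proof eventually_elim
    case (elim x)
    have "x \<ge> 1" using elim one_le_exp_iff[of 1] by linarith
    note b = logsum_bounds(1)[OF this, of r]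
    have l: "ln x ^ Suc r > 0" using lnp[OF elim] by simp
    have "1 / real (Suc r) - inverse (ln x ^ Suc r) = (ln x ^ Suc r / real (Suc r) - 1) / ln x ^ Suc r"
      using l lnp[OF elim] by (simp add: diff_divide_distrib inverse_eq_divide del: power_Suc)
    also have "\<dots> \<le> logsum r x / ln x ^ Suc r" using b l by (intro divide_right_mono) auto
    finally show ?case .
  qed
  show "\<forall>\<^sub>F x in at_top. logsum r x / ln x ^ Suc r \<le> inverse (ln x) + 1 / real (Suc r)"
    using ev
  proof eventually_elim
    case (elim x)
    have "x \<ge> 1" using elim one_le_exp_iff[of 1] by linarith
    note b = logsum_bounds(2)[OF this, of r]
    have l: "ln x > 0" "ln x ^ Suc r > 0" using lnp[OF elim] by simp_all
    have "logsum r x / ln x ^ Suc r \<le> (ln x ^ r + ln x ^ Suc r / real (Suc r)) / ln x ^ Suc r"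
      using b l by (intro divide_right_mono) auto
    also have "\<dots> = inverse (ln x) + 1 / real (Suc r)" using l by (simp add: add_divide_distrib inverse_eq_divide)
    finally show ?case .
  qed
  have "((\<lambda>x::real. inverse (ln x ^ Suc r)) \<longlongrightarrow> 0) at_top" by (intro tendsto_inverse_0_at_top lninf) simp
  from tendsto_diff[OF tendsto_const this] show "((\<lambda>x. 1 / real (Suc r) - inverse (ln x ^ Suc r)) \<longlongrightarrow> 1 / real (Suc r)) at_top" by simp
  have "((\<lambda>x::real. inverse (ln x)) \<longlongrightarrow> 0) at_top" by (intro tendsto_inverse_0_at_top ln_at_top)
  from tendsto_add[OF this tendsto_const] show "((\<lambda>x. inverse (ln x) + 1 / real (Suc r)) \<longlongrightarrow> 1 / real (Suc r)) at_top" by simp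
qed

text \<open>Replacing A y by its main term c y (ln y)^r turns the sum into c x
  \<open>logsum r x\<close>, which gains one logarithm and the denominator r + 1. The error is at
  most an arbitrarily small multiple of the same sum plus a term linear in x.\<close>

lemma growth_step:
  assumes A: "growth A r c"
  shows "growth (\<lambda>x. \<Sum>k\<in>{1..nat \<lfloor>x\<rfloor>}. A (x / real k)) (Suc r) (c / real (Suc r))"
  unfolding growth_def
proof
  obtain C where C: "C \<ge> 0" "\<And>y. y \<ge> 1 \<Longrightarrow> \<bar>A y\<bar> \<le> C * y * (1 + ln y) ^ r" using A unfolding growth_def by blast
  have lim: "((\<lambda>x. A x / (x * ln x ^ r)) \<longlongrightarrow> c) at_top" using A unfolding growth_def by blast
  let ?S = "\<lambda>x. \<Sum>k\<in>{1..nat \<lfloor>x\<rfloor>}. A (x / real k)"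
  have arg: "x / real k \<ge> 1" "x / real k \<le> x" if "x \<ge> 1" "k \<in> {1..nat \<lfloor>x\<rfloor>}" for x k
  proof -
    note k = floor_range[OF that]
    thus "x / real k \<ge> 1" by (simp add: field_simps)
    show "x / real k \<le> x" using k that(1) by (simp add: divide_le_eq mult_le_cancel_left1)
  qed
  have logsum1: "(\<Sum>k\<in>{1..nat \<lfloor>x\<rfloor>}. 1 / real k) \<le> 1 + ln x" if "x \<ge> 1" for x
    using logsum_bounds(2)[OF that, of 0] unfolding logsum_def by simp
  show "\<exists>C\<ge>0. \<forall>y\<ge>1. \<bar>?S y\<bar> \<le> C * y * (1 + ln y) ^ Suc r"
  proof (intro exI[of _ C] conjI allI impI C(1))
    fix x :: real assume x: "x \<ge> 1"
    have l: "0 \<le> ln x" using x by simp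
    have "\<bar>?S x\<bar> \<le> (\<Sum>k\<in>{1..nat \<lfloor>x\<rfloor>}. \<bar>A (x / real k)\<bar>)" by (rule sum_abs)
    also have "\<dots> \<le> (\<Sum>k\<in>{1..nat \<lfloor>x\<rfloor>}. (C * x * (1 + ln x) ^ r) * (1 / real k))"
    proof (rule sum_mono)
      fix k assume k: "k \<in> {1..nat \<lfloor>x\<rfloor>}"
      note a = arg[OF x k]
      have "\<bar>A (x / real k)\<bar> \<le> C * (x / real k) * (1 + ln (x / real k)) ^ r" by (rule C(2)[OF a(1)])
      also have "\<dots> \<le> C * (x / real k) * (1 + ln x) ^ r"
        using C(1) a x by (intro mult_left_mono power_mono) auto
      finally show "\<bar>A (x / real k)\<bar> \<le> (C * x * (1 + ln x) ^ r) * (1 / real k)" by (simp add: mult_ac)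
    qed
    also have "\<dots> = (C * x * (1 + ln x) ^ r) * (\<Sum>k\<in>{1..nat \<lfloor>x\<rfloor>}. 1 / real k)" by (simp only: sum_distrib_left)
    also have "\<dots> \<le> (C * x * (1 + ln x) ^ r) * (1 + ln x)" using C(1) x l logsum1[OF x] by (intro mult_left_mono) auto
    finally show "\<bar>?S x\<bar> \<le> C * x * (1 + ln x) ^ Suc r" by (simp add: mult_ac)
  qed
  \<comment> \<open>D absorbs both functions on a bounded range of y, where the limit gives no
    information. Summed over at most x values of k it costs D x, which is of lower order than
    \<open>x * ln x ^ Suc r\<close>.\<close>
  have key: "\<exists>D\<ge>0. \<forall>x\<ge>1. \<bar>?S x - c * x * logsum r x\<bar> \<le> \<epsilon> * x * logsum r x + D * x" if \<epsilon>: "\<epsilon> > 0" for \<epsilon>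
  proof -
    have "\<forall>\<^sub>F y in at_top. dist (A y / (y * ln y ^ r)) c < \<epsilon>" using lim \<epsilon> by (rule tendstoD)
    then obtain Y0 where Y0: "\<And>y. y \<ge> Y0 \<Longrightarrow> dist (A y / (y * ln y ^ r)) c < \<epsilon>" unfolding eventually_at_top_linorder by blast
    define Y where "Y = max Y0 (exp 1)"
    have Y1: "Y \<ge> exp 1" unfolding Y_def by simp
    hence Y1: "Y \<ge> exp 1" "Y \<ge> 1" "Y > 1" using exp_ge_add_one_self[of "1::real"] by linarith+
    define D where "D = (C + \<bar>c\<bar>) * Y * (1 + ln Y) ^ r"
    have D: "D \<ge> 0" unfolding D_def using C(1) Y1 by (intro mult_nonneg_nonneg) auto
    have bd: "\<bar>A y - c * y * ln y ^ r\<bar> \<le> \<epsilon> * y * ln y ^ r + D" if y: "y \<ge> 1" for y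
    proof (cases "y \<ge> Y")
      case True
      have l: "y * ln y ^ r > 0" using True Y1 by (intro mult_pos_pos zero_less_power ln_gt_zero) auto
      have "\<bar>A y / (y * ln y ^ r) - c\<bar> \<le> \<epsilon>" using Y0[of y] True unfolding Y_def dist_real_def by simp
      hence "\<bar>A y / (y * ln y ^ r) - c\<bar> * (y * ln y ^ r) \<le> \<epsilon> * (y * ln y ^ r)" using l by (intro mult_right_mono) auto
      moreover have "\<bar>A y / (y * ln y ^ r) - c\<bar> * (y * ln y ^ r) = \<bar>(A y / (y * ln y ^ r) - c) * (y * ln y ^ r)\<bar>"
        by (rule abs_mult_pos[OF less_imp_le[OF l]])
      moreover have "(A y / (y * ln y ^ r) - c) * (y * ln y ^ r) = A y - c * y * ln y ^ r"
      proof -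
        have gen: "(u / Q - c) * Q = u - c * Q" if "Q \<noteq> 0" for u Q :: real using that by (simp add: left_diff_distrib)
        show ?thesis unfolding mult.assoc by (rule gen) (use l in linarith)
      qed
      ultimately show ?thesis using D by (simp add: mult_ac)
    next
      case False
      hence yY: "y \<le> Y" by simp
      have l: "0 \<le> ln y" "ln y \<le> ln Y" using y yY by auto
      have l3: "ln y \<le> 1 + ln Y" using l by linarith
      have "\<bar>A y - c * y * ln y ^ r\<bar> \<le> \<bar>A y\<bar> + \<bar>c * y * ln y ^ r\<bar>" by linarith
      also have "\<dots> \<le> C * y * (1 + ln y) ^ r + \<bar>c\<bar> * y * ln y ^ r" using C(2)[OF y] y l by (simp add: abs_mult)
      also have "\<dots> \<le> C * Y * (1 + ln Y) ^ r + \<bar>c\<bar> * Y * (1 + ln Y) ^ r"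
        using C(1) y yY l by (intro add_mono mult_mono power_mono l3) auto
      also have "\<dots> = D" unfolding D_def by (simp add: algebra_simps)
      also have "\<dots> \<le> \<epsilon> * y * ln y ^ r + D" using \<epsilon> y l by simp
      finally show ?thesis .
    qed
    have "\<bar>?S x - c * x * logsum r x\<bar> \<le> \<epsilon> * x * logsum r x + D * x" if x: "x \<ge> 1" for x
    proof -
      let ?K = "{1..nat \<lfloor>x\<rfloor>}"
      have e: "d * x * logsum r x = (\<Sum>k\<in>?K. d * (x / real k) * ln (x / real k) ^ r)" for d
        unfolding logsum_def sum_distrib_left by (intro sum.cong) auto
      have "?S x - c * x * logsum r x = (\<Sum>k\<in>?K. A (x / real k) - c * (x / real k) * ln (x / real k) ^ r)"
        unfolding e by (simp only: sum_subtractf)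
      also have "\<bar>\<dots>\<bar> \<le> (\<Sum>k\<in>?K. \<bar>A (x / real k) - c * (x / real k) * ln (x / real k) ^ r\<bar>)" by (rule sum_abs)
      also have "\<dots> \<le> (\<Sum>k\<in>?K. \<epsilon> * (x / real k) * ln (x / real k) ^ r + D)" by (intro sum_mono bd arg(1)[OF x])
      also have "\<dots> = \<epsilon> * x * logsum r x + real (card ?K) * D" unfolding e by (simp add: sum.distrib)
      also have "real (card ?K) * D \<le> D * x" using nat_floor_bounds(2)[OF x] D by (simp add: mult.commute mult_left_mono)
      finally show ?thesis by simp
    qed
    thus ?thesis using D by blast
  qed
  have zero: "((\<lambda>x. ?S x / (x * ln x ^ Suc r) - c * (logsum r x / ln x ^ Suc r)) \<longlongrightarrow> 0) at_top"
  proof (rule tendstoI)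
    fix \<epsilon> :: real assume \<epsilon>: "\<epsilon> > 0"
    \<comment> \<open>A quarter is enough because \<open>logsum r x / ln x ^ Suc r\<close> is
      eventually below 2, its limit being at most 1.\<close>
    obtain D where D: "D \<ge> 0" "\<And>x. x \<ge> 1 \<Longrightarrow> \<bar>?S x - c * x * logsum r x\<bar> \<le> (\<epsilon> / 4) * x * logsum r x + D * x"
      using key[of "\<epsilon> / 4"] \<epsilon> by auto
    have "((\<lambda>x::real. inverse (ln x ^ Suc r)) \<longlongrightarrow> 0) at_top" by (intro tendsto_inverse_0_at_top filterlim_pow_at_top ln_at_top) simp
    from tendsto_mult_right_zero[OF this, of D] have "((\<lambda>x::real. D * inverse (ln x ^ Suc r)) \<longlongrightarrow> 0) at_top" by simp
    hence e1: "\<forall>\<^sub>F x::real in at_top. dist (D * inverse (ln x ^ Suc r)) 0 < \<epsilon> / 2" using \<epsilon> by (intro tendstoD) auto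
    have "\<forall>\<^sub>F x in at_top. dist (logsum r x / ln x ^ Suc r) (1 / real (Suc r)) < 1" by (rule tendstoD[OF logsum_limit]) simp
    hence e2: "\<forall>\<^sub>F x in at_top. logsum r x / ln x ^ Suc r < 2"
    proof eventually_elim
      case (elim x)
      have "1 / real (Suc r) \<le> 1" by simp
      thus ?case using elim unfolding dist_real_def by linarith
    qed
    have e3: "\<forall>\<^sub>F x::real in at_top. x > exp 1" by (rule eventually_gt_at_top)
    show "\<forall>\<^sub>F x in at_top. dist (?S x / (x * ln x ^ Suc r) - c * (logsum r x / ln x ^ Suc r)) 0 < \<epsilon>"
      using e1 e2 e3
    proof eventually_elim
      case (elim x)
      have x1: "x \<ge> 1" "x > 0" using elim(3) one_le_exp_iff[of 1] by linarith+
      have "ln x > 0" using elim(3) x1 one_le_exp_iff[of 1] by (intro ln_gt_zero) linarith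
      hence l: "ln x ^ Suc r > 0" by simp
      have q: "x * ln x ^ Suc r > 0" using x1 l by simp
      have "?S x / (x * ln x ^ Suc r) - c * (logsum r x / ln x ^ Suc r) = (?S x - c * x * logsum r x) / (x * ln x ^ Suc r)"
        using x1 l by (simp add: diff_divide_distrib mult_ac)
      hence "\<bar>?S x / (x * ln x ^ Suc r) - c * (logsum r x / ln x ^ Suc r)\<bar> = \<bar>?S x - c * x * logsum r x\<bar> / (x * ln x ^ Suc r)"
        using q by (simp only: abs_divide abs_of_pos)
      also have "\<dots> \<le> ((\<epsilon> / 4) * x * logsum r x + D * x) / (x * ln x ^ Suc r)" using D(2)[OF x1(1)] q by (intro divide_right_mono) auto
      also have "\<dots> = (\<epsilon> / 4) * (logsum r x / ln x ^ Suc r) + D * inverse (ln x ^ Suc r)"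
      proof -
        have gen: "(u * x * L + D * x) / (x * Q) = u * (L / Q) + D * inverse Q" if "Q \<noteq> 0" for u L Q :: real
          using that x1(2) by (simp add: add_divide_distrib inverse_eq_divide)
        show ?thesis by (rule gen) (use l in linarith)
      qed
      also have "\<dots> < (\<epsilon> / 4) * 2 + \<epsilon> / 2"
        using elim(1,2) \<epsilon> by (intro add_strict_mono mult_strict_left_mono) (auto simp: dist_real_def abs_less_iff simp del: power_Suc)
      finally show ?case using \<epsilon> by (simp add: dist_real_def)
    qed
  qed
  from tendsto_add[OF zero tendsto_mult_left[OF logsum_limit, of c r]]
  show "((\<lambda>x. ?S x / (x * ln x ^ Suc r)) \<longlongrightarrow> c / real (Suc r)) at_top" by simp
qed

text \<open>Dominated convergence for series: for fixed k the normalized term tends to c q k / k,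
  and the uniform bound in \<open>growth\<close> provides a summable majorant proportional to
  \<bar>q k\<bar> / k.\<close>

lemma conv_limit:
  assumes A: "growth A r c" and q: "summable (\<lambda>n. \<bar>q n\<bar> / real n)"
  shows "((\<lambda>x. (\<Sum>d\<in>{1..nat \<lfloor>x\<rfloor>}. q d * A (x / real d)) / (x * ln x ^ r)) \<longlongrightarrow> c * (\<Sum>n. q n / real n)) at_top"
proof -
  obtain C where C: "C \<ge> 0" "\<And>y. y \<ge> 1 \<Longrightarrow> \<bar>A y\<bar> \<le> C * y * (1 + ln y) ^ r" using A unfolding growth_def by blast
  have lim: "((\<lambda>x. A x / (x * ln x ^ r)) \<longlongrightarrow> c) at_top" using A unfolding growth_def by blast
  define a where "a k x = (if k \<in> {1..nat \<lfloor>x\<rfloor>} then q k * A (x / real k) / (x * ln x ^ r) else 0)" for k x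
  define M where "M k = C * 2 ^ r * (\<bar>q k\<bar> / real k)" for k
  have "((\<lambda>x. \<Sum>k. a k x) \<longlongrightarrow> (\<Sum>k. c * (q k / real k))) at_top"
  proof -
    have l1: "((\<lambda>x. a k x) \<longlongrightarrow> c * (q k / real k)) at_top" for k
    proof (cases "k = 0")
      \<comment> \<open>The index 0 contributes nothing: the finite sum starts at 1, and q 0 / 0 is
        0.\<close>
      case True thus ?thesis by (simp add: a_def)
    next
      case False
      hence k: "real k > 0" by simp
      have dk: "filterlim (\<lambda>x. x / real k) at_top at_top"
        using filterlim_tendsto_pos_mult_at_top[OF tendsto_const[of "1 / real k"] _ filterlim_ident] k by simp
      have t1: "((\<lambda>x. A (x / real k) / ((x / real k) * ln (x / real k) ^ r)) \<longlongrightarrow> c) at_top"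
        using filterlim_compose[OF lim dk] by simp
      have "((\<lambda>x::real. 1 - ln (real k) * inverse (ln x)) \<longlongrightarrow> 1 - ln (real k) * 0) at_top"
        by (intro tendsto_intros tendsto_inverse_0_at_top ln_at_top)
      hence t2: "((\<lambda>x::real. (1 - ln (real k) * inverse (ln x)) ^ r) \<longlongrightarrow> (1 - ln (real k) * 0) ^ r) at_top" by (rule tendsto_power)
      have t3: "((\<lambda>x. A (x / real k) / ((x / real k) * ln (x / real k) ^ r) * (1 - ln (real k) * inverse (ln x)) ^ r * (q k / real k)) \<longlongrightarrow> c * (1 - ln (real k) * 0) ^ r * (q k / real k)) at_top"
        by (intro tendsto_mult t1 t2 tendsto_const)
      have "\<forall>\<^sub>F x in at_top. A (x / real k) / ((x / real k) * ln (x / real k) ^ r) * (1 - ln (real k) * inverse (ln x)) ^ r * (q k / real k) = a k x"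
        using eventually_gt_at_top[of "max (exp 1) (real k + 1)"]
      proof eventually_elim
        case (elim x)
        have x: "x > 1" "x > real k" "x \<ge> real k" using elim one_le_exp_iff[of 1] by (auto simp: max_def split: if_splits)
        hence kin: "k \<in> {1..nat \<lfloor>x\<rfloor>}" using False by (simp add: le_nat_floor)
        have lx: "ln x > 0" using x by simp
        have lk: "ln (x / real k) = ln x - ln (real k)" using x k by (simp add: ln_div)
        have lk0: "ln (x / real k) > 0" using x k by (intro ln_gt_zero) simp
        have "(1 - ln (real k) * inverse (ln x)) = ln (x / real k) / ln x" unfolding lk using lx by (simp add: field_simps)
        hence "(1 - ln (real k) * inverse (ln x)) ^ r = ln (x / real k) ^ r / ln x ^ r" by (simp only: power_divide)
        thus ?case using kin lk0 lx x k by (simp add: a_def field_simps)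
      qed
      thus ?thesis using t3 by (simp add: tendsto_cong)
    qed
    \<comment> \<open>For x > exp 1 one has ln x \<ge> 1 and hence 1 + ln (x / k) \<le> 2 ln x; this
      is the source of the factor \<open>2 ^ r\<close> in M.\<close>
    have bd: "norm (a k x) \<le> M k" if x: "x > exp 1" for k x
    proof (cases "k \<in> {1..nat \<lfloor>x\<rfloor>}")
      case True
      have x1: "x \<ge> 1" "x > 0" using x one_le_exp_iff[of 1] by linarith+
      have lx: "ln x \<ge> 1" using x by (metis exp_gt_zero less_imp_le less_trans ln_exp ln_le_cancel_iff)
      note k = floor_range[OF x1(1) True]
      have y: "x / real k \<ge> 1" "x / real k \<le> x" using k x1 by (auto simp: field_simps mult_le_cancel_left1)
      have "\<bar>A (x / real k)\<bar> \<le> C * (x / real k) * (1 + ln (x / real k)) ^ r" by (rule C(2)[OF y(1)])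
      also have "\<dots> \<le> C * (x / real k) * (2 * ln x) ^ r"
      proof (intro mult_left_mono power_mono)
        have "ln (x / real k) \<le> ln x" using y x1 by simp
        thus "1 + ln (x / real k) \<le> 2 * ln x" using lx by linarith
        show "0 \<le> 1 + ln (x / real k)" using y by (simp add: add_nonneg_nonneg)
        show "0 \<le> C * (x / real k)" using C(1) x1 by simp
      qed
      finally have b: "\<bar>A (x / real k)\<bar> \<le> C * 2 ^ r * (x * ln x ^ r) / real k" by (simp add: power_mult_distrib mult_ac)
      have q0: "x * ln x ^ r > 0" using x1 lx by (intro mult_pos_pos zero_less_power) linarith+
      have "norm (a k x) = \<bar>q k\<bar> * \<bar>A (x / real k)\<bar> / (x * ln x ^ r)" 
        using True q0 abs_of_pos[OF q0] by (simp only: a_def if_True real_norm_def abs_divide abs_mult[of "q k"])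
      also have "\<dots> \<le> \<bar>q k\<bar> * (C * 2 ^ r * (x * ln x ^ r) / real k) / (x * ln x ^ r)"
        using b q0 by (intro divide_right_mono mult_left_mono) auto
      also have "\<dots> = M k"
      proof -
        have gen: "u * (w * Q / t) / Q = w * (u / t)" if "Q \<noteq> 0" for u w Q t :: real using that by simp
        show ?thesis unfolding M_def by (rule gen) (use q0 in linarith)
      qed
      finally show ?thesis .
    next
      case False
      hence "a k x = 0" by (simp only: a_def if_False)
      thus ?thesis unfolding M_def using C(1) by simp
    qed
    have "eventually (\<lambda>(k, x). norm (a k x) \<le> M k) (at_top \<times>\<^sub>F at_top)"
      unfolding eventually_prod_filter
      by (rule exI[of _ "\<lambda>_. True"], rule exI[of _ "\<lambda>x. x > exp 1"]) (use bd eventually_gt_at_top[of "exp 1 :: real"] in auto)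
    moreover have "summable M" unfolding M_def by (intro summable_mult q)
    ultimately show ?thesis using tannerys_theorem[OF l1] by simp
  qed
  moreover have "(\<Sum>k. a k x) = (\<Sum>d\<in>{1..nat \<lfloor>x\<rfloor>}. q d * A (x / real d)) / (x * ln x ^ r)" for x
  proof -
    have "(\<Sum>k. a k x) = (\<Sum>k\<in>{1..nat \<lfloor>x\<rfloor>}. a k x)" by (rule suminf_finite) (auto simp: a_def)
    thus ?thesis by (simp add: a_def sum_divide_distrib)
  qed
  moreover have "(\<Sum>k. c * (q k / real k)) = c * (\<Sum>n. q n / real n)"
  proof (rule suminf_mult)
    show "summable (\<lambda>n. q n / real n)"
      by (rule summable_comparison_test'[OF q, of 0]) (simp add: abs_divide)
  qed
  ultimately show ?thesis by simp
qed

section \<open>Convolutions with the constant function 1\<close>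

definition one_fn :: "nat \<Rightarrow> real" where "one_fn n = (if n = 0 then 0 else 1)"

lemma mult_fun_one_fn: "mult_fun one_fn"
  by (auto simp: mult_fun_def one_fn_def)

lemma one_fn_prime_power: "prime p \<Longrightarrow> one_fn (p ^ e) = 1"
  by (simp add: one_fn_def)

text \<open>\<open>g\<close> convolved with j + 1 copies of the constant function; the shift matches
  the growth x (ln x)^j. The first copy stands on the right so that \<open>conv_limit\<close>
  applies to the floor function, the others on the left so that each is one
  \<open>growth_step\<close>.\<close>

fun dchain :: "(nat \<Rightarrow> real) \<Rightarrow> nat \<Rightarrow> nat \<Rightarrow> real" where
  "dchain g 0 = conv g one_fn"
| "dchain g (Suc j) = conv one_fn (dchain g j)"

lemma mult_fun_dchain: "mult_fun g \<Longrightarrow> mult_fun (dchain g j)"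
  by (induction j) (auto intro: mult_fun_conv mult_fun_one_fn)

lemma summ_one_fn: "x \<ge> 0 \<Longrightarrow> summ one_fn x = real (nat \<lfloor>x\<rfloor>)"
  by (simp add: summ_def one_fn_def)

lemma growth_floor: "growth (summ one_fn) 0 1"
  unfolding growth_def
proof
  have "((\<lambda>x::real. 1 - inverse x) \<longlongrightarrow> 1 - 0) at_top"
    by (intro tendsto_intros tendsto_inverse_0_at_top filterlim_ident)
  hence lo: "((\<lambda>x::real. 1 - inverse x) \<longlongrightarrow> 1) at_top" by simp
  show "((\<lambda>x. summ one_fn x / (x * ln x ^ 0)) \<longlongrightarrow> 1) at_top"
  proof (rule tendsto_sandwich[OF _ _ lo tendsto_const])
    show "\<forall>\<^sub>F x in at_top. 1 - inverse x \<le> summ one_fn x / (x * ln x ^ 0)"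
      using eventually_ge_at_top[of 1]
    proof eventually_elim
      case (elim x)
      have "x - 1 \<le> real (nat \<lfloor>x\<rfloor>)" using nat_floor_bounds(3)[OF elim] by linarith
      hence "(x - 1) / x \<le> real (nat \<lfloor>x\<rfloor>) / x" using elim by (intro divide_right_mono) auto
      moreover have "(x - 1) / x = 1 - inverse x" using elim by (simp add: field_simps)
      ultimately show ?case using summ_one_fn[of x] elim by simp
    qed
    show "\<forall>\<^sub>F x in at_top. summ one_fn x / (x * ln x ^ 0) \<le> 1"
      using eventually_ge_at_top[of 1]
    proof eventually_elim
      case (elim x)
      have "real (nat \<lfloor>x\<rfloor>) / x \<le> 1" using nat_floor_bounds(2)[OF elim] elim by (simp add: divide_le_eq_1)
      thus ?case using summ_one_fn[of x] elim by simp
    qed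
  qed
  show "\<exists>C\<ge>0. \<forall>y\<ge>1. \<bar>summ one_fn y\<bar> \<le> C * y * (1 + ln y) ^ 0"
  proof (intro exI[of _ 1] conjI allI impI)
    fix y :: real assume y: "y \<ge> 1"
    thus "\<bar>summ one_fn y\<bar> \<le> 1 * y * (1 + ln y) ^ 0"
      using nat_floor_bounds(2)[OF y] summ_one_fn[of y] by simp
  qed simp
qed

text \<open>The first convolution gives the constant as the sum of g n / n; the successive divisions
  by 1, ..., j in \<open>growth_step\<close> produce the factorial.\<close>

lemma growth_dchain:
  assumes q: "summable (\<lambda>n. \<bar>g n\<bar> / real n)"
  shows "growth (summ (dchain g j)) j ((\<Sum>n. g n / real n) / fact j)"
proof (induction j)
  case 0
  let ?A = "\<lambda>x. \<Sum>d\<in>{1..nat \<lfloor>x\<rfloor>}. g d * summ one_fn (x / real d)"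
  have eq: "summ (dchain g 0) x = ?A x" if "x \<ge> 0" for x using summ_conv[OF that] by simp
  show ?case unfolding growth_def
  proof
    have "((\<lambda>x. ?A x / (x * ln x ^ 0)) \<longlongrightarrow> 1 * (\<Sum>n. g n / real n)) at_top" by (rule conv_limit[OF growth_floor q])
    moreover have "\<forall>\<^sub>F x in at_top. ?A x / (x * ln x ^ 0) = summ (dchain g 0) x / (x * ln x ^ 0)"
      using eventually_ge_at_top[of 0] by eventually_elim (simp only: eq)
    ultimately have "((\<lambda>x. summ (dchain g 0) x / (x * ln x ^ 0)) \<longlongrightarrow> 1 * (\<Sum>n. g n / real n)) at_top"
      by (rule Lim_transform_eventually)
    thus "((\<lambda>x. summ (dchain g 0) x / (x * ln x ^ 0)) \<longlongrightarrow> (\<Sum>n. g n / real n) / fact 0) at_top" by simp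
    let ?C = "\<Sum>n. \<bar>g n\<bar> / real n"
    show "\<exists>C\<ge>0. \<forall>y\<ge>1. \<bar>summ (dchain g 0) y\<bar> \<le> C * y * (1 + ln y) ^ 0"
    proof (intro exI[of _ ?C] conjI allI impI)
      show "?C \<ge> 0" by (intro suminf_nonneg q) simp
      fix y :: real assume y: "y \<ge> 1"
      have "\<bar>?A y\<bar> \<le> (\<Sum>d\<in>{1..nat \<lfloor>y\<rfloor>}. \<bar>g d * summ one_fn (y / real d)\<bar>)" by (rule sum_abs)
      also have "\<dots> \<le> (\<Sum>d\<in>{1..nat \<lfloor>y\<rfloor>}. (\<bar>g d\<bar> / real d) * y)"
      proof (rule sum_mono)
        fix d assume "d \<in> {1..nat \<lfloor>y\<rfloor>}"
        hence d: "real d \<ge> 1" "real d \<le> y" using floor_range[OF y] by auto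
        have yd: "y / real d \<ge> 1" using d by (simp add: field_simps)
        have "\<bar>summ one_fn (y / real d)\<bar> \<le> y / real d"
          using summ_one_fn[of "y / real d"] nat_floor_bounds(2)[OF yd] yd by simp
        hence "\<bar>g d\<bar> * \<bar>summ one_fn (y / real d)\<bar> \<le> \<bar>g d\<bar> * (y / real d)" by (rule mult_left_mono) simp
        thus "\<bar>g d * summ one_fn (y / real d)\<bar> \<le> (\<bar>g d\<bar> / real d) * y" by (simp add: abs_mult)
      qed
      also have "\<dots> = (\<Sum>d\<in>{1..nat \<lfloor>y\<rfloor>}. \<bar>g d\<bar> / real d) * y" by (simp only: sum_distrib_right)
      also have "\<dots> \<le> ?C * y" using y by (intro mult_right_mono sum_le_suminf q) auto
      finally show "\<bar>summ (dchain g 0) y\<bar> \<le> ?C * y * (1 + ln y) ^ 0" using eq[of y] y by simp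
    qed
  qed
next
  case (Suc j)
  have st: "growth (\<lambda>x. \<Sum>k\<in>{1..nat \<lfloor>x\<rfloor>}. summ (dchain g j) (x / real k)) (Suc j) ((\<Sum>n. g n / real n) / fact j / real (Suc j))"
    by (rule growth_step[OF Suc])
  have eq: "(\<Sum>k\<in>{1..nat \<lfloor>x\<rfloor>}. summ (dchain g j) (x / real k)) = summ (dchain g (Suc j)) x" if "x \<ge> 0" for x
    unfolding dchain.simps summ_conv[OF that] by (intro sum.cong) (auto simp: one_fn_def)
  have "((\<lambda>x. summ (dchain g (Suc j)) x / (x * ln x ^ Suc j)) \<longlongrightarrow> (\<Sum>n. g n / real n) / fact j / real (Suc j)) at_top"
  proof (rule Lim_transform_eventually)
    show "((\<lambda>x. (\<Sum>k\<in>{1..nat \<lfloor>x\<rfloor>}. summ (dchain g j) (x / real k)) / (x * ln x ^ Suc j)) \<longlongrightarrow> (\<Sum>n. g n / real n) / fact j / real (Suc j)) at_top"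
      using st unfolding growth_def by blast
    show "\<forall>\<^sub>F x in at_top. (\<Sum>k\<in>{1..nat \<lfloor>x\<rfloor>}. summ (dchain g j) (x / real k)) / (x * ln x ^ Suc j) = summ (dchain g (Suc j)) x / (x * ln x ^ Suc j)"
      using eventually_ge_at_top[of 0] by eventually_elim (simp only: eq)
  qed
  moreover obtain C where "C \<ge> 0" "\<And>y. y \<ge> 1 \<Longrightarrow> \<bar>\<Sum>k\<in>{1..nat \<lfloor>y\<rfloor>}. summ (dchain g j) (y / real k)\<bar> \<le> C * y * (1 + ln y) ^ Suc j"
    using st unfolding growth_def by blast
  hence "\<exists>C\<ge>0. \<forall>y\<ge>1. \<bar>summ (dchain g (Suc j)) y\<bar> \<le> C * y * (1 + ln y) ^ Suc j" using eq by (intro exI[of _ C]) simp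
  moreover have "(\<Sum>n. g n / real n) / fact j / real (Suc j) = (\<Sum>n. g n / real n) / fact (Suc j)" by (simp add: field_simps)
  ultimately show ?case unfolding growth_def by (simp only: simp_thms)
qed

lemma sum_prime_power_bound:
  fixes b :: "nat \<Rightarrow> real"
  assumes a: "a < -1" and b: "summable b" "\<And>e. b e \<ge> 0"
    and u: "\<And>p e. prime p \<Longrightarrow> e \<ge> 1 \<Longrightarrow> u p e \<le> b e * real p powr a"
  shows "\<exists>B. \<forall>N. (\<Sum>p | prime p \<and> p \<le> N. \<Sum>e\<in>{1..N}. u p e) \<le> B"
proof -
  let ?Z = "\<Sum>n. real n powr a"
  have sZ: "summable (\<lambda>n. real n powr a)" using a by (simp add: summable_real_powr_iff)
  have "(\<Sum>p | prime p \<and> p \<le> N. \<Sum>e\<in>{1..N}. u p e) \<le> ?Z * suminf b" for N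
  proof -
    have "(\<Sum>p | prime p \<and> p \<le> N. \<Sum>e\<in>{1..N}. u p e) \<le> (\<Sum>p | prime p \<and> p \<le> N. \<Sum>e\<in>{1..N}. b e * real p powr a)"
      by (intro sum_mono u) auto
    also have "\<dots> = (\<Sum>p | prime p \<and> p \<le> N. real p powr a) * (\<Sum>e\<in>{1..N}. b e)"
      by (simp only: sum_distrib_left[symmetric] sum_distrib_right[symmetric] mult.commute)
    also have "\<dots> \<le> ?Z * suminf b"
    proof (intro mult_mono)
      have "finite {p::nat. prime p \<and> p \<le> N}" by (rule finite_subset[of _ "{..N}"]) auto
      thus "(\<Sum>p | prime p \<and> p \<le> N. real p powr a) \<le> ?Z" by (intro sum_le_suminf sZ) auto
      show "(\<Sum>e\<in>{1..N}. b e) \<le> suminf b" using b by (intro sum_le_suminf) auto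
      show "0 \<le> ?Z" by (intro suminf_nonneg sZ) simp
      show "0 \<le> (\<Sum>e\<in>{1..N}. b e)" using b(2) by (intro sum_nonneg) auto
    qed
    finally show ?thesis .
  qed
  thus ?thesis by blast
qed

text \<open>The local sums start at p^2, where the bound after division by \<open>p ^ e\<close> is a
  summable function of e times p^(-3/2), and the latter is summable over primes.\<close>

lemma summable_local:
  assumes u: "mult_fun u" and u1: "\<And>p. prime p \<Longrightarrow> u p = 0"
    and b: "summable b" "\<And>e. b e \<ge> 0"
    and u2: "\<And>p e. prime p \<Longrightarrow> e \<ge> 2 \<Longrightarrow> \<bar>u (p ^ e)\<bar> \<le> b e * real p ^ e * real p powr (-3/2)"
  shows "summable (\<lambda>n. \<bar>u n\<bar> / real n)"
proof -
  let ?h = "\<lambda>n. \<bar>u n\<bar> / real n"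
  have m: "mult_fun ?h" using u unfolding mult_fun_def by (auto simp: abs_mult)
  have "?h (p ^ e) \<le> b e * real p powr (-3/2)" if p: "prime p" and e: "e \<ge> 1" for p e
  proof (cases "e = 1")
    case True thus ?thesis using u1[OF p] b(2) by simp
  next
    case False
    hence "\<bar>u (p ^ e)\<bar> \<le> b e * real p ^ e * real p powr (-3/2)" using u2[OF p, of e] e by simp
    hence "\<bar>u (p ^ e)\<bar> / real p ^ e \<le> (b e * real p ^ e * real p powr (-3/2)) / real p ^ e" by (rule divide_right_mono) simp
    thus ?thesis using prime_gt_0_nat[OF p] by simp
  qed
  from sum_prime_power_bound[OF _ b this] obtain B where "\<And>N. (\<Sum>p | prime p \<and> p \<le> N. \<Sum>e\<in>{1..N}. ?h (p ^ e)) \<le> B" by auto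
  thus ?thesis by (intro summable_mult_fun[OF m]) auto
qed

text \<open>The coefficients at \<open>p ^ e\<close> of the local factor \<open>(\<Sum>e. f p e X ^ e) * (1 - X) ^ r\<close>, that is, of the Euler
  factor divided by \<open>r\<close> zeta factors.\<close>

primrec zeta_quot :: "(nat \<Rightarrow> nat \<Rightarrow> real) \<Rightarrow> nat \<Rightarrow> nat \<Rightarrow> nat \<Rightarrow> real" where
  "zeta_quot f 0 = f"
| "zeta_quot f (Suc r) = (\<lambda>p e. if e = 0 then 1 else zeta_quot f r p e - zeta_quot f r p (e - 1))"

lemma zeta_quot_0: "f p 0 = 1 \<Longrightarrow> zeta_quot f r p 0 = 1"
  by (cases r) auto

lemma zeta_quot_telescope:
  assumes "f p 0 = 1" shows "(\<Sum>i\<le>e. zeta_quot f (Suc r) p i) = zeta_quot f r p e"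
  by (induction e) (use zeta_quot_0[of f p, OF assms] in auto)

lemma zeta_quot_1: "f p 0 = 1 \<Longrightarrow> zeta_quot f r p 1 = f p 1 - real r"
  by (induction r) (auto simp: zeta_quot_0)

text \<open>Each step subtracts the preceding coefficient, for which the bound with smaller
  \<open>p ^ (e - 1)\<close> is more than enough. Only e = 2 sees the coefficient at p, which lies
  outside the bound; it equals m - r, and p^2 p^(-3/2) \<ge> 1 absorbs it.\<close>

lemma zeta_quot_bound:
  fixes m :: nat
  assumes f0: "\<And>p. prime p \<Longrightarrow> f p 0 = 1" and f1: "\<And>p. prime p \<Longrightarrow> f p 1 = real m"
    and b: "summable b" "\<And>e. b e \<ge> 0"
    and f2: "\<And>p e. prime p \<Longrightarrow> e \<ge> 2 \<Longrightarrow> \<bar>f p e\<bar> \<le> b e * real p ^ e * real p powr (-3/2)"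
    and r: "r \<le> m"
  shows "\<exists>b'. summable b' \<and> (\<forall>e. b' e \<ge> 0) \<and> (\<forall>p e. prime p \<longrightarrow> e \<ge> 2 \<longrightarrow> \<bar>zeta_quot f r p e\<bar> \<le> b' e * real p ^ e * real p powr (-3/2))"
  using r
proof (induction r)
  case 0
  show ?case using b f2 by (intro exI[of _ b]) auto
next
  case (Suc r)
  then obtain b' where b': "summable b'" "\<And>e. b' e \<ge> 0"
    "\<And>p e. prime p \<Longrightarrow> e \<ge> 2 \<Longrightarrow> \<bar>zeta_quot f r p e\<bar> \<le> b' e * real p ^ e * real p powr (-3/2)" by auto
  define b'' where "b'' e = b' e + b' (e - 1) + (if e = 2 then real m else 0)" for e
  have "summable (\<lambda>e. b' (Suc e - 1))" using b'(1) by simp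
  hence "summable (\<lambda>e. b' (e - 1))" by (subst (asm) summable_Suc_iff)
  hence "summable b''" unfolding b''_def using b'(1) by (intro summable_add summable_single) auto
  moreover have "b'' e \<ge> 0" for e unfolding b''_def using b'(2) by simp
  moreover have "\<bar>zeta_quot f (Suc r) p e\<bar> \<le> b'' e * real p ^ e * real p powr (-3/2)" if p: "prime p" and e: "e \<ge> 2" for p e
  proof -
    have p1: "real p \<ge> 1" using prime_ge_1_nat[OF p] by simp
    let ?w = "real p ^ e * real p powr (-3/2)"
    have w: "?w \<ge> 0" by simp
    have "\<bar>zeta_quot f (Suc r) p e\<bar> \<le> \<bar>zeta_quot f r p e\<bar> + \<bar>zeta_quot f r p (e - 1)\<bar>" using e by simp
    also have "\<bar>zeta_quot f r p e\<bar> \<le> b' e * ?w" using b'(3)[OF p e] by (simp only: mult.assoc)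
    also have "\<bar>zeta_quot f r p (e - 1)\<bar> \<le> (b' (e - 1) + (if e = 2 then real m else 0)) * ?w"
    proof (cases "e = 2")
      case True
      have "\<bar>zeta_quot f r p (e - 1)\<bar> = real m - real r" using True zeta_quot_1[of f p r, OF f0[OF p]] f1[OF p] Suc.prems by simp
      also have "\<dots> \<le> real m * 1" by simp
      also have "\<dots> \<le> real m * ?w"
      proof (rule mult_left_mono)
        have "?w = real p powr 2 * real p powr (-3/2)" using True p1 by (simp add: powr_numeral)
        also have "\<dots> = real p powr (1/2)" by (simp only: powr_add[symmetric]) simp
        also have "\<dots> \<ge> 1" using p1 by (intro ge_one_powr_ge_zero) auto
        finally show "1 \<le> ?w" .
      qed simp
      also have "\<dots> \<le> (b' (e - 1) + (if e = 2 then real m else 0)) * ?w"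
        using True b'(2)[of "e - 1"] w by (intro mult_right_mono) auto
      finally show ?thesis .
    next
      case False
      hence "e - 1 \<ge> 2" using e by simp
      hence "\<bar>zeta_quot f r p (e - 1)\<bar> \<le> b' (e - 1) * (real p ^ (e - 1) * real p powr (-3/2))" using b'(3)[OF p] by (simp only: mult.assoc)
      also have "\<dots> \<le> b' (e - 1) * ?w" using p1 b'(2) by (intro mult_left_mono mult_right_mono power_increasing) auto
      finally show ?thesis using False by simp
    qed
    finally show ?thesis unfolding b''_def by (simp only: distrib_right mult.assoc add.assoc)
  qed
  ultimately show ?case by blast
qed

lemma mult_extend_zeta_quot_step:
  assumes f0: "\<And>p. prime p \<Longrightarrow> f p 0 = 1"
  shows "conv one_fn (mult_extend (zeta_quot f (Suc r))) = mult_extend (zeta_quot f r)" "conv (mult_extend (zeta_quot f (Suc r))) one_fn = mult_extend (zeta_quot f r)"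
proof -
  have v: "mult_extend (zeta_quot f r) (p ^ e) = zeta_quot f r p e" if "prime p" for p e r by (rule mult_extend_prime_power[of p "zeta_quot f r", OF that zeta_quot_0[of f p, OF f0[OF that]]])
  have s: "(\<Sum>i\<le>e. zeta_quot f (Suc r) p (e - i)) = (\<Sum>i\<le>e. zeta_quot f (Suc r) p i)" for p e
    using sum.nat_diff_reindex[of "zeta_quot f (Suc r) p" "Suc e"] by (simp only: lessThan_Suc_atMost diff_Suc_Suc) 
  show "conv one_fn (mult_extend (zeta_quot f (Suc r))) = mult_extend (zeta_quot f r)"
  proof (rule ext, rule mult_fun_eq)
    fix p e :: nat assume p: "prime p"
    have "conv one_fn (mult_extend (zeta_quot f (Suc r))) (p ^ e) = (\<Sum>i\<le>e. zeta_quot f (Suc r) p (e - i))"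
      unfolding conv_prime_power[OF p] one_fn_prime_power[OF p] v[OF p] by simp
    thus "conv one_fn (mult_extend (zeta_quot f (Suc r))) (p ^ e) = mult_extend (zeta_quot f r) (p ^ e)"
      unfolding s zeta_quot_telescope[of f p, OF f0[OF p]] v[OF p] .
  qed (intro mult_fun_conv mult_fun_one_fn mult_fun_mult_extend)+
  show "conv (mult_extend (zeta_quot f (Suc r))) one_fn = mult_extend (zeta_quot f r)"
  proof (rule ext, rule mult_fun_eq)
    fix p e :: nat assume p: "prime p"
    have "conv (mult_extend (zeta_quot f (Suc r))) one_fn (p ^ e) = (\<Sum>i\<le>e. zeta_quot f (Suc r) p i)"
      unfolding conv_prime_power[OF p] one_fn_prime_power[OF p] v[OF p] by simp
    thus "conv (mult_extend (zeta_quot f (Suc r))) one_fn (p ^ e) = mult_extend (zeta_quot f r) (p ^ e)"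
      unfolding zeta_quot_telescope[of f p, OF f0[OF p]] v[OF p] .
  qed (intro mult_fun_conv mult_fun_one_fn mult_fun_mult_extend)+
qed

text \<open>Every convolution with the constant function undoes one division by a zeta
  factor.\<close>

lemma dchain_zeta_quot:
  assumes f0: "\<And>p. prime p \<Longrightarrow> f p 0 = 1" and "j < m"
  shows "dchain (mult_extend (zeta_quot f m)) j = mult_extend (zeta_quot f (m - Suc j))"
  using assms(2)
proof (induction j)
  case 0
  then obtain m' where "m = Suc m'" by (cases m) auto
  thus ?case using mult_extend_zeta_quot_step(2)[of f m', OF f0] by simp
next
  case (Suc j)
  have "m - Suc j = Suc (m - Suc (Suc j))" using Suc.prems by simp
  hence "dchain (mult_extend (zeta_quot f m)) (Suc j) = conv one_fn (mult_extend (zeta_quot f (Suc (m - Suc (Suc j)))))" using Suc by simp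
  thus ?case using mult_extend_zeta_quot_step(1)[of f "m - Suc (Suc j)", OF f0] by simp
qed

text \<open>The unit of Dirichlet convolution, so that \<open>dchain delta_fn j\<close> is the (j +
  1)-fold divisor function.\<close>

definition delta_fn :: "nat \<Rightarrow> real" where "delta_fn n = (if n = 1 then 1 else 0)"

lemma mult_fun_delta: "mult_fun delta_fn"
  by (auto simp: mult_fun_def delta_fn_def)

lemma delta_prime_power: "prime p \<Longrightarrow> delta_fn (p ^ e) = (if e = 0 then 1 else 0)"
  using prime_gt_1_nat[of p] by (auto simp: delta_fn_def)

lemma dchain_delta_bounds:
  assumes p: "prime p"
  shows "0 \<le> dchain delta_fn j (p ^ e) \<and> dchain delta_fn j (p ^ e) \<le> real (Suc e) ^ Suc j \<and> dchain delta_fn j p = real (Suc j)"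
proof (induction j arbitrary: e)
  case 0
  have e: "dchain delta_fn 0 (p ^ e) = 1" for e
    by (simp add: conv_prime_power[OF p] one_fn_prime_power[OF p] delta_prime_power[OF p])
  show ?case using e[of e] e[of 1] by simp
next
  case (Suc j)
  have v: "dchain delta_fn (Suc j) (p ^ e) = (\<Sum>i\<le>e. dchain delta_fn j (p ^ (e - i)))" for e
    by (simp add: conv_prime_power[OF p] one_fn_prime_power[OF p])
  have "dchain delta_fn (Suc j) (p ^ e) \<le> (\<Sum>i\<le>e. real (Suc e) ^ Suc j)" unfolding v
  proof (rule sum_mono)
    fix i
    have "dchain delta_fn j (p ^ (e - i)) \<le> real (Suc (e - i)) ^ Suc j" using Suc by blast
    also have "\<dots> \<le> real (Suc e) ^ Suc j" by (intro power_mono) auto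
    finally show "dchain delta_fn j (p ^ (e - i)) \<le> real (Suc e) ^ Suc j" .
  qed
  hence 1: "dchain delta_fn (Suc j) (p ^ e) \<le> real (Suc e) ^ Suc (Suc j)" by simp
  have 2: "0 \<le> dchain delta_fn (Suc j) (p ^ e)" unfolding v using Suc by (intro sum_nonneg) blast
  have "dchain delta_fn (Suc j) (p ^ 1) = dchain delta_fn j (p ^ 1) + dchain delta_fn j (p ^ 0)" unfolding v by simp
  moreover have "dchain delta_fn j 1 = 1" using mult_fun_1[OF mult_fun_dchain[OF mult_fun_delta]] .
  ultimately have "dchain delta_fn (Suc j) p = real (Suc j) + 1" using Suc by simp
  thus ?case using 1 2 by simp
qed

text \<open>The limit is the sum of g n / n divided by a factorial, and its positivity comes from a
  lower bound: the m-fold divisor function d is at most \<open>conv q h\<close> for some q \<ge> 0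
  with convergent sum of q n / n. Comparing limits, c times that sum is at least 1 / (m - 1)!, so c
  cannot be zero or negative.\<close>

theorem mult_fun_summatory_asymptotics:
  fixes h :: "nat \<Rightarrow> real"
  assumes h: "mult_fun h" "\<And>n. h n \<ge> 0" and m: "m \<ge> 1" and h1: "\<And>p. prime p \<Longrightarrow> h p = real m"
    and b: "summable b" "\<And>e. b e \<ge> 0"
    and h2: "\<And>p e. prime p \<Longrightarrow> e \<ge> 2 \<Longrightarrow> h (p ^ e) \<le> b e * real p ^ e * real p powr (-3/2)"
  shows "\<exists>c>0. ((\<lambda>x. summ h x / (x * ln x ^ (m - 1))) \<longlongrightarrow> c) at_top"
proof -
  define f where "f p e = h (p ^ e)" for p e
  have f0: "f p 0 = 1" for p using mult_fun_1[OF h(1)] by (simp add: f_def)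
  have f1: "f p 1 = real m" if "prime p" for p using h1[OF that] by (simp add: f_def)
  define g where "g = mult_extend (zeta_quot f m)"
  obtain b' where b': "summable b'" "\<And>e. b' e \<ge> 0"
    "\<And>p e. prime p \<Longrightarrow> e \<ge> 2 \<Longrightarrow> \<bar>zeta_quot f m p e\<bar> \<le> b' e * real p ^ e * real p powr (-3/2)"
    using zeta_quot_bound[of f m b m, OF f0 f1 b] h2 h(2) unfolding f_def by auto
  have gv: "g (p ^ e) = zeta_quot f m p e" if "prime p" for p e unfolding g_def by (rule mult_extend_prime_power[of p "zeta_quot f m", OF that zeta_quot_0[of f p, OF f0]])
  have sg: "summable (\<lambda>n. \<bar>g n\<bar> / real n)"
  proof (rule summable_local[OF _ _ b'(1,2)])
    show "mult_fun g" unfolding g_def by (rule mult_fun_mult_extend)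
    show "g p = 0" if "prime p" for p using gv[OF that, of 1] zeta_quot_1[of f p m, OF f0] f1[OF that] by simp
    show "\<bar>g (p ^ e)\<bar> \<le> b' e * real p ^ e * real p powr (-3/2)" if "prime p" "e \<ge> 2" for p e using b'(3)[OF that] gv[OF that(1)] by simp
  qed
  have "dchain g (m - 1) = mult_extend (zeta_quot f 0)" unfolding g_def using dchain_zeta_quot[of f "m - 1" m, OF f0] m by simp
  also have "\<dots> = h"
  proof (rule ext, rule mult_fun_eq[OF mult_fun_mult_extend h(1)])
    fix p e :: nat assume "prime p"
    thus "mult_extend (zeta_quot f 0) (p ^ e) = h (p ^ e)" using mult_extend_prime_power[of p "zeta_quot f 0" e] f0 by (simp add: f_def)
  qed
  finally have hg: "growth (summ h) (m - 1) ((\<Sum>n. g n / real n) / fact (m - 1))" using growth_dchain[OF sg, of "m - 1"] by simp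
  define c where "c = (\<Sum>n. g n / real n) / fact (m - 1)"
  define d where "d = dchain delta_fn (m - 1)"
  have sd: "(\<Sum>n. delta_fn n / real n) = 1" "summable (\<lambda>n. \<bar>delta_fn n\<bar> / real n)"
  proof -
    have "(\<Sum>n. delta_fn n / real n) = (\<Sum>n\<in>{1}. delta_fn n / real n)" by (rule suminf_finite) (auto simp: delta_fn_def)
    thus "(\<Sum>n. delta_fn n / real n) = 1" by (simp add: delta_fn_def)
    show "summable (\<lambda>n. \<bar>delta_fn n\<bar> / real n)" by (rule summable_finite[of "{1}"]) (auto simp: delta_fn_def)
  qed
  have dg: "growth (summ d) (m - 1) (1 / fact (m - 1))" using growth_dchain[OF sd(2), of "m - 1"] sd(1) unfolding d_def by simp
  \<comment> \<open>Chosen so that \<open>conv q h\<close> dominates d at every prime power: at p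
    the term h p already equals d p, and at higher powers the term q (p^e) h 1 equals d (p^e).
    Vanishing at primes makes the sum of q n / n converge.\<close>
  define q where "q = mult_extend (\<lambda>p e. if e = 0 then 1 else if e = 1 then 0 else d (p ^ e))"
  have qv: "q (p ^ e) = (if e = 0 then 1 else if e = 1 then 0 else d (p ^ e))" if "prime p" for p e
    unfolding q_def by (subst mult_extend_prime_power[OF that]) auto
  have mq: "mult_fun q" unfolding q_def by (rule mult_fun_mult_extend)
  have dpos: "0 \<le> d (p ^ e)" "d (p ^ e) \<le> real (Suc e) ^ m" "d p = real m" if "prime p" for p e
    using dchain_delta_bounds[OF that, of "m - 1" e] m unfolding d_def by auto
  have qpos: "0 \<le> q n" for n using mult_fun_le[OF mq mq] qv dpos by simp
  have sq: "summable (\<lambda>n. \<bar>q n\<bar> / real n)"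
  proof (rule summable_local[OF mq])
    show "q p = 0" if "prime p" for p using qv[OF that, of 1] by simp
    \<comment> \<open>The second factor is the inverse of the least value of \<open>p ^ e\<close>
      times p^(-3/2) over primes, attained at p = 2; the first bounds d.\<close>
    define b2 where "b2 e = real (Suc e) ^ m * (2 powr (3/2) * (1/2) ^ e)" for e
    show "b2 e \<ge> 0" for e unfolding b2_def by simp
    have "summable (\<lambda>e. real (Suc e) ^ m * (1/2) ^ e)"
    proof -
      have "summable (\<lambda>e. (1/2 :: real) ^ Suc e * real (Suc e) ^ m)"
      proof -
        have "summable (\<lambda>n. real n ^ m * (1/2) ^ n)"
        proof (rule summable_comparison_test_bigo[of "\<lambda>n. (3/4 :: real) ^ n"])
          show "summable (\<lambda>n. norm ((3/4 :: real) ^ n))" by (simp add: summable_geometric)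
          show "(\<lambda>n. real n ^ m * (1/2) ^ n) \<in> O(\<lambda>n. (3/4) ^ n)" by real_asymp
        qed
        hence "summable (\<lambda>n. real (Suc n) ^ m * (1/2) ^ Suc n)" by (subst summable_Suc_iff)
        thus ?thesis by (simp add: mult.commute)
      qed
      hence "summable (\<lambda>e. 2 * ((1/2 :: real) ^ Suc e * real (Suc e) ^ m))" by (rule summable_mult)
      thus ?thesis by (simp add: mult.commute)
    qed
    hence "summable (\<lambda>e. 2 powr (3/2) * (real (Suc e) ^ m * (1/2) ^ e))" by (rule summable_mult)
    thus "summable b2" unfolding b2_def by (simp add: mult_ac)
    show "\<bar>q (p ^ e)\<bar> \<le> b2 e * real p ^ e * real p powr (-3/2)" if p: "prime p" and e: "e \<ge> 2" for p e
    proof -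
      have p2: "real p \<ge> 2" using prime_ge_2_nat[OF p] by simp
      have "(2::real) powr (real e - 3/2) \<le> real p powr (real e - 3/2)" using p2 e by (intro powr_mono2) auto
      moreover have "real p powr (real e - 3/2) = real p ^ e * real p powr (-3/2)"
        using p2 by (simp add: powr_realpow[symmetric] powr_add[symmetric])
      moreover have "(1::real) = 2 powr (3/2) * (1/2) ^ e * 2 powr (real e - 3/2)"
      proof -
        have "(1/2::real) ^ e = 2 powr (- real e)" by (simp add: powr_minus powr_realpow power_divide field_simps)
        thus ?thesis by (simp add: powr_add[symmetric])
      qed
      ultimately have "1 \<le> 2 powr (3/2) * (1/2) ^ e * (real p ^ e * real p powr (-3/2))"
        by (metis mult_left_mono mult_nonneg_nonneg powr_ge_zero zero_le_power zero_le_divide_1_iff zero_le_numeral)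
      hence "real (Suc e) ^ m * 1 \<le> real (Suc e) ^ m * (2 powr (3/2) * (1/2) ^ e * (real p ^ e * real p powr (-3/2)))"
        by (rule mult_left_mono) simp
      moreover have "\<bar>q (p ^ e)\<bar> \<le> real (Suc e) ^ m" using qv[OF p, of e] dpos(1,2)[OF p, of e] e by simp
      ultimately have "\<bar>q (p ^ e)\<bar> \<le> real (Suc e) ^ m * (2 powr (3/2) * (1/2) ^ e * (real p ^ e * real p powr (-3/2)))" by linarith
      thus ?thesis unfolding b2_def by (simp only: mult.assoc)
    qed
  qed
  have dle: "d n \<le> conv q h n" for n
  proof -
    have "0 \<le> d n \<and> d n \<le> conv q h n"
    proof (rule mult_fun_le)
      show "mult_fun d" unfolding d_def by (intro mult_fun_dchain mult_fun_delta)
      show "mult_fun (conv q h)" by (intro mult_fun_conv mq h)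
      fix p e :: nat assume p: "prime p"
      have nn: "0 \<le> q (p ^ i) * h (p ^ (e - i))" for i using qpos h(2) by simp
      have "d (p ^ e) \<le> conv q h (p ^ e)"
      proof (cases "e = 1")
        case True
        have "q (p ^ 0) * h (p ^ (e - 0)) \<le> (\<Sum>i\<le>e. q (p ^ i) * h (p ^ (e - i)))" by (rule member_le_sum) (use nn in auto)
        thus ?thesis unfolding conv_prime_power[OF p] using True qv[OF p, of 0] h1[OF p] dpos(3)[OF p] by simp
      next
        case False
        have "q (p ^ e) * h (p ^ (e - e)) \<le> (\<Sum>i\<le>e. q (p ^ i) * h (p ^ (e - i)))" by (rule member_le_sum) (use nn in auto)
        moreover have "q (p ^ e) = d (p ^ e)"
          using False qv[OF p, of e] mult_fun_1[OF mult_fun_dchain[OF mult_fun_delta]] by (simp add: d_def)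
        ultimately show ?thesis unfolding conv_prime_power[OF p] using mult_fun_1[OF h(1)] by simp
      qed
      thus "0 \<le> d (p ^ e) \<and> d (p ^ e) \<le> conv q h (p ^ e)" using dpos[OF p] by simp
    qed
    thus ?thesis by blast
  qed
  have L1: "((\<lambda>x. summ d x / (x * ln x ^ (m - 1))) \<longlongrightarrow> 1 / fact (m - 1)) at_top" using dg unfolding growth_def by blast
  have L2: "((\<lambda>x. (\<Sum>t\<in>{1..nat \<lfloor>x\<rfloor>}. q t * summ h (x / real t)) / (x * ln x ^ (m - 1))) \<longlongrightarrow> c * (\<Sum>n. q n / real n)) at_top"
    unfolding c_def by (rule conv_limit[OF hg sq])
  have "1 / fact (m - 1) \<le> c * (\<Sum>n. q n / real n)"
  proof (rule tendsto_le[OF _ L2 L1])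
    show "\<forall>\<^sub>F x in at_top. summ d x / (x * ln x ^ (m - 1)) \<le> (\<Sum>t\<in>{1..nat \<lfloor>x\<rfloor>}. q t * summ h (x / real t)) / (x * ln x ^ (m - 1))"
      using eventually_ge_at_top[of 1]
    proof eventually_elim
      case (elim x)
      have "summ d x \<le> summ (conv q h) x" unfolding summ_def by (intro sum_mono dle)
      also have "\<dots> = (\<Sum>t\<in>{1..nat \<lfloor>x\<rfloor>}. q t * summ h (x / real t))" using elim by (intro summ_conv) simp
      finally show ?case using elim by (intro divide_right_mono) auto
    qed
  qed simp
  moreover have "(\<Sum>n. q n / real n) \<ge> 0"
    by (intro suminf_nonneg) (use sq qpos in auto)
  ultimately have "c > 0" by (metis divide_pos_pos fact_gt_zero less_le_trans mult_nonneg_nonneg mult_nonpos_nonneg not_le zero_less_one)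
  moreover have "((\<lambda>x. summ h x / (x * ln x ^ (m - 1))) \<longlongrightarrow> c) at_top" using hg unfolding growth_def c_def by blast
  ultimately show ?thesis by blast
qed

section \<open>Orders of given index\<close>

definition gords :: "nat set \<Rightarrow> nat \<Rightarrow> (nat \<Rightarrow> int) set set" where
  "gords I k = {A. suborder I A \<and> finite (cosets_of I A) \<and> card (cosets_of I A) = k}"

lemma gordsD:
  assumes "A \<in> gords I k" "finite I"
  shows "suborder I A" "add_subgroup A" "A \<subseteq> vecs I" "k > 0" "full k I A"
    "\<And>N. N > 0 \<Longrightarrow> full N I A \<Longrightarrow> card (resid N A) * k = N ^ card I"
proof -
  have A: "suborder I A" "finite (cosets_of I A)" "card (cosets_of I A) = k" using assms(1) by (auto simp: gords_def)
  show "suborder I A" by (rule A)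
  show s: "add_subgroup A" "A \<subseteq> vecs I" using A(1) suborder_add_subgroup suborder_vecs by auto
  show "k > 0" "full k I A" using full_index[OF s A(2)] A(3) by auto
  fix N assume "N > 0" "full N I A"
  thus "card (resid N A) * k = N ^ card I" using card_resid_mult_index(2)[OF s assms(2)] A(3) by auto
qed

lemma gordsI:
  assumes "suborder I A" "finite I" "N > 0" "full N I A" "card (resid N A) * k = N ^ card I"
  shows "A \<in> gords I k"
proof -
  note s = suborder_add_subgroup[OF assms(1)] suborder_vecs[OF assms(1)]
  have f: "finite (cosets_of I A)" "card (resid N A) * card (cosets_of I A) = N ^ card I"
    using card_resid_mult_index[OF s assms(2,3,4)] by auto
  have "card (resid N A) \<noteq> 0" using f(2) assms(3) by (metis mult_zero_left power_not_zero not_gr_zero)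
  moreover have "card (resid N A) * card (cosets_of I A) = card (resid N A) * k" using f(2) assms(5) by simp
  ultimately have "card (cosets_of I A) = k" by simp
  thus ?thesis using f(1) assms(1) by (simp add: gords_def)
qed

lemma mem_iff_vmod:
  assumes "add_subgroup A" "A \<subseteq> vecs I" "full N I A" "x \<in> vecs I"
  shows "x \<in> A \<longleftrightarrow> vmod N x \<in> A"
proof
  show "x \<in> A \<Longrightarrow> vmod N x \<in> A" by (rule vmod_mem[OF assms(1-3)])
  assume "vmod N x \<in> A"
  hence "(x - vmod N x) + vmod N x \<in> A" by (intro add_subgroup_add[OF assms(1)] vmod_diff_mem[OF assms(3,4)])
  thus "x \<in> A" by (simp only: diff_add_cancel)
qed

lemma eq_of_resid_subset:
  assumes A: "add_subgroup A" "A \<subseteq> vecs I" "full N I A" and B: "add_subgroup B" "B \<subseteq> vecs I" "full N I B"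
    and N: "N > 0" and r: "resid N A = resid N B"
  shows "A = B"
proof -
  have "x \<in> A \<longleftrightarrow> x \<in> B" if x: "x \<in> vecs I" for x
  proof -
    have "vmod N x \<in> A \<longleftrightarrow> vmod N x \<in> resid N A" using N by (simp add: resid_def)
    moreover have "vmod N x \<in> B \<longleftrightarrow> vmod N x \<in> resid N B" using N by (simp add: resid_def)
    ultimately show ?thesis using mem_iff_vmod[OF A x] mem_iff_vmod[OF B x] r by simp
  qed
  thus ?thesis using A(2) B(2) by blast
qed

text \<open>A subgroup of index k contains k Z^I, so it is determined by its residues modulo
  k.\<close>

lemma finite_gords: assumes I: "finite I" shows "finite (gords I k)"
proof (cases "k = 0")
  case True
  hence "gords I k = {}" using gordsD(4)[OF _ I, of _ k] by auto
  thus ?thesis by simp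
next
  case False
  show ?thesis
  proof (rule inj_on_finite[of "resid k" _ "Pow (resid k (vecs I))"])
    show "inj_on (resid k) (gords I k)"
    proof (rule inj_onI)
      fix A B assume "A \<in> gords I k" "B \<in> gords I k" "resid k A = resid k B"
      thus "A = B" using eq_of_resid_subset[of A I k B] gordsD[OF _ I] by blast
    qed
    show "resid k ` gords I k \<subseteq> Pow (resid k (vecs I))"
      using gordsD(3)[OF _ I] by (fastforce simp: resid_def)
    show "finite (Pow (resid k (vecs I)))" using card_resid_vecs[OF I, of k] False by simp
  qed
qed

lemma gords_subset_ords: assumes "finite I" "prime p" shows "gords I (p ^ e) \<subseteq> ords p I e"
proof
  fix A assume A: "A \<in> gords I (p ^ e)"
  note g = gordsD[OF A assms(1)]
  have "pidx p I A e" unfolding pidx_def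
  proof (intro exI[of _ e] allI impI conjI)
    fix K assume "e \<le> K"
    hence d: "p ^ e dvd p ^ K" by (rule le_imp_power_dvd)
    show f: "full (p ^ K) I A" by (rule full_dvd[OF g(5) d])
    show "card (resid (p ^ K) A) * p ^ e = p ^ (K * card I)"
      using g(6)[OF _ f] prime_gt_0_nat[OF assms(2)] by (simp add: power_mult)
  qed
  thus "A \<in> ords p I e" using g(1) by (simp add: ords_def)
qed

lemma gords_1: assumes "finite I" shows "gords I 1 = {vecs I}"
proof -
  have v: "suborder I (vecs I)" unfolding suborder_def using vecs_subrng by (auto simp: vecs_def)
  have "vecs I \<in> gords I 1" by (rule gordsI[OF v assms, of 1]) (use card_resid_vecs[OF assms, of 1] full_vecs in auto)
  moreover have "A = vecs I" if A: "A \<in> gords I 1" for A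
  proof -
    note g = gordsD[OF A assms]
    have "x \<in> A" if "x \<in> vecs I" for x using g(5) that by (intro full_mem[OF g(5)]) auto
    thus ?thesis using g(3) by blast
  qed
  ultimately show ?thesis by blast
qed

section \<open>Multiplicativity in the index\<close>

definition adjoin :: "nat \<Rightarrow> nat set \<Rightarrow> (nat \<Rightarrow> int) set \<Rightarrow> (nat \<Rightarrow> int) set" where
  "adjoin a I A = {x \<in> vecs I. \<exists>y\<in>A. \<forall>i. int a dvd x i - y i}"

lemma suborder_adjoin:
  assumes A: "suborder I A" shows "suborder I (adjoin a I A)" "A \<subseteq> adjoin a I A" "full a I (adjoin a I A)"
proof -
  note s = suborder_add_subgroup[OF A] suborder_vecs[OF A]
  show sub: "A \<subseteq> adjoin a I A" unfolding adjoin_def using s(2) by force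
  show "full a I (adjoin a I A)" unfolding full_def
  proof
    fix x assume x: "x \<in> vecs I"
    have "sc (int a) x \<in> vecs I" by (rule add_subgroup_sc[OF vecs_add_subgroup x])
    moreover have "\<forall>i. int a dvd sc (int a) x i - (0 :: nat \<Rightarrow> int) i" by simp
    ultimately show "sc (int a) x \<in> adjoin a I A" unfolding adjoin_def using add_subgroup_0[OF s(1)] by blast
  qed
  show "suborder I (adjoin a I A)" unfolding suborder_def subrng_def add_subgroup_def
  proof (intro conjI ballI)
    show "adjoin a I A \<subseteq> vecs I" by (auto simp: adjoin_def)
    show "0 \<in> adjoin a I A" using sub add_subgroup_0[OF s(1)] by blast
    show "indicator I \<in> adjoin a I A" using sub suborder_one[OF A] by blast
    fix x y assume "x \<in> adjoin a I A" "y \<in> adjoin a I A"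
    then obtain u v where v: "x \<in> vecs I" "y \<in> vecs I" and u: "u \<in> A" "v \<in> A"
      "\<And>i. int a dvd x i - u i" "\<And>i. int a dvd y i - v i" unfolding adjoin_def by blast
    have "int a dvd (x - y) i - (u - v) i" for i
    proof -
      have "(x - y) i - (u - v) i = (x i - u i) - (y i - v i)" by simp
      thus ?thesis using dvd_diff[OF u(3,4)] by metis
    qed
    thus "x - y \<in> adjoin a I A" unfolding adjoin_def
      using add_subgroup_diff[OF vecs_add_subgroup v] add_subgroup_diff[OF s(1) u(1,2)] by blast
    have "int a dvd (x * y) i - (u * v) i" for i
    proof -
      have "(x * y) i - (u * v) i = (x i - u i) * y i + u i * (y i - v i)" by (simp add: algebra_simps)
      thus ?thesis using dvd_add[OF dvd_mult2[OF u(3)[of i], of "y i"] dvd_mult[OF u(4)[of i], of "u i"]] by metis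
    qed
    thus "x * y \<in> adjoin a I A" unfolding adjoin_def
      using subrng_mult[OF vecs_subrng v] suborder_mult[OF A u(1,2)] by blast
  qed
qed

lemma suborder_Int: "suborder I A \<Longrightarrow> suborder I B \<Longrightarrow> suborder I (A \<inter> B)"
  unfolding suborder_def using subrng_Int by auto

lemma card_resid_Int_coprime:
  assumes co: "coprime a b" "a > 0" "b > 0" and I: "finite I"
    and A: "add_subgroup A" "A \<subseteq> vecs I" "full a I A" and B: "add_subgroup B" "B \<subseteq> vecs I" "full b I B"
  shows "card (resid (a * b) (A \<inter> B)) = card (resid a A) * card (resid b B)"
proof -
  have cop: "coprime (int a) (int b)" using co(1) by simp
  have "bij_betw (\<lambda>x. (vmod a x, vmod b x)) (resid (a * b) (A \<inter> B)) (resid a A \<times> resid b B)"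
  proof (rule bij_betw_imageI)
    show "inj_on (\<lambda>x. (vmod a x, vmod b x)) (resid (a * b) (A \<inter> B))"
    proof (rule inj_onI)
      fix x y assume x: "x \<in> resid (a * b) (A \<inter> B)" and y: "y \<in> resid (a * b) (A \<inter> B)" and e: "(vmod a x, vmod b x) = (vmod a y, vmod b y)"
      show "x = y"
      proof
        fix i
        have "vmod a x = vmod a y" "vmod b x = vmod b y" using e by (simp_all only: prod.inject)
        hence "vmod a x i = vmod a y i" "vmod b x i = vmod b y i" by (simp_all only:)
        hence "int a dvd x i - y i" "int b dvd x i - y i" by (simp_all add: mod_eq_dvd_iff)
        hence "int a * int b dvd x i - y i" using cop by (rule divides_mult)
        hence "x i mod (int (a * b)) = y i mod (int (a * b))" by (simp add: mod_eq_dvd_iff)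
        moreover have "0 \<le> x i" "x i < int (a * b)" "0 \<le> y i" "y i < int (a * b)"
          using x y unfolding resid_def by blast+
        ultimately show "x i = y i" by (simp only: mod_pos_pos_trivial)
      qed
    qed
    show "(\<lambda>x. (vmod a x, vmod b x)) ` resid (a * b) (A \<inter> B) = resid a A \<times> resid b B"
    proof
      show "(\<lambda>x. (vmod a x, vmod b x)) ` resid (a * b) (A \<inter> B) \<subseteq> resid a A \<times> resid b B"
      proof (rule image_subsetI)
        fix x assume "x \<in> resid (a * b) (A \<inter> B)"
        hence "x \<in> A" "x \<in> B" unfolding resid_def by blast+
        thus "(vmod a x, vmod b x) \<in> resid a A \<times> resid b B"
          using vmod_resid[OF A _ co(2)] vmod_resid[OF B _ co(3)] by blast
      qed
      show "resid a A \<times> resid b B \<subseteq> (\<lambda>x. (vmod a x, vmod b x)) ` resid (a * b) (A \<inter> B)"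
      proof
        fix z assume "z \<in> resid a A \<times> resid b B"
        then obtain y w where z: "z = (y, w)" "y \<in> resid a A" "w \<in> resid b B" by blast
        have yA: "y \<in> A" "w \<in> B" using z unfolding resid_def by blast+
        have "\<exists>t. [t = y i] (mod int a) \<and> [t = w i] (mod int b)" for i
          using binary_chinese_remainder_int[OF cop] by blast
        then obtain t where t: "\<And>i. [t i = y i] (mod int a) \<and> [t i = w i] (mod int b)" by metis
        define x where "x = (\<lambda>i. if i \<in> I then t i mod int (a * b) else 0)"
        have xa: "vmod a x = y"
        proof
          fix i show "vmod a x i = y i"
          proof (cases "i \<in> I")
            case True
            have "vmod a x i = t i mod int a" using True by (simp add: x_def mod_mult2_eq mod_mod_cancel)
            also have "\<dots> = y i mod int a" using t[of i] by (simp add: Cong.cong_def)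
            also have "\<dots> = y i" using z(2) unfolding resid_def by simp
            finally show ?thesis .
          next
            case False thus ?thesis using vecs_zero[OF A(2) yA(1)] by (simp add: x_def)
          qed
        qed
        have xb: "vmod b x = w"
        proof
          fix i show "vmod b x i = w i"
          proof (cases "i \<in> I")
            case True
            have "vmod b x i = t i mod int b" using True by (simp add: x_def mod_mod_cancel)
            also have "\<dots> = w i mod int b" using t[of i] by (simp add: Cong.cong_def)
            also have "\<dots> = w i" using z(3) unfolding resid_def by simp
            finally show ?thesis .
          next
            case False thus ?thesis using vecs_zero[OF B(2) yA(2)] by (simp add: x_def)
          qed
        qed
        have xv: "x \<in> vecs I" by (simp add: x_def vecs_def)
        have "x \<in> A" "x \<in> B" using mem_iff_vmod[OF A xv] mem_iff_vmod[OF B xv] xa xb yA by simp_all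
        moreover have "0 \<le> x i \<and> x i < int (a * b)" for i using co(2,3) by (simp add: x_def)
        ultimately have "x \<in> resid (a * b) (A \<inter> B)" unfolding resid_def by blast
        thus "z \<in> (\<lambda>x. (vmod a x, vmod b x)) ` resid (a * b) (A \<inter> B)" using xa xb z(1) by blast
      qed
    qed
  qed
  from bij_betw_same_card[OF this] show ?thesis by (simp only: card_cartesian_product)
qed

text \<open>For x in A and b s congruent to 1 modulo a, the vector b s x lies in both A and B and is
  congruent to x modulo a.\<close>

lemma adjoin_Int:
  assumes co: "coprime a b" and A: "suborder I A" "full a I A" and B: "suborder I B" "full b I B"
  shows "adjoin a I (A \<inter> B) = A"
proof -
  note sA = suborder_add_subgroup[OF A(1)] suborder_vecs[OF A(1)] and sB = suborder_add_subgroup[OF B(1)]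
  have "adjoin a I (A \<inter> B) \<subseteq> A"
  proof
    fix x assume "x \<in> adjoin a I (A \<inter> B)"
    then obtain y where x: "x \<in> vecs I" "y \<in> A" "\<And>i. int a dvd x i - y i" unfolding adjoin_def by blast
    have "x - y \<in> A" by (rule full_mem[OF A(2)]) (use x sA(2) add_subgroup_diff[OF vecs_add_subgroup] in auto)
    hence "(x - y) + y \<in> A" by (rule add_subgroup_add[OF sA(1) _ x(2)])
    thus "x \<in> A" by (simp only: diff_add_cancel)
  qed
  moreover have "A \<subseteq> adjoin a I (A \<inter> B)"
  proof
    fix x assume x: "x \<in> A"
    have "coprime (int b) (int a)" using co by (simp add: coprime_commute)
    then obtain s where s: "[int b * s = 1] (mod int a)" using cong_solve_coprime_int by blast
    let ?y = "sc (int b) (sc s x)"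
    have xv: "x \<in> vecs I" using x sA(2) by blast
    have "?y \<in> A" by (intro add_subgroup_sc[OF sA(1)] x)
    moreover have "?y \<in> B" using B(2) add_subgroup_sc[OF vecs_add_subgroup xv] unfolding full_def by blast
    moreover have "int a dvd x i - ?y i" for i
    proof -
      have "int a dvd 1 - int b * s" using s by (simp only: cong_iff_dvd_diff dvd_diff_commute)
      hence "int a dvd (1 - int b * s) * x i" by (rule dvd_mult2)
      thus ?thesis by (simp add: algebra_simps)
    qed
    ultimately show "x \<in> adjoin a I (A \<inter> B)" unfolding adjoin_def using xv by blast
  qed
  ultimately show ?thesis by blast
qed

text \<open>If x is congruent modulo a to an element of A, then b x lies in A, because A contains a
  b Z^I. Symmetrically a x lies in A, and a Bezout relation recovers x.\<close>

lemma adjoin_inter_self: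
  assumes co: "coprime a b" and A: "suborder I A" "full (a * b) I A"
  shows "adjoin a I A \<inter> adjoin b I A = A"
proof -
  note sA = suborder_add_subgroup[OF A(1)] suborder_vecs[OF A(1)]
  have "x \<in> A" if x: "x \<in> adjoin a I A" "x \<in> adjoin b I A" for x
  proof -
    obtain y z where y: "x \<in> vecs I" "y \<in> A" "z \<in> A" "\<And>i. int a dvd x i - y i" "\<And>i. int b dvd x i - z i"
      using x unfolding adjoin_def by blast
    have v: "y \<in> vecs I" "z \<in> vecs I" using y sA(2) by auto
    have "sc (int b) (x - y) \<in> A"
    proof (rule full_mem[OF A(2)])
      show "sc (int b) (x - y) \<in> vecs I" by (intro add_subgroup_sc[OF vecs_add_subgroup] add_subgroup_diff[OF vecs_add_subgroup] y v)
      show "int (a * b) dvd sc (int b) (x - y) i" for i using y(4)[of i] by (simp add: mult.commute mult_dvd_mono)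
    qed
    hence "sc (int b) (x - y) + sc (int b) y \<in> A" by (rule add_subgroup_add[OF sA(1) _ add_subgroup_sc[OF sA(1) y(2)]])
    moreover have "sc (int b) (x - y) + sc (int b) y = sc (int b) x" by (simp add: fun_eq_iff algebra_simps)
    ultimately have bx: "sc (int b) x \<in> A" by (simp only:)
    have "sc (int a) (x - z) \<in> A"
    proof (rule full_mem[OF A(2)])
      show "sc (int a) (x - z) \<in> vecs I" by (intro add_subgroup_sc[OF vecs_add_subgroup] add_subgroup_diff[OF vecs_add_subgroup] y v)
      show "int (a * b) dvd sc (int a) (x - z) i" for i using y(5)[of i] by (simp add: mult_dvd_mono)
    qed
    hence "sc (int a) (x - z) + sc (int a) z \<in> A" by (rule add_subgroup_add[OF sA(1) _ add_subgroup_sc[OF sA(1) y(3)]])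
    moreover have "sc (int a) (x - z) + sc (int a) z = sc (int a) x" by (simp add: fun_eq_iff algebra_simps)
    ultimately have ax: "sc (int a) x \<in> A" by (simp only:)
    have "coprime (int a) (int b)" using co by simp
    then obtain r s where rs: "r * int a + s * int b = 1" using bezout_int[of "int a" "int b"] by auto
    have "sc r (sc (int a) x) + sc s (sc (int b) x) \<in> A" by (intro add_subgroup_add[OF sA(1)] add_subgroup_sc[OF sA(1)] ax bx)
    moreover have "sc r (sc (int a) x) + sc s (sc (int b) x) = sc (r * int a + s * int b) x" by (simp add: fun_eq_iff algebra_simps)
    ultimately show ?thesis unfolding rs by (simp add: sc_def)
  qed
  thus ?thesis using suborder_adjoin(2)[OF A(1)] by blast
qed

text \<open>An order of index a b is the intersection of its enlargements A + a Z^I and A + b Z^I,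
  which are orders of index a and b; intersection is the inverse map on pairs of orders.\<close>

lemma card_gords_mult:
  assumes co: "coprime a b" "a > 0" "b > 0" and I: "finite I"
  shows "card (gords I (a * b)) = card (gords I a) * card (gords I b)"
proof -
  have "bij_betw (\<lambda>A. (adjoin a I A, adjoin b I A)) (gords I (a * b)) (gords I a \<times> gords I b)"
  proof (rule bij_betw_byWitness[where f' = "\<lambda>(A, B). A \<inter> B"])
    show "\<forall>A\<in>gords I (a * b). (\<lambda>(A, B). A \<inter> B) (adjoin a I A, adjoin b I A) = A"
      using adjoin_inter_self[OF co(1)] gordsD(1,5)[OF _ I] by auto
    show "\<forall>z\<in>gords I a \<times> gords I b. (\<lambda>A. (adjoin a I A, adjoin b I A)) ((\<lambda>(A, B). A \<inter> B) z) = z"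
    proof
      fix z assume "z \<in> gords I a \<times> gords I b"
      then obtain A B where z: "z = (A, B)" "A \<in> gords I a" "B \<in> gords I b" by blast
      note gA = gordsD[OF z(2) I] and gB = gordsD[OF z(3) I]
      have "coprime b a" using co(1) by (simp add: coprime_commute)
      hence "adjoin b I (B \<inter> A) = B" by (rule adjoin_Int[OF _ gB(1,5) gA(1,5)])
      thus "(\<lambda>A. (adjoin a I A, adjoin b I A)) ((\<lambda>(A, B). A \<inter> B) z) = z"
        using adjoin_Int[OF co(1) gA(1,5) gB(1,5)] z(1) by (simp add: Int_commute)
    qed
    show "(\<lambda>A. (adjoin a I A, adjoin b I A)) ` gords I (a * b) \<subseteq> gords I a \<times> gords I b"
    proof (rule image_subsetI)
      fix A assume A: "A \<in> gords I (a * b)"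
      note g = gordsD[OF A I]
      let ?P = "adjoin a I A" and ?Q = "adjoin b I A"
      note P = suborder_adjoin[OF g(1), of a] and Q = suborder_adjoin[OF g(1), of b]
      note sP = suborder_add_subgroup[OF P(1)] suborder_vecs[OF P(1)] and sQ = suborder_add_subgroup[OF Q(1)] suborder_vecs[OF Q(1)]
      define k1 k2 where "k1 = card (cosets_of I ?P)" and "k2 = card (cosets_of I ?Q)"
      have c1: "card (resid a ?P) * k1 = a ^ card I" unfolding k1_def by (rule card_resid_mult_index(2)[OF sP I co(2) P(3)])
      have c2: "card (resid b ?Q) * k2 = b ^ card I" unfolding k2_def by (rule card_resid_mult_index(2)[OF sQ I co(3) Q(3)])
      have "card (resid (a * b) A) = card (resid a ?P) * card (resid b ?Q)"
        using card_resid_Int_coprime[OF co I sP P(3) sQ Q(3)] adjoin_inter_self[OF co(1) g(1,5)] by simp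
      moreover have "card (resid (a * b) A) * (a * b) = (a * b) ^ card I" using co by (intro g(6) g(5)) simp
      ultimately have "(card (resid a ?P) * card (resid b ?Q)) * (a * b) = (card (resid a ?P) * k1) * (card (resid b ?Q) * k2)"
        unfolding c1 c2 by (simp add: power_mult_distrib)
      hence "(card (resid a ?P) * card (resid b ?Q)) * (a * b) = (card (resid a ?P) * card (resid b ?Q)) * (k1 * k2)" by (simp only: ac_simps)
      moreover have "card (resid a ?P) \<noteq> 0" "card (resid b ?Q) \<noteq> 0" using c1 c2 co(2,3) by (metis mult_zero_left power_not_zero not_gr_zero)+
      ultimately have kk: "a * b = k1 * k2" by simp
      \<comment> \<open>Counting gives only the product k1 k2 = a b. That k1 divides a power of a,
        hence is coprime to b, separates the two indices.\<close>
      have "k1 dvd a ^ card I" "k2 dvd b ^ card I" using c1 c2 by (metis dvd_triv_right)+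
      hence "coprime k1 b" "coprime k2 a"
        using co(1) coprime_divisors[of k1 "a ^ card I" b b] coprime_divisors[of k2 "b ^ card I" a a] by (auto simp: coprime_commute)
      moreover have "k1 dvd a * b" "k2 dvd a * b" using kk by auto
      ultimately have d: "k1 dvd a" "k2 dvd b" by (simp_all add: coprime_dvd_mult_left_iff coprime_dvd_mult_right_iff)
      have le: "k1 \<le> a" "k2 \<le> b" using d co(2,3) by (auto intro: dvd_imp_le)
      have "k2 > 0" using kk co(2,3) by (metis mult_is_0 not_gr_zero)
      have "k1 = a"
      proof (rule ccontr)
        assume "k1 \<noteq> a"
        hence "k1 * k2 < a * b" using le \<open>k2 > 0\<close> by (intro mult_less_le_imp_less) auto
        thus False using kk by simp
      qed
      moreover hence "k2 = b" using kk co(2) by simp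
      ultimately show "(?P, ?Q) \<in> gords I a \<times> gords I b"
        using gordsI[OF P(1) I co(2) P(3), of a] gordsI[OF Q(1) I co(3) Q(3), of b] c1 c2 by simp
    qed
    show "(\<lambda>(A, B). A \<inter> B) ` (gords I a \<times> gords I b) \<subseteq> gords I (a * b)"
    proof (rule image_subsetI)
      fix z assume "z \<in> gords I a \<times> gords I b"
      then obtain A B where z: "z = (A, B)" "A \<in> gords I a" "B \<in> gords I b" by blast
      note gA = gordsD[OF z(2) I] and gB = gordsD[OF z(3) I]
      have "full (a * b) I (A \<inter> B)" using full_dvd[OF gA(5), of "a * b"] full_dvd[OF gB(5), of "a * b"] unfolding full_def by simp
      moreover have "card (resid (a * b) (A \<inter> B)) * (a * b) = (a * b) ^ card I"
        unfolding card_resid_Int_coprime[OF co I gA(2,3,5) gB(2,3,5)] power_mult_distrib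
        using gA(6)[OF co(2) gA(5)] gB(6)[OF co(3) gB(5)] by (metis mult.assoc mult.left_commute)
      ultimately have "A \<inter> B \<in> gords I (a * b)" using co by (intro gordsI[OF suborder_Int[OF gA(1) gB(1)] I]) auto
      thus "(\<lambda>(A, B). A \<inter> B) z \<in> gords I (a * b)" using z(1) by simp
    qed
  qed
  from bij_betw_same_card[OF this] show ?thesis by (simp only: card_cartesian_product)
qed


section \<open>Orders of prime index\<close>

definition glue :: "nat \<Rightarrow> nat set \<Rightarrow> nat set \<Rightarrow> (nat \<Rightarrow> int) set" where
  "glue p I K = {x \<in> vecs I. \<forall>i\<in>K. \<forall>j\<in>K. int p dvd x i - x j}"

lemma suborder_glue: "K \<subseteq> I \<Longrightarrow> suborder I (glue p I K)"
  unfolding suborder_def subrng_def add_subgroup_def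
proof (intro conjI ballI)
  assume K: "K \<subseteq> I"
  show "glue p I K \<subseteq> vecs I" by (auto simp: glue_def)
  show "0 \<in> glue p I K" by (simp add: glue_def vecs_def)
  show "indicator I \<in> glue p I K" using K by (auto simp: glue_def vecs_def indicator_def)
  fix x y assume "x \<in> glue p I K" "y \<in> glue p I K"
  hence v: "x \<in> vecs I" "y \<in> vecs I" and d: "\<And>i j. i \<in> K \<Longrightarrow> j \<in> K \<Longrightarrow> int p dvd x i - x j \<and> int p dvd y i - y j"
    by (auto simp: glue_def)
  have "int p dvd (x - y) i - (x - y) j" if "i \<in> K" "j \<in> K" for i j
  proof -
    have "(x - y) i - (x - y) j = (x i - x j) - (y i - y j)" by simp
    thus ?thesis using dvd_diff[of "int p" "x i - x j" "y i - y j"] d[OF that] by metis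
  qed
  thus "x - y \<in> glue p I K" unfolding glue_def using add_subgroup_diff[OF vecs_add_subgroup v] by blast
  have "int p dvd (x * y) i - (x * y) j" if "i \<in> K" "j \<in> K" for i j
  proof -
    have "(x * y) i - (x * y) j = (x i - x j) * y i + x j * (y i - y j)" by (simp add: algebra_simps)
    thus ?thesis using dvd_add[OF dvd_mult2[of "int p" "x i - x j" "y i"] dvd_mult[of "int p" "y i - y j" "x j"]] d[OF that] by metis
  qed
  thus "x * y \<in> glue p I K" unfolding glue_def using subrng_mult[OF vecs_subrng v] by blast
qed

lemma glue_gords:
  assumes p: "p > 0" and ab: "a \<in> I" "b \<in> I" "a \<noteq> b"
  shows "glue p I {a, b} \<in> gords I p"
proof -
  let ?G = "glue p I {a, b}" and ?f = "\<lambda>t. (+) (sc t (indicator {a})) ` glue p I {a, b}"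
  have G: "suborder I ?G" using ab by (intro suborder_glue) auto
  note sg = suborder_add_subgroup[OF G]
  have mem: "x \<in> ?G \<longleftrightarrow> x \<in> vecs I \<and> int p dvd x a - x b" for x
    unfolding glue_def using dvd_diff_commute[of "int p" "x a" "x b"] by auto
  have "cosets_of I ?G = ?f ` {0..<int p}"
  proof
    show "?f ` {0..<int p} \<subseteq> cosets_of I ?G" unfolding cosets_of_def using indicator_vecs[OF ab(1)] by blast
    show "cosets_of I ?G \<subseteq> ?f ` {0..<int p}"
    proof
      fix C assume "C \<in> cosets_of I ?G"
      then obtain x where x: "x \<in> vecs I" "C = (+) x ` ?G" unfolding cosets_of_def by blast
      define t where "t = (x a - x b) mod int p"
      have "x - sc t (indicator {a}) \<in> vecs I" by (intro add_subgroup_diff[OF vecs_add_subgroup] x indicator_vecs ab)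
      moreover have "int p dvd (x - sc t (indicator {a})) a - (x - sc t (indicator {a})) b"
      proof -
        have "(x - sc t (indicator {a})) a - (x - sc t (indicator {a})) b = (x a - x b) - t" using ab(3) by simp
        also have "int p dvd \<dots>" unfolding t_def by (simp add: minus_mod_eq_mult_div)
        finally show ?thesis .
      qed
      ultimately have "x - sc t (indicator {a}) \<in> ?G" unfolding mem by blast
      hence "C = ?f t" unfolding x(2) by (simp only: coset_eq_iff[OF sg])
      moreover have "t \<in> {0..<int p}" using p unfolding t_def by simp
      ultimately show "C \<in> ?f ` {0..<int p}" by blast
    qed
  qed
  moreover have "inj_on ?f {0..<int p}"
  proof (rule inj_onI)
    fix s t assume st: "s \<in> {0..<int p}" "t \<in> {0..<int p}" "?f s = ?f t"
    hence "sc s (indicator {a}) - sc t (indicator {a}) \<in> ?G" by (simp only: coset_eq_iff[OF sg])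
    hence "int p dvd (sc s (indicator {a}) - sc t (indicator {a})) a - (sc s (indicator {a}) - sc t (indicator {a})) b" unfolding mem by blast
    hence "int p dvd s - t" using ab(3) by simp
    hence "s mod int p = t mod int p" by (simp only: mod_eq_dvd_iff)
    thus "s = t" using st by simp
  qed
  ultimately have "finite (cosets_of I ?G)" "card (cosets_of I ?G) = p" by (simp_all add: card_image)
  thus ?thesis using G by (simp add: gords_def)
qed

text \<open>If every two coordinates could be separated modulo p by an element of A, products of the
  resulting idempotents would isolate each single coordinate and A would be all of Z^I. So some pair
  is never separated; A lies in the corresponding glued order, and equality of the indices
  finishes.\<close>

lemma gords_prime_glue:
  assumes p: "prime p" and I: "finite I" and A: "A \<in> gords I p"
  obtains a b where "a \<in> I" "b \<in> I" "a \<noteq> b" "A = glue p I {a, b}"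
proof -
  note g = gordsD[OF A I]
  have "\<exists>a\<in>I. \<exists>b\<in>I. a \<noteq> b \<and> (\<forall>x\<in>A. [x a = x b] (mod int p))"
  proof (rule ccontr)
    assume "\<not> ?thesis"
    hence n: "\<exists>x\<in>A. \<not> [x a = x b] (mod int p)" if "a \<in> I" "b \<in> I" "a \<noteq> b" for a b using that by blast
    have full1: "full (p ^ 1) I A" using g(5) by simp
    have "\<exists>T\<subseteq>I. a \<in> T \<and> T \<inter> S = {} \<and> indicator T \<in> A" if a: "a \<in> I" and S: "finite S" "S \<subseteq> I - {a}" for a S
      using S
    proof (induction S rule: finite_induct)
      case empty
      show ?case using a suborder_one[OF g(1)] by (intro exI[of _ I]) auto
    next
      case (insert b S)
      then obtain T where T: "T \<subseteq> I" "a \<in> T" "T \<inter> S = {}" "indicator T \<in> A" by auto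
      have b: "b \<in> I" "a \<noteq> b" using insert.prems by auto
      obtain x where x: "x \<in> A" "\<not> [x a = x b] (mod int p)" using n[OF a b] by blast
      obtain U where U: "U \<subseteq> I" "a \<in> U" "b \<notin> U" "indicator U \<in> A"
        by (rule idempotent_exists[OF p g(1) full1 x(1) a b(1) x(2)])
      have "indicator (T \<inter> U) = indicator T * (indicator U :: nat \<Rightarrow> int)" by (auto simp: fun_eq_iff indicator_def)
      hence "indicator (T \<inter> U) \<in> A" using suborder_mult[OF g(1) T(4) U(4)] by (simp only:)
      thus ?case using T U by (intro exI[of _ "T \<inter> U"]) blast
    qed
    hence ind: "indicator {a} \<in> A" if a: "a \<in> I" for a
    proof -
      obtain T where T: "T \<subseteq> I" "a \<in> T" "T \<inter> (I - {a}) = {}" "indicator T \<in> A"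
        using \<open>\<And>S a. a \<in> I \<Longrightarrow> finite S \<Longrightarrow> S \<subseteq> I - {a} \<Longrightarrow> \<exists>T\<subseteq>I. a \<in> T \<and> T \<inter> S = {} \<and> indicator T \<in> A\<close>[OF a, of "I - {a}"] I by auto
      hence "T = {a}" by blast
      thus ?thesis using T(4) by simp
    qed
    have "x \<in> A" if x: "x \<in> vecs I" for x
    proof -
      have "(\<Sum>i\<in>I. sc (x i) (indicator {i})) \<in> A" by (intro add_subgroup_sum[OF g(2)] add_subgroup_sc[OF g(2)] ind)
      thus ?thesis using vec_decomp[OF I x] by (simp only:)
    qed
    hence "A = vecs I" using g(3) by blast
    hence "A \<in> gords I 1" using gords_1[OF I] by simp
    hence "p = 1" using A by (simp add: gords_def)
    thus False using p by simp
  qed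
  then obtain a b where ab: "a \<in> I" "b \<in> I" "a \<noteq> b" "\<And>x. x \<in> A \<Longrightarrow> [x a = x b] (mod int p)" by blast
  let ?G = "glue p I {a, b}"
  have p0: "p > 0" using p prime_gt_0_nat by blast
  have G: "?G \<in> gords I p" by (rule glue_gords[OF p0 ab(1-3)])
  note h = gordsD[OF G I]
  have "int p dvd x a - x b" if "x \<in> A" for x using ab(4)[OF that] by (simp add: cong_iff_dvd_diff)
  hence "int p dvd x i - x j" if "x \<in> A" "i \<in> {a, b}" "j \<in> {a, b}" for x i j
    using that dvd_diff_commute[of "int p" "x a" "x b"] by auto
  hence "A \<subseteq> ?G" unfolding glue_def using g(3) by blast
  hence sub: "resid p A \<subseteq> resid p ?G" unfolding resid_def by blast
  have "card (resid p A) * p = card (resid p ?G) * p" using g(6)[OF p0 g(5)] h(6)[OF p0 h(5)] by simp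
  hence "card (resid p A) = card (resid p ?G)" using p0 by simp
  hence "resid p A = resid p ?G" using card_subset_eq[OF finite_resid[OF I p0 h(3)] sub] by blast
  hence "A = ?G" by (rule eq_of_resid_subset[OF g(2,3,5) h(2,3,5) p0])
  thus ?thesis using that ab by blast
qed

lemma card_gords_prime:
  assumes p: "prime p" and I: "finite I"
  shows "card (gords I p) = card I choose 2"
proof -
  let ?P = "{K. K \<subseteq> I \<and> card K = 2}"
  have p1: "p > 0" "p > 1" using p prime_gt_0_nat prime_gt_1_nat by auto
  have "gords I p = glue p I ` ?P"
  proof
    show "gords I p \<subseteq> glue p I ` ?P"
    proof
      fix A assume "A \<in> gords I p"
      then obtain a b where "a \<in> I" "b \<in> I" "a \<noteq> b" "A = glue p I {a, b}" by (rule gords_prime_glue[OF p I])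
      thus "A \<in> glue p I ` ?P" by (intro image_eqI[of _ _ "{a, b}"]) auto
    qed
    show "glue p I ` ?P \<subseteq> gords I p"
    proof (rule image_subsetI)
      fix K assume K: "K \<in> ?P"
      then obtain a b where "K = {a, b}" "a \<noteq> b" by (auto simp: card_2_iff)
      thus "glue p I K \<in> gords I p" using K glue_gords[OF p1(1), of a I b] by auto
    qed
  qed
  moreover have "inj_on (glue p I) ?P"
  proof (rule inj_onI)
    fix K L assume K: "K \<in> ?P" and L: "L \<in> ?P" and e: "glue p I K = glue p I L"
    have "K \<subseteq> L"
    proof
      fix a assume a: "a \<in> K"
      show "a \<in> L"
      proof (rule ccontr)
        assume aL: "a \<notin> L"
        \<comment> \<open>The unit vector at a satisfies the gluing condition for L, which misses a,
          but not the one for K, where a has a partner b.\<close>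
        have "card (K - {a}) = 1" using K a by (simp add: card_Diff_singleton)
        then obtain b where b: "b \<in> K" "b \<noteq> a" by (metis Diff_iff card_1_singletonE insertI1)
        have aI: "a \<in> I" using K a by blast
        have "sc 1 (indicator {a}) \<in> vecs I" by (rule indicator_vecs[OF aI])
        hence "(indicator {a} :: nat \<Rightarrow> int) \<in> vecs I" by (simp add: sc_def)
        hence "indicator {a} \<in> glue p I L" unfolding glue_def using aL by (auto simp: indicator_def)
        hence "indicator {a} \<in> glue p I K" by (simp only: e)
        hence "int p dvd indicator {a} a - indicator {a} b" unfolding glue_def using a b(1) by blast
        hence "int p dvd 1" using b(2) by simp
        thus False using p1 by simp
      qed
    qed
    moreover have "finite L" using L I finite_subset by blast
    ultimately show "K = L" using K L by (simp add: card_subset_eq)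
  qed
  ultimately have "card (gords I p) = card ?P" by (simp add: card_image)
  thus ?thesis using n_subsets[OF I, of 2] by simp
qed

text \<open>The carrier of the ring in the statement consists of functions that are \<open>undefined\<close>, not 0,
  outside \<open>{..<d}\<close>.\<close>

lemma num_orders_eq:
  "num_orders d B = card {A. suborder {..<d} A \<and> finite (cosets_of {..<d} A) \<and> real (card (cosets_of {..<d} A)) \<le> B}"
proof -
  let ?I = "{..<d}" and ?R = "int_power_ring d"
  define \<rho> where "\<rho> x = restrict x {..<d}" for x :: "nat \<Rightarrow> int"
  define \<zeta> where "\<zeta> x = (\<lambda>i. if i < d then x i else 0)" for x :: "nat \<Rightarrow> int"
  interpret R: cring ?R by (rule cring_int_power_ring)
  have zr: "\<zeta> (\<rho> x) = x" if "x \<in> vecs ?I" for x using that by (auto simp: \<zeta>_def \<rho>_def vecs_def fun_eq_iff)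
  have rz: "\<rho> (\<zeta> x) = x" if "x \<in> extensional ?I" for x using that by (auto simp: \<zeta>_def \<rho>_def extensional_def fun_eq_iff)
  have ze: "\<zeta> x \<in> vecs ?I" for x by (simp add: \<zeta>_def vecs_def)
  have inj: "inj_on \<rho> (vecs ?I)" by (rule inj_on_inverseI[of _ \<zeta>]) (rule zr)
  have rho_add: "\<rho> x \<oplus>\<^bsub>?R\<^esub> \<rho> y = \<rho> (x + y)" "\<rho> x \<otimes>\<^bsub>?R\<^esub> \<rho> y = \<rho> (x * y)" for x y
    by (auto simp: \<rho>_def restrict_def)
  have rho_one: "\<one>\<^bsub>?R\<^esub> = \<rho> (indicator ?I)" "\<zero>\<^bsub>?R\<^esub> = \<rho> 0" by (auto simp: \<rho>_def restrict_def indicator_def)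
  have rho_car: "\<rho> x \<in> carrier ?R" for x by (simp add: \<rho>_def)
  have rho_neg: "\<ominus>\<^bsub>?R\<^esub> \<rho> x = \<rho> (- x)" for x
    by (rule R.minus_equality[OF _ rho_car rho_car]) (simp only: rho_add rho_one, simp)
  have ring_fwd: "subring (\<rho> ` A) ?R" if A: "suborder ?I A" for A
  proof (rule R.subringI)
    note sg = suborder_add_subgroup[OF A]
    show "\<rho> ` A \<subseteq> carrier ?R" using rho_car by blast
    show "\<one>\<^bsub>?R\<^esub> \<in> \<rho> ` A" unfolding rho_one using suborder_one[OF A] by blast
    show "\<ominus>\<^bsub>?R\<^esub> h \<in> \<rho> ` A" if "h \<in> \<rho> ` A" for h using that rho_neg add_subgroup_uminus[OF sg] by blast
    show "h1 \<otimes>\<^bsub>?R\<^esub> h2 \<in> \<rho> ` A" if "h1 \<in> \<rho> ` A" "h2 \<in> \<rho> ` A" for h1 h2 using that rho_add suborder_mult[OF A] by blast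
    show "h1 \<oplus>\<^bsub>?R\<^esub> h2 \<in> \<rho> ` A" if "h1 \<in> \<rho> ` A" "h2 \<in> \<rho> ` A" for h1 h2 using that rho_add add_subgroup_add[OF sg] by blast
  qed
  have ring_bwd: "suborder ?I (\<zeta> ` S)" "\<rho> ` \<zeta> ` S = S" if S: "subring S ?R" for S
  proof -
    have car: "S \<subseteq> extensional ?I" using subringE(1)[OF S] by simp
    have e: "\<rho> (\<zeta> x) = x" if "x \<in> S" for x using rz car that by blast
    show im: "\<rho> ` \<zeta> ` S = S" using e by force
    have mem: "y \<in> \<zeta> ` S" if "y \<in> vecs ?I" "\<rho> y \<in> S" for y using zr[OF that(1)] that(2) by (metis imageI)
    show "suborder ?I (\<zeta> ` S)" unfolding suborder_def subrng_def add_subgroup_def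
    proof (intro conjI ballI)
      show "\<zeta> ` S \<subseteq> vecs ?I" using ze by blast
      show "0 \<in> \<zeta> ` S" by (rule mem) (use subringE(2)[OF S] rho_one in \<open>auto simp: vecs_def\<close>)
      show "indicator ?I \<in> \<zeta> ` S" by (rule mem) (use subringE(3)[OF S] rho_one in \<open>auto simp: vecs_def\<close>)
      fix x y assume "x \<in> \<zeta> ` S" "y \<in> \<zeta> ` S"
      then obtain s t where st: "s \<in> S" "t \<in> S" "x = \<zeta> s" "y = \<zeta> t" by blast
      have xy: "\<rho> x \<in> S" "\<rho> y \<in> S" using st e by simp_all
      have v: "x \<in> vecs ?I" "y \<in> vecs ?I" using st ze by simp_all
      have "\<rho> x \<oplus>\<^bsub>?R\<^esub> (\<ominus>\<^bsub>?R\<^esub> \<rho> y) \<in> S" by (intro subringE(7)[OF S] subringE(5)[OF S] xy)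
      hence "\<rho> (x - y) \<in> S" unfolding rho_neg rho_add by simp
      thus "x - y \<in> \<zeta> ` S" by (rule mem[OF add_subgroup_diff[OF vecs_add_subgroup v]])
      have "\<rho> x \<otimes>\<^bsub>?R\<^esub> \<rho> y \<in> S" by (intro subringE(6)[OF S] xy)
      hence "\<rho> (x * y) \<in> S" unfolding rho_add .
      thus "x * y \<in> \<zeta> ` S" by (rule mem[OF subrng_mult[OF vecs_subrng v]])
    qed
  qed
  have cos: "a_rcosets\<^bsub>?R\<^esub> (\<rho> ` A) = (\<lambda>C. \<rho> ` C) ` cosets_of ?I A" for A
  proof -
    have c1: "\<rho> ` A +>\<^bsub>?R\<^esub> \<rho> x = \<rho> ` ((+) x ` A)" for x
      unfolding a_r_coset_def' using rho_add by (auto simp: image_image add.commute)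
    have car: "carrier ?R = \<rho> ` vecs ?I"
    proof
      show "\<rho> ` vecs ?I \<subseteq> carrier ?R" using rho_car by blast
      show "carrier ?R \<subseteq> \<rho> ` vecs ?I"
      proof
        fix x assume "x \<in> carrier ?R"
        hence "x = \<rho> (\<zeta> x)" using rz by simp
        thus "x \<in> \<rho> ` vecs ?I" using ze by blast
      qed
    qed
    have "a_rcosets\<^bsub>?R\<^esub> (\<rho> ` A) = (\<lambda>a. \<rho> ` A +>\<^bsub>?R\<^esub> a) ` carrier ?R" unfolding A_RCOSETS_def' by auto
    also have "\<dots> = (\<lambda>x. \<rho> ` ((+) x ` A)) ` vecs ?I" unfolding car image_image c1 ..
    also have "\<dots> = (\<lambda>C. \<rho> ` C) ` cosets_of ?I A" unfolding cosets_of_def by (simp only: image_image)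
    finally show ?thesis .
  qed
  have injc: "inj_on (\<lambda>C. \<rho> ` C) (cosets_of ?I A)" if "A \<subseteq> vecs ?I" for A
  proof (rule inj_onI)
    have s: "C \<subseteq> vecs ?I" if "C \<in> cosets_of ?I A" for C
      using that \<open>A \<subseteq> vecs ?I\<close> add_subgroup_add[OF vecs_add_subgroup] unfolding cosets_of_def by blast
    fix C D assume "C \<in> cosets_of ?I A" "D \<in> cosets_of ?I A" "\<rho> ` C = \<rho> ` D"
    thus "C = D" using inj_on_image_eq_iff[OF inj s s] by blast
  qed
  let ?X = "{A. suborder ?I A \<and> finite (cosets_of ?I A) \<and> real (card (cosets_of ?I A)) \<le> B}"
  let ?Y = "{A. is_order_of A d \<and> real (additive_index ?R A) \<le> B}"
  have iff: "\<rho> ` A \<in> ?Y \<longleftrightarrow> A \<in> ?X" if A: "suborder ?I A" for A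
  proof -
    note i = injc[OF suborder_vecs[OF A]]
    have "finite (a_rcosets\<^bsub>?R\<^esub> (\<rho> ` A)) \<longleftrightarrow> finite (cosets_of ?I A)" unfolding cos by (rule finite_image_iff[OF i])
    moreover have "additive_index ?R (\<rho> ` A) = card (cosets_of ?I A)" unfolding additive_index_def cos by (rule card_image[OF i])
    ultimately show ?thesis using A ring_fwd[OF A] by (simp add: is_order_of_def)
  qed
  have "bij_betw (\<lambda>A. \<rho> ` A) ?X ?Y"
  proof (rule bij_betw_imageI)
    show "inj_on (\<lambda>A. \<rho> ` A) ?X"
    proof (rule inj_onI)
      fix A A' assume "A \<in> ?X" "A' \<in> ?X" "\<rho> ` A = \<rho> ` A'"
      thus "A = A'" using inj_on_image_eq_iff[OF inj suborder_vecs suborder_vecs] by blast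
    qed
    show "(\<lambda>A. \<rho> ` A) ` ?X = ?Y"
    proof
      show "(\<lambda>A. \<rho> ` A) ` ?X \<subseteq> ?Y"
      proof (rule image_subsetI)
        fix A assume A: "A \<in> ?X"
        hence "suborder ?I A" by blast
        from iff[OF this] A show "\<rho> ` A \<in> ?Y" by blast
      qed
      show "?Y \<subseteq> (\<lambda>A. \<rho> ` A) ` ?X"
      proof
        fix S assume S: "S \<in> ?Y"
        hence "subring S ?R" by (simp add: is_order_of_def)
        note b = ring_bwd[OF this]
        have "\<zeta> ` S \<in> ?X" using iff[OF b(1)] S unfolding b(2) by blast
        from image_eqI[of S "\<lambda>A. \<rho> ` A", OF b(2)[symmetric] this] show "S \<in> (\<lambda>A. \<rho> ` A) ` ?X" .
      qed
    qed
  qed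
  from bij_betw_same_card[OF this] show ?thesis unfolding num_orders_def by simp
qed

section \<open>Asymptotics of the number of orders\<close>

lemma E4_le_E5: "E4 e \<le> E5 e"
  using E5_numeric[of 0 e 0] by simp

lemma ords_bound_mono:
  assumes "ords_bound n c E" "\<And>e. E e \<le> F e"
  shows "ords_bound n c F"
  unfolding ords_bound_def
proof (intro conjI allI impI)
  show "mono c" using assms(1) by (simp add: ords_bound_def)
  fix p e :: nat and I :: "nat set" assume p: "prime p" and I: "finite I" "card I = n"
  show "finite (ords p I e)" using assms(1) p I unfolding ords_bound_def by blast
  have "card (ords p I e) \<le> c e * p ^ E e" using assms(1) p I unfolding ords_bound_def by blast
  also have "\<dots> \<le> c e * p ^ F e"
    using assms(2) prime_gt_0_nat[OF p] by (intro mult_le_mono2 power_increasing) auto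
  finally show "card (ords p I e) \<le> c e * p ^ F e" .
qed

lemma ords_bound_le_5:
  assumes "2 \<le> d" "d \<le> 5"
  obtains c where "poly_bound c" "ords_bound d c E5"
proof -
  have div3: "e div 3 \<le> E5 e" for e using E4_ge[of 0 e] E4_le_E5[of e] by simp
  consider "d = 2" | "d = 3" | "d = 4" | "d = 5" using assms by linarith
  thus ?thesis
  proof cases
    case 1
    obtain c where "poly_bound c" "ords_bound 2 c (\<lambda>_. 0)" by (rule ords_bound_2)
    thus ?thesis using that[of c] ords_bound_mono[of 2 c "\<lambda>_. 0" E5] unfolding 1 by simp
  next
    case 2
    obtain c where "poly_bound c" "ords_bound 3 c (\<lambda>e. e div 3)" by (rule ords_bound_3)
    thus ?thesis using that[of c] ords_bound_mono[of 3 c "\<lambda>e. e div 3" E5] div3 unfolding 2 by simp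
  next
    case 3
    obtain c where "poly_bound c" "ords_bound 4 c E4" by (rule ords_bound_4)
    thus ?thesis using that[of c] ords_bound_mono[of 4 c E4 E5] E4_le_E5 unfolding 3 by simp
  next
    case 4 thus ?thesis using that ords_bound_5 by blast
  qed
qed

lemma summable_poly_geometric:
  fixes a C :: real
  assumes "a > 0"
  shows "summable (\<lambda>e. C * real (Suc e) ^ r * 2 powr (- a * real e))"
proof (rule summable_comparison_test_bigo[where g = "\<lambda>e. 2 powr (- a / 2 * real e)"])
  have "summable (\<lambda>e. (2 powr (- a / 2)) ^ e)" using assms by (intro summable_geometric) (simp add: powr_less_one)
  thus "summable (\<lambda>e. norm (2 powr (- a / 2 * real e) :: real))" by (simp add: powr_realpow[symmetric] powr_powr)
  show "(\<lambda>e. C * real (Suc e) ^ r * 2 powr (- a * real e)) \<in> O(\<lambda>e. 2 powr (- a / 2 * real e))"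
    using assms by real_asymp
qed

definition num_index :: "nat \<Rightarrow> nat \<Rightarrow> real" where
  "num_index d k = real (card (gords {..<d} k))"

lemma num_index_nonneg: "num_index d k \<ge> 0" by (simp add: num_index_def)

lemma mult_fun_num_index: "mult_fun (num_index d)"
proof -
  have z: "num_index d 0 = 0"
  proof -
    have "gords {..<d} 0 = {}" using gordsD(4)[of _ "{..<d}" 0] by auto
    thus ?thesis by (simp add: num_index_def)
  qed
  have o: "num_index d 1 = 1" unfolding num_index_def gords_1[OF finite_lessThan] by simp
  have "num_index d (a * b) = num_index d a * num_index d b" if ab: "coprime a b" for a b
  proof (cases "a = 0 \<or> b = 0")
    case True thus ?thesis using z by auto
  next
    case False
    hence "card (gords {..<d} (a * b)) = card (gords {..<d} a) * card (gords {..<d} b)"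
      using ab by (intro card_gords_mult) auto
    thus ?thesis by (simp add: num_index_def)
  qed
  thus ?thesis using z o unfolding mult_fun_def by blast
qed

lemma num_index_prime: "prime p \<Longrightarrow> num_index d p = real (d choose 2)"
  by (simp add: num_index_def card_gords_prime)

lemma num_index_prime_power:
  assumes "ords_bound d c E" "prime p"
  shows "num_index d (p ^ e) \<le> real (c e) * real p ^ E e"
proof -
  have b: "finite (ords p {..<d} e)" "card (ords p {..<d} e) \<le> c e * p ^ E e"
    using assms unfolding ords_bound_def by auto
  have "card (gords {..<d} (p ^ e)) \<le> card (ords p {..<d} e)"
    by (rule card_mono[OF b(1) gords_subset_ords[OF finite_lessThan assms(2)]])
  hence "real (card (gords {..<d} (p ^ e))) \<le> real (c e * p ^ E e)" using b(2) by linarith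
  thus ?thesis by (simp add: num_index_def)
qed

lemma num_orders_summ: "real (num_orders d B) = summ (num_index d) B"
proof -
  let ?G = "gords {..<d}"
  have "{A. suborder {..<d} A \<and> finite (cosets_of {..<d} A) \<and> real (card (cosets_of {..<d} A)) \<le> B}
      = (\<Union>k\<in>{1..nat \<lfloor>B\<rfloor>}. ?G k)" (is "?L = ?R")
  proof (intro equalityI subsetI)
    fix A assume A: "A \<in> ?L"
    hence g: "A \<in> ?G (card (cosets_of {..<d} A))" by (simp add: gords_def)
    have "card (cosets_of {..<d} A) > 0" by (rule gordsD(4)[OF g]) simp
    moreover have "card (cosets_of {..<d} A) \<le> nat \<lfloor>B\<rfloor>" using A by (simp add: le_nat_floor)
    ultimately show "A \<in> ?R" using g by (intro UN_I[of "card (cosets_of {..<d} A)"]) auto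
  next
    fix A assume "A \<in> ?R"
    then obtain k where k: "1 \<le> k" "k \<le> nat \<lfloor>B\<rfloor>" "A \<in> ?G k" by auto
    hence "real k \<le> B" by linarith
    thus "A \<in> ?L" using k(3) by (simp add: gords_def)
  qed
  moreover have "card (\<Union>k\<in>{1..nat \<lfloor>B\<rfloor>}. ?G k) = (\<Sum>k\<in>{1..nat \<lfloor>B\<rfloor>}. card (?G k))"
  proof (rule card_UN_disjoint)
    show "\<forall>k\<in>{1..nat \<lfloor>B\<rfloor>}. finite (?G k)" using finite_gords by blast
  qed (auto simp: gords_def)
  ultimately show ?thesis unfolding num_orders_eq summ_def num_index_def by simp
qed

lemma poly_bound_real:
  assumes "poly_bound c"
  obtains C r where "C \<ge> 0" "\<And>e. real (c e) \<le> C * real (Suc e) ^ r"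
proof -
  obtain C r where C: "\<And>e. c e \<le> C * Suc e ^ r" using assms unfolding poly_bound_def by blast
  have "real (c e) \<le> real C * real (Suc e) ^ r" for e
  proof -
    have "real (c e) \<le> real (C * Suc e ^ r)" using C[of e] by linarith
    thus ?thesis by (simp only: of_nat_mult of_nat_power)
  qed
  thus ?thesis using that[of "real C" r] by simp
qed

lemma num_orders_asymptotics:
  assumes d: "2 \<le> d" "d \<le> 5"
  shows "\<exists>C>0. ((\<lambda>B. real (num_orders d B) / (B * ln B ^ ((d choose 2) - 1))) \<longlongrightarrow> C) at_top"
proof -
  obtain c where c: "poly_bound c" "ords_bound d c E5" by (rule ords_bound_le_5[OF d])
  obtain C r where C: "C \<ge> 0" "\<And>e. real (c e) \<le> C * real (Suc e) ^ r" using poly_bound_real[OF c(1)] by blast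
  let ?b = "\<lambda>e. C * real (Suc e) ^ r * 2 powr (- (1/40) * real e)"
  have "\<exists>K>0. ((\<lambda>x. summ (num_index d) x / (x * ln x ^ ((d choose 2) - 1))) \<longlongrightarrow> K) at_top"
  proof (rule mult_fun_summatory_asymptotics[where b = ?b, OF mult_fun_num_index num_index_nonneg _ num_index_prime])
    show "1 \<le> d choose 2" using d zero_less_binomial[of 2 d] by linarith
    show "summable ?b" by (rule summable_poly_geometric) simp
    show "?b e \<ge> 0" for e using C(1) by simp
    fix p e :: nat assume p: "prime p" and e: "e \<ge> 2"
    have p2: "real p \<ge> 2" using prime_ge_2_nat[OF p] by simp
    \<comment> \<open>Interpolates between the two parts of \<open>E5\<close>: e - 2 is below the
      right-hand side for e \<le> 20, and 9 e / 10 for e \<ge> 20. The spare e / 40 becomes the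
      geometric factor of \<open>?b\<close>, and 3/2 > 1 makes the sum over primes converge.\<close>
    have E: "real (E5 e) \<le> real e - 3/2 - real e / 40"
    proof -
      have "E5 e \<le> e - 2" "E5 e \<le> 9 * e div 10" by (simp_all add: E5_def)
      hence "real (E5 e) \<le> real e - 2" "real (E5 e) \<le> 9 * real e / 10" using e by linarith+
      thus ?thesis by (cases "e \<le> 20") auto
    qed
    have "num_index d (p ^ e) \<le> real (c e) * real p ^ E5 e" by (rule num_index_prime_power[OF c(2) p])
    also have "\<dots> = real (c e) * real p powr real (E5 e)" using p2 by (simp add: powr_realpow)
    also have "\<dots> \<le> (C * real (Suc e) ^ r) * real p powr (real e - 3/2 - real e / 40)"
      using p2 E C(1) by (intro mult_mono C(2) powr_mono) auto
    also have "real p powr (real e - 3/2 - real e / 40) = real p powr (- (1/40) * real e) * (real p ^ e * real p powr (-3/2))"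
      using p2 by (simp add: powr_realpow[symmetric] powr_add[symmetric] algebra_simps)
    also have "(C * real (Suc e) ^ r) * (real p powr (- (1/40) * real e) * (real p ^ e * real p powr (-3/2)))
        \<le> (C * real (Suc e) ^ r) * (2 powr (- (1/40) * real e) * (real p ^ e * real p powr (-3/2)))"
      using p2 C(1) by (intro mult_left_mono mult_right_mono powr_mono2') auto
    finally show "num_index d (p ^ e) \<le> ?b e * real p ^ e * real p powr (-3/2)" by (simp only: mult.assoc)
  qed
  thus ?thesis unfolding num_orders_summ .
qed

text \<open>On squarefree indices the count is governed by its exact value at primes, so the
  summatory theorem applies with the zero bound at higher prime powers and in every dimension from 2
  on.\<close>

lemma num_orders_lower_bound:
  assumes d: "2 \<le> d"
  shows "(\<lambda>B. B * ln B ^ ((d choose 2) - 1)) \<in> O[at_top](\<lambda>B. real (num_orders d B))"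
proof -
  define h where "h n = (if squarefree n then num_index d n else 0)" for n
  let ?k = "(d choose 2) - 1"
  have h: "mult_fun h"
  proof -
    have m: "num_index d 1 = 1" "coprime a b \<Longrightarrow> num_index d (a * b) = num_index d a * num_index d b" for a b
      using mult_fun_num_index[of d] unfolding mult_fun_def by blast+
    have "h (a * b) = h a * h b" if "coprime a b" for a b
      using m(2)[OF that] squarefree_mult_coprime[OF that] squarefree_multD[of a b] by (auto simp: h_def)
    moreover have "h 0 = 0" "h 1 = 1" using m(1) by (simp_all add: h_def)
    ultimately show ?thesis unfolding mult_fun_def by blast
  qed
  have "\<exists>K>0. ((\<lambda>x. summ h x / (x * ln x ^ ?k)) \<longlongrightarrow> K) at_top"
  proof (rule mult_fun_summatory_asymptotics[where b = "\<lambda>_. 0", OF h])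
    show "h n \<ge> 0" for n using num_index_nonneg by (simp add: h_def)
    show "1 \<le> d choose 2" using d zero_less_binomial[of 2 d] by linarith
    show "h p = real (d choose 2)" if "prime p" for p
      using that num_index_prime[OF that] squarefree_prime[of p] by (simp add: h_def)
    fix p e :: nat assume p: "prime p" and e: "e \<ge> 2"
    have "\<not> squarefree (p ^ e)" using squarefree_power_iff[of p e] p e by auto
    thus "h (p ^ e) \<le> 0 * real p ^ e * real p powr (-3/2)" by (simp add: h_def)
  qed simp_all
  then obtain K where K: "K > 0" "((\<lambda>x. summ h x / (x * ln x ^ ?k)) \<longlongrightarrow> K) at_top" by blast
  have "eventually (\<lambda>x. summ h x / (x * ln x ^ ?k) > K / 2) at_top"
    using order_tendstoD(1)[OF K(2), of "K / 2"] K(1) by simp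
  hence "eventually (\<lambda>B. norm (B * ln B ^ ?k) \<le> (2 / K) * norm (real (num_orders d B))) at_top"
    using eventually_gt_at_top[of 1]
  proof eventually_elim
    case (elim x)
    have pos: "x * ln x ^ ?k > 0" using elim(2) by simp
    have "summ h x \<le> real (num_orders d x)"
      unfolding num_orders_summ summ_def using num_index_nonneg by (intro sum_mono) (simp add: h_def)
    moreover have "K / 2 * (x * ln x ^ ?k) < summ h x" using elim(1) pos by (simp add: pos_less_divide_eq)
    ultimately have "K / 2 * (x * ln x ^ ?k) \<le> real (num_orders d x)" by linarith
    hence "(2 / K) * (K / 2 * (x * ln x ^ ?k)) \<le> (2 / K) * real (num_orders d x)" using K(1) by (intro mult_left_mono) auto
    moreover have "(2 / K) * (K / 2 * (x * ln x ^ ?k)) = x * ln x ^ ?k" using K(1) by simp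
    ultimately show ?case using pos by simp
  qed
  thus ?thesis by (rule bigoI)
qed

text \<open>Rankin's trick: for k \<le> x the weight (x / k)^s is at least 1, so the counting
  function is at most x^s times the value of the Dirichlet series at s.\<close>

lemma num_orders_upper_bound:
  assumes d: "5 \<le> d" and eps: "(\<epsilon>::real) > 0"
  shows "(\<lambda>B. real (num_orders d B)) \<in> O[at_top](\<lambda>B. B powr (real d / 2 - 7 / 6 + \<epsilon>))"
proof -
  obtain c E where c: "poly_bound c" "ords_bound d c E" "\<And>e. e \<ge> 1 \<Longrightarrow> real (E e) \<le> (real d / 2 - 7 / 6) * real e - 1"
    using ords_bound_ge_5[OF d] by blast
  obtain C r where C: "C \<ge> 0" "\<And>e. real (c e) \<le> C * real (Suc e) ^ r" using poly_bound_real[OF c(1)] by blast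
  let ?s = "real d / 2 - 7 / 6 + \<epsilon>"
  have s: "?s > 0" using d eps by simp
  let ?b = "\<lambda>e. C * real (Suc e) ^ r * 2 powr (- (\<epsilon>/2) * real e)"
  define h where "h k = num_index d k * real k powr (- ?s)" for k
  have h: "mult_fun h" using mult_fun_num_index[of d] unfolding mult_fun_def h_def by (auto simp: powr_mult)
  have h0: "h k \<ge> 0" for k using num_index_nonneg by (simp add: h_def)
  have "h (p ^ e) \<le> ?b e * real p powr (- 1 - \<epsilon>/2)" if p: "prime p" and e: "e \<ge> 1" for p e
  proof -
    have p2: "real p \<ge> 2" using prime_ge_2_nat[OF p] by simp
    have "num_index d (p ^ e) \<le> real (c e) * real p ^ E e" by (rule num_index_prime_power[OF c(2) p])
    also have "\<dots> = real (c e) * real p powr real (E e)" using p2 by (simp add: powr_realpow)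
    also have "\<dots> \<le> (C * real (Suc e) ^ r) * real p powr ((real d / 2 - 7 / 6) * real e - 1)"
      using p2 c(3)[OF e] C(1) by (intro mult_mono C(2) powr_mono) auto
    finally have "h (p ^ e) \<le> (C * real (Suc e) ^ r) * real p powr ((real d / 2 - 7 / 6) * real e - 1) * real (p ^ e) powr (- ?s)"
      unfolding h_def by (rule mult_right_mono) simp
    also have "real (p ^ e) powr (- ?s) = real p powr (real e * (- ?s))"
      using p2 by (simp only: of_nat_power powr_realpow[symmetric] powr_powr)
    also have "(C * real (Suc e) ^ r) * real p powr ((real d / 2 - 7 / 6) * real e - 1) * real p powr (real e * (- ?s))
      = (C * real (Suc e) ^ r) * real p powr ((real d / 2 - 7 / 6) * real e - 1 + real e * (- ?s))"
      by (simp only: powr_add mult.assoc)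
    also have "(real d / 2 - 7 / 6) * real e - 1 + real e * (- ?s) = - 1 - \<epsilon> * real e" by (simp add: algebra_simps)
    \<comment> \<open>The margin \<epsilon> e is split: one half makes the sum over e converge, the
      other, at least \<epsilon> / 2 as e \<ge> 1, pushes the exponent of p below -1.\<close>
    also have "(C * real (Suc e) ^ r) * real p powr (- 1 - \<epsilon> * real e)
      \<le> (C * real (Suc e) ^ r) * real p powr (- (\<epsilon>/2) * real e + (- 1 - \<epsilon>/2))"
    proof -
      have "\<epsilon> * 1 \<le> \<epsilon> * real e" using e eps by (intro mult_left_mono) auto
      thus ?thesis using p2 C(1) by (intro mult_left_mono powr_mono) auto
    qed
    also have "\<dots> = (C * real (Suc e) ^ r) * (real p powr (- (\<epsilon>/2) * real e) * real p powr (- 1 - \<epsilon>/2))"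
      by (simp only: powr_add)
    also have "\<dots> \<le> (C * real (Suc e) ^ r) * (2 powr (- (\<epsilon>/2) * real e) * real p powr (- 1 - \<epsilon>/2))"
      using p2 C(1) eps by (intro mult_left_mono mult_right_mono powr_mono2') auto
    finally show ?thesis by (simp only: mult.assoc)
  qed
  hence "\<exists>B. \<forall>N. (\<Sum>p | prime p \<and> p \<le> N. \<Sum>e\<in>{1..N}. h (p ^ e)) \<le> B"
    using eps C(1) by (intro sum_prime_power_bound[where b = ?b and a = "- 1 - \<epsilon>/2"] summable_poly_geometric) auto
  then obtain B where B: "\<And>N. (\<Sum>p | prime p \<and> p \<le> N. \<Sum>e\<in>{1..N}. h (p ^ e)) \<le> B" by blast
  have sm: "summable h" by (rule summable_mult_fun[OF h h0 B])
  have "norm (real (num_orders d x)) \<le> suminf h * norm (x powr ?s)" if x: "x \<ge> 1" for x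
  proof -
    have "real (num_orders d x) \<le> (\<Sum>k\<in>{1..nat \<lfloor>x\<rfloor>}. h k * x powr ?s)"
      unfolding num_orders_summ summ_def
    proof (rule sum_mono)
      fix k assume k: "k \<in> {1..nat \<lfloor>x\<rfloor>}"
      hence "1 \<le> k" "k \<le> nat \<lfloor>x\<rfloor>" by auto
      hence kx: "1 \<le> real k" "real k \<le> x" using x by linarith+
      have "num_index d k = h k * real k powr ?s" using kx by (simp add: h_def mult.assoc powr_add[symmetric])
      also have "\<dots> \<le> h k * x powr ?s" using kx s by (intro mult_left_mono h0 powr_mono2) auto
      finally show "num_index d k \<le> h k * x powr ?s" .
    qed
    also have "\<dots> = (\<Sum>k\<in>{1..nat \<lfloor>x\<rfloor>}. h k) * x powr ?s" by (simp only: sum_distrib_right)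
    also have "\<dots> \<le> suminf h * x powr ?s" using h0 by (intro mult_right_mono sum_le_suminf[OF sm]) auto
    finally show ?thesis by simp
  qed
  hence "eventually (\<lambda>x. norm (real (num_orders d x)) \<le> suminf h * norm (x powr ?s)) at_top"
    by (intro eventually_mono[OF eventually_ge_at_top[of 1]])
  thus ?thesis by (rule bigoI)
qed

theorem theorem1p12:
  fixes d :: nat
  shows "(2 \<le> d \<and> d \<le> 5 \<longrightarrow>
      (\<exists>C::real. C > 0 \<and>
        (\<lambda>B::real. real (num_orders d B)) \<sim>[at_top]
          (\<lambda>B. C * B * (ln B) ^ ((d choose 2) - 1)))) \<and>
    (6 \<le> d \<longrightarrow>
      (\<forall>\<epsilon>::real. \<epsilon> > 0 \<longrightarrow>
        (\<lambda>B::real. B * (ln B) ^ ((d choose 2) - 1)) \<in> O[at_top](\<lambda>B. real (num_orders d B)) \<and>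
        (\<lambda>B::real. real (num_orders d B)) \<in> O[at_top](\<lambda>B. B powr (real d / 2 - 7 / 6 + \<epsilon>))))"
proof (intro conjI impI allI)
  assume d: "2 \<le> d \<and> d \<le> 5"
  let ?k = "(d choose 2) - 1"
  obtain C where C: "C > 0" "((\<lambda>B. real (num_orders d B) / (B * ln B ^ ?k)) \<longlongrightarrow> C) at_top"
    using num_orders_asymptotics[of d] d by blast
  have "((\<lambda>B. real (num_orders d B) / (B * ln B ^ ?k) / C) \<longlongrightarrow> C / C) at_top"
    using C by (intro tendsto_divide tendsto_const) auto
  moreover have "real (num_orders d B) / (B * ln B ^ ?k) / C = real (num_orders d B) / (C * B * ln B ^ ?k)" for B
    by (simp add: mult_ac)
  ultimately have "((\<lambda>B. real (num_orders d B) / (C * B * ln B ^ ?k)) \<longlongrightarrow> C / C) at_top" by (simp only:)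
  hence "((\<lambda>B. real (num_orders d B) / (C * B * ln B ^ ?k)) \<longlongrightarrow> 1) at_top" using C(1) by (simp only: divide_self_if if_False less_irrefl) simp
  hence "(\<lambda>B. real (num_orders d B)) \<sim>[at_top] (\<lambda>B. C * B * ln B ^ ?k)" by (rule asymp_equivI')
  thus "\<exists>C>0. (\<lambda>B. real (num_orders d B)) \<sim>[at_top] (\<lambda>B. C * B * ln B ^ ?k)" using C(1) by blast
next
  fix \<epsilon> :: real
  assume d: "6 \<le> d" and eps: "\<epsilon> > 0"
  show "(\<lambda>B. B * ln B ^ ((d choose 2) - 1)) \<in> O[at_top](\<lambda>B. real (num_orders d B))"
    by (rule num_orders_lower_bound) (use d in simp)
  show "(\<lambda>B. real (num_orders d B)) \<in> O[at_top](\<lambda>B. B powr (real d / 2 - 7 / 6 + \<epsilon>))"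
    by (rule num_orders_upper_bound[OF _ eps]) (use d in simp)
qed

end
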